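(* Consider the Weighted Recursive Tree with vertex-weights $(W_i)_{i\in\mathbb{N}}$ that are i.i.d. copies of a strictly positive random variable $W$ with $\sup\{x\in\mathbb{R}:\mathbb{P}(W\le x)<1\}=1$ and $\mathbb{P}(W=1)=q_0$ for some $q_0\in(0,1]$. Let $\theta:=1+\mathbb{E}[W]$, $\mu:=1-(\theta-1)/(\theta\log\theta)$ and $\sigma^2:=1-(\theta-1)^2/(\theta^2\log\theta)$. Let $v^1,\dots,v^n$ be the vertices of the tree $\mathcal{G}_n$ in decreasing order of in-degree (ties split uniformly at random), and let $d_n^i$ and $\ell_n^i$ denote the in-degree and the label of $v^i$, respectively, for $i\in[n]$. Fix $\varepsilon\in[0,1]$, let $\varepsilon_n:=\log_\theta n-\lfloor\log_\theta n\rfloor$, and let $(n_j)_{j\in\mathbb{N}}$ be a positive, diverging integer sequence such that $\varepsilon_{n_j}\to\varepsilon$ as $j\to\infty$. Let $(P_i)_{i\in\mathbb{N}}$ be the points, in decreasing order, of a Poisson point process $\mathcal{P}$ on $\mathbb{R}$ with intensity measure $q_0\theta^{-x}\log\theta\,\mathrm{d}x$, and let $(M_i)_{i\in\mathbb{N}}$ be a sequence of i.i.d. standard normal random variables (independent of $\mathcal{P}$). Then, as $j\to\infty$, $$\Big(d_{n_j}^i-\lfloor\log_\theta n_j\rfloor,\ \frac{\log(\ell_{n_j}^i)-\mu\log n_j}{\sqrt{(1-\sigma^2)\log n_j}}\Big)_{i\in[n_j]}\ \longrightarrow\ \big(\lfloor P_i+\varepsilon\rfloor,\ M_i\big)_{i\in\mathbb{N}}\quad\text{in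 distribution.}$$
   Context: Notation: $[n]=\{1,\dots,n\}$. Weighted Recursive Tree (WRT): let $(W_i)_{i\ge1}$ be i.i.d. copies of $W$, $\mathbb{P}(W>0)=1$, and $S_n:=\sum_{i=1}^nW_i$. $\mathcal{G}_1$ is a single vertex $1$ (the root) with weight $W_1$. For $n\ge1$, a new vertex $n+1$ with weight $W_{n+1}$ is added and, conditionally on $\mathcal{G}_n$ (and the weights), is connected by one directed edge to a vertex $i\in[n]$ chosen with probability $W_i/S_n$; the result is $\mathcal{G}_{n+1}$. Vertex labels are the integers $1,\dots,n$. Convergence in distribution of the (finite but growing) sequences to an infinite sequence is understood as convergence in distribution of the first $K$ entries, jointly, for every fixed $K\in\mathbb{N}$. The paper identifies it with weak convergence of the marked point processes $\sum_{i=1}^{n_j}\delta_{(d^i_{n_j}-\lfloor\log_\theta n_j\rfloor,\,(\log \ell^i_{n_j}-\mu\log n_j)/\sqrt{(1-\sigma^2)\log n_j})}$ to $\sum_{i}\delta_{(\lfloor P_i+\varepsilon\rfloor,M_i)}$ in the space of boundedly finite measures on $\mathbb{Z}^*\times\mathbb{R}$ (vague topology), where $\mathbb{Z}^*=\mathbb{Z}\cup\{\infty\}$ has the metric $d(i,j)=|2^{-i}-2^{-j}|$, $d(i,\infty)=2^{-i}$. *)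

theory Defs
  imports "HOL-Probability.Probability" "Graph_Theory.Digraph"
begin

section \<open>The weighted recursive tree\<close>

text \<open>
  Vertices are labelled from 1. For \<open>k \<ge> 2\<close>, \<open>p k\<close> is the vertex to which vertex \<open>k\<close> is attached
  when it enters the tree, so the edges point from \<open>k\<close> to \<open>p k\<close>.
\<close>

definition tree_of :: "(nat \<Rightarrow> nat) \<Rightarrow> nat \<Rightarrow> (nat, nat \<times> nat) pre_digraph" where
  "tree_of p n = \<lparr> verts = {1..n}, arcs = {(k, p k) | k. k \<in> {2..n}}, tail = fst, head = snd \<rparr>"

text \<open>
  The sigma-algebra of all vertex-weights together with the tree on \<open>n\<close> vertices (that is,
  the attachments of the vertices \<open>2..n\<close>).
\<close>

definition history ::
    "'a measure \<Rightarrow> (nat \<Rightarrow> 'a \<Rightarrow> real) \<Rightarrow> (nat \<Rightarrow> 'a \<Rightarrow> nat) \<Rightarrow> nat \<Rightarrow> 'a measure" where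
  "history M W p n =
     vimage_algebra (space M)
       (\<lambda>\<omega>. (\<lambda>i\<in>{1..}. W i \<omega>, \<lambda>k\<in>{2..n}. p k \<omega>))
       (Pi\<^sub>M {1..} (\<lambda>_. borel) \<Otimes>\<^sub>M Pi\<^sub>M {2..n} (\<lambda>_. count_space UNIV))"

text \<open>
  \<open>D\<close> is the law of the generic weight. That \<open>p (Suc n)\<close> lies in \<open>{1..n}\<close> almost surely is part of
  \<open>attachment\<close>, because the conditional probabilities prescribed there add up to 1.
\<close>

locale weighted_recursive_tree = prob_space M
  for M :: "'a measure" +
  fixes D :: "real measure" and W :: "nat \<Rightarrow> 'a \<Rightarrow> real" and p :: "nat \<Rightarrow> 'a \<Rightarrow> nat"
  assumes weight_law: "real_distribution D"
    and weight_pos: "measure D {0<..} = 1"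
    and weights_indep: "indep_vars (\<lambda>_. borel) W {1..}"
    and weights_law: "\<And>i. i \<ge> 1 \<Longrightarrow> distr M borel (W i) = D"
    and parent_measurable: "\<And>k. k \<ge> 2 \<Longrightarrow> p k \<in> measurable M (count_space UNIV)"
    and attachment: "\<And>n i. n \<ge> 1 \<Longrightarrow> i \<in> {1..n} \<Longrightarrow>
      AE \<omega> in M. real_cond_exp M (history M W p n) (indicator {\<omega> \<in> space M. p (Suc n) \<omega> = i}) \<omega>
        = W i \<omega> / (\<Sum>k=1..n. W k \<omega>)"

definition degree_orderings :: "(nat, nat \<times> nat) pre_digraph \<Rightarrow> nat list set" where
  "degree_orderings G =
     {vs \<in> permutations_of_set (verts G). sorted_wrt (\<lambda>u v. in_degree G u \<ge> in_degree G v) vs}"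

text \<open>
  Splitting ties uniformly at random: conditionally on the weights and the tree, the list of
  vertices is uniform among all orderings that are decreasing in the in-degree.
\<close>

definition uniform_degree_ordering ::
    "'a measure \<Rightarrow> (nat \<Rightarrow> 'a \<Rightarrow> real) \<Rightarrow> (nat \<Rightarrow> 'a \<Rightarrow> nat) \<Rightarrow> nat \<Rightarrow> ('a \<Rightarrow> nat list) \<Rightarrow> bool" where
  "uniform_degree_ordering M W p n v \<longleftrightarrow>
     v \<in> measurable M (count_space UNIV) \<and>
     (\<forall>vs. AE \<omega> in M. real_cond_exp M (history M W p n) (indicator {\<omega> \<in> space M. v \<omega> = vs}) \<omega>
        = pmf (pmf_of_set (degree_orderings (tree_of (\<lambda>k. p k \<omega>) n))) vs)"

section \<open>Poisson point processes\<close>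

text \<open>
  The case \<open>emeasure \<Lambda> A = \<infinity>\<close> need not be prescribed for sigma-finite \<open>\<Lambda>\<close>: the count of \<open>A\<close> is
  then almost surely infinite as a consequence.
\<close>

definition poisson_point_process :: "'b measure \<Rightarrow> 'x measure \<Rightarrow> ('b \<Rightarrow> 'x measure) \<Rightarrow> bool" where
  "poisson_point_process N \<Lambda> \<Xi> \<longleftrightarrow>
     (\<forall>\<omega>\<in>space N. sets (\<Xi> \<omega>) = sets \<Lambda>) \<and>
     (\<forall>A\<in>sets \<Lambda>. (\<lambda>\<omega>. emeasure (\<Xi> \<omega>) A) \<in> borel_measurable N) \<and>
     (\<forall>A\<in>sets \<Lambda>. emeasure \<Lambda> A < \<infinity> \<longrightarrow>
        (\<forall>k::nat. measure N {\<omega> \<in> space N. emeasure (\<Xi> \<omega>) A = of_nat k}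
           = measure \<Lambda> A ^ k / fact k * exp (- measure \<Lambda> A))) \<and>
     (\<forall>(I::nat set) A. finite I \<longrightarrow> A ` I \<subseteq> sets \<Lambda> \<longrightarrow> disjoint_family_on A I \<longrightarrow>
        prob_space.indep_vars N (\<lambda>_. borel) (\<lambda>i \<omega>. emeasure (\<Xi> \<omega>) (A i)) I)"

text \<open>
  \<open>P 1, P 2, \<dots>\<close> are the points of \<open>\<Xi>\<close> in decreasing order, with multiplicity: almost surely
  \<open>\<Xi>\<close> is the sum of the unit masses at the points \<open>P i\<close>, \<open>i \<ge> 1\<close>.
\<close>

definition decreasing_points ::
    "'b measure \<Rightarrow> ('b \<Rightarrow> real measure) \<Rightarrow> (nat \<Rightarrow> 'b \<Rightarrow> real) \<Rightarrow> bool" where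
  "decreasing_points N \<Xi> P \<longleftrightarrow>
     (\<forall>i\<ge>1. P i \<in> borel_measurable N) \<and>
     (AE \<omega> in N. (\<forall>i\<ge>1. P (Suc i) \<omega> \<le> P i \<omega>) \<and>
        \<Xi> \<omega> = distr (count_space {1..}) borel (\<lambda>i. P i \<omega>))"

section \<open>Convergence in distribution\<close>

definition borel_of :: "'s topology \<Rightarrow> 's measure" where
  "borel_of T = sigma (topspace T) {U. openin T U}"

definition converges_in_distribution ::
    "'s topology \<Rightarrow> 'a measure \<Rightarrow> (nat \<Rightarrow> 'a \<Rightarrow> 's) \<Rightarrow> 'b measure \<Rightarrow> ('b \<Rightarrow> 's) \<Rightarrow> bool" where
  "converges_in_distribution T M X N Y \<longleftrightarrow>
     (\<forall>j. X j \<in> measurable M (borel_of T)) \<and> Y \<in> measurable N (borel_of T) \<and>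
     (\<forall>f. continuous_map T euclideanreal f \<and> bounded (f ` topspace T) \<longrightarrow>
        (\<lambda>j. \<integral>\<omega>. f (X j \<omega>) \<partial>M) \<longlonglongrightarrow> (\<integral>\<omega>. f (Y \<omega>) \<partial>N))"

text \<open>
  Convergence in distribution of sequences indexed from 1: joint convergence of the first \<open>K\<close>
  entries, for every \<open>K\<close>. If the sequence \<open>X j\<close> has only finitely many meaningful entries, but
  their number grows to infinity with \<open>j\<close>, the entries beyond them are irrelevant.
\<close>

definition sequence_converges_in_distribution ::
    "'a measure \<Rightarrow> (nat \<Rightarrow> nat \<Rightarrow> 'a \<Rightarrow> 's::topological_space) \<Rightarrow> 'b measure \<Rightarrow> (nat \<Rightarrow> 'b \<Rightarrow> 's) \<Rightarrow> bool" where
  "sequence_converges_in_distribution M X N Y \<longleftrightarrow>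
     (\<forall>K. converges_in_distribution (product_topology (\<lambda>_. euclidean) {1..K})
        M (\<lambda>j \<omega>. \<lambda>i\<in>{1..K}. X j i \<omega>) N (\<lambda>\<omega>. \<lambda>i\<in>{1..K}. Y i \<omega>))"

end

theory Submission
  imports Defs "HOL-Real_Asymp.Real_Asymp"
begin

text \<open>
  Given the weights, a vertex with label \<open>v\<close> and weight \<open>w\<close> is chosen at step \<open>k > v\<close> with probability
  close to \<open>w / (e k)\<close>, where \<open>e = \<theta> - 1\<close> is the mean weight. Hence the in-degrees of
  finitely many vertices with labels in \<open>n\<^sup>h .. n\<close> are jointly close to independent Poisson variables with
  means \<open>w ln (n / v) / e\<close>. Writing \<open>v = n exp (- x)\<close>, the sum over \<open>v\<close> of the probabilities of in-degree \<open>m\<close>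
  near \<open>log\<^sub>\<theta> n\<close> becomes an integral against the density of an Erlang variable \<open>x\<close>; vertices of weight less
  than 1 drop out, and the central limit theorem for \<open>x\<close> makes the labels asymptotically normal.
  The same computation for tuples of vertices, together with inclusion-exclusion, gives the joint law of
  the in-degrees in a bounded window around \<open>log\<^sub>\<theta> n\<close> and of their labels: Poisson counts with
  independent normal marks. First-moment bounds exclude vertices that are too old or of too high in-degree.
  Finally, the first \<open>K\<close> vertices are read off from such a window, the limit being decomposed according
  to the counts of the Poisson process in the cells \<open>[r - \<epsilon>, r + 1 - \<epsilon>)\<close>.
\<close>

section \<open>Poisson approximation of the in-degrees\<close>

text \<open>An expected count of order one is a sum over about \<open>n ^ k\<close> tuples of
  average probability about \<open>n ^ (- k)\<close>, so an absolute error bound for the Poisson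
  approximation would be worthless. Errors are therefore measured in a norm weighted by
  \<open>(1 + e) ^ m\<close>, with \<open>m\<close> the total in-degree. Near
  \<open>log\<^sub>\<theta> n\<close> this gains a factor \<open>1 / n\<close> per vertex, while the
  tilted Poisson mass costs only \<open>n / v\<close>, whose sum over \<open>v\<close> exceeds
  \<open>n\<close> by a logarithm. The remaining error is a negative power of \<open>n ^ h\<close>;
  it beats all logarithms, and weight sums that deviate from their mean beyond \<open>n ^ h\<close>
  are unlikely enough to be ignored even \<open>n ^ k\<close> times. Below \<open>n ^ h\<close> a
  Chernoff bound with a smaller tilt takes the place of the Poisson law. A second obstacle is
  tightness: \<open>K\<close> vertices must be found in a bounded range of in-degrees. This is shown
  for the Poisson process only. As the same finite sums approximate both sides, for every test
  function including the constant 1, the mass missing in the tree is the mass missing in the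
  limit.\<close>

definition pois :: "real \<Rightarrow> nat \<Rightarrow> real" where
  "pois l m = exp (- l) * l ^ m / fact m"

definition jpois :: "'v set \<Rightarrow> ('v \<Rightarrow> real) \<Rightarrow> ('v \<Rightarrow> nat) \<Rightarrow> real" where
  "jpois V a m = (\<Prod>v\<in>V. pois (a v) (m v))"

text \<open>The value at the state before the latest edge into \<open>v\<close>. The case
  \<open>m v = 0\<close> is separate because truncated subtraction would return \<open>F m\<close>
  there.\<close>

definition down :: "'v \<Rightarrow> (('v \<Rightarrow> nat) \<Rightarrow> real) \<Rightarrow> ('v \<Rightarrow> nat) \<Rightarrow> real" where
  "down v F m = (if m v = 0 then 0 else F (m(v := m v - 1)))"

lemma pois_nonneg: "0 \<le> l \<Longrightarrow> 0 \<le> pois l m"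
  by (simp add: pois_def)

lemma power_le_fact_exp: "0 \<le> (x::real) \<Longrightarrow> x ^ m / fact m \<le> exp x"
proof -
  assume x: "0 \<le> x"
  have "(\<Sum>n\<in>{m}. x ^ n /\<^sub>R fact n) \<le> (\<Sum>n. x ^ n /\<^sub>R fact n)"
    by (rule sum_le_suminf) (use x summable_exp_generic[of x] in auto)
  then show ?thesis by (simp add: exp_def divide_inverse mult.commute)
qed

text \<open>A single term of the generating function of the Poisson law at \<open>t\<close> is at
  most the whole sum \<open>exp ((t - 1) * l)\<close>.\<close>

lemma pois_tilt:
  assumes "0 \<le> l" "0 \<le> t"
  shows "t ^ m * pois l m \<le> exp ((t - 1) * l)"
proof -
  have "t ^ m * pois l m = exp (- l) * ((t * l) ^ m / fact m)"
    by (simp add: pois_def power_mult_distrib)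
  also have "\<dots> \<le> exp (- l) * exp (t * l)"
    using power_le_fact_exp[of "t * l" m] assms by (intro mult_left_mono) auto
  also have "\<dots> = exp ((t - 1) * l)"
    by (simp add: exp_add[symmetric] algebra_simps)
  finally show ?thesis .
qed

lemma jpois_nonneg: "(\<And>v. v \<in> V \<Longrightarrow> 0 \<le> a v) \<Longrightarrow> 0 \<le> jpois V a m"
  unfolding jpois_def by (intro prod_nonneg) (auto intro: pois_nonneg)

text \<open>Decay like a negative power of \<open>t\<close> in the total degree: this bounds the
  supremum over \<open>m\<close> of \<open>t ^ (\<Sum>v\<in>V. m v) * \<bar>F m\<bar>\<close>, the
  norm in which all approximation errors are measured.\<close>

lemma jpois_tilt:
  assumes "finite V" "\<And>v. v \<in> V \<Longrightarrow> 0 \<le> a v" "0 \<le> t"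
  shows "t ^ (\<Sum>v\<in>V. m v) * jpois V a m \<le> exp ((t - 1) * (\<Sum>v\<in>V. a v))"
proof -
  have "t ^ (\<Sum>v\<in>V. m v) * jpois V a m = (\<Prod>v\<in>V. t ^ m v * pois (a v) (m v))"
    by (simp add: jpois_def power_sum prod.distrib)
  also have "\<dots> \<le> (\<Prod>v\<in>V. exp ((t - 1) * a v))"
    by (intro prod_mono) (use assms in \<open>auto intro!: pois_tilt mult_nonneg_nonneg pois_nonneg\<close>)
  also have "\<dots> = exp ((t - 1) * (\<Sum>v\<in>V. a v))"
    using assms by (simp add: exp_sum sum_distrib_left)
  finally show ?thesis .
qed

lemma power_sum_upd:
  fixes t :: real and m :: "'v \<Rightarrow> nat"
  assumes "finite V" "v \<in> V" "m v \<noteq> 0"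
  shows "t ^ (\<Sum>u\<in>V. m u) = t * t ^ (\<Sum>u\<in>V. (m(v := m v - 1)) u)"
proof -
  have "(\<Sum>u\<in>V. m u) = Suc (\<Sum>u\<in>V. (m(v := m v - 1)) u)"
    using assms by (simp add: sum.remove[of V v])
  then show ?thesis by simp
qed

text \<open>In the weighted norm a shift of one coordinate costs at most one factor
  \<open>t\<close>, since the total degree drops by one.\<close>

lemma down_tilt:
  fixes t :: real and m :: "'v \<Rightarrow> nat"
  assumes "finite V" "v \<in> V" "0 \<le> t" "0 \<le> B"
    and "\<And>m. t ^ (\<Sum>v\<in>V. m v) * \<bar>F m\<bar> \<le> B"
  shows "t ^ (\<Sum>v\<in>V. m v) * \<bar>down v F m\<bar> \<le> t * B"
proof (cases "m v = 0")
  case True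
  then show ?thesis using assms by (simp add: down_def)
next
  case False
  have "t ^ (\<Sum>v\<in>V. m v) * \<bar>down v F m\<bar>
      = t * (t ^ (\<Sum>u\<in>V. (m(v := m v - 1)) u) * \<bar>F (m(v := m v - 1))\<bar>)"
    using False unfolding power_sum_upd[where m = m and v = v, OF assms(1,2) False] by (simp add: down_def)
  also have "\<dots> \<le> t * B" using assms(3) by (rule mult_left_mono[OF assms(5)])
  finally show ?thesis .
qed

lemma down_diff: "down v F m - down v G m = down v (\<lambda>m. F m - G m) m"
  by (simp add: down_def)

text \<open>The forward equation of a Poisson process run at rate \<open>b\<close>.\<close>

lemma pois_deriv:
  "((\<lambda>x. pois (a + x * b) m) has_real_derivative
     b * ((if m = 0 then 0 else pois (a + x * b) (m - 1)) - pois (a + x * b) m)) (at x)"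
proof (cases m)
  case 0
  show ?thesis unfolding pois_def 0 by (auto intro!: derivative_eq_intros)
next
  case (Suc k)
  let ?y = "\<lambda>x. a + x * b"
  have "((\<lambda>x. exp (- ?y x) * ?y x ^ Suc k) has_real_derivative
      (- b * exp (- ?y x) * ?y x ^ Suc k + exp (- ?y x) * (real (Suc k) * ?y x ^ k * b))) (at x)"
    by (rule derivative_eq_intros refl | simp)+
  from DERIV_cdivide[OF this, of "fact (Suc k)"]
  have "((\<lambda>x. pois (?y x) (Suc k)) has_real_derivative
      (- b * exp (- ?y x) * ?y x ^ Suc k + exp (- ?y x) * (real (Suc k) * ?y x ^ k * b)) / fact (Suc k)) (at x)"
    by (simp add: pois_def)
  moreover have "(- b * exp (- ?y x) * ?y x ^ Suc k + exp (- ?y x) * (real (Suc k) * ?y x ^ k * b)) / fact (Suc k)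
    = b * (pois (?y x) k - pois (?y x) (Suc k))"
  proof -
    have "fact (Suc k) = real (Suc k) * fact k" by simp
    then have "pois (?y x) k = exp (- ?y x) * (real (Suc k) * ?y x ^ k) / fact (Suc k)"
      by (simp add: pois_def del: of_nat_Suc fact_Suc)
    then show ?thesis by (simp add: pois_def algebra_simps diff_divide_distrib add_divide_distrib del: fact_Suc)
  qed
  ultimately show ?thesis unfolding Suc by simp
qed

text \<open>The joint forward equation of independent Poisson processes. The recursion for
  \<open>dlaw\<close> below is its Euler scheme, which is why the two laws are close.\<close>

lemma jpois_deriv:
  fixes a b :: "'v \<Rightarrow> real"
  assumes "finite V"
  shows "((\<lambda>x. jpois V (\<lambda>v. a v + x * b v) m) has_real_derivative
    (\<Sum>v\<in>V. b v * (down v (jpois V (\<lambda>v. a v + x * b v)) m - jpois V (\<lambda>v. a v + x * b v) m))) (at x)"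
proof -
  let ?p = "\<lambda>x v k. pois (a v + x * b v) k"
  have "((\<lambda>x. \<Prod>v\<in>V. ?p x v (m v)) has_real_derivative
     (\<Sum>v\<in>V. (b v * ((if m v = 0 then 0 else ?p x v (m v - 1)) - ?p x v (m v))) * (\<Prod>u\<in>V-{v}. ?p x u (m u)))) (at x)"
    by (rule has_field_derivative_prod) (rule pois_deriv)
  also have "(\<Sum>v\<in>V. (b v * ((if m v = 0 then 0 else ?p x v (m v - 1)) - ?p x v (m v))) * (\<Prod>u\<in>V-{v}. ?p x u (m u)))
    = (\<Sum>v\<in>V. b v * (down v (jpois V (\<lambda>v. a v + x * b v)) m - jpois V (\<lambda>v. a v + x * b v) m))"
  proof (rule sum.cong[OF refl])
    fix v assume v: "v \<in> V"
    have 1: "jpois V (\<lambda>v. a v + x * b v) m = ?p x v (m v) * (\<Prod>u\<in>V-{v}. ?p x u (m u))"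
      unfolding jpois_def using assms v by (simp add: prod.remove)
    have 2: "jpois V (\<lambda>v. a v + x * b v) (m(v := m v - 1)) = ?p x v (m v - 1) * (\<Prod>u\<in>V-{v}. ?p x u (m u))"
      unfolding jpois_def using assms v by (simp add: prod.remove)
    show "(b v * ((if m v = 0 then 0 else ?p x v (m v - 1)) - ?p x v (m v))) * (\<Prod>u\<in>V-{v}. ?p x u (m u))
     = b v * (down v (jpois V (\<lambda>v. a v + x * b v)) m - jpois V (\<lambda>v. a v + x * b v) m)"
      unfolding down_def 1 2 by (auto simp: algebra_simps)
  qed
  finally show ?thesis unfolding jpois_def .
qed

text \<open>Mean value theorem on the segment from \<open>a\<close> to \<open>a'\<close>. The
  intermediate means stay below \<open>max (a v) (a' v)\<close>, so the tilted bound applies to the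
  derivative.\<close>

lemma jpois_lipschitz:
  fixes a a' :: "'v \<Rightarrow> real"
  assumes fin: "finite V" and a: "\<And>v. v \<in> V \<Longrightarrow> 0 \<le> a v" "\<And>v. v \<in> V \<Longrightarrow> 0 \<le> a' v"
    and t: "1 \<le> t" and S: "(\<Sum>v\<in>V. max (a v) (a' v)) \<le> S"
  shows "t ^ (\<Sum>v\<in>V. m v) * \<bar>jpois V a' m - jpois V a m\<bar>
      \<le> (t + 1) * (\<Sum>v\<in>V. \<bar>a' v - a v\<bar>) * exp ((t - 1) * S)"
proof -
  define b where "b v = a' v - a v" for v
  define h where "h x = jpois V (\<lambda>v. a v + x * b v) m" for x
  define h' where "h' x = (\<Sum>v\<in>V. b v * (down v (jpois V (\<lambda>v. a v + x * b v)) m - jpois V (\<lambda>v. a v + x * b v) m))" for x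
  have "\<exists>x::real. x > 0 \<and> x < 1 \<and> h 1 - h 0 = (1 - 0) * h' x"
    by (rule MVT2) (auto simp: h_def h'_def intro: jpois_deriv[OF fin])
  then obtain x where x: "0 < x" "x < 1" "h 1 - h 0 = h' x" by auto
  have conv: "a v + x * b v = (1 - x) * a v + x * a' v" for v by (simp add: b_def algebra_simps)
  have nn: "0 \<le> a v + x * b v" if "v \<in> V" for v
    unfolding conv using a that x by auto
  have le: "a v + x * b v \<le> max (a v) (a' v)" for v
    unfolding conv using convex_bound_le[of "a v" "max (a v) (a' v)" "a' v" "1-x" x] x by auto
  let ?E = "exp ((t - 1) * S)"
  have "(\<Sum>v\<in>V. a v + x * b v) \<le> S"
    using S sum_mono[of V "\<lambda>v. a v + x * b v" "\<lambda>v. max (a v) (a' v)"] le by force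
  then have E: "exp ((t - 1) * (\<Sum>v\<in>V. a v + x * b v)) \<le> ?E"
    using t by (auto intro!: mult_left_mono)
  have jp: "t ^ (\<Sum>v\<in>V. m v) * \<bar>jpois V (\<lambda>v. a v + x * b v) m\<bar> \<le> ?E" for m
  proof -
    have "0 \<le> jpois V (\<lambda>v. a v + x * b v) m" by (intro jpois_nonneg nn)
    moreover have "t ^ (\<Sum>v\<in>V. m v) * jpois V (\<lambda>v. a v + x * b v) m \<le> exp ((t - 1) * (\<Sum>v\<in>V. a v + x * b v))"
      using t by (intro jpois_tilt fin nn) auto
    ultimately show ?thesis using E by linarith
  qed
  have dn: "t ^ (\<Sum>v\<in>V. m v) * \<bar>down u (jpois V (\<lambda>v. a v + x * b v)) m\<bar> \<le> t * ?E" if "u \<in> V" for u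
    by (rule down_tilt) (use fin that t jp in auto)
  have "t ^ (\<Sum>v\<in>V. m v) * \<bar>h' x\<bar>
    \<le> t ^ (\<Sum>v\<in>V. m v) * (\<Sum>v\<in>V. \<bar>b v\<bar> * (\<bar>down v (jpois V (\<lambda>v. a v + x * b v)) m\<bar> + \<bar>jpois V (\<lambda>v. a v + x * b v) m\<bar>))"
    unfolding h'_def using t
    by (intro mult_left_mono order.trans[OF sum_abs] sum_mono) (auto simp: abs_mult intro!: mult_left_mono)
  also have "\<dots> = (\<Sum>v\<in>V. \<bar>b v\<bar> * (t ^ (\<Sum>v\<in>V. m v) * \<bar>down v (jpois V (\<lambda>v. a v + x * b v)) m\<bar> + t ^ (\<Sum>v\<in>V. m v) * \<bar>jpois V (\<lambda>v. a v + x * b v) m\<bar>))"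
    by (simp add: sum_distrib_left algebra_simps)
  also have "\<dots> \<le> (\<Sum>v\<in>V. \<bar>b v\<bar> * (t * ?E + ?E))"
    by (intro sum_mono mult_left_mono add_mono dn jp) auto
  also have "\<dots> = (t + 1) * (\<Sum>v\<in>V. \<bar>a' v - a v\<bar>) * ?E"
    unfolding sum_distrib_right[symmetric] by (simp add: b_def algebra_simps)
  finally have "t ^ (\<Sum>v\<in>V. m v) * \<bar>h 1 - h 0\<bar> \<le> (t + 1) * (\<Sum>v\<in>V. \<bar>a' v - a v\<bar>) * ?E"
    using x(3) by simp
  then show ?thesis by (simp add: h_def b_def)
qed

text \<open>Local error of one Euler step. It is quadratic in \<open>\<Sum>v\<in>V. b v\<close>
  because it is a difference of two derivatives, to which the Lipschitz bound applies once
  more.\<close>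

lemma jpois_taylor:
  fixes a b :: "'v \<Rightarrow> real"
  assumes fin: "finite V" and a: "\<And>v. v \<in> V \<Longrightarrow> 0 \<le> a v" "\<And>v. v \<in> V \<Longrightarrow> 0 \<le> b v" and t: "1 \<le> t"
  shows "t ^ (\<Sum>v\<in>V. m v) * \<bar>jpois V (\<lambda>v. a v + b v) m
       - ((1 - (\<Sum>v\<in>V. b v)) * jpois V a m + (\<Sum>v\<in>V. b v * down v (jpois V a) m))\<bar>
      \<le> (t + 1)\<^sup>2 * (\<Sum>v\<in>V. b v)\<^sup>2 * exp ((t - 1) * (\<Sum>v\<in>V. a v + b v))"
proof -
  define h where "h x = jpois V (\<lambda>v. a v + x * b v) m" for x
  define h' where "h' x = (\<Sum>v\<in>V. b v * (down v (jpois V (\<lambda>v. a v + x * b v)) m - jpois V (\<lambda>v. a v + x * b v) m))" for x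
  have "\<exists>x::real. x > 0 \<and> x < 1 \<and> h 1 - h 0 = (1 - 0) * h' x"
    by (rule MVT2) (auto simp: h_def h'_def intro: jpois_deriv[OF fin])
  then obtain x where x: "0 < x" "x < 1" "h 1 - h 0 = h' x" by auto
  let ?B = "\<Sum>v\<in>V. b v"
  let ?E = "exp ((t - 1) * (\<Sum>v\<in>V. a v + b v))"
  let ?ax = "\<lambda>v. a v + x * b v"
  have B0: "0 \<le> ?B" using a by (intro sum_nonneg) auto
  have xb: "x * b v \<le> b v" "0 \<le> x * b v" if "v \<in> V" for v
    using a(2)[OF that] x by (auto simp: mult_left_le_one_le)
  have lip: "t ^ (\<Sum>v\<in>V. m v) * \<bar>jpois V ?ax m - jpois V a m\<bar> \<le> (t + 1) * ?B * ?E" for m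
  proof -
    have "t ^ (\<Sum>v\<in>V. m v) * \<bar>jpois V ?ax m - jpois V a m\<bar>
      \<le> (t + 1) * (\<Sum>v\<in>V. \<bar>?ax v - a v\<bar>) * ?E"
    proof (rule jpois_lipschitz[OF fin _ _ t])
      show "(\<Sum>v\<in>V. max (a v) (?ax v)) \<le> (\<Sum>v\<in>V. a v + b v)"
        by (intro sum_mono) (use xb a in auto)
    qed (use a xb x in \<open>auto intro!: add_nonneg_nonneg\<close>)
    also have "\<dots> \<le> (t + 1) * ?B * ?E"
      using t by (intro mult_right_mono mult_left_mono sum_mono) (use xb a in auto)
    finally show ?thesis .
  qed
  have dn: "t ^ (\<Sum>v\<in>V. m v) * \<bar>down u (jpois V ?ax) m - down u (jpois V a) m\<bar> \<le> t * ((t + 1) * ?B * ?E)"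
    if "u \<in> V" for u
    unfolding down_diff by (rule down_tilt) (use fin that t lip B0 in auto)
  have "jpois V (\<lambda>v. a v + b v) m - ((1 - ?B) * jpois V a m + (\<Sum>v\<in>V. b v * down v (jpois V a) m))
    = (h 1 - h 0) - (\<Sum>v\<in>V. b v * (down v (jpois V a) m - jpois V a m))"
    using sum_distrib_right[of b V "jpois V a m"] by (simp add: h_def algebra_simps sum_subtractf)
  also have "\<dots> = (\<Sum>v\<in>V. b v * ((down v (jpois V ?ax) m - down v (jpois V a) m) - (jpois V ?ax m - jpois V a m)))"
    unfolding x h'_def by (simp add: sum_subtractf[symmetric] algebra_simps)
  finally have eq: "jpois V (\<lambda>v. a v + b v) m - ((1 - ?B) * jpois V a m + (\<Sum>v\<in>V. b v * down v (jpois V a) m)) = \<dots>" .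
  have "t ^ (\<Sum>v\<in>V. m v) * \<bar>\<Sum>v\<in>V. b v * ((down v (jpois V ?ax) m - down v (jpois V a) m) - (jpois V ?ax m - jpois V a m))\<bar>
    \<le> t ^ (\<Sum>v\<in>V. m v) * (\<Sum>v\<in>V. b v * (\<bar>down v (jpois V ?ax) m - down v (jpois V a) m\<bar> + \<bar>jpois V ?ax m - jpois V a m\<bar>))"
    using t a by (intro mult_left_mono order.trans[OF sum_abs] sum_mono) (auto simp: abs_mult intro!: mult_left_mono)
  also have "\<dots> = (\<Sum>v\<in>V. b v * (t ^ (\<Sum>v\<in>V. m v) * \<bar>down v (jpois V ?ax) m - down v (jpois V a) m\<bar> + t ^ (\<Sum>v\<in>V. m v) * \<bar>jpois V ?ax m - jpois V a m\<bar>))"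
    by (simp add: sum_distrib_left algebra_simps)
  also have "\<dots> \<le> (\<Sum>v\<in>V. b v * (t * ((t + 1) * ?B * ?E) + (t + 1) * ?B * ?E))"
    using a by (intro sum_mono mult_left_mono add_mono dn lip) auto
  also have "\<dots> = (t + 1)\<^sup>2 * ?B\<^sup>2 * ?E"
    unfolding sum_distrib_right[symmetric] by (simp add: power2_eq_square algebra_simps)
  finally show ?thesis unfolding eq .
qed

text \<open>
  The joint law of the in-degrees of the vertices in \<open>V\<close> when vertex \<open>n + 1\<close> attaches to \<open>v\<close> with
  probability \<open>b n v\<close>.
\<close>

primrec dlaw :: "(nat \<Rightarrow> 'v \<Rightarrow> real) \<Rightarrow> 'v set \<Rightarrow> nat \<Rightarrow> ('v \<Rightarrow> nat) \<Rightarrow> real" where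
  "dlaw b V 0 = (\<lambda>m. if \<forall>v\<in>V. m v = 0 then 1 else 0)"
| "dlaw b V (Suc n) = (\<lambda>m. (1 - (\<Sum>v\<in>V. b n v)) * dlaw b V n m + (\<Sum>v\<in>V. b n v * down v (dlaw b V n) m))"

text \<open>Local errors accumulate to the sum of the squared step sizes. Each step of the recursion
  amplifies the weighted norm by at most \<open>1 + (t - 1) * (\<Sum>v\<in>V. b n v)\<close>, which
  the growth of the exponential on the right absorbs.\<close>

lemma dlaw_jpois:
  fixes b :: "nat \<Rightarrow> 'v \<Rightarrow> real"
  assumes fin: "finite V" and b: "\<And>n v. v \<in> V \<Longrightarrow> 0 \<le> b n v" "\<And>n. (\<Sum>v\<in>V. b n v) \<le> 1" and t: "1 \<le> t"
  shows "t ^ (\<Sum>v\<in>V. m v) * \<bar>dlaw b V n m - jpois V (\<lambda>v. \<Sum>j<n. b j v) m\<bar>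
      \<le> (t + 1)\<^sup>2 * (\<Sum>j<n. (\<Sum>v\<in>V. b j v)\<^sup>2) * exp ((t - 1) * (\<Sum>v\<in>V. \<Sum>j<n. b j v))"
proof (induction n arbitrary: m)
  case 0
  have "jpois V (\<lambda>v. 0) m = (\<Prod>v\<in>V. if m v = 0 then 1 else 0)"
    unfolding jpois_def pois_def by (intro prod.cong) (auto simp: power_0_left)
  also have "\<dots> = (if \<forall>v\<in>V. m v = 0 then 1 else 0)"
    using fin by (auto simp: prod_zero_iff)
  finally show ?case by simp
next
  case (Suc n)
  let ?a = "\<lambda>v. \<Sum>j<n. b j v" and ?A = "\<Sum>v\<in>V. b n v"
  let ?E = "exp ((t - 1) * (\<Sum>v\<in>V. ?a v))" and ?E' = "exp ((t - 1) * (\<Sum>v\<in>V. ?a v + b n v))"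
  let ?e = "(t + 1)\<^sup>2 * (\<Sum>j<n. (\<Sum>v\<in>V. b j v)\<^sup>2) * ?E"
  let ?d = "\<lambda>m. dlaw b V n m - jpois V ?a m"
  let ?T = "t ^ (\<Sum>v\<in>V. m v)"
  let ?r = "(1 - ?A) * jpois V ?a m + (\<Sum>v\<in>V. b n v * down v (jpois V ?a) m)"
  have A0: "0 \<le> ?A" using b by (intro sum_nonneg) auto
  have e0: "0 \<le> ?e" by (intro mult_nonneg_nonneg sum_nonneg) auto
  have dn: "?T * \<bar>down v ?d m\<bar> \<le> t * ?e" if "v \<in> V" for v
    by (rule down_tilt) (use fin that t Suc e0 in auto)
  \<comment> \<open>The old error \<open>?d\<close> is transported linearly by the recursion; the
    only new error is the distance of \<open>?r\<close> from the next Poisson law, estimated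
    afterwards.\<close>
  have "dlaw b V (Suc n) m - ?r = (1 - ?A) * ?d m + (\<Sum>v\<in>V. b n v * down v ?d m)"
    by (simp add: down_diff[symmetric] sum_subtractf algebra_simps)
  then have "?T * \<bar>dlaw b V (Suc n) m - ?r\<bar> \<le> ?T * ((1 - ?A) * \<bar>?d m\<bar> + (\<Sum>v\<in>V. b n v * \<bar>down v ?d m\<bar>))"
    using t b(2)[of n] b(1)
    by (simp only:) (intro mult_left_mono order.trans[OF abs_triangle_ineq] add_mono order.trans[OF sum_abs] sum_mono;
       auto simp: abs_mult)
  also have "\<dots> = (1 - ?A) * (?T * \<bar>?d m\<bar>) + (\<Sum>v\<in>V. b n v * (?T * \<bar>down v ?d m\<bar>))"
    by (simp only: distrib_left sum_distrib_left mult.left_commute)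
  also have "\<dots> \<le> (1 - ?A) * ?e + (\<Sum>v\<in>V. b n v * (t * ?e))"
    using b(2)[of n] b(1) by (intro add_mono mult_left_mono sum_mono dn Suc) auto
  also have "\<dots> = ?e * (1 + (t - 1) * ?A)"
    unfolding sum_distrib_right[symmetric] by (simp add: algebra_simps)
  also have "\<dots> \<le> ?e * exp ((t - 1) * ?A)"
    using e0 exp_ge_add_one_self[of "(t - 1) * ?A"] by (intro mult_left_mono) auto
  also have "\<dots> = (t + 1)\<^sup>2 * (\<Sum>j<n. (\<Sum>v\<in>V. b j v)\<^sup>2) * ?E'"
    by (simp add: exp_add[symmetric] sum.distrib algebra_simps)
  finally have 1: "?T * \<bar>dlaw b V (Suc n) m - ?r\<bar> \<le> \<dots>" .
  have 2: "?T * \<bar>jpois V (\<lambda>v. ?a v + b n v) m - ?r\<bar> \<le> (t + 1)\<^sup>2 * ?A\<^sup>2 * ?E'"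
    by (rule jpois_taylor[OF fin _ _ t]) (auto intro!: sum_nonneg b)
  have "?T * \<bar>dlaw b V (Suc n) m - jpois V (\<lambda>v. ?a v + b n v) m\<bar>
     \<le> ?T * (\<bar>dlaw b V (Suc n) m - ?r\<bar> + \<bar>jpois V (\<lambda>v. ?a v + b n v) m - ?r\<bar>)"
    using t by (intro mult_left_mono) auto
  also have "\<dots> \<le> (t + 1)\<^sup>2 * (\<Sum>j<n. (\<Sum>v\<in>V. b j v)\<^sup>2) * ?E' + (t + 1)\<^sup>2 * ?A\<^sup>2 * ?E'"
    using 1 2 by (simp only: distrib_left)
  also have "\<dots> = (t + 1)\<^sup>2 * (\<Sum>j<Suc n. (\<Sum>v\<in>V. b j v)\<^sup>2) * ?E'"
    by (simp add: algebra_simps)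
  finally show ?case by simp
qed

section \<open>Attachment probabilities when the weight sums are close to their means\<close>

lemma inverse_sum_ln:
  assumes "1 \<le> v" "v \<le> n"
  shows "ln (real n / real v) \<le> (\<Sum>j=v..<n. 1 / real j)"
    and "(\<Sum>j=v..<n. 1 / real j) \<le> ln (real n / real v) + 1 / v - 1 / n"
proof -
  have "ln (real n / real v) \<le> (\<Sum>j=v..<n. 1 / real j) \<and>
        (\<Sum>j=v..<n. 1 / real j) \<le> ln (real n / real v) + 1 / v - 1 / n"
    using assms(2)
  proof (induction n rule: dec_induct)
    case base
    show ?case using assms by simp
  next
    case (step n)
    have n: "real n > 0" using step assms by simp
    have e: "ln (real (Suc n) / real v) = ln (real n / real v) + ln (1 + 1 / n)"
    proof -
      have "real (Suc n) / real v = (real n / real v) * (1 + 1 / n)"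
        using n by (simp add: distrib_left add_divide_distrib)
      then show ?thesis using n assms by (subst (asm) eq_commute) (metis (no_types, lifting) ln_mult_pos add_pos_pos divide_pos_pos less_numeral_extra(1) of_nat_0_less_iff order_less_le_trans)
    
    qed
    have u: "ln (1 + 1 / real n) \<le> 1 / n" using n by (intro ln_add_one_self_le_self) auto
    have "ln (1 + 1 / real n) = - ln (1 - 1 / real (Suc n))"
    proof -
      have "1 + 1 / real n = inverse (1 - 1 / real (Suc n))" using n by (simp add: field_simps)
      moreover have "0 < 1 - 1 / real (Suc n)" using n by (simp add: field_simps)
      ultimately show ?thesis by (simp only: ln_inverse)
    qed
    moreover have "ln (1 - 1 / real (Suc n)) \<le> - (1 / real (Suc n))"
      using n ln_add_one_self_le_self2[of "- (1 / real (Suc n))"] by (simp add: field_simps)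
    ultimately have l: "1 / real (Suc n) \<le> ln (1 + 1 / real n)" by linarith
    have s: "(\<Sum>j=v..<Suc n. 1 / real j) = (\<Sum>j=v..<n. 1 / real j) + 1 / real n"
      using step by simp
    show ?case using step e u l unfolding s by auto
  qed
  then show "ln (real n / real v) \<le> (\<Sum>j=v..<n. 1 / real j)"
    "(\<Sum>j=v..<n. 1 / real j) \<le> ln (real n / real v) + 1 / v - 1 / n" by auto
qed

lemma inverse_sum_le:
  assumes "1 \<le> n"
  shows "(\<Sum>j=1..n. 1 / real j) \<le> 1 + ln n"
proof -
  have "(\<Sum>j=1..n. 1 / real j) = (\<Sum>j=1..<n. 1 / real j) + 1 / n"
    using assms by (cases n) (auto simp: atLeastLessThanSuc_atLeastAtMost[symmetric])
  then show ?thesis using inverse_sum_ln(2)[of 1 n] assms by simp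
qed

text \<open>The probability with which vertex \<open>n + 1\<close> chooses \<open>v\<close>. The
  value 0 for \<open>v > n\<close> lets the recursions start at time 0, before \<open>v\<close> has
  entered the tree.\<close>

definition attach :: "(nat \<Rightarrow> real) \<Rightarrow> nat \<Rightarrow> nat \<Rightarrow> real" where
  "attach w n v = (if v \<le> n then w v / (\<Sum>k=1..n. w k) else 0)"

text \<open>The exponent 3/4 lies strictly between 1/2 and 1: the relative error
  \<open>j powr (-1/4)\<close> decays polynomially, while Hoeffding's inequality makes a failure at
  \<open>j\<close> as unlikely as \<open>2 * exp (- 2 * sqrt j)\<close>.\<close>

definition good_weights :: "real \<Rightarrow> nat \<Rightarrow> nat \<Rightarrow> (nat \<Rightarrow> real) \<Rightarrow> bool" where
  "good_weights e a n w \<longleftrightarrow> (\<forall>j\<in>{a..n}. \<bar>(\<Sum>k=1..j. w k) - e * real j\<bar> \<le> real j powr (3/4))"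

text \<open>Relative error for \<open>k\<close> vertices, to be taken at
  \<open>x = a powr (-1/4) * (1 + ln n)\<close>. In the first factor one summand comes from the
  Euler steps and the other from replacing the means; the exponential accounts for the changed means
  in the tilted bound.\<close>

definition rho :: "real \<Rightarrow> nat \<Rightarrow> real \<Rightarrow> real" where
  "rho e k x = ((e + 2)\<^sup>2 * (2 * real k / e)\<^sup>2 + (e + 2) * (real k * (2 / e\<^sup>2 + 1 / e))) * x
      * exp (e * (real k * (2 / e\<^sup>2 + 1 / e)) * x)"

lemma attach_nonneg: "(\<And>k. k \<ge> 1 \<Longrightarrow> 0 < w k) \<Longrightarrow> v \<ge> 1 \<Longrightarrow> 0 \<le> attach w n v"
  unfolding attach_def by (auto intro!: divide_nonneg_nonneg sum_nonneg) (meson less_eq_real_def)+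

lemma sum_attach_le_1:
  assumes w: "\<And>k. k \<ge> 1 \<Longrightarrow> 0 < w k" and V: "finite V" "V \<subseteq> {1..}"
  shows "(\<Sum>v\<in>V. attach w n v) \<le> 1"
proof -
  let ?S = "\<Sum>k=1..n. w k"
  have S: "0 \<le> ?S" using w by (intro sum_nonneg) (auto simp: less_imp_le)
  have "(\<Sum>v\<in>V. attach w n v) = (\<Sum>v\<in>V \<inter> {..n}. w v) / ?S"
    using V by (simp add: attach_def sum.inter_restrict[symmetric] sum_divide_distrib[symmetric] sum.If_cases)
       (simp add: atMost_def)
  also have "(\<Sum>v\<in>V \<inter> {..n}. w v) \<le> ?S"
    by (rule sum_mono2) (use V w in \<open>auto simp: less_imp_le\<close>)
  then have "(\<Sum>v\<in>V \<inter> {..n}. w v) / ?S \<le> ?S / ?S" using S by (intro divide_right_mono) auto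
  also have "\<dots> \<le> 1" by simp
  finally show ?thesis .
qed

text \<open>The tilt is \<open>1 + e\<close> because
  \<open>e * (w v * ln (n / v) / e) \<le> ln (n / v)\<close> for weights at most 1: the tilted mass
  of a vertex is then at most \<open>n / v\<close>, whose sum over the labels exceeds
  \<open>n\<close> only by a logarithmic factor.\<close>

lemma attach_law_close:
  assumes e: "0 < e" and w: "\<And>k. k \<ge> 1 \<Longrightarrow> 0 < w k" "\<And>k. k \<ge> 1 \<Longrightarrow> w k \<le> 1"
    and good: "good_weights e a n w" and a: "1 \<le> a" "2 / e \<le> real a powr (1/4)"
    and V: "V \<subseteq> {a<..n}" and n: "1 \<le> n"
  shows "(1 + e) ^ (\<Sum>v\<in>V. m v) * \<bar>dlaw (attach w) V n m - jpois V (\<lambda>v. w v * ln (real n / real v) / e) m\<bar>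
     \<le> rho e (card V) (real a powr (-1/4) * (1 + ln (real n))) * (\<Prod>v\<in>V. real n / real v)"
proof -
  define x where "x = real a powr (-1/4) * (1 + ln (real n))"
  define k where "k = card V"
  define C where "C = 2 / e\<^sup>2 + 1 / e"
  define al where "al v = (\<Sum>j<n. attach w j v)" for v
  define la where "la v = w v * ln (real n / real v) / e" for v
  let ?S = "\<lambda>j. \<Sum>k=1..j. w k" and ?q = "real a powr (-1/4)"
  have finV: "finite V" using V finite_subset by blast
  have V1: "V \<subseteq> {1..}" using V a by auto
  have q: "0 < ?q" "?q \<le> 1" using a powr_mono2'[of "-1/4" 1 "real a"] by auto
  have lnn: "0 \<le> ln (real n)" using n by simp
  have "?q * 1 \<le> x" unfolding x_def by (rule mult_left_mono) (use q lnn in simp_all)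
  with q have x0: "0 \<le> x" "?q \<le> x" by linarith+
  have C0: "0 < C" unfolding C_def using e by (intro add_pos_pos divide_pos_pos) auto
  have aq: "1 / real a \<le> ?q"
  proof -
    have "real a powr (-1) \<le> real a powr (-1/4)" using a by (intro powr_mono) auto
    moreover have "real a powr (-1) = 1 / real a" using a by (subst powr_minus_divide) simp
    ultimately show ?thesis by linarith
  qed
  have jq: "real j powr (3/4) \<le> ?q * real j" "real j powr (3/4) \<le> e / 2 * real j" if "a \<le> j" for j
  proof -
    have j: "real j > 0" using that a by linarith
    have "real j powr (3/4) = real j powr (-1/4) * real j"
      using j powr_add[of "real j" "-1/4" 1] by simp
    moreover have m: "real j powr (-1/4) \<le> ?q"
      using powr_mono2'[of "-1/4" "real a" "real j"] that a by simp
    ultimately show 1: "real j powr (3/4) \<le> ?q * real j"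
      by (simp only: mult_right_mono[OF m, of "real j"] of_nat_0_le_iff)
    \<comment> \<open>Origin of the hypothesis \<open>2 / e \<le> real a powr (1/4)\<close>: it
      makes the fluctuation of the weight sum at most half of the mean \<open>e * j\<close>.\<close>
    have "?q \<le> e / 2"
    proof -
      have "?q = 1 / real a powr (1/4)" using powr_minus_divide[of "real a" "1/4"] by simp
      also have "\<dots> \<le> 1 / (2 / e)"
        by (rule divide_left_mono[OF a(2)]) (use a e in simp_all)
      finally show ?thesis by simp
    qed
    then have "?q * real j \<le> e / 2 * real j" using j by (intro mult_right_mono) auto
    with 1 show "real j powr (3/4) \<le> e / 2 * real j" by linarith
  qed
  have Slow: "e / 2 * real j \<le> ?S j" if "a \<le> j" "j \<le> n" for j
  proof -
    have "\<bar>?S j - e * real j\<bar> \<le> real j powr (3/4)"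
      using good that unfolding good_weights_def by (meson atLeastAtMost_iff)
    with jq(2)[OF that(1)] show ?thesis by linarith
  qed
  have Sinv: "\<bar>1 / ?S j - 1 / (e * real j)\<bar> \<le> 2 / e\<^sup>2 * ?q * (1 / real j)" if "a \<le> j" "j \<le> n" for j
  proof -
    have j: "real j > 0" using that a by linarith
    have Sp: "0 < e / 2 * real j" using j e by simp
    with Slow[OF that] have Sp': "0 < ?S j" by linarith
    have "1 / ?S j - 1 / (e * real j) = (e * real j - ?S j) / (?S j * (e * real j))"
      using Sp' e j by (simp add: field_simps)
    then have "\<bar>1 / ?S j - 1 / (e * real j)\<bar> = \<bar>?S j - e * real j\<bar> / (?S j * (e * real j))"
      using Sp' e j by (simp add: abs_mult abs_minus_commute)
    also have "\<dots> \<le> (?q * real j) / ((e / 2 * real j) * (e * real j))"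
    proof (intro frac_le mult_right_mono Slow that)
      have "\<bar>?S j - e * real j\<bar> \<le> real j powr (3/4)"
        using good that unfolding good_weights_def by (meson atLeastAtMost_iff)
      with jq(1)[OF that(1)] show "\<bar>?S j - e * real j\<bar> \<le> ?q * real j" by linarith
    qed (use Sp e j q in simp_all)
    also have "\<dots> = 2 / e\<^sup>2 * ?q * (1 / real j)"
      using j e by (simp add: field_simps power2_eq_square)
    finally show ?thesis .
  qed
  have harm: "(\<Sum>j=v..<n. 1 / real j) \<le> 1 + ln (real n)" if "1 \<le> v" for v
  proof -
    have "(\<Sum>j=v..<n. 1 / real j) \<le> (\<Sum>j=1..n. 1 / real j)"
      by (rule sum_mono2) (use that in auto)
    then show ?thesis using inverse_sum_le[OF n] by linarith
  qed
  have al_eq: "al v = (\<Sum>j=v..<n. w v * (1 / ?S j))" for v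
  proof -
    have "al v = (\<Sum>j\<in>{..<n} \<inter> {j. v \<le> j}. w v / ?S j)"
      unfolding al_def attach_def by (subst sum.inter_restrict) (auto intro!: sum.cong)
    also have "{..<n} \<inter> {j. v \<le> j} = {v..<n}" by auto
    finally show ?thesis by simp
  qed
  \<comment> \<open>Two errors: the weight sums are replaced by \<open>e * j\<close>, and then the
    harmonic sum by a logarithm.\<close>
  have al_la: "\<bar>al v - la v\<bar> \<le> C * x" if v: "v \<in> V" for v
  proof -
    have v': "a < v" "v \<le> n" "1 \<le> v" using V v a by auto
    have wv: "0 < w v" "w v \<le> 1" using w v' by auto
    have 1: "\<bar>al v - (\<Sum>j=v..<n. w v * (1 / (e * real j)))\<bar> \<le> 2 / e\<^sup>2 * x"
    proof -
      have "\<bar>al v - (\<Sum>j=v..<n. w v * (1 / (e * real j)))\<bar> \<le> (\<Sum>j=v..<n. w v * \<bar>1 / ?S j - 1 / (e * real j)\<bar>)"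
        unfolding al_eq sum_subtractf[symmetric] right_diff_distrib[symmetric]
        by (rule order.trans[OF sum_abs]) (use wv in \<open>simp add: abs_mult\<close>)
      also have "\<dots> \<le> (\<Sum>j=v..<n. 1 * (2 / e\<^sup>2 * ?q * (1 / real j)))"
        by (intro sum_mono mult_mono Sinv) (use wv v' in auto)
      also have "\<dots> = 2 / e\<^sup>2 * ?q * (\<Sum>j=v..<n. 1 / real j)" by (simp add: sum_distrib_left)
      also have "\<dots> \<le> 2 / e\<^sup>2 * ?q * (1 + ln (real n))"
        using harm[OF v'(3)] q by (intro mult_left_mono) auto
      finally show ?thesis by (simp add: x_def)
    qed
    have 2: "\<bar>(\<Sum>j=v..<n. w v * (1 / (e * real j))) - la v\<bar> \<le> 1 / e * x"
    proof -
      have "(\<Sum>j=v..<n. w v * (1 / (e * real j))) - la v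
         = w v / e * ((\<Sum>j=v..<n. 1 / real j) - ln (real n / real v))"
        by (simp add: la_def sum_distrib_left right_diff_distrib)
      moreover have "\<bar>(\<Sum>j=v..<n. 1 / real j) - ln (real n / real v)\<bar> \<le> x"
      proof -
        have "1 / real v \<le> 1 / real a" using v' a by (simp add: frac_le)
        then have "1 / real v - 1 / real n \<le> x" using aq x0
          by (smt (verit) divide_nonneg_nonneg of_nat_0_le_iff)
        then show ?thesis using inverse_sum_ln[OF v'(3,2)] x0 by auto
      qed
      moreover have "w v / e \<le> 1 / e" using wv e by (simp add: divide_right_mono)
      moreover have "0 \<le> w v / e" using wv e by simp
      ultimately show ?thesis
        by (simp only: abs_mult abs_of_nonneg) (intro mult_mono; use e in simp)
    qed
    have "C * x = 2 / e\<^sup>2 * x + 1 / e * x" by (simp add: C_def algebra_simps)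
    with 1 2 show ?thesis by linarith
  qed
  have la0: "0 \<le> la v" if "v \<in> V" for v
  proof -
    have "1 \<le> v" "v \<le> n" using that V a by auto
    then show ?thesis unfolding la_def using w(1)[of v] e by (intro divide_nonneg_pos mult_nonneg_nonneg) auto
  qed
  have al0: "0 \<le> al v" if "v \<in> V" for v
    unfolding al_def by (intro sum_nonneg attach_nonneg w) (use that V1 in auto)
  have sumla: "e * (\<Sum>v\<in>V. la v) \<le> (\<Sum>v\<in>V. ln (real n / real v))"
    unfolding sum_distrib_left
  proof (rule sum_mono)
    fix v assume "v \<in> V"
    then have "1 \<le> v" "v \<le> n" using V a by auto
    then show "e * la v \<le> ln (real n / real v)"
      unfolding la_def using w[of v] e by (simp add: mult_left_le_one_le)
  qed
  have summax: "(\<Sum>v\<in>V. max (la v) (al v)) \<le> (\<Sum>v\<in>V. la v) + real k * (C * x)"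
  proof -
    have "(\<Sum>v\<in>V. max (la v) (al v)) \<le> (\<Sum>v\<in>V. la v + C * x)"
    proof (rule sum_mono)
      fix v assume "v \<in> V"
      from al_la[OF this] have "al v \<le> la v + C * x" by linarith
      moreover have "0 \<le> C * x" using x0 C0 by simp
      ultimately show "max (la v) (al v) \<le> la v + C * x" by simp
    qed
    then show ?thesis by (simp add: sum.distrib k_def)
  qed
  define E where "E = exp (e * (real k * C) * x) * (\<Prod>v\<in>V. real n / real v)"
  have E: "exp (e * ((\<Sum>v\<in>V. la v) + real k * (C * x))) \<le> E"
  proof -
    have "exp (\<Sum>v\<in>V. ln (real n / real v)) = (\<Prod>v\<in>V. real n / real v)"
      unfolding exp_sum[OF finV] by (intro prod.cong refl exp_ln) (use V a in \<open>auto intro!: divide_pos_pos\<close>)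
    then have "E = exp (e * (real k * C) * x + (\<Sum>v\<in>V. ln (real n / real v)))"
      unfolding E_def by (simp add: exp_add)
    then show ?thesis using sumla by (simp add: algebra_simps)
  qed
  \<comment> \<open>A squared step probability is of order \<open>1 / j\<^sup>2\<close>. One factor
    \<open>1 / j\<close> is below \<open>1 / a\<close>, hence below \<open>?q\<close>; the other is
    summed harmonically.\<close>
  have A2: "(\<Sum>j<n. (\<Sum>v\<in>V. attach w j v)\<^sup>2) \<le> (2 * real k / e)\<^sup>2 * x"
  proof -
    have A: "(\<Sum>v\<in>V. attach w j v)\<^sup>2 \<le> (if a < j then (2 * real k / e)\<^sup>2 * (?q * (1 / real j)) else 0)" if "j < n" for j
    proof (cases "a < j")
      case False
      then have "attach w j v = 0" if "v \<in> V" for v using that V by (auto simp: attach_def)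
      then show ?thesis using False by simp
    next
      case True
      have j: "real j > 0" using True by linarith
      have "attach w j v \<le> 2 / (e * real j)" if "v \<in> V" for v
      proof (cases "v \<le> j")
        case False then show ?thesis using e j by (simp add: attach_def)
      next
        case vj: True
        have "w v / ?S j \<le> 1 / (e / 2 * real j)"
          using w[of v] that V a Slow[of j] True \<open>j < n\<close> e j by (intro frac_le) auto
        then show ?thesis using vj by (simp add: attach_def)
      qed
      then have "(\<Sum>v\<in>V. attach w j v) \<le> real k * (2 / (e * real j))"
        unfolding k_def by (rule sum_bounded_above)
      moreover have "0 \<le> (\<Sum>v\<in>V. attach w j v)" by (intro sum_nonneg attach_nonneg w) (use V1 in auto)
      ultimately have "(\<Sum>v\<in>V. attach w j v)\<^sup>2 \<le> (real k * (2 / (e * real j)))\<^sup>2"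
        by (intro power_mono)
      also have "\<dots> = (2 * real k / e)\<^sup>2 * (1 / real j * (1 / real j))"
        by (simp add: power2_eq_square)
      also have "\<dots> \<le> (2 * real k / e)\<^sup>2 * (?q * (1 / real j))"
      proof (intro mult_left_mono mult_right_mono)
        have "1 / real j \<le> 1 / real a" using True a by (simp add: frac_le)
        then show "1 / real j \<le> ?q" using aq by linarith
      qed auto
      finally show ?thesis using True by simp
    qed
    have "(\<Sum>j<n. (\<Sum>v\<in>V. attach w j v)\<^sup>2) \<le> (\<Sum>j<n. if a < j then (2 * real k / e)\<^sup>2 * (?q * (1 / real j)) else 0)"
      by (intro sum_mono A) auto
    also have "\<dots> = (\<Sum>j\<in>{..<n} \<inter> {j. a < j}. (2 * real k / e)\<^sup>2 * (?q * (1 / real j)))"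
      by (subst sum.inter_restrict) (auto intro!: sum.cong)
    also have "{..<n} \<inter> {j. a < j} = {Suc a..<n}" by auto
    also have "(\<Sum>j=Suc a..<n. (2 * real k / e)\<^sup>2 * (?q * (1 / real j))) = (2 * real k / e)\<^sup>2 * (?q * (\<Sum>j=Suc a..<n. 1 / real j))"
      by (simp only: sum_distrib_left)
    also have "\<dots> \<le> (2 * real k / e)\<^sup>2 * x"
      unfolding x_def by (intro mult_left_mono harm less_imp_le[OF q(1)]) simp_all
    finally show ?thesis .
  qed
  let ?T = "(1 + e) ^ (\<Sum>v\<in>V. m v)"
  have sumal: "(\<Sum>v\<in>V. al v) \<le> (\<Sum>v\<in>V. la v) + real k * (C * x)"
    by (rule order.trans[OF sum_mono summax]) auto
  have 1: "?T * \<bar>dlaw (attach w) V n m - jpois V al m\<bar> \<le> (e + 2)\<^sup>2 * ((2 * real k / e)\<^sup>2 * x) * E"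
  proof -
    have "?T * \<bar>dlaw (attach w) V n m - jpois V al m\<bar>
      \<le> (1 + e + 1)\<^sup>2 * (\<Sum>j<n. (\<Sum>v\<in>V. attach w j v)\<^sup>2) * exp ((1 + e - 1) * (\<Sum>v\<in>V. al v))"
      unfolding al_def
      by (rule dlaw_jpois[OF finV]) (use e V1 w in \<open>auto intro!: attach_nonneg sum_attach_le_1 finV\<close>)
    also have "\<dots> \<le> (e + 2)\<^sup>2 * ((2 * real k / e)\<^sup>2 * x) * E"
    proof (intro mult_mono A2)
      have "exp ((1 + e - 1) * (\<Sum>v\<in>V. al v)) \<le> exp (e * ((\<Sum>v\<in>V. la v) + real k * (C * x)))"
        using sumal e by simp
      then show "exp ((1 + e - 1) * (\<Sum>v\<in>V. al v)) \<le> E" using E by linarith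
    qed (auto simp: x0 add.commute intro!: sum_nonneg mult_nonneg_nonneg)
    finally show ?thesis .
  qed
  have 2: "?T * \<bar>jpois V al m - jpois V la m\<bar> \<le> (e + 2) * (real k * (C * x)) * E"
  proof -
    have "?T * \<bar>jpois V al m - jpois V la m\<bar>
       \<le> (1 + e + 1) * (\<Sum>v\<in>V. \<bar>al v - la v\<bar>) * exp ((1 + e - 1) * ((\<Sum>v\<in>V. la v) + real k * (C * x)))"
      by (rule jpois_lipschitz[OF finV la0 al0 _ summax]) (use e in auto)
    also have "\<dots> \<le> (e + 2) * (real k * (C * x)) * E"
    proof (intro mult_mono)
      show "(\<Sum>v\<in>V. \<bar>al v - la v\<bar>) \<le> real k * (C * x)"
        unfolding k_def by (intro sum_bounded_above al_la)
      show "exp ((1 + e - 1) * ((\<Sum>v\<in>V. la v) + real k * (C * x))) \<le> E" using E by simp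
    qed (use e C0 x0 in \<open>auto intro!: mult_nonneg_nonneg sum_nonneg\<close>)
    finally show ?thesis .
  qed
  have "?T * \<bar>dlaw (attach w) V n m - jpois V la m\<bar> \<le> ?T * (\<bar>dlaw (attach w) V n m - jpois V al m\<bar> + \<bar>jpois V al m - jpois V la m\<bar>)"
    using e by (intro mult_left_mono) auto
  also have "\<dots> \<le> (e + 2)\<^sup>2 * ((2 * real k / e)\<^sup>2 * x) * E + (e + 2) * (real k * (C * x)) * E"
    unfolding distrib_left by (intro add_mono 1 2)
  also have "\<dots> = rho e k x * (\<Prod>v\<in>V. real n / real v)"
    unfolding rho_def E_def C_def[symmetric] by (simp only: distrib_left distrib_right mult.assoc mult.left_commute mult.commute)
  finally show ?thesis unfolding la_def x_def k_def .
qed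

section \<open>The law of the in-degrees given the weights\<close>

definition indeg :: "(nat \<Rightarrow> nat) \<Rightarrow> nat \<Rightarrow> nat \<Rightarrow> nat" where
  "indeg x n v = card {k \<in> {2..n}. x k = v}"

lemma in_degree_tree_of: "in_degree (tree_of x n) v = indeg x n v"
proof -
  have "in_arcs (tree_of x n) v = (\<lambda>k. (k, x k)) ` {k \<in> {2..n}. x k = v}"
    by (auto simp: in_arcs_def tree_of_def)
  moreover have "inj_on (\<lambda>k. (k, x k)) {k \<in> {2..n}. x k = v}" by (auto intro: inj_onI)
  ultimately show ?thesis by (simp only: in_degree_def indeg_def card_image)
qed

lemma indeg_Suc: "1 \<le> n \<Longrightarrow> indeg x (Suc n) v = indeg x n v + (if x (Suc n) = v then 1 else 0)"
proof -
  assume n: "1 \<le> n"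
  have "{k \<in> {2..Suc n}. x k = v} = {k \<in> {2..n}. x k = v} \<union> (if x (Suc n) = v then {Suc n} else {})"
    using n by (auto simp: le_Suc_eq)
  then show ?thesis by (auto simp: indeg_def)
qed

lemma indeg_le: "indeg x n v \<le> n"
proof -
  have "card {k \<in> {2..n}. x k = v} \<le> card {1..n}" by (intro card_mono) auto
  then show ?thesis by (simp add: indeg_def)
qed

lemma indeg_restrict: "indeg (restrict x {2..n}) n v = indeg x n v"
  unfolding indeg_def by (intro arg_cong[where f = card]) auto

lemma indeg_0_1: "indeg x 0 v = 0" "indeg x (Suc 0) v = 0"
  by (auto simp: indeg_def)

lemma dlaw_bounds:
  assumes b: "\<And>n v. v \<in> V \<Longrightarrow> 0 \<le> b n v" "\<And>n. (\<Sum>v\<in>V. b n v) \<le> 1"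
  shows "0 \<le> dlaw b V n m \<and> dlaw b V n m \<le> 1"
proof (induction n arbitrary: m)
  case (Suc n)
  have dn: "0 \<le> down v (dlaw b V n) m \<and> down v (dlaw b V n) m \<le> 1" for v
    using Suc by (simp add: down_def)
  have "dlaw b V (Suc n) m \<le> (1 - (\<Sum>v\<in>V. b n v)) * 1 + (\<Sum>v\<in>V. b n v * 1)"
    unfolding dlaw.simps using b Suc dn
    by (intro add_mono mult_left_mono sum_mono) auto
  moreover have "0 \<le> dlaw b V (Suc n) m"
    unfolding dlaw.simps using b Suc dn
    by (intro add_nonneg_nonneg mult_nonneg_nonneg sum_nonneg) auto
  ultimately show ?case by simp
qed simp

context weighted_recursive_tree
begin

abbreviation wt :: "'a \<Rightarrow> nat \<Rightarrow> real" where "wt \<omega> \<equiv> (\<lambda>k. W k \<omega>)"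
abbreviation par :: "'a \<Rightarrow> nat \<Rightarrow> nat" where "par \<omega> \<equiv> (\<lambda>k. p k \<omega>)"

lemma W_measurable [measurable]: "1 \<le> i \<Longrightarrow> W i \<in> borel_measurable M"
  using weights_indep by (auto simp: indep_vars_def)

lemma W_measurable' [measurable]: "W (Suc i) \<in> borel_measurable M"
  by (rule W_measurable) simp

lemma history_map_measurable:
  "(\<lambda>\<omega>. (\<lambda>i\<in>{1..}. W i \<omega>, \<lambda>k\<in>{2..n}. p k \<omega>))
     \<in> M \<rightarrow>\<^sub>M (Pi\<^sub>M {1..} (\<lambda>_. borel) \<Otimes>\<^sub>M Pi\<^sub>M {2..n} (\<lambda>_. count_space UNIV))"
  by (intro measurable_Pair measurable_restrict W_measurable parent_measurable) auto

lemma subalgebra_history: "subalgebra M (history M W p n)"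
  unfolding subalgebra_def history_def
  using sets_image_in_sets[OF refl history_map_measurable] by (auto simp: space_vimage_algebra)

sublocale hist: finite_measure_subalgebra M "history M W p n" for n
  by unfold_locales (rule subalgebra_history)

lemma space_history [simp]: "space (history M W p n) = space M"
  by (simp add: history_def)

lemma history_map_measurable':
  "(\<lambda>\<omega>. (\<lambda>i\<in>{1..}. W i \<omega>, \<lambda>k\<in>{2..n}. p k \<omega>))
     \<in> history M W p n \<rightarrow>\<^sub>M (Pi\<^sub>M {1..} (\<lambda>_. borel) \<Otimes>\<^sub>M Pi\<^sub>M {2..n} (\<lambda>_. count_space UNIV))"
  unfolding history_def
  by (rule measurable_vimage_algebra1) (use measurable_space[OF history_map_measurable] in auto)

lemma W_measurable_history [measurable]:
  assumes "1 \<le> i"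
  shows "W i \<in> borel_measurable (history M W p n)"
proof -
  have "(\<lambda>\<omega>. fst (\<lambda>i\<in>{1..}. W i \<omega>, \<lambda>k\<in>{2..n}. p k \<omega>) i) \<in> borel_measurable (history M W p n)"
    by (rule measurable_compose[OF measurable_compose[OF history_map_measurable' measurable_fst]
        measurable_component_singleton]) (use assms in auto)
  then show ?thesis using assms by simp
qed

lemma W_measurable_history' [measurable]: "W (Suc i) \<in> borel_measurable (history M W p n)"
  by (rule W_measurable_history) simp

text \<open>The attachments of finitely many vertices take values in a countable discrete space, so
  every function of them is measurable.\<close>

lemma parents_measurable_history:
  fixes f :: "(nat \<Rightarrow> nat) \<Rightarrow> 'c"
  assumes "\<And>x. f x \<in> space N"
  shows "(\<lambda>\<omega>. f (restrict (par \<omega>) {2..n})) \<in> measurable (history M W p n) N"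
proof -
  have "Pi\<^sub>M {2..n} (\<lambda>_. count_space UNIV) = count_space (PiE {2..n} (\<lambda>_. UNIV::nat set))"
    by (rule count_space_PiM_finite) auto
  then have "f \<in> measurable (Pi\<^sub>M {2..n} (\<lambda>_. count_space UNIV)) N"
    using assms by simp
  with history_map_measurable' have
   "(\<lambda>\<omega>. f (snd (\<lambda>i\<in>{1..}. W i \<omega>, \<lambda>k\<in>{2..n}. p k \<omega>))) \<in> measurable (history M W p n) N"
    by (intro measurable_compose[OF measurable_compose[OF history_map_measurable' measurable_snd]])
  then show ?thesis by simp
qed

lemma indeg_measurable_history:
  "(\<lambda>\<omega>. F (indeg (par \<omega>) n)) \<in> borel_measurable (history M W p n)" for F :: "(nat \<Rightarrow> nat) \<Rightarrow> real"
proof -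
  have "(\<lambda>\<omega>. F (indeg (restrict (par \<omega>) {2..n}) n)) \<in> borel_measurable (history M W p n)"
    by (rule parents_measurable_history) simp
  moreover have "indeg (restrict x {2..n}) n = indeg x n" for x
    by (rule ext) (rule indeg_restrict)
  ultimately show ?thesis by simp
qed

lemma indeg_measurable: "(\<lambda>\<omega>. F (indeg (par \<omega>) n)) \<in> borel_measurable M" for F :: "(nat \<Rightarrow> nat) \<Rightarrow> real"
  by (rule measurable_from_subalg[OF subalgebra_history indeg_measurable_history])

lemma AE_weights_pos: "AE \<omega> in M. \<forall>k\<ge>1. 0 < W k \<omega>"
proof -
  have "AE \<omega> in M. k \<ge> 1 \<longrightarrow> 0 < W k \<omega>" for k
  proof (cases "k \<ge> 1")
    case True
    interpret D: prob_space D using weight_law by (simp add: real_distribution_def)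
    have sD: "sets D = sets borel" using weight_law by (simp add: real_distribution_def real_distribution_axioms_def)
    have "AE x in D. x \<in> {0<..}"
      by (rule D.AE_prob_1) (rule weight_pos)
    then have "AE x in distr M borel (W k). x \<in> {0<..}" unfolding weights_law[OF True] .
    then show ?thesis using True by (subst (asm) AE_distr_iff) auto
  qed auto
  then show ?thesis by (simp add: AE_all_countable)
qed

lemma attach_measurable_history [measurable]:
  "1 \<le> v \<Longrightarrow> (\<lambda>\<omega>. attach (wt \<omega>) n v) \<in> borel_measurable (history M W p k)"
  unfolding attach_def by measurable

lemma dlaw_measurable_history:
  assumes "V \<subseteq> {1..}"
  shows "(\<lambda>\<omega>. dlaw (attach (wt \<omega>)) V n m) \<in> borel_measurable (history M W p k)"
proof (induction n arbitrary: m)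
  case (Suc n)
  note [measurable] = Suc
  have [measurable]: "(\<lambda>\<omega>. down v (dlaw (attach (wt \<omega>)) V n) m) \<in> borel_measurable (history M W p k)" for v
    by (cases "m v = 0") (auto simp: down_def)
  have [measurable]: "(\<lambda>\<omega>. attach (wt \<omega>) n v) \<in> borel_measurable (history M W p k)" if "v \<in> V" for v
    using assms that by (intro attach_measurable_history) auto
  show ?case unfolding dlaw.simps by measurable
qed simp

lemma AE_attach:
  "AE \<omega> in M. \<forall>n. \<forall>v\<ge>1. 0 \<le> attach (wt \<omega>) n v \<and> attach (wt \<omega>) n v \<le> 1"
  using AE_weights_pos
proof eventually_elim
  case (elim \<omega>)
  have "attach (wt \<omega>) n v \<le> 1" if "v \<ge> 1" for n v
    using sum_attach_le_1[of "wt \<omega>" "{v}" n] elim that by auto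
  then show ?case using elim by (auto intro!: attach_nonneg)
qed

lemma AE_dlaw:
  assumes "finite V" "V \<subseteq> {1..}"
  shows "AE \<omega> in M. \<forall>n m. 0 \<le> dlaw (attach (wt \<omega>)) V n m \<and> dlaw (attach (wt \<omega>)) V n m \<le> 1"
  using AE_weights_pos
proof eventually_elim
  case (elim \<omega>)
  show ?case
    by (intro allI dlaw_bounds) (use elim assms in \<open>auto intro!: attach_nonneg sum_attach_le_1\<close>)
qed

lemma AE_bounded_integrable:
  assumes "f \<in> borel_measurable M" "AE \<omega> in M. \<bar>f \<omega>\<bar> \<le> (B::real)"
  shows "integrable M f"
  by (rule integrable_const_bound[of _ B]) (use assms in auto)

text \<open>The conditional probability prescribed by \<open>attachment\<close>, tested against a
  history-measurable factor.\<close>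

lemma attachment_expectation_le:
  assumes n: "1 \<le> n" and i: "i \<in> {1..n}"
    and H: "H \<in> borel_measurable (history M W p n)" "AE \<omega> in M. \<bar>H \<omega>\<bar> \<le> (B::real)"
  shows "expectation (\<lambda>\<omega>. H \<omega> * indicator {\<omega> \<in> space M. p (Suc n) \<omega> = i} \<omega>)
       = expectation (\<lambda>\<omega>. H \<omega> * attach (wt \<omega>) n i)"
proof -
  let ?I = "indicator {\<omega> \<in> space M. p (Suc n) \<omega> = i} :: 'a \<Rightarrow> real"
  have [measurable]: "p (Suc n) \<in> measurable M (count_space UNIV)" using n by (intro parent_measurable) auto
  have I: "?I \<in> borel_measurable M" by measurable
  have HM [measurable]: "H \<in> borel_measurable M" by (rule measurable_from_subalg[OF subalgebra_history H(1)])
  have int: "integrable M (\<lambda>\<omega>. H \<omega> * ?I \<omega>)"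
    by (rule AE_bounded_integrable[where B = "\<bar>B\<bar>"]) (use H(2) in \<open>auto split: split_indicator elim!: eventually_mono\<close>)
  have "expectation (\<lambda>\<omega>. H \<omega> * ?I \<omega>) = expectation (\<lambda>\<omega>. H \<omega> * real_cond_exp M (history M W p n) ?I \<omega>)"
    using hist.real_cond_exp_intg(2)[OF int H(1) I] by simp
  also have "\<dots> = expectation (\<lambda>\<omega>. H \<omega> * attach (wt \<omega>) n i)"
    by (rule integral_cong_AE) (use attachment[OF n i] i in \<open>auto simp: attach_def elim!: eventually_mono\<close>)
  finally show ?thesis .
qed

text \<open>The probabilities of the admissible parents are the expectations of the attachment
  probabilities, and these add up to 1 almost surely.\<close>

lemma AE_parent:
  assumes n: "1 \<le> n"
  shows "AE \<omega> in M. p (Suc n) \<omega> \<in> {1..n}"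
proof -
  have [measurable]: "p (Suc n) \<in> measurable M (count_space UNIV)" using n by (intro parent_measurable) auto
  have "prob {\<omega> \<in> space M. p (Suc n) \<omega> \<in> {1..n}} = (\<Sum>i=1..n. prob {\<omega> \<in> space M. p (Suc n) \<omega> = i})"
  proof -
    have "{\<omega> \<in> space M. p (Suc n) \<omega> \<in> {1..n}} = (\<Union>i\<in>{1..n}. {\<omega> \<in> space M. p (Suc n) \<omega> = i})" by auto
    then show ?thesis
      by (simp only:) (rule finite_measure_finite_Union; auto simp: disjoint_family_on_def)
  qed
  also have "\<dots> = (\<Sum>i=1..n. expectation (\<lambda>\<omega>. 1 * indicator {\<omega> \<in> space M. p (Suc n) \<omega> = i} \<omega>))"
    by (intro sum.cong refl) (simp add: Int_absorb1 subset_eq)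
  also have "\<dots> = (\<Sum>i=1..n. expectation (\<lambda>\<omega>. attach (wt \<omega>) n i))"
    by (intro sum.cong refl, subst attachment_expectation_le[where B = 1]) (use n in auto)
  also have "\<dots> = expectation (\<lambda>\<omega>. \<Sum>i=1..n. attach (wt \<omega>) n i)"
  proof (rule Bochner_Integration.integral_sum[symmetric])
    fix i assume "i \<in> {1..n}"
    then have i: "1 \<le> i" by simp
    show "integrable M (\<lambda>\<omega>. attach (wt \<omega>) n i)"
      by (rule AE_bounded_integrable[where B = 1])
        (use AE_attach i in \<open>auto intro: measurable_from_subalg[OF subalgebra_history attach_measurable_history] elim!: eventually_mono\<close>)
  qed
  also have "\<dots> = expectation (\<lambda>\<omega>. 1)"
  proof (rule integral_cong_AE)
    show "AE \<omega> in M. (\<Sum>i=1..n. attach (wt \<omega>) n i) = 1"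
      using AE_weights_pos
    proof eventually_elim
      case (elim \<omega>)
      have "0 < (\<Sum>k=1..n. W k \<omega>)" using n elim by (intro sum_pos) auto
      moreover have "(\<Sum>i=1..n. attach (wt \<omega>) n i) = (\<Sum>i=1..n. W i \<omega>) / (\<Sum>k=1..n. W k \<omega>)"
        unfolding sum_divide_distrib by (intro sum.cong) (auto simp: attach_def)
      ultimately show ?case by (metis divide_self less_irrefl)
    qed
  qed (auto intro!: borel_measurable_sum measurable_from_subalg[OF subalgebra_history attach_measurable_history])
  finally have "prob {\<omega> \<in> space M. p (Suc n) \<omega> \<in> {1..n}} = 1" by (simp add: prob_space)
  then have "AE \<omega> in M. \<omega> \<in> {\<omega> \<in> space M. p (Suc n) \<omega> \<in> {1..n}}"
    by (intro AE_prob_1)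
  then show ?thesis by (rule eventually_mono) simp
qed

text \<open>For \<open>i > n\<close> both sides vanish, the left one because the parent almost
  surely lies in \<open>{1..n}\<close>.\<close>

lemma attachment_expectation:
  assumes n: "1 \<le> n" and i: "1 \<le> i"
    and H: "H \<in> borel_measurable (history M W p n)" "AE \<omega> in M. \<bar>H \<omega>\<bar> \<le> (B::real)"
  shows "expectation (\<lambda>\<omega>. H \<omega> * (if p (Suc n) \<omega> = i then 1 else 0))
       = expectation (\<lambda>\<omega>. H \<omega> * attach (wt \<omega>) n i)"
proof (cases "i \<le> n")
  case True
  have "expectation (\<lambda>\<omega>. H \<omega> * (if p (Suc n) \<omega> = i then 1 else 0))
      = expectation (\<lambda>\<omega>. H \<omega> * indicator {\<omega> \<in> space M. p (Suc n) \<omega> = i} \<omega>)"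
    by (rule Bochner_Integration.integral_cong) auto
  then show ?thesis using attachment_expectation_le[OF n _ H, of i] True i by simp
next
  case False
  have [measurable]: "p (Suc n) \<in> measurable M (count_space UNIV)" using n by (intro parent_measurable) auto
  have HM [measurable]: "H \<in> borel_measurable M" by (rule measurable_from_subalg[OF subalgebra_history H(1)])
  have "expectation (\<lambda>\<omega>. H \<omega> * (if p (Suc n) \<omega> = i then 1 else 0)) = expectation (\<lambda>\<omega>. 0)"
    by (rule integral_cong_AE, measurable) (rule eventually_mono[OF AE_parent[OF n]], use False in auto)
  then show ?thesis using False by (simp add: attach_def)
qed

text \<open>In substance, \<open>dlaw (attach (wt \<omega>))\<close> is the conditional law of the
  in-degrees given all weights. It is stated with a test function \<open>g\<close> that is
  measurable in every history, in effect a function of the weights, because the induction step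
  absorbs attachment probabilities into \<open>g\<close>.\<close>

lemma expectation_dlaw:
  assumes V: "finite V" "V \<subseteq> {1..}"
    and g: "\<And>k. g \<in> borel_measurable (history M W p k)" "AE \<omega> in M. \<bar>g \<omega>\<bar> \<le> (B::real)"
  shows "expectation (\<lambda>\<omega>. g \<omega> * (if \<forall>v\<in>V. indeg (par \<omega>) n v = m v then 1 else 0))
       = expectation (\<lambda>\<omega>. g \<omega> * dlaw (attach (wt \<omega>)) V n m)"
  using g
proof (induction n arbitrary: m g B)
  case 0
  show ?case by (intro arg_cong[where f = expectation]) (auto simp: indeg_0_1)
next
  case (Suc n)
  show ?case
  proof (cases "n = 0")
    \<comment> \<open>Vertex 1 enters without an edge, and \<open>attach w 0\<close> vanishes on
      positive labels, so nothing changes on either side between times 0 and 1.\<close>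
    case True
    have z: "attach w 0 v = 0" if "v \<in> V" for v w using V that by (auto simp: attach_def)
    have "dlaw (attach w) V (Suc 0) m = dlaw (attach w) V 0 m" for w by (simp add: z)
    then show ?thesis unfolding True by (intro arg_cong[where f = expectation]) (auto simp: indeg_0_1 z)
  next
    case False
    then have n: "1 \<le> n" by simp
    define I where "I m \<omega> = (if \<forall>v\<in>V. indeg (par \<omega>) n v = m v then 1 else 0 :: real)" for m \<omega>
    define J where "J v \<omega> = (if p (Suc n) \<omega> = v then 1 else 0 :: real)" for v \<omega>
    define A where "A v \<omega> = attach (wt \<omega>) n v" for v \<omega>
    define d where "d m \<omega> = dlaw (attach (wt \<omega>)) V n m" for m \<omega>
    note g = Suc.prems
    have V1: "1 \<le> v" if "v \<in> V" for v using V that by auto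
    have Ih [measurable]: "I m \<in> borel_measurable (history M W p n)" for m
      unfolding I_def by (rule indeg_measurable_history[where F = "\<lambda>x. if \<forall>v\<in>V. x v = m v then 1 else 0"])
    have gM [measurable]: "g \<in> borel_measurable M" by (rule measurable_from_subalg[OF subalgebra_history g(1)])
    have IM [measurable]: "I m \<in> borel_measurable M" for m by (rule measurable_from_subalg[OF subalgebra_history Ih])
    have pM [measurable]: "p (Suc n) \<in> measurable M (count_space UNIV)" using n by (intro parent_measurable) auto
    have JM [measurable]: "J v \<in> borel_measurable M" for v unfolding J_def by measurable
    have Ah: "A v \<in> borel_measurable (history M W p k)" if "v \<in> V" for v k
      unfolding A_def by (rule attach_measurable_history[OF V1[OF that]])
    have AM: "A v \<in> borel_measurable M" if "v \<in> V" for v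
      by (rule measurable_from_subalg[OF subalgebra_history Ah[OF that]])
    have dM [measurable]: "d m \<in> borel_measurable M" for m
      unfolding d_def by (rule measurable_from_subalg[OF subalgebra_history dlaw_measurable_history[OF V(2)]])
    have A01: "AE \<omega> in M. 0 \<le> A v \<omega> \<and> A v \<omega> \<le> 1" if "v \<in> V" for v
      using AE_attach V1[OF that] by (auto simp: A_def elim!: eventually_mono)
    have I01: "0 \<le> I m \<omega>" "I m \<omega> \<le> 1" for m \<omega> by (auto simp: I_def)
    have J01: "0 \<le> J v \<omega>" "J v \<omega> \<le> 1" for v \<omega> by (auto simp: J_def)
    have d01: "AE \<omega> in M. \<forall>m. 0 \<le> d m \<omega> \<and> d m \<omega> \<le> 1"
      using AE_dlaw[OF V] by (auto simp: d_def elim!: eventually_mono)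
    define dI where "dI v \<omega> = down v (\<lambda>m. I m \<omega>) m" for v \<omega>
    define dd where "dd v \<omega> = down v (\<lambda>m. d m \<omega>) m" for v \<omega>
    have dIh [measurable]: "dI v \<in> borel_measurable (history M W p n)" for v
      unfolding dI_def by (cases "m v = 0") (auto simp: down_def)
    have dIM [measurable]: "dI v \<in> borel_measurable M" for v by (rule measurable_from_subalg[OF subalgebra_history dIh])
    have ddM [measurable]: "dd v \<in> borel_measurable M" for v
      unfolding dd_def by (cases "m v = 0") (auto simp: down_def)
    have dI01: "0 \<le> dI v \<omega>" "dI v \<omega> \<le> 1" for v \<omega> by (auto simp: dI_def down_def I01)
    have dd01: "AE \<omega> in M. \<forall>v. 0 \<le> dd v \<omega> \<and> dd v \<omega> \<le> 1"
      using d01 by (auto simp: dd_def down_def elim!: eventually_mono)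
    \<comment> \<open>One step of the tree as an identity of indicators: the old state survives
      unless the new edge hits \<open>V\<close>, and a hit at \<open>v\<close> must start from the
      state with \<open>m v\<close> lowered by one.\<close>
    have pt: "(if \<forall>v\<in>V. indeg (par \<omega>) (Suc n) v = m v then 1 else 0)
        = I m \<omega> - (\<Sum>v\<in>V. I m \<omega> * J v \<omega>) + (\<Sum>v\<in>V. dI v \<omega> * J v \<omega>)" for \<omega>
    proof (cases "p (Suc n) \<omega> \<in> V")
      case False
      then have "J v \<omega> = 0" if "v \<in> V" for v using that by (auto simp: J_def)
      moreover have "indeg (par \<omega>) (Suc n) v = indeg (par \<omega>) n v" if "v \<in> V" for v
        using False that by (auto simp: indeg_Suc[OF n])
      ultimately show ?thesis by (simp add: I_def)
    next
      case True
      define u where "u = p (Suc n) \<omega>"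
      have Ju: "J v \<omega> = (if v = u then 1 else 0)" for v by (auto simp: J_def u_def)
      have "(\<Sum>v\<in>V. I m \<omega> * J v \<omega>) = I m \<omega>" "(\<Sum>v\<in>V. dI v \<omega> * J v \<omega>) = dI u \<omega>"
        using True V(1) by (simp_all add: Ju if_distrib[where f = "\<lambda>x. _ * x"] sum.delta u_def cong: if_cong)
      moreover have "(if \<forall>v\<in>V. indeg (par \<omega>) (Suc n) v = m v then 1 else 0) = dI u \<omega>"
      proof (cases "m u = 0")
        case mu: True
        have "indeg (par \<omega>) (Suc n) u \<noteq> m u" by (simp add: indeg_Suc[OF n] u_def[symmetric] mu)
        then have "\<not> (\<forall>v\<in>V. indeg (par \<omega>) (Suc n) v = m v)" using True by (auto simp: u_def)
        then show ?thesis using mu by (simp add: dI_def down_def)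
      next
        case mu: False
        have "(\<forall>v\<in>V. indeg (par \<omega>) (Suc n) v = m v) = (\<forall>v\<in>V. indeg (par \<omega>) n v = (m(u := m u - 1)) v)"
          using mu by (auto simp: indeg_Suc[OF n] u_def[symmetric])
        then show ?thesis using mu by (simp add: dI_def down_def I_def)
      qed
      ultimately show ?thesis by simp
    qed
    have int1: "integrable M (\<lambda>\<omega>. g \<omega> * I m \<omega>)" for m
      by (rule AE_bounded_integrable[where B = B])
        (use g(2) I01 in \<open>auto simp: abs_mult elim!: eventually_mono intro: order.trans[OF mult_left_le]\<close>)
    have int2: "integrable M (\<lambda>\<omega>. g \<omega> * I m \<omega> * J v \<omega>)" for m v
      by (rule AE_bounded_integrable[where B = B])
        (use g(2) I01 J01 in \<open>auto simp: abs_mult elim!: eventually_mono intro!: order.trans[OF mult_left_le]\<close>)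
    have int3: "integrable M (\<lambda>\<omega>. g \<omega> * dI v \<omega> * J v \<omega>)" for v
      by (rule AE_bounded_integrable[where B = B])
        (use g(2) dI01 J01 in \<open>auto simp: abs_mult elim!: eventually_mono intro!: order.trans[OF mult_left_le]\<close>)
    have gA: "AE \<omega> in M. \<bar>g \<omega> * A v \<omega>\<bar> \<le> B" if "v \<in> V" for v
      using g(2) A01[OF that] by eventually_elim (auto simp: abs_mult intro: order.trans[OF mult_left_le])
    have int4: "integrable M (\<lambda>\<omega>. g \<omega> * d m \<omega>)" for m
      by (rule AE_bounded_integrable[where B = B], measurable)
        (use g(2) d01 in eventually_elim, auto simp: abs_mult intro: order.trans[OF mult_left_le])
    have int5: "integrable M (\<lambda>\<omega>. g \<omega> * A v \<omega> * d m \<omega>)" if "v \<in> V" for m v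
      by (rule AE_bounded_integrable[where B = B], use AM[OF that] in measurable)
        (use gA[OF that] d01 in eventually_elim, simp add: abs_mult, metis abs_ge_zero abs_mult mult_left_le order.trans)
    have int6: "integrable M (\<lambda>\<omega>. g \<omega> * A v \<omega> * dd v \<omega>)" if "v \<in> V" for v
      using int5[OF that] by (cases "m v = 0") (auto simp: dd_def down_def)
    have e1: "expectation (\<lambda>\<omega>. g \<omega> * I m \<omega>) = expectation (\<lambda>\<omega>. g \<omega> * d m \<omega>)" for m
      using Suc.IH[OF g, of m] unfolding I_def d_def .
    \<comment> \<open>The induction hypothesis is used a second time, with \<open>g * A v\<close> as
      the test function; this is why \<open>g\<close> is kept general.\<close>
    have IHA: "expectation (\<lambda>\<omega>. g \<omega> * A v \<omega> * I m \<omega>) = expectation (\<lambda>\<omega>. g \<omega> * A v \<omega> * d m \<omega>)" if "v \<in> V" for v m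
      using Suc.IH[of "\<lambda>\<omega>. g \<omega> * A v \<omega>" B m, OF borel_measurable_times[OF g(1) Ah[OF that]] gA[OF that]] unfolding I_def d_def .
    have e2: "expectation (\<lambda>\<omega>. g \<omega> * I m \<omega> * J v \<omega>) = expectation (\<lambda>\<omega>. g \<omega> * A v \<omega> * d m \<omega>)" if "v \<in> V" for v m
    proof -
      have "expectation (\<lambda>\<omega>. g \<omega> * I m \<omega> * J v \<omega>) = expectation (\<lambda>\<omega>. g \<omega> * I m \<omega> * A v \<omega>)"
        unfolding J_def A_def
        by (rule attachment_expectation[OF n V1[OF that], where B = B])
          (use g Ih I01 in \<open>auto simp: abs_mult elim!: eventually_mono intro: order.trans[OF mult_left_le]\<close>)
      also have "\<dots> = expectation (\<lambda>\<omega>. g \<omega> * A v \<omega> * I m \<omega>)" by (simp add: mult_ac)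
      finally show ?thesis using IHA[OF that] by simp
    qed
    have e3: "expectation (\<lambda>\<omega>. g \<omega> * dI v \<omega> * J v \<omega>) = expectation (\<lambda>\<omega>. g \<omega> * A v \<omega> * dd v \<omega>)" if "v \<in> V" for v
      using e2[OF that] by (cases "m v = 0") (auto simp: dI_def dd_def down_def)
    have "expectation (\<lambda>\<omega>. g \<omega> * (if \<forall>v\<in>V. indeg (par \<omega>) (Suc n) v = m v then 1 else 0))
       = expectation (\<lambda>\<omega>. g \<omega> * I m \<omega> - (\<Sum>v\<in>V. g \<omega> * I m \<omega> * J v \<omega>) + (\<Sum>v\<in>V. g \<omega> * dI v \<omega> * J v \<omega>))"
      unfolding pt by (simp add: algebra_simps sum_distrib_left)
    also have "\<dots> = expectation (\<lambda>\<omega>. g \<omega> * I m \<omega>) - (\<Sum>v\<in>V. expectation (\<lambda>\<omega>. g \<omega> * I m \<omega> * J v \<omega>))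
        + (\<Sum>v\<in>V. expectation (\<lambda>\<omega>. g \<omega> * dI v \<omega> * J v \<omega>))"
      using int1 int2 int3 by (simp add: Bochner_Integration.integral_sum)
    also have "\<dots> = expectation (\<lambda>\<omega>. g \<omega> * d m \<omega>) - (\<Sum>v\<in>V. expectation (\<lambda>\<omega>. g \<omega> * A v \<omega> * d m \<omega>))
        + (\<Sum>v\<in>V. expectation (\<lambda>\<omega>. g \<omega> * A v \<omega> * dd v \<omega>))"
      by (simp add: e1 e2 e3)
    also have "\<dots> = expectation (\<lambda>\<omega>. g \<omega> * d m \<omega> - (\<Sum>v\<in>V. g \<omega> * A v \<omega> * d m \<omega>) + (\<Sum>v\<in>V. g \<omega> * A v \<omega> * dd v \<omega>))"
      using int4 int5 int6 by (simp add: Bochner_Integration.integral_sum)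
    also have "\<dots> = expectation (\<lambda>\<omega>. g \<omega> * dlaw (attach (wt \<omega>)) V (Suc n) m)"
    proof (rule arg_cong[where f = expectation], rule ext)
      fix \<omega>
      show "g \<omega> * d m \<omega> - (\<Sum>v\<in>V. g \<omega> * A v \<omega> * d m \<omega>) + (\<Sum>v\<in>V. g \<omega> * A v \<omega> * dd v \<omega>)
        = g \<omega> * dlaw (attach (wt \<omega>)) V (Suc n) m"
        unfolding sum_distrib_right[symmetric] sum_distrib_left[symmetric] mult.assoc
        by (simp add: d_def dd_def A_def algebra_simps sum_distrib_left sum_distrib_right)
    qed
    finally show ?thesis .
  qed
qed

lemma expectation_tilt:
  assumes v: "1 \<le> v"
    and g: "\<And>k. g \<in> borel_measurable (history M W p k)" "AE \<omega> in M. \<bar>g \<omega>\<bar> \<le> (B::real)" and z: "1 \<le> z"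
  shows "expectation (\<lambda>\<omega>. g \<omega> * z ^ indeg (par \<omega>) n v)
       = expectation (\<lambda>\<omega>. g \<omega> * (\<Prod>j<n. 1 + (z - 1) * attach (wt \<omega>) j v))"
  using g
proof (induction n arbitrary: g B)
  case 0
  show ?case by (simp add: indeg_0_1)
next
  case (Suc n)
  note g = Suc.prems
  show ?case
  proof (cases "n = 0")
    case True
    show ?thesis using v by (simp add: True indeg_0_1 attach_def)
  next
    case False
    then have n: "1 \<le> n" by simp
    have Zh [measurable]: "(\<lambda>\<omega>. z ^ indeg (par \<omega>) n v) \<in> borel_measurable (history M W p n)"
      by (rule indeg_measurable_history[where F = "\<lambda>x. z ^ x v"])
    have pM [measurable]: "p (Suc n) \<in> measurable M (count_space UNIV)" using n by (intro parent_measurable) auto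
    have gM [measurable]: "g \<in> borel_measurable M" by (rule measurable_from_subalg[OF subalgebra_history g(1)])
    have ZM [measurable]: "(\<lambda>\<omega>. z ^ indeg (par \<omega>) n v) \<in> borel_measurable M"
      by (rule measurable_from_subalg[OF subalgebra_history Zh])
    have AM [measurable]: "(\<lambda>\<omega>. attach (wt \<omega>) n v) \<in> borel_measurable M"
      by (rule measurable_from_subalg[OF subalgebra_history attach_measurable_history[OF v]])
    have Hb: "AE \<omega> in M. \<bar>g \<omega> * z ^ indeg (par \<omega>) n v\<bar> \<le> \<bar>B\<bar> * z ^ n"
      using g(2)
    proof eventually_elim
      case (elim \<omega>)
      have "\<bar>g \<omega>\<bar> * z ^ indeg (par \<omega>) n v \<le> \<bar>B\<bar> * z ^ n"
        by (intro mult_mono power_increasing indeg_le) (use elim z in auto)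
      then show ?case using z by (simp add: abs_mult)
    qed
    have "expectation (\<lambda>\<omega>. g \<omega> * z ^ indeg (par \<omega>) (Suc n) v)
      = expectation (\<lambda>\<omega>. g \<omega> * z ^ indeg (par \<omega>) n v
          + (z - 1) * (g \<omega> * z ^ indeg (par \<omega>) n v * (if p (Suc n) \<omega> = v then 1 else 0)))"
      by (intro Bochner_Integration.integral_cong refl) (auto simp: indeg_Suc[OF n] algebra_simps)
    also have "\<dots> = expectation (\<lambda>\<omega>. g \<omega> * z ^ indeg (par \<omega>) n v)
          + (z - 1) * expectation (\<lambda>\<omega>. g \<omega> * z ^ indeg (par \<omega>) n v * (if p (Suc n) \<omega> = v then 1 else 0))"
    proof (subst Bochner_Integration.integral_add)
      show "integrable M (\<lambda>\<omega>. g \<omega> * z ^ indeg (par \<omega>) n v)"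
        by (rule AE_bounded_integrable[OF _ Hb]) measurable
      show "integrable M (\<lambda>\<omega>. (z - 1) * (g \<omega> * z ^ indeg (par \<omega>) n v * (if p (Suc n) \<omega> = v then 1 else 0)))"
        by (intro integrable_mult_right AE_bounded_integrable[where B = "\<bar>B\<bar> * z ^ n"], measurable)
          (use Hb z in \<open>auto elim!: eventually_mono\<close>)
    qed auto
    also have "expectation (\<lambda>\<omega>. g \<omega> * z ^ indeg (par \<omega>) n v * (if p (Suc n) \<omega> = v then 1 else 0))
       = expectation (\<lambda>\<omega>. g \<omega> * z ^ indeg (par \<omega>) n v * attach (wt \<omega>) n v)"
      by (rule attachment_expectation[OF n v borel_measurable_times[OF g(1) Zh] Hb])
    also have "expectation (\<lambda>\<omega>. g \<omega> * z ^ indeg (par \<omega>) n v) + (z - 1) * \<dots>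
       = expectation (\<lambda>\<omega>. g \<omega> * z ^ indeg (par \<omega>) n v + (z - 1) * (g \<omega> * z ^ indeg (par \<omega>) n v * attach (wt \<omega>) n v))"
    proof (subst Bochner_Integration.integral_add)
      show "integrable M (\<lambda>\<omega>. g \<omega> * z ^ indeg (par \<omega>) n v)"
        by (rule AE_bounded_integrable[OF _ Hb]) measurable
      have "AE \<omega> in M. \<bar>g \<omega> * z ^ indeg (par \<omega>) n v * attach (wt \<omega>) n v\<bar> \<le> \<bar>B\<bar> * z ^ n"
        using Hb AE_attach
      proof eventually_elim
        case (elim \<omega>)
        then have "\<bar>g \<omega> * z ^ indeg (par \<omega>) n v\<bar> * \<bar>attach (wt \<omega>) n v\<bar> \<le> (\<bar>B\<bar> * z ^ n) * 1"
          using v z by (intro mult_mono) auto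
        then show ?case by (simp add: abs_mult)
      qed
      then show "integrable M (\<lambda>\<omega>. (z - 1) * (g \<omega> * z ^ indeg (par \<omega>) n v * attach (wt \<omega>) n v))"
        by (intro integrable_mult_right AE_bounded_integrable) measurable
    qed auto
    also have "\<dots> = expectation (\<lambda>\<omega>. (g \<omega> * (1 + (z - 1) * attach (wt \<omega>) n v)) * z ^ indeg (par \<omega>) n v)"
      by (intro Bochner_Integration.integral_cong refl) (simp add: algebra_simps)
    \<comment> \<open>The factor of the last step has been moved into the test function, so that the
      induction hypothesis applies.\<close>
    also have "\<dots> = expectation (\<lambda>\<omega>. (g \<omega> * (1 + (z - 1) * attach (wt \<omega>) n v)) * (\<Prod>j<n. 1 + (z - 1) * attach (wt \<omega>) j v))"
    proof (rule Suc.IH)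
      show "(\<lambda>\<omega>. g \<omega> * (1 + (z - 1) * attach (wt \<omega>) n v)) \<in> borel_measurable (history M W p k)" for k
        using g(1)[of k] attach_measurable_history[OF v, of n k] by measurable
      show "AE \<omega> in M. \<bar>g \<omega> * (1 + (z - 1) * attach (wt \<omega>) n v)\<bar> \<le> \<bar>B\<bar> * z"
        using g(2) AE_attach
      proof eventually_elim
        case (elim \<omega>)
        have A: "0 \<le> attach (wt \<omega>) n v" "attach (wt \<omega>) n v \<le> 1" using elim v by auto
        define t where "t = (z - 1) * attach (wt \<omega>) n v"
        have "t \<le> (z - 1) * 1" unfolding t_def using A z by (intro mult_left_mono) auto
        moreover have "0 \<le> t" using A z by (simp add: t_def)
        ultimately have "\<bar>1 + t\<bar> \<le> z" by simp
        then have "\<bar>1 + (z - 1) * attach (wt \<omega>) n v\<bar> \<le> z" by (simp only: t_def)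
        then have "\<bar>g \<omega>\<bar> * \<bar>1 + (z - 1) * attach (wt \<omega>) n v\<bar> \<le> \<bar>B\<bar> * z"
          using elim z by (intro mult_mono) auto
        then show ?case by (simp add: abs_mult)
      qed
    qed
    finally show ?thesis by (simp add: mult_ac)
  qed
qed

end

text \<open>
  The approximate law of the in-degree of vertex \<open>v\<close>, averaged over its weight.
\<close>

definition gq :: "real \<Rightarrow> real measure \<Rightarrow> nat \<Rightarrow> nat \<Rightarrow> nat \<Rightarrow> real" where
  "gq e D n v m = (\<integral>w. pois (w * ln (real n / real v) / e) m \<partial>D)"

section \<open>Averaging over the weights\<close>

locale bounded_weight_tree = weighted_recursive_tree +
  fixes e :: real
  assumes weight_le_1: "measure D {..1} = 1" and mean: "e = (\<integral>x. x \<partial>D)"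
begin

sublocale D: prob_space D using weight_law by (simp add: real_distribution_def)

lemma sets_D [simp, measurable_cong]: "sets D = sets borel"
  using weight_law by (simp add: real_distribution_def real_distribution_axioms_def)

lemma space_D [simp]: "space D = UNIV"
  using sets_eq_imp_space_eq[OF sets_D] by simp

lemma AE_D: "AE x in D. 0 < x \<and> x \<le> 1"
proof -
  have "AE x in D. x \<in> {0<..}" by (rule D.AE_prob_1) (rule weight_pos)
  moreover have "AE x in D. x \<in> {..1}" by (rule D.AE_prob_1) (rule weight_le_1)
  ultimately show ?thesis by eventually_elim auto
qed

lemma integrable_D: "f \<in> borel_measurable borel \<Longrightarrow> (\<And>x. 0 < x \<Longrightarrow> x \<le> 1 \<Longrightarrow> \<bar>f x\<bar> \<le> (B::real)) \<Longrightarrow> integrable D f"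
  by (rule D.integrable_const_bound[of _ B], rule eventually_mono[OF AE_D]) auto

lemma measure_D_UNIV [simp]: "measure D UNIV = 1"
  using D.prob_space by simp

lemma mean_pos: "0 < e" and mean_le_1: "e \<le> 1"
proof -
  have int: "integrable D (\<lambda>x. x)" by (rule integrable_D[where B = 1]) auto
  have "0 \<le> e" unfolding mean by (rule integral_nonneg_AE) (use AE_D in \<open>auto elim!: eventually_mono\<close>)
  moreover have "e \<noteq> 0"
  proof
    assume "e = 0"
    moreover have "AE x in D. 0 \<le> x" by (rule eventually_mono[OF AE_D]) auto
    ultimately have "AE x in D. x = 0"
      using integral_nonneg_eq_0_iff_AE[OF int] mean by simp
    with AE_D have "AE x in D. False" by eventually_elim auto
    then show False using D.AE_False by simp
  qed
  ultimately show "0 < e" by simp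
  have "e \<le> (\<integral>x. 1 \<partial>D)" unfolding mean
    by (rule integral_mono_AE) (use int AE_D in \<open>auto elim!: eventually_mono\<close>)
  then show "e \<le> 1" by simp
qed

lemma AE_weights: "AE \<omega> in M. \<forall>k\<ge>1. 0 < W k \<omega> \<and> W k \<omega> \<le> 1"
proof -
  have "AE \<omega> in M. k \<ge> 1 \<longrightarrow> 0 < W k \<omega> \<and> W k \<omega> \<le> 1" for k
  proof (cases "k \<ge> 1")
    case True
    have "AE x in distr M borel (W k). 0 < x \<and> x \<le> 1" unfolding weights_law[OF True] by (rule AE_D)
    then show ?thesis using True by (subst (asm) AE_distr_iff) auto
  qed auto
  then show ?thesis by (simp add: AE_all_countable)
qed

lemma good_weights_measurable_history:
  assumes "1 \<le> a"
  shows "(\<lambda>\<omega>. if good_weights e a n (wt \<omega>) then 1 else 0 :: real) \<in> borel_measurable (history M W p k)"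
proof -
  have [measurable]: "(\<lambda>\<omega>. \<Sum>k=1..j. W k \<omega>) \<in> borel_measurable (history M W p k)" for j
    by (intro borel_measurable_sum W_measurable_history) auto
  have "Measurable.pred (history M W p k) (\<lambda>\<omega>. good_weights e a n (wt \<omega>))"
    unfolding good_weights_def by measurable
  then show ?thesis by measurable
qed

definition bad :: "nat \<Rightarrow> nat \<Rightarrow> real" where
  "bad a n = prob {\<omega> \<in> space M. \<not> good_weights e a n (wt \<omega>)}"

lemma good_event: "1 \<le> a \<Longrightarrow> {\<omega> \<in> space M. \<not> good_weights e a n (wt \<omega>)} \<in> sets M"
proof -
  assume a: "1 \<le> a"
  have [measurable]: "(\<lambda>\<omega>. \<Sum>k=1..j. W k \<omega>) \<in> borel_measurable M" for j
    by (intro borel_measurable_sum W_measurable) auto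
  show ?thesis unfolding good_weights_def by measurable
qed

text \<open>Union bound over \<open>j\<close>. For the deviation \<open>j powr (3/4)\<close> the
  exponent in Hoeffding's inequality is \<open>2 * j powr (3/2) / j = 2 * sqrt j\<close>.\<close>

lemma bad_le:
  assumes a: "1 \<le> a"
  shows "bad a n \<le> (\<Sum>j=a..n. 2 * exp (- 2 * sqrt (real j)))"
proof -
  have [measurable]: "(\<lambda>\<omega>. \<Sum>k=1..j. W k \<omega>) \<in> borel_measurable M" for j
    by (intro borel_measurable_sum W_measurable) auto
  let ?B = "\<lambda>j. {\<omega> \<in> space M. \<bar>(\<Sum>k=1..j. W k \<omega>) - real (card {1..j}) * e\<bar> \<ge> real j powr (3/4)}"
  have "bad a n \<le> prob (\<Union>j\<in>{a..n}. ?B j)"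
    unfolding bad_def
  proof (rule finite_measure_mono)
    show "{\<omega> \<in> space M. \<not> good_weights e a n (wt \<omega>)} \<subseteq> (\<Union>j\<in>{a..n}. ?B j)"
    proof
      fix \<omega> assume "\<omega> \<in> {\<omega> \<in> space M. \<not> good_weights e a n (wt \<omega>)}"
      then obtain j where "j \<in> {a..n}" "\<omega> \<in> space M" "\<not> \<bar>(\<Sum>k=1..j. W k \<omega>) - e * real j\<bar> \<le> real j powr (3/4)"
        unfolding good_weights_def by blast
      moreover have "real (card {1..j}) * e = e * real j" by simp
      ultimately show "\<omega> \<in> (\<Union>j\<in>{a..n}. ?B j)"
        by (intro UN_I[of j]) (simp_all only: mem_Collect_eq not_le less_imp_le)
    qed
  qed measurable
  also have "\<dots> \<le> (\<Sum>j=a..n. prob (?B j))"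
    by (rule finite_measure_subadditive_finite) auto
  also have "\<dots> \<le> (\<Sum>j=a..n. 2 * exp (- 2 * sqrt (real j)))"
  proof (rule sum_mono)
    fix j assume j: "j \<in> {a..n}"
    have e1: "expectation (W 1) = e"
      unfolding mean weights_law[OF order_refl, symmetric] by (rule integral_distr[symmetric]) auto
    interpret Hoeffding_ineq_iid M "{1..j}" W "W 1" 0 1 "expectation (W 1)"
    proof unfold_locales
      show "indep_vars (\<lambda>_. borel) W {1..j}" by (rule indep_vars_subset[OF weights_indep]) auto
      show "AE x in M. W 1 x \<in> {0..1}" using AE_weights by eventually_elim (auto simp: less_imp_le)
      show "distr M borel (W i) = distr M borel (W 1)" if "i \<in> {1..j}" for i
        using weights_law[of i] weights_law[of 1] that by auto
    qed auto
    have j0: "0 < real j" using j a by auto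
    have "prob (?B j) \<le> 2 * exp (-2 * (real j powr (3/4))\<^sup>2 / (real (card {1..j}) * (1 - 0)\<^sup>2))"
      unfolding e1[symmetric] by (rule Hoeffding_ineq_abs_ge) (use j a in auto)
    also have "(real j powr (3/4))\<^sup>2 = real j * sqrt (real j)"
    proof -
      have "real j powr (3/4) * real j powr (3/4) = real j powr (3/2)"
        using powr_add[of "real j" "3/4" "3/4"] by simp
      moreover have "real j powr (3/2) = real j * sqrt (real j)"
        using powr_add[of "real j" 1 "1/2"] j0 by (simp add: powr_half_sqrt)
      ultimately show ?thesis by (simp add: power2_eq_square)
    qed
    finally show "prob (?B j) \<le> 2 * exp (- 2 * sqrt (real j))" using j0 by simp
  qed
  finally show ?thesis .
qed

lemma pois_integrable:
  assumes "0 \<le> x"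
  shows "integrable D (\<lambda>w. pois (w * x / e) m)"
proof (rule integrable_D)
  fix w :: real assume w: "0 < w" "w \<le> 1"
  have "0 \<le> w * x / e" using w assms mean_pos by simp
  from pois_tilt[OF this, of 1 m] pois_nonneg[OF this, of m] show "\<bar>pois (w * x / e) m\<bar> \<le> 1" by simp
qed (simp add: pois_def)

text \<open>The second bound is the tilted Poisson bound at \<open>1 + e\<close>, averaged over
  weights that are at most 1.\<close>

lemma gq_bounds:
  assumes "1 \<le> v" "v \<le> n"
  shows "0 \<le> gq e D n v m" and "(1 + e) ^ m * gq e D n v m \<le> real n / real v"
proof -
  have x: "0 \<le> ln (real n / real v)" using assms by simp
  have nn: "0 \<le> w * ln (real n / real v) / e" if "0 < w" for w
    using that x mean_pos by simp
  show "0 \<le> gq e D n v m" unfolding gq_def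
    by (rule integral_nonneg_AE) (use AE_D nn in \<open>auto elim!: eventually_mono intro: pois_nonneg\<close>)
  have "(1 + e) ^ m * gq e D n v m = (\<integral>w. (1 + e) ^ m * pois (w * ln (real n / real v) / e) m \<partial>D)"
    unfolding gq_def by (rule integral_mult_right_zero[symmetric])
  also have "\<dots> \<le> (\<integral>w. real n / real v \<partial>D)"
  proof (rule integral_mono_AE)
    show "AE w in D. (1 + e) ^ m * pois (w * ln (real n / real v) / e) m \<le> real n / real v"
      using AE_D
    proof eventually_elim
      case (elim w)
      have "(1 + e) ^ m * pois (w * ln (real n / real v) / e) m \<le> exp ((1 + e - 1) * (w * ln (real n / real v) / e))"
        by (rule pois_tilt) (use elim nn mean_pos in auto)
      also have "\<dots> \<le> exp (ln (real n / real v))"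
        using elim x mean_pos by (simp add: mult_left_le_one_le)
      also have "\<dots> = real n / real v" using assms by simp
      finally show ?case .
    qed
  qed (auto intro: pois_integrable[OF x])
  finally show "(1 + e) ^ m * gq e D n v m \<le> real n / real v" by simp
qed

text \<open>On good weights the conditional law is replaced by a product of Poisson laws. Without
  that restriction the product has expectation \<open>\<Prod>v\<in>V. gq e D n v (m v)\<close>, by
  independence of the weights. Imposing and lifting the restriction costs \<open>bad a n\<close>
  each.\<close>

lemma joint_degree_estimate:
  assumes a: "1 \<le> a" "2 / e \<le> real a powr (1/4)" and V: "V \<subseteq> {a<..n}" and n: "1 \<le> n"
  shows "\<bar>prob {\<omega> \<in> space M. \<forall>v\<in>V. indeg (par \<omega>) n v = m v} - (\<Prod>v\<in>V. gq e D n v (m v))\<bar>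
     \<le> (1 / (1 + e)) ^ (\<Sum>v\<in>V. m v) * (rho e (card V) (real a powr (-1/4) * (1 + ln (real n))) * (\<Prod>v\<in>V. real n / real v))
        + 2 * bad a n"
proof -
  define G where "G \<omega> = (if good_weights e a n (wt \<omega>) then 1 else 0 :: real)" for \<omega>
  define I where "I \<omega> = (if \<forall>v\<in>V. indeg (par \<omega>) n v = m v then 1 else 0 :: real)" for \<omega>
  define d where "d \<omega> = dlaw (attach (wt \<omega>)) V n m" for \<omega>
  define j where "j \<omega> = jpois V (\<lambda>v. W v \<omega> * ln (real n / real v) / e) m" for \<omega>
  define R where "R = (1 / (1 + e)) ^ (\<Sum>v\<in>V. m v) * (rho e (card V) (real a powr (-1/4) * (1 + ln (real n))) * (\<Prod>v\<in>V. real n / real v))"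
  have V1: "finite V" "V \<subseteq> {1..}" using V a by (auto intro: finite_subset)
  have Gh: "G \<in> borel_measurable (history M W p k)" for k
    unfolding G_def by (rule good_weights_measurable_history[OF a(1)])
  have [measurable]: "G \<in> borel_measurable M" by (rule measurable_from_subalg[OF subalgebra_history Gh])
  have [measurable]: "I \<in> borel_measurable M"
    unfolding I_def by (rule indeg_measurable[where F = "\<lambda>x. if \<forall>v\<in>V. x v = m v then 1 else 0"])
  have [measurable]: "d \<in> borel_measurable M"
    unfolding d_def by (rule measurable_from_subalg[OF subalgebra_history dlaw_measurable_history[OF V1(2)]])
  have jv: "(\<lambda>\<omega>. pois (W v \<omega> * ln (real n / real v) / e) (m v)) \<in> borel_measurable M" if "v \<in> V" for v
  proof -
    have "W v \<in> borel_measurable M" using V1 that by (intro W_measurable) auto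
    then show ?thesis unfolding pois_def by measurable
  qed
  have [measurable]: "j \<in> borel_measurable M"
    unfolding j_def jpois_def by (intro borel_measurable_prod jv)
  have j01: "AE \<omega> in M. 0 \<le> j \<omega> \<and> j \<omega> \<le> 1"
    using AE_weights
  proof eventually_elim
    case (elim \<omega>)
    have nn: "0 \<le> W v \<omega> * ln (real n / real v) / e" if "v \<in> V" for v
    proof -
      have "1 \<le> v" "v \<le> n" using V a that by auto
      then show ?thesis using elim mean_pos by (intro divide_nonneg_pos mult_nonneg_nonneg) (auto simp: less_imp_le)
    qed
    have "0 \<le> j \<omega>" unfolding j_def by (rule jpois_nonneg) (rule nn)
    moreover have "1 ^ (\<Sum>v\<in>V. m v) * j \<omega> \<le> exp ((1 - 1) * (\<Sum>v\<in>V. W v \<omega> * ln (real n / real v) / e))"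
      unfolding j_def by (rule jpois_tilt[OF V1(1)]) (auto intro: nn)
    ultimately show ?case by simp
  qed
  have G01: "G \<omega> = 0 \<or> G \<omega> = 1" for \<omega> by (auto simp: G_def)
  have I01: "0 \<le> I \<omega>" "I \<omega> \<le> 1" for \<omega> by (auto simp: I_def)
  have d01: "AE \<omega> in M. 0 \<le> d \<omega> \<and> d \<omega> \<le> 1"
    using AE_dlaw[OF V1] by eventually_elim (auto simp: d_def)
  have intI: "integrable M I" by (rule AE_bounded_integrable[where B = 1]) (use I01 in auto)
  have intG: "integrable M G"
  proof (rule AE_bounded_integrable[where B = 1])
    show "AE \<omega> in M. \<bar>G \<omega>\<bar> \<le> 1" by (rule AE_I2) (metis G01 abs_0 abs_1 order_refl zero_le_one)
  qed simp
  have intj: "integrable M j" by (rule AE_bounded_integrable[where B = 1], simp, rule eventually_mono[OF j01]) auto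
  have intGX: "integrable M (\<lambda>\<omega>. G \<omega> * X \<omega>)" if [measurable]: "X \<in> borel_measurable M" and X: "AE \<omega> in M. 0 \<le> X \<omega> \<and> X \<omega> \<le> 1" for X
  proof (rule AE_bounded_integrable[where B = 1])
    show "AE \<omega> in M. \<bar>G \<omega> * X \<omega>\<bar> \<le> 1"
      by (rule eventually_mono[OF X]) (metis G01 abs_0 abs_of_nonneg lambda_one mult_zero_left zero_le_one)
  qed measurable
  have intGI: "integrable M (\<lambda>\<omega>. G \<omega> * I \<omega>)" by (rule intGX) (use I01 in auto)
  have intGd: "integrable M (\<lambda>\<omega>. G \<omega> * d \<omega>)" by (rule intGX[OF _ d01]) simp
  have intGj: "integrable M (\<lambda>\<omega>. G \<omega> * j \<omega>)" by (rule intGX[OF _ j01]) simp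
  have prob_I: "prob {\<omega> \<in> space M. \<forall>v\<in>V. indeg (par \<omega>) n v = m v} = expectation I"
  proof -
    have "expectation I = expectation (indicator {\<omega> \<in> space M. \<forall>v\<in>V. indeg (par \<omega>) n v = m v})"
      by (rule Bochner_Integration.integral_cong) (auto simp: I_def)
    then show ?thesis by (simp add: Int_absorb2 subset_eq)
  qed
  have bad: "bad a n = expectation (\<lambda>\<omega>. 1 - G \<omega>)"
  proof -
    have "expectation (\<lambda>\<omega>. 1 - G \<omega>) = expectation (indicator {\<omega> \<in> space M. \<not> good_weights e a n (wt \<omega>)})"
      by (rule Bochner_Integration.integral_cong) (auto simp: G_def)
    then show ?thesis unfolding bad_def by (simp add: Int_absorb2 subset_eq)
  qed
  have Ej: "expectation j = (\<Prod>v\<in>V. gq e D n v (m v))"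
  proof (cases "V = {}")
    case True
    then have "j = (\<lambda>\<omega>. 1)" by (auto simp: j_def jpois_def)
    then show ?thesis using True by (simp add: prob_space)
  next
    case False
    have ind: "indep_vars (\<lambda>_. borel) (\<lambda>v \<omega>. pois (W v \<omega> * ln (real n / real v) / e) (m v)) V"
      by (rule indep_vars_compose2[OF indep_vars_subset[OF weights_indep V1(2)]]) (simp add: pois_def)
    have "expectation j = (\<Prod>v\<in>V. expectation (\<lambda>\<omega>. pois (W v \<omega> * ln (real n / real v) / e) (m v)))"
      unfolding j_def jpois_def
    proof (rule indep_vars_lebesgue_integral[OF V1(1) ind])
      fix v assume v: "v \<in> V"
      have v': "1 \<le> v" "v \<le> n" using V a v by auto
      show "integrable M (\<lambda>\<omega>. pois (W v \<omega> * ln (real n / real v) / e) (m v))"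
      proof (rule AE_bounded_integrable[OF jv[OF v], where B = 1])
        show "AE \<omega> in M. \<bar>pois (W v \<omega> * ln (real n / real v) / e) (m v)\<bar> \<le> 1"
          using AE_weights
        proof eventually_elim
          case (elim \<omega>)
          have "0 \<le> W v \<omega> * ln (real n / real v) / e"
            using elim v' mean_pos by (intro divide_nonneg_pos mult_nonneg_nonneg) (auto simp: less_imp_le)
          from pois_tilt[OF this, of 1 "m v"] pois_nonneg[OF this, of "m v"] show ?case by simp
        qed
      qed
    qed
    also have "\<dots> = (\<Prod>v\<in>V. gq e D n v (m v))"
    proof (rule prod.cong[OF refl])
      fix v assume "v \<in> V"
      then have v: "1 \<le> v" using V1 by auto
      show "expectation (\<lambda>\<omega>. pois (W v \<omega> * ln (real n / real v) / e) (m v)) = gq e D n v (m v)"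
        unfolding gq_def weights_law[OF v, symmetric]
        by (rule integral_distr[symmetric]) (use v in \<open>auto simp: pois_def\<close>)
    qed
    finally show ?thesis .
  qed
  have 1: "expectation (\<lambda>\<omega>. G \<omega> * I \<omega>) = expectation (\<lambda>\<omega>. G \<omega> * d \<omega>)"
    unfolding I_def d_def by (rule expectation_dlaw[OF V1 Gh, where B = 1]) (simp add: G_def)
  have close: "AE \<omega> in M. \<bar>G \<omega> * d \<omega> - G \<omega> * j \<omega>\<bar> \<le> R"
    using AE_weights
  proof eventually_elim
    case (elim \<omega>)
    have R0: "0 \<le> R" unfolding R_def rho_def using mean_pos n
      by (intro mult_nonneg_nonneg prod_nonneg add_nonneg_nonneg) auto
    show ?case
    proof (cases "good_weights e a n (wt \<omega>)")
      case False then show ?thesis using R0 by (simp add: G_def)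
    next
      case True
      have "(1 + e) ^ (\<Sum>v\<in>V. m v) * \<bar>d \<omega> - j \<omega>\<bar> \<le> rho e (card V) (real a powr (-1/4) * (1 + ln (real n))) * (\<Prod>v\<in>V. real n / real v)"
        unfolding d_def j_def by (rule attach_law_close[OF mean_pos _ _ True a V n]) (use elim in auto)
      then have "\<bar>d \<omega> - j \<omega>\<bar> \<le> R"
        unfolding R_def using mean_pos by (simp add: power_divide field_simps)
      then show ?thesis using True by (simp add: G_def)
    qed
  qed
  have 2: "\<bar>expectation (\<lambda>\<omega>. G \<omega> * d \<omega>) - expectation (\<lambda>\<omega>. G \<omega> * j \<omega>)\<bar> \<le> R"
  proof -
    have "\<bar>expectation (\<lambda>\<omega>. G \<omega> * d \<omega> - G \<omega> * j \<omega>)\<bar> \<le> expectation (\<lambda>\<omega>. \<bar>G \<omega> * d \<omega> - G \<omega> * j \<omega>\<bar>)"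
      by (rule integral_abs_bound)
    also have "\<dots> \<le> expectation (\<lambda>\<omega>. R)"
      by (rule integral_mono_AE) (use close intGd intGj in auto)
    finally show ?thesis using intGd intGj by (simp add: prob_space)
  qed
  have 3: "\<bar>expectation I - expectation (\<lambda>\<omega>. G \<omega> * I \<omega>)\<bar> \<le> bad a n"
  proof -
    have "expectation I - expectation (\<lambda>\<omega>. G \<omega> * I \<omega>) = expectation (\<lambda>\<omega>. I \<omega> - G \<omega> * I \<omega>)"
      using intI intGI by simp
    moreover have "\<dots> \<le> expectation (\<lambda>\<omega>. 1 - G \<omega>)"
    proof (rule integral_mono)
      show "I \<omega> - G \<omega> * I \<omega> \<le> 1 - G \<omega>" for \<omega> using G01[of \<omega>] I01[of \<omega>] by auto
    qed (use intI intGI intG in auto)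
    moreover have "0 \<le> expectation (\<lambda>\<omega>. I \<omega> - G \<omega> * I \<omega>)"
    proof (rule Bochner_Integration.integral_nonneg)
      show "0 \<le> I \<omega> - G \<omega> * I \<omega>" for \<omega> using G01[of \<omega>] I01[of \<omega>] by auto
    qed
    ultimately show ?thesis unfolding bad by simp
  qed
  have 4: "\<bar>expectation j - expectation (\<lambda>\<omega>. G \<omega> * j \<omega>)\<bar> \<le> bad a n"
  proof -
    have "expectation j - expectation (\<lambda>\<omega>. G \<omega> * j \<omega>) = expectation (\<lambda>\<omega>. j \<omega> - G \<omega> * j \<omega>)"
      using intj intGj by simp
    moreover have "\<dots> \<le> expectation (\<lambda>\<omega>. 1 - G \<omega>)"
    proof (rule integral_mono_AE)
      show "AE \<omega> in M. j \<omega> - G \<omega> * j \<omega> \<le> 1 - G \<omega>"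
        using j01
      proof eventually_elim
        case (elim \<omega>) then show ?case using G01[of \<omega>] by auto
      qed
    qed (use intj intGj intG in auto)
    moreover have "0 \<le> expectation (\<lambda>\<omega>. j \<omega> - G \<omega> * j \<omega>)"
    proof (rule integral_nonneg_AE)
      show "AE \<omega> in M. 0 \<le> j \<omega> - G \<omega> * j \<omega>"
        using j01
      proof eventually_elim
        case (elim \<omega>) then show ?case using G01[of \<omega>] by auto
      qed
    qed
    ultimately show ?thesis unfolding bad by simp
  qed
  show ?thesis using 1 2 3 4 unfolding prob_I Ej[symmetric] R_def[symmetric] by linarith
qed

end

section \<open>Erlang variables and the central limit theorem\<close>

text \<open>An Erlang variable with \<open>n + 1\<close> stages is a sum of \<open>n + 1\<close>
  exponential variables, so the central limit theorem applies. Skorohod's theorem turns it into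
  pointwise convergence, which allows integrands that vary with \<open>n\<close>; only the law of
  each single \<open>Y n\<close> is prescribed, and the integrals depend on nothing else.\<close>

lemma erlang_Skorohod:
  fixes k :: real
  assumes k: "0 < k"
  shows "\<exists>(\<Omega> :: real measure) Y Z. prob_space \<Omega> \<and> (\<forall>n. Y n \<in> borel_measurable \<Omega>) \<and> Z \<in> borel_measurable \<Omega>
    \<and> distr \<Omega> borel Z = std_normal_distribution \<and> (\<forall>\<omega>\<in>space \<Omega>. (\<lambda>n. Y n \<omega>) \<longlonglongrightarrow> Z \<omega>)
    \<and> (\<forall>n F. F \<in> borel_measurable borel \<longrightarrow>
        (\<integral>\<omega>. F ((real (Suc n) - sqrt (real (Suc n)) * Y (Suc n) \<omega>) / k) \<partial>\<Omega>) = (\<integral>x. erlang_density n k x * (F x :: real) \<partial>lborel))"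
proof -
  define E where "E = density lborel (exponential_density k)"
  interpret E: prob_space E unfolding E_def by (rule prob_space_exponential_density[OF k])
  interpret PS: product_prob_space "\<lambda>_::nat. E" UNIV ..
  define P where "P = PiM (UNIV :: nat set) (\<lambda>_. E)"
  interpret P: prob_space P unfolding P_def by (rule PS.prob_space_axioms)
  define X where "X i \<omega> = (\<omega> i :: real)" for i :: nat and \<omega> :: "nat \<Rightarrow> real"
  have sE [measurable_cong]: "sets E = sets borel" by (simp add: E_def)
  have X_E: "X i \<in> measurable P E" for i unfolding X_def P_def by (rule measurable_component_singleton) simp
  then have X_meas [measurable]: "X i \<in> borel_measurable P" for i by (simp cong: measurable_cong_sets add: measurable_cong_sets[OF refl sE])
  have dX: "distr P borel (X i) = E" for i
  proof -
    have "distr P borel (X i) = distr P E (X i)" by (rule distr_cong) (auto simp: sE)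
    also have "\<dots> = E" unfolding P_def X_def by (rule distr_PiM_component) (auto intro: E.prob_space_axioms)
    finally show ?thesis .
  qed
  have distX: "distributed P lborel (X i) (exponential_density k)" for i
    unfolding distributed_def
    using dX[of i] k by (auto simp: E_def cong: distr_cong intro: exponential_density_nonneg)
  have ind: "P.indep_vars (\<lambda>_. borel) X UNIV"
  proof (subst P.indep_vars_iff_distr_eq_PiM)
    have "distr P (Pi\<^sub>M UNIV (\<lambda>i. borel)) (\<lambda>x. \<lambda>i\<in>UNIV. X i x) = distr P P (\<lambda>x. x)"
      by (rule distr_cong) (auto simp: X_def P_def intro!: sets_PiM_cong sE[symmetric])
    then show "distr P (Pi\<^sub>M UNIV (\<lambda>i. borel)) (\<lambda>x. \<lambda>i\<in>UNIV. X i x) = Pi\<^sub>M UNIV (\<lambda>i. distr P borel (X i))"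
      by (simp add: dX distr_id) (simp add: P_def)
  qed auto
  \<comment> \<open>The summands are centred with reversed sign: labels \<open>n * exp (- x)\<close>
    decrease in \<open>x\<close>, so a positive value of \<open>Y\<close> stands for a large
    label.\<close>
  define X' where "X' i \<omega> = 1 / k - X i \<omega>" for i \<omega>
  have ind': "P.indep_vars (\<lambda>_. borel) X' UNIV"
    unfolding X'_def by (rule P.indep_vars_compose2[OF ind]) auto
  have X_int: "integrable P (X i)" "integrable P (\<lambda>\<omega>. (X i \<omega>)\<^sup>2)" for i
    using P.erlang_ith_moment_integrable[OF k distX, of i 1] P.erlang_ith_moment_integrable[OF k distX, of i 2] by auto
  have mean: "P.expectation (X' i) = 0" for i
    unfolding X'_def using X_int(1)[of i] P.exponential_distributed_expectation[OF k distX[of i]]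
    by (simp add: P.prob_space)
  have var: "P.variance (X' i) = (1 / k)\<^sup>2" for i
  proof -
    have "P.variance (X' i) = P.variance (X i)"
      unfolding mean by (intro Bochner_Integration.integral_cong refl)
        (simp add: P.exponential_distributed_expectation[OF k distX] X'_def power2_commute)
    then show ?thesis using P.exponential_distributed_variance[OF k distX] by (simp add: power_divide)
  qed
  define S where "S n \<omega> = (\<Sum>i<n. X' i \<omega>) / sqrt (real n * (1 / k)\<^sup>2)" for n \<omega>
  have SM [measurable]: "S n \<in> borel_measurable P" for n unfolding S_def X'_def by measurable
  have dX': "distr P borel (X' n) = distr E borel (\<lambda>x. 1 / k - x)" for n
    unfolding X'_def dX[of n, symmetric] by (subst distr_distr) (auto simp: comp_def)
  have "weak_conv_m (\<lambda>n. distr P borel (\<lambda>x. (\<Sum>i<n. X' i x) / sqrt (real n * (1 / k)\<^sup>2))) std_normal_distribution"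
  proof (rule P.central_limit_theorem_zero_mean[OF ind' mean _ _ var dX'])
    show "integrable P (\<lambda>x. (X' n x)\<^sup>2)" for n
      unfolding X'_def power2_diff using X_int[of n] by simp
  qed (use k in simp)
  then have wc: "weak_conv_m (\<lambda>n. distr P borel (S n)) std_normal_distribution"
    by (simp add: S_def[abs_def])
  have rd: "real_distribution (distr P borel (S n))" for n
    by (rule real_distribution.intro) (auto intro: P.prob_space_distr simp: real_distribution_axioms_def)
  obtain \<Omega> :: "real measure" and Y Z where \<Omega>: "prob_space \<Omega>" "\<forall>n. Y n \<in> measurable \<Omega> borel"
    "\<forall>n. distr \<Omega> borel (Y n) = distr P borel (S n)" "Z \<in> measurable \<Omega> lborel"
    "distr \<Omega> borel Z = std_normal_distribution" "\<forall>x\<in>space \<Omega>. (\<lambda>n. Y n x) \<longlonglongrightarrow> Z x"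
    using Skorohod[OF rd real_dist_normal_dist wc] by blast
  have [measurable]: "Y n \<in> borel_measurable \<Omega>" for n using \<Omega>(2) by blast
  have FE: "(\<integral>\<omega>. F ((real (Suc n) - sqrt (real (Suc n)) * Y (Suc n) \<omega>) / k) \<partial>\<Omega>) = (\<integral>x. erlang_density n k x * F x \<partial>lborel)"
    if [measurable]: "F \<in> borel_measurable borel" for n and F :: "real \<Rightarrow> real"
  proof -
    let ?N = "real (Suc n)"
    let ?G = "\<lambda>y. F ((?N - sqrt ?N * y) / k)"
    have "(\<integral>\<omega>. ?G (Y (Suc n) \<omega>) \<partial>\<Omega>) = (\<integral>y. ?G y \<partial>distr \<Omega> borel (Y (Suc n)))"
      by (rule integral_distr[symmetric]) auto
    also have "\<dots> = (\<integral>\<omega>. ?G (S (Suc n) \<omega>) \<partial>P)"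
      using \<Omega>(3) by (simp add: integral_distr)
    \<comment> \<open>The argument of \<open>F\<close> undoes the standardisation:
      \<open>?N - sqrt ?N * S (Suc n) \<omega>\<close> is \<open>k\<close> times the sum of the
      exponential variables.\<close>
    also have "\<dots> = (\<integral>\<omega>. F (\<Sum>i<Suc n. X i \<omega>) \<partial>P)"
    proof (rule Bochner_Integration.integral_cong[OF refl], rule arg_cong[where f = F])
      fix \<omega>
      have "sqrt (?N * (1 / k)\<^sup>2) = sqrt ?N / k" using k by (simp add: real_sqrt_mult)
      moreover have "(\<Sum>i<Suc n. X' i \<omega>) = ?N / k - (\<Sum>i<Suc n. X i \<omega>)"
        unfolding X'_def sum_subtractf by simp
      moreover have "sqrt ?N \<noteq> 0" by simp
      moreover have "s * ((r / k - A) / (s / k)) = r - k * A" if "s \<noteq> 0" for s r A :: real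
        using that k by (simp add: field_simps)
      ultimately have "sqrt ?N * S (Suc n) \<omega> = ?N - k * (\<Sum>i<Suc n. X i \<omega>)"
        unfolding S_def by metis
      then show "(?N - sqrt ?N * S (Suc n) \<omega>) / k = (\<Sum>i<Suc n. X i \<omega>)" using k by simp
    qed
    also have "\<dots> = (\<integral>x. erlang_density n k x * F x \<partial>lborel)"
    proof -
      have "distributed P lborel (\<lambda>\<omega>. \<Sum>i\<in>{..<Suc n}. X i \<omega>) (erlang_density (card {..<Suc n} - 1) k)"
        by (rule P.exponential_distributed_sum[OF _ _ k distX P.indep_vars_subset[OF ind]]) auto
      then have "distributed P lborel (\<lambda>\<omega>. \<Sum>i<Suc n. X i \<omega>) (erlang_density n k)" by simp
      from distributed_integral[OF this, of F] show ?thesis using k by simp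
    qed
    finally show ?thesis .
  qed
  have ZM: "Z \<in> borel_measurable \<Omega>" using \<Omega>(4) by simp
  show ?thesis
    by (rule exI[of _ \<Omega>], rule exI[of _ Y], rule exI[of _ Z]) (intro conjI allI impI \<Omega>(1,5,6) \<Omega>(2)[rule_format] ZM FE)
qed

section \<open>Sums over labels as Erlang integrals\<close>

text \<open>For \<open>2 \<le> l \<le> n\<close> the points with label \<open>l\<close> form the
  interval from \<open>ln (n / l)\<close> to \<open>ln (n / (l - 1))\<close>, on which
  \<open>n * exp (- x)\<close> integrates to 1. A sum over labels thus becomes an integral against
  that density.\<close>

definition lab :: "nat \<Rightarrow> real \<Rightarrow> nat" where
  "lab n x = nat \<lceil>real n * exp (- x)\<rceil>"

lemma lab_measurable [measurable]: "lab n \<in> measurable borel (count_space UNIV)"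
  unfolding lab_def by measurable

lemma lab_measurable' [measurable]: "lab n \<in> borel_measurable borel"
  by (rule measurable_compose[OF lab_measurable]) simp

lemma lab_iff:
  assumes "2 \<le> l" "l \<le> n"
  shows "0 \<le> x \<and> lab n x = l \<longleftrightarrow> ln (real n / real l) \<le> x \<and> x < ln (real n / real (l - 1))"
proof -
  have l: "0 < real l" "0 < real (l - 1)" "0 < real n" using assms by auto
  have "lab n x = l \<longleftrightarrow> \<lceil>real n * exp (- x)\<rceil> = int l"
    unfolding lab_def using l by auto
  also have "\<dots> \<longleftrightarrow> real (l - 1) < real n * exp (- x) \<and> real n * exp (- x) \<le> real l"
    using assms by (simp add: ceiling_eq_iff of_nat_diff)
  also have "real n * exp (- x) \<le> real l \<longleftrightarrow> real n / real l \<le> exp x"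
    using l by (simp add: exp_minus field_simps)
  also have "\<dots> \<longleftrightarrow> ln (real n / real l) \<le> x"
    using l by (metis divide_pos_pos exp_le_cancel_iff exp_ln)
  also have "real (l - 1) < real n * exp (- x) \<longleftrightarrow> exp x < real n / real (l - 1)"
    using l by (simp add: exp_minus field_simps)
  also have "\<dots> \<longleftrightarrow> x < ln (real n / real (l - 1))"
    using l by (metis divide_pos_pos exp_less_cancel_iff exp_ln)
  finally show ?thesis
    using assms by (auto intro: order.trans[rotated])
qed

text \<open>The substitution \<open>u = n * exp (- x)\<close> turns the cell into the unit interval
  between \<open>l - 1\<close> and \<open>l\<close>; \<open>l \<ge> 2\<close> keeps the cell
  bounded.\<close>

lemma cell_integral:
  assumes l: "2 \<le> l" "l \<le> n"
  shows "has_bochner_integral lborel (\<lambda>x. indicator {x. 0 \<le> x \<and> lab n x = l} x * (real n * exp (- x))) 1"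
proof -
  let ?A = "ln (real n / real l)" and ?B = "ln (real n / real (l - 1))"
  have p: "0 < real l" "0 < real (l - 1)" "0 < real n" using l by auto
  have AB: "?A \<le> ?B" using p l by (simp add: frac_le)
  have "has_bochner_integral lborel (\<lambda>x. (real n * exp (- x)) * indicator {?A..?B} x) (- (real n * exp (- ?B)) - (- (real n * exp (- ?A))))"
    by (rule has_bochner_integral_FTC_Icc_real[OF AB]) (auto intro!: derivative_eq_intros continuous_intros)
  moreover have "- (real n * exp (- ?B)) - (- (real n * exp (- ?A))) = 1"
  proof -
    have "exp (- ?A) = real l / real n" "exp (- ?B) = real (l - 1) / real n"
      using p by (simp_all add: exp_minus)
    then show ?thesis using l p by (simp add: of_nat_diff field_simps)
  qed
  ultimately have 1: "has_bochner_integral lborel (\<lambda>x. (real n * exp (- x)) * indicator {?A..?B} x) 1" by simp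
  have set: "{x. 0 \<le> x \<and> lab n x = l} = {?A..<?B}"
  proof (rule set_eqI)
    show "x \<in> {x. 0 \<le> x \<and> lab n x = l} \<longleftrightarrow> x \<in> {?A..<?B}" for x
      using lab_iff[OF l, of x] by (simp only: mem_Collect_eq atLeastLessThan_iff)
  qed
  \<comment> \<open>The closed interval of the fundamental theorem and the half-open cell differ in
    one point.\<close>
  have "AE x in lborel. (real n * exp (- x)) * indicator {?A..?B} x = indicator {x. 0 \<le> x \<and> lab n x = l} x * (real n * exp (- x))"
    unfolding set using AE_lborel_singleton[of ?B] by eventually_elim (auto split: split_indicator)
  from has_bochner_integral_cong_AE[THEN iffD1, OF _ _ this 1] show ?thesis unfolding set by simp
qed

lemma pois_lipschitz:
  assumes "0 \<le> a" "a \<le> b" "1 \<le> t"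
  shows "t ^ m * \<bar>pois b m - pois a m\<bar> \<le> (t + 1) * (b - a) * exp ((t - 1) * b)"
  using jpois_lipschitz[of "{()}" "\<lambda>_. a" "\<lambda>_. b" t b "\<lambda>_. m"] assms by (simp add: jpois_def)

lemma pois_le_1: "0 \<le> a \<Longrightarrow> pois a m \<le> 1"
  using pois_tilt[of a 1 m] by simp

lemma pois_measurable [measurable]: "(\<lambda>x. pois x m) \<in> borel_measurable borel"
  unfolding pois_def by measurable

text \<open>Error, relative to \<open>n * (1 / (1 + e)) ^ m\<close>, of replacing values at labels
  above \<open>a\<close> by averages over their cells.\<close>

definition cellerr :: "real \<Rightarrow> nat \<Rightarrow> nat \<Rightarrow> real" where
  "cellerr e a n = (2 + e) / e * ((1 + ln (real n)) / real a)"

text \<open>Inside a cell only the Poisson factor varies relative to the density, since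
  \<open>c (lab n x)\<close> is constant there. Its variation is controlled by the tilted Lipschitz
  estimate at \<open>1 + e\<close>, which preserves the factor
  \<open>(1 / (1 + e)) ^ m\<close>.\<close>

lemma cell_sum:
  fixes c :: "nat \<Rightarrow> real"
  assumes e: "0 < e" and w: "0 \<le> w" "w \<le> 1" and a: "1 \<le> a" and n: "1 \<le> n" and c: "\<And>l. \<bar>c l\<bar> \<le> B"
  shows "\<bar>(\<Sum>l\<in>{a<..n}. pois (w * ln (real n / real l) / e) m * c l)
    - (\<integral>x. (if 0 \<le> x \<and> lab n x \<in> {a<..n} then real n * exp (- x) * pois (w * x / e) m * c (lab n x) else 0) \<partial>lborel)\<bar>
    \<le> B * ((1 / (1 + e)) ^ m * real n * cellerr e a n)" (is "\<bar>?S - ?I\<bar> \<le> _")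
proof -
  define C where "C l = {x. 0 \<le> x \<and> lab n x = l}" for l
  define h where "h x = real n * exp (- x) * pois (w * x / e) m" for x
  have CM [measurable]: "C l \<in> sets borel" for l unfolding C_def by measurable
  have B0: "0 \<le> B" using c[of 0] by linarith
  have hM [measurable]: "h \<in> borel_measurable borel" unfolding h_def by measurable
  have I1: "has_bochner_integral lborel (\<lambda>x. indicator (C l) x * (real n * exp (- x))) 1" if "l \<in> {a<..n}" for l
    unfolding C_def by (rule cell_integral) (use that a in auto)
  have Ih: "integrable lborel (\<lambda>x. indicator (C l) x * h x)" if l: "l \<in> {a<..n}" for l
  proof (rule Bochner_Integration.integrable_bound[OF integrable.intros[OF I1[OF l]]])
    show "AE x in lborel. norm (indicator (C l) x * h x) \<le> norm (indicator (C l) x * (real n * exp (- x)))"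
    proof (rule AE_I2)
      fix x
      show "norm (indicator (C l) x * h x) \<le> norm (indicator (C l) x * (real n * exp (- x)))"
      proof (cases "x \<in> C l")
        case True
        then have "0 \<le> w * x / e" using w e by (simp add: C_def)
        then show ?thesis using True pois_le_1[of "w * x / e" m] pois_nonneg[of "w * x / e" m]
          by (simp add: h_def abs_mult mult_left_le)
      qed simp
    qed
  qed measurable
  have I: "?I = (\<Sum>l\<in>{a<..n}. c l * (\<integral>x. indicator (C l) x * h x \<partial>lborel))"
  proof -
    have "?I = (\<integral>x. (\<Sum>l\<in>{a<..n}. c l * (indicator (C l) x * h x)) \<partial>lborel)"
    proof (rule Bochner_Integration.integral_cong[OF refl])
      fix x
      have "(\<Sum>l\<in>{a<..n}. c l * (indicator (C l) x * h x)) = (\<Sum>l\<in>{a<..n}. if lab n x = l then (if 0 \<le> x then h x * c l else 0) else 0)"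
        by (intro sum.cong refl) (auto simp: C_def)
      also have "\<dots> = (if 0 \<le> x \<and> lab n x \<in> {a<..n} then real n * exp (- x) * pois (w * x / e) m * c (lab n x) else 0)"
        by (subst sum.delta') (auto simp: h_def)
      finally show "(if 0 \<le> x \<and> lab n x \<in> {a<..n} then real n * exp (- x) * pois (w * x / e) m * c (lab n x) else 0)
        = (\<Sum>l\<in>{a<..n}. c l * (indicator (C l) x * h x))" by simp
    qed
    also have "\<dots> = (\<Sum>l\<in>{a<..n}. c l * (\<integral>x. indicator (C l) x * h x \<partial>lborel))"
      using Ih by (subst Bochner_Integration.integral_sum) auto
    finally show ?thesis .
  qed
  let ?K = "\<lambda>l. (1 / (1 + e)) ^ m * ((2 + e) / e * (1 / real (l - 1)) * (real n / real (l - 1)))"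
  have cell: "\<bar>pois (w * ln (real n / real l) / e) m - (\<integral>x. indicator (C l) x * h x \<partial>lborel)\<bar> \<le> ?K l" if l: "l \<in> {a<..n}" for l
  proof -
    let ?p = "pois (w * ln (real n / real l) / e) m"
    have l2: "2 \<le> l" "l \<le> n" using l a by auto
    have p: "0 < real l" "0 < real (l - 1)" "0 < real n" using l2 by auto
    \<comment> \<open>The factors of \<open>?K\<close> come from the tilt, the Lipschitz constant,
      the width of the cell, which is at most \<open>1 / (l - 1)\<close>, and the tilted
      exponential, which is at most \<open>n / (l - 1)\<close>.\<close>
    have pt: "\<bar>?p - pois (w * x / e) m\<bar> \<le> ?K l" if x: "x \<in> C l" for x
    proof -
      have x1: "ln (real n / real l) \<le> x" "x < ln (real n / real (l - 1))" using x lab_iff[OF l2, of x] by (auto simp: C_def)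
      have x0: "0 \<le> ln (real n / real l)" using p l2 by simp
      have le: "w * ln (real n / real l) / e \<le> w * x / e"
        using w e x1 by (intro divide_right_mono mult_left_mono) auto
      have "(1 + e) ^ m * \<bar>pois (w * x / e) m - ?p\<bar> \<le> (1 + e + 1) * (w * x / e - w * ln (real n / real l) / e) * exp ((1 + e - 1) * (w * x / e))"
        by (rule pois_lipschitz) (use w e x0 le in auto)
      also have "\<dots> \<le> (2 + e) * (1 / e * (1 / real (l - 1))) * (real n / real (l - 1))"
      proof (intro mult_mono)
        have "w * x / e - w * ln (real n / real l) / e = w / e * (x - ln (real n / real l))" by (simp add: algebra_simps diff_divide_distrib)
        also have "\<dots> \<le> 1 / e * (1 / real (l - 1))"
        proof (rule mult_mono)
          show "w / e \<le> 1 / e" using w e by (simp add: divide_right_mono)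
          show "0 \<le> 1 / e" using e by simp
          show "0 \<le> x - ln (real n / real l)" using x1(1) by (simp only: diff_ge_0_iff_ge)
          have "ln (real n / real (l - 1)) - ln (real n / real l) = ln (1 + 1 / real (l - 1))"
          proof -
            have "1 + 1 / real (l - 1) = real l / real (l - 1)" using p l2 by (simp add: field_simps of_nat_diff)
            then show ?thesis using p by (simp add: ln_div)
          qed
          also have "\<dots> \<le> 1 / real (l - 1)" using p by (intro ln_add_one_self_le_self) auto
          finally show "x - ln (real n / real l) \<le> 1 / real (l - 1)"
            by (rule order.trans[rotated]) (simp only: diff_right_mono less_imp_le[OF x1(2)])
        qed
        finally show "w * x / e - w * ln (real n / real l) / e \<le> 1 / e * (1 / real (l - 1))" .
        have "(1 + e - 1) * (w * x / e) = w * x" using e by simp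
        also have "\<dots> \<le> x" using w x1 x0 by (simp add: mult_left_le_one_le)
        also have "\<dots> \<le> ln (real n / real (l - 1))" using x1 by simp
        finally have "exp ((1 + e - 1) * (w * x / e)) \<le> exp (ln (real n / real (l - 1)))" by simp
        then show "exp ((1 + e - 1) * (w * x / e)) \<le> real n / real (l - 1)"
          using p by (simp only: exp_ln divide_pos_pos)
        show "0 \<le> w * x / e - w * ln (real n / real l) / e" using le by (simp only: diff_ge_0_iff_ge)
      qed (use e in simp_all)
      finally have "(1 + e) ^ m * \<bar>pois (w * x / e) m - ?p\<bar> \<le> (2 + e) * (1 / e * (1 / real (l - 1))) * (real n / real (l - 1))" .
      then have "\<bar>pois (w * x / e) m - ?p\<bar> \<le> (2 + e) * (1 / e * (1 / real (l - 1))) * (real n / real (l - 1)) / (1 + e) ^ m"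
        using e by (subst pos_le_divide_eq) (auto simp: mult.commute)
      then show ?thesis by (simp add: power_divide abs_minus_commute mult_ac)
    qed
    have eq: "?p - (\<integral>x. indicator (C l) x * h x \<partial>lborel) = (\<integral>x. indicator (C l) x * (real n * exp (- x)) * ?p - indicator (C l) x * h x \<partial>lborel)"
      using has_bochner_integral_integral_eq[OF I1[OF l]] integrable.intros[OF I1[OF l]] Ih[OF l]
      by (subst Bochner_Integration.integral_diff) auto
    have "\<bar>?p - (\<integral>x. indicator (C l) x * h x \<partial>lborel)\<bar> \<le> (\<integral>x. \<bar>indicator (C l) x * (real n * exp (- x)) * ?p - indicator (C l) x * h x\<bar> \<partial>lborel)"
      unfolding eq by (rule integral_abs_bound)
    also have "\<dots> \<le> (\<integral>x. ?K l * (indicator (C l) x * (real n * exp (- x))) \<partial>lborel)"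
    proof (rule integral_mono)
      show "\<bar>indicator (C l) x * (real n * exp (- x)) * ?p - indicator (C l) x * h x\<bar> \<le> ?K l * (indicator (C l) x * (real n * exp (- x)))" for x
      proof (cases "x \<in> C l")
        case True
        have "\<bar>real n * exp (- x) * ?p - h x\<bar> = real n * exp (- x) * \<bar>?p - pois (w * x / e) m\<bar>"
          unfolding h_def right_diff_distrib[symmetric] abs_mult by simp
        also have "\<dots> \<le> real n * exp (- x) * ?K l" by (rule mult_left_mono[OF pt[OF True]]) simp
        finally show ?thesis using True by (simp add: mult_ac)
      qed simp
    qed (use integrable.intros[OF I1[OF l]] Ih[OF l] in auto)
    also have "\<dots> = ?K l" using has_bochner_integral_integral_eq[OF I1[OF l]] by simp
    finally show ?thesis .
  qed
  have "\<bar>?S - ?I\<bar> = \<bar>\<Sum>l\<in>{a<..n}. (pois (w * ln (real n / real l) / e) m - (\<integral>x. indicator (C l) x * h x \<partial>lborel)) * c l\<bar>"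
    unfolding I sum_subtractf[symmetric] by (intro arg_cong[where f = abs] sum.cong refl) (simp add: algebra_simps)
  also have "\<dots> \<le> (\<Sum>l\<in>{a<..n}. ?K l * B)"
  proof (intro order.trans[OF sum_abs] sum_mono)
    fix l assume l: "l \<in> {a<..n}"
    show "\<bar>(pois (w * ln (real n / real l) / e) m - (\<integral>x. indicator (C l) x * h x \<partial>lborel)) * c l\<bar> \<le> ?K l * B"
      unfolding abs_mult by (rule mult_mono[OF cell[OF l] c order.trans[OF abs_ge_zero cell[OF l]] abs_ge_zero])
  qed
  \<comment> \<open>Of the two factors \<open>1 / (l - 1)\<close> one is bounded by
    \<open>1 / a\<close> and the other is summed harmonically.\<close>
  also have "\<dots> \<le> (\<Sum>l\<in>{a<..n}. (B * (1 / (1 + e)) ^ m * real n * ((2 + e) / e) * (1 / real a)) * (1 / real (l - 1)))"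
  proof (rule sum_mono)
    fix l assume l: "l \<in> {a<..n}"
    have "1 / real (l - 1) \<le> 1 / real a" using l a by (intro divide_left_mono mult_pos_pos) auto
    then have "(B * (1 / (1 + e)) ^ m * real n * ((2 + e) / e) * (1 / real (l - 1))) * (1 / real (l - 1))
       \<le> (B * (1 / (1 + e)) ^ m * real n * ((2 + e) / e) * (1 / real a)) * (1 / real (l - 1))"
      using B0 e by (intro mult_right_mono mult_left_mono) auto
    then show "?K l * B \<le> (B * (1 / (1 + e)) ^ m * real n * ((2 + e) / e) * (1 / real a)) * (1 / real (l - 1))"
      by (simp add: mult_ac)
  qed
  also have "\<dots> = (B * (1 / (1 + e)) ^ m * real n * ((2 + e) / e) * (1 / real a)) * (\<Sum>l\<in>{a<..n}. 1 / real (l - 1))"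
    by (simp only: sum_distrib_left)
  also have "\<dots> \<le> (B * (1 / (1 + e)) ^ m * real n * ((2 + e) / e) * (1 / real a)) * (1 + ln (real n))"
  proof (rule mult_left_mono)
    have "(\<Sum>l\<in>{a<..n}. 1 / real (l - 1)) = (\<Sum>j\<in>{a..<n}. 1 / real j)"
      by (rule sum.reindex_bij_witness[of _ Suc "\<lambda>l. l - 1"]) auto
    also have "\<dots> \<le> (\<Sum>j=1..n. 1 / real j)" by (rule sum_mono2) (use a in auto)
    finally show "(\<Sum>l\<in>{a<..n}. 1 / real (l - 1)) \<le> 1 + ln (real n)" using inverse_sum_le[OF n] by linarith
  qed (use B0 e in auto)
  also have "\<dots> = B * ((1 / (1 + e)) ^ m * real n * cellerr e a n)"
    by (simp add: cellerr_def)
  finally show ?thesis .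
qed

text \<open>The density \<open>exp (- x)\<close> times the Poisson weight with mean
  \<open>w * x / e\<close> has the Erlang shape with rate \<open>1 + w / e\<close>; the remaining
  constants are what normalises it.\<close>

lemma exp_pois_erlang:
  assumes e: "0 < e" and w: "0 \<le> w" and x: "0 \<le> x"
  shows "real n * exp (- x) * pois (w * x / e) m
     = real n * (w / (w + e)) ^ m * (e / (w + e)) * erlang_density m ((w + e) / e) x"
proof -
  define k where "k = (w + e) / e"
  have k: "0 < k" unfolding k_def using e w by simp
  have 1: "exp (- x) * exp (- (w * x / e)) = exp (- k * x)"
    unfolding exp_add[symmetric] k_def using e by (simp add: field_simps)
  have 2: "(w / (w + e)) ^ m * (e / (w + e)) * k ^ Suc m = (w / e) ^ m"
  proof -
    have "w + e \<noteq> 0" using e w by linarith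
    then have "w / (w + e) * k = w / e" "e / (w + e) * k = 1" unfolding k_def using e by simp_all
    then show ?thesis by (metis (no_types, lifting) mult.assoc mult.commute mult.right_neutral power_Suc power_mult_distrib)
  qed
  have "real n * (w / (w + e)) ^ m * (e / (w + e)) * erlang_density m k x
    = real n * ((w / (w + e)) ^ m * (e / (w + e)) * k ^ Suc m) * x ^ m * exp (- k * x) / fact m"
    using x by (simp add: erlang_density_def)
  also have "\<dots> = real n * (w / e) ^ m * x ^ m * (exp (- x) * exp (- (w * x / e))) / fact m"
    unfolding 1 2 ..
  also have "\<dots> = real n * exp (- x) * pois (w * x / e) m"
    by (simp add: pois_def power_divide power_mult_distrib)
  finally show ?thesis unfolding k_def by simp
qed

lemma cell_sum_erlang:
  fixes c :: "nat \<Rightarrow> real"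
  assumes e: "0 < e" and w: "0 \<le> w" "w \<le> 1" and a: "1 \<le> a" and n: "1 \<le> n" and c: "\<And>l. \<bar>c l\<bar> \<le> B"
  shows "\<bar>(\<Sum>l\<in>{a<..n}. pois (w * ln (real n / real l) / e) m * c l)
    - real n * (w / (w + e)) ^ m * (e / (w + e)) *
      (\<integral>x. erlang_density m ((w + e) / e) x * (if 0 \<le> x \<and> lab n x \<in> {a<..n} then c (lab n x) else 0) \<partial>lborel)\<bar>
    \<le> B * ((1 / (1 + e)) ^ m * real n * cellerr e a n)"
proof -
  have "real n * (w / (w + e)) ^ m * (e / (w + e)) *
      (\<integral>x. erlang_density m ((w + e) / e) x * (if 0 \<le> x \<and> lab n x \<in> {a<..n} then c (lab n x) else 0) \<partial>lborel)
    = (\<integral>x. (if 0 \<le> x \<and> lab n x \<in> {a<..n} then real n * exp (- x) * pois (w * x / e) m * c (lab n x) else 0) \<partial>lborel)"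
    by (subst integral_mult_right_zero[symmetric])
       (intro Bochner_Integration.integral_cong refl, auto simp: exp_pois_erlang[OF e w(1)])
  then show ?thesis using cell_sum[OF assms, of m] by simp
qed

lemma erlang_integral_le_1:
  assumes k: "0 < k" and F: "\<And>x. 0 \<le> F x \<and> F x \<le> (1::real)" "F \<in> borel_measurable borel"
  shows "(\<integral>x. erlang_density m k x * F x \<partial>lborel) \<le> 1"
proof -
  interpret D: prob_space "density lborel (erlang_density m k)" by (rule prob_space_erlang_density[OF k])
  have "(\<integral>x. erlang_density m k x * F x \<partial>lborel) = (\<integral>x. F x \<partial>density lborel (erlang_density m k))"
    by (rule integral_real_density[symmetric]) (use k F(2) in simp_all)
  also have "\<dots> \<le> (\<integral>x. 1 \<partial>density lborel (erlang_density m k))"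
  proof (rule integral_mono)
    show "integrable (density lborel (erlang_density m k)) F"
      by (rule D.integrable_const_bound[where B = 1]) (use F in simp_all)
    show "F x \<le> 1" for x using F(1) by blast
  qed simp
  also have "\<dots> = 1" using D.prob_space by simp
  finally show ?thesis .
qed

text \<open>The Erlang probability is bounded by 1. The ratio \<open>w / (w + e)\<close> increases
  in \<open>w\<close>, so for large \<open>m\<close> a weight below 1 yields a far smaller main term
  than weight 1.\<close>

lemma pois_sum_le:
  assumes e: "0 < e" and w: "0 \<le> w" "w \<le> 1" and a: "1 \<le> a" and n: "1 \<le> n"
  shows "(\<Sum>l\<in>{a<..n}. pois (w * ln (real n / real l) / e) m)
    \<le> real n * (w / (w + e)) ^ m + (1 / (1 + e)) ^ m * real n * cellerr e a n"
proof -
  let ?I = "\<integral>x. erlang_density m ((w + e) / e) x * (if 0 \<le> x \<and> lab n x \<in> {a<..n} then 1 else 0) \<partial>lborel"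
  let ?F = "\<lambda>x. if 0 \<le> x \<and> lab n x \<in> {a<..n} then 1 else 0 :: real"
  have k: "0 < (w + e) / e" using e w by simp
  have FM: "?F \<in> borel_measurable borel" by measurable
  have F01: "0 \<le> ?F x \<and> ?F x \<le> 1" for x by simp
  have I1: "?I \<le> 1" using erlang_integral_le_1[OF k F01 FM] .
  have I0: "0 \<le> ?I"
  proof -
    have "0 \<le> erlang_density m ((w + e) / e) x * ?F x" for x
      by (rule mult_nonneg_nonneg[OF erlang_density_nonneg[OF less_imp_le[OF k]] conjunct1[OF F01]])
    then show ?thesis by (intro integral_nonneg_AE AE_I2)
  qed
  have pos: "0 < w + e" using e w by linarith
  have "e / (w + e) \<le> 1" unfolding divide_le_eq_1_pos[OF pos] using w by linarith
  then have "real n * (w / (w + e)) ^ m * (e / (w + e)) * ?I \<le> real n * (w / (w + e)) ^ m * 1 * 1"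
    using e w I0 I1 by (intro mult_mono) simp_all
  moreover have "\<bar>(\<Sum>l\<in>{a<..n}. pois (w * ln (real n / real l) / e) m * 1) - real n * (w / (w + e)) ^ m * (e / (w + e)) * ?I\<bar>
      \<le> 1 * ((1 / (1 + e)) ^ m * real n * cellerr e a n)"
    by (rule cell_sum_erlang[OF e w a n]) simp
  ultimately show ?thesis by (simp only: mult_1_right mult_1_left)
qed

section \<open>Labels of vertices of high in-degree\<close>

text \<open>An Erlang variable with \<open>m + 1\<close> stages and rate \<open>(1 + e) / e\<close>
  has mean \<open>(m + 1) * e / (1 + e)\<close> and variance
  \<open>(m + 1) * (e / (1 + e))\<^sup>2\<close>. With \<open>m\<close> near
  \<open>ln n / ln (1 + e)\<close>, the logarithm of \<open>n * exp (- x)\<close> is centred near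
  \<open>loc e * ln n\<close>; the variance yields the constant in \<open>std_label\<close>.\<close>

definition loc :: "real \<Rightarrow> real" where
  "loc e = 1 - e / ((1 + e) * ln (1 + e))"

definition std_label :: "real \<Rightarrow> nat \<Rightarrow> nat \<Rightarrow> real" where
  "std_label e n l = (ln (real l) - loc e * ln (real n)) / sqrt (e\<^sup>2 / ((1 + e)\<^sup>2 * ln (1 + e)) * ln (real n))"

text \<open>The window of labels starts near \<open>n powr h\<close>. Positivity of \<open>h\<close>
  makes the error terms smaller than every negative power of \<open>ln n\<close>;
  \<open>h < loc e\<close> keeps the typical labels, near \<open>n powr loc e\<close>, inside the
  window.\<close>

locale label_window =
  fixes e h :: real and ns a :: "nat \<Rightarrow> nat"
  assumes e_pos: "0 < e" and ns_top: "filterlim ns at_top sequentially"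
    and h_pos: "0 < h" and h_less: "h < loc e"
    and a_pos: "\<And>j. 1 \<le> a j"
    and a_le: "eventually (\<lambda>j. real (a j) \<le> real (ns j) powr h) sequentially"
    and a_ge: "eventually (\<lambda>j. real (ns j) powr h / 2 \<le> real (a j)) sequentially"
begin

abbreviation window :: "nat \<Rightarrow> nat set" where "window j \<equiv> {a j<..ns j}"

lemma ln1e_pos: "0 < ln (1 + e)"
  using e_pos by simp

lemma ln_ns_top: "filterlim (\<lambda>j. ln (real (ns j))) at_top sequentially"
  by (rule filterlim_compose[OF ln_at_top filterlim_compose[OF filterlim_real_sequentially ns_top]])

lemma eventually_ns_gt: "eventually (\<lambda>j. c < ln (real (ns j))) sequentially"
  using ln_ns_top by (simp add: filterlim_at_top_dense)

lemma eventually_ns_ge: "eventually (\<lambda>j. k \<le> ns j) sequentially"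
  using ns_top by (simp add: filterlim_at_top)

lemma inverse_a_ln_tendsto: "(\<lambda>j. (1 + ln (real (ns j))) ^ k / real (a j)) \<longlonglongrightarrow> 0"
proof -
  have "(\<lambda>n. (1 + ln (real n)) ^ k * 2 / real n powr h) \<longlonglongrightarrow> 0" using h_pos by real_asymp
  from filterlim_compose[OF this ns_top]
  have lim: "(\<lambda>j. (1 + ln (real (ns j))) ^ k * 2 / real (ns j) powr h) \<longlonglongrightarrow> 0" .
  show ?thesis
  proof (rule Lim_null_comparison[OF _ lim])
    show "eventually (\<lambda>j. norm ((1 + ln (real (ns j))) ^ k / real (a j)) \<le> (1 + ln (real (ns j))) ^ k * 2 / real (ns j) powr h) sequentially"
      using a_ge eventually_ns_ge[of 1]
    proof eventually_elim
      case (elim j)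
      have p: "0 < real (ns j) powr h / 2" using elim by simp
      have l: "0 \<le> (1 + ln (real (ns j))) ^ k" using elim by simp
      have "(1 + ln (real (ns j))) ^ k / real (a j) \<le> (1 + ln (real (ns j))) ^ k / (real (ns j) powr h / 2)"
        by (rule divide_left_mono[OF elim(1) l mult_pos_pos[OF less_le_trans[OF p elim(1)] p]])
      then show ?case using l by simp
    qed
  qed
qed

lemma cellerr_tendsto: "(\<lambda>j. cellerr e (a j) (ns j)) \<longlonglongrightarrow> 0"
  using tendsto_mult[OF tendsto_const[of "(2 + e) / e"] inverse_a_ln_tendsto[of 1]] by (simp add: cellerr_def)

lemma inverse_a_tendsto: "(\<lambda>j. 1 / real (a j)) \<longlonglongrightarrow> 0"
  using inverse_a_ln_tendsto[of 0] by simp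

text \<open>The extra power of the logarithm is the price of summing \<open>n / v\<close> over the
  labels of a tuple.\<close>

lemma rho_tendsto: "(\<lambda>j. rho e q (real (a j) powr (-1/4) * (1 + ln (real (ns j)))) * (1 + ln (real (ns j))) ^ k) \<longlonglongrightarrow> 0"
proof -
  define x where "x j = real (a j) powr (-1/4) * (1 + ln (real (ns j)))" for j
  define C where "C = (e + 2)\<^sup>2 * (2 * real q / e)\<^sup>2 + (e + 2) * (real q * (2 / e\<^sup>2 + 1 / e))"
  have xk: "(\<lambda>j. x j * (1 + ln (real (ns j))) ^ k) \<longlonglongrightarrow> 0" for k
  proof -
    have "(\<lambda>n. (real n powr h / 2) powr (-1/4) * (1 + ln (real n)) ^ Suc k) \<longlonglongrightarrow> 0" using h_pos by real_asymp
    from filterlim_compose[OF this ns_top]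
    have lim: "(\<lambda>j. (real (ns j) powr h / 2) powr (-1/4) * (1 + ln (real (ns j))) ^ Suc k) \<longlonglongrightarrow> 0" .
    show ?thesis
    proof (rule Lim_null_comparison[OF _ lim])
      show "eventually (\<lambda>j. norm (x j * (1 + ln (real (ns j))) ^ k) \<le> (real (ns j) powr h / 2) powr (-1/4) * (1 + ln (real (ns j))) ^ Suc k) sequentially"
        using a_ge eventually_ns_ge[of 1]
      proof eventually_elim
        case (elim j)
        have l: "0 \<le> (1 + ln (real (ns j)))" using elim by simp
        have "real (a j) powr (-1/4) \<le> (real (ns j) powr h / 2) powr (-1/4)"
          by (rule powr_mono2') (use elim in simp_all)
        from mult_right_mono[OF this zero_le_power[OF l, of "Suc k"]]
        show ?case using l by (simp add: x_def mult_ac)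
      qed
    qed
  qed
  have x0: "x \<longlonglongrightarrow> 0" using xk[of 0] by simp
  have "(\<lambda>j. C * (x j * (1 + ln (real (ns j))) ^ k) * exp (e * (real q * (2 / e\<^sup>2 + 1 / e)) * x j)) \<longlonglongrightarrow> C * 0 * exp (e * (real q * (2 / e\<^sup>2 + 1 / e)) * 0)"
    by (intro tendsto_mult tendsto_const tendsto_exp xk x0)
  then show ?thesis unfolding rho_def C_def[symmetric] x_def by (simp add: mult_ac)
qed

text \<open>The logarithm of \<open>n * (1 / (1 + e)) ^ (m + 1)\<close>. It converges along the
  in-degrees of interest and so disappears after division by \<open>sqrt (ln n)\<close>.\<close>

definition gap :: "(nat \<Rightarrow> nat) \<Rightarrow> nat \<Rightarrow> real" where
  "gap m j = ln (real (ns j)) - real (Suc (m j)) * ln (1 + e)"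

lemma gap_tendsto:
  assumes m: "(\<lambda>j. real (ns j) * (1 / (1 + e)) ^ m j) \<longlonglongrightarrow> t" and t: "0 < t"
  shows "gap m \<longlonglongrightarrow> ln t - ln (1 + e)"
proof -
  have "(\<lambda>j. ln (real (ns j) * (1 / (1 + e)) ^ m j) - ln (1 + e)) \<longlonglongrightarrow> ln t - ln (1 + e)"
    by (intro tendsto_diff tendsto_ln m tendsto_const) (use t in simp)
  moreover have "eventually (\<lambda>j. ln (real (ns j) * (1 / (1 + e)) ^ m j) - ln (1 + e) = gap m j) sequentially"
    using eventually_ns_ge[of 1]
  proof eventually_elim
    case (elim j)
    have "ln (real (ns j) * (1 / (1 + e)) ^ m j) = ln (real (ns j)) + real (m j) * ln (1 / (1 + e))"
      using elim e_pos by (subst ln_mult_pos) (auto simp: ln_realpow)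
    moreover have "ln (1 / (1 + e)) = - ln (1 + e)" using e_pos by (simp add: ln_div)
    ultimately show ?case by (simp add: gap_def algebra_simps)
  qed
  ultimately show ?thesis by (rule Lim_transform_eventually)
qed

lemma level_ratio_tendsto:
  assumes m: "(\<lambda>j. real (ns j) * (1 / (1 + e)) ^ m j) \<longlonglongrightarrow> t" and t: "0 < t"
  shows "(\<lambda>j. real (Suc (m j)) / ln (real (ns j))) \<longlonglongrightarrow> 1 / ln (1 + e)"
proof -
  have g0: "(\<lambda>j. gap m j / ln (real (ns j))) \<longlonglongrightarrow> 0"
    by (rule real_tendsto_divide_at_top[OF gap_tendsto[OF assms] ln_ns_top])
  have "(\<lambda>j. (1 - gap m j / ln (real (ns j))) / ln (1 + e)) \<longlonglongrightarrow> (1 - 0) / ln (1 + e)"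
    by (intro tendsto_divide tendsto_diff tendsto_const g0) (rule less_imp_neq[OF ln1e_pos, symmetric])
  moreover have "eventually (\<lambda>j. (1 - gap m j / ln (real (ns j))) / ln (1 + e) = real (Suc (m j)) / ln (real (ns j))) sequentially"
    using eventually_ns_gt[of 0]
  proof eventually_elim
    case (elim j)
    define L where "L = ln (real (ns j))"
    have "L \<noteq> 0" "ln (1 + e) \<noteq> 0" using elim ln1e_pos by (auto simp: L_def)
    then show ?case unfolding gap_def L_def[symmetric] by (simp add: diff_divide_distrib)
  qed
  ultimately show ?thesis using Lim_transform_eventually by fastforce
qed

lemma level_top:
  assumes m: "(\<lambda>j. real (ns j) * (1 / (1 + e)) ^ m j) \<longlonglongrightarrow> t" and t: "0 < t"
  shows "filterlim m at_top sequentially"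
proof -
  have "filterlim (\<lambda>j. real (Suc (m j)) / ln (real (ns j)) * ln (real (ns j))) at_top sequentially"
    by (rule filterlim_tendsto_pos_mult_at_top[OF level_ratio_tendsto[OF assms] _ ln_ns_top]) (use ln1e_pos in simp)
  moreover have "eventually (\<lambda>j. real (Suc (m j)) / ln (real (ns j)) * ln (real (ns j)) = real (Suc (m j))) sequentially"
    using eventually_ns_gt[of 0] by eventually_elim simp
  ultimately have "filterlim (\<lambda>j. real (Suc (m j))) at_top sequentially"
    using filterlim_cong[OF refl refl] by fast
  then have "filterlim (\<lambda>j. Suc (m j)) at_top sequentially"
    by (simp only: filterlim_sequentially_iff_filterlim_real)
  then have "eventually (\<lambda>j. Suc Z \<le> Suc (m j)) sequentially" for Z
    unfolding filterlim_at_top by blast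
  then show ?thesis by (simp add: filterlim_at_top)
qed

text \<open>
  The labels that matter have the form \<open>n exp (- x)\<close> with \<open>x\<close> distributed as an Erlang variable with
  \<open>m + 1\<close> stages, which is asymptotically normal.
\<close>

lemma std_label_lab:
  assumes m: "(\<lambda>j. real (ns j) * (1 / (1 + e)) ^ m j) \<longlonglongrightarrow> t" and t: "0 < t"
    and y: "ys \<longlonglongrightarrow> y"
  defines "x \<equiv> \<lambda>j. (real (Suc (m j)) - sqrt (real (Suc (m j))) * ys j) / ((1 + e) / e)"
  shows "eventually (\<lambda>j. 0 \<le> x j \<and> lab (ns j) (x j) \<in> window j) sequentially"
    and "(\<lambda>j. std_label e (ns j) (lab (ns j) (x j))) \<longlonglongrightarrow> y"
proof -
  define k where "k = (1 + e) / e"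
  define lam where "lam = ln (1 + e)"
  define L where "L j = ln (real (ns j))" for j
  define Q where "Q j = real (Suc (m j)) / L j" for j
  have k: "0 < k" and lam: "0 < lam" unfolding k_def lam_def using e_pos by auto
  have loc: "loc e = 1 - 1 / (lam * k)" unfolding loc_def lam_def k_def using e_pos by simp
  have L_top: "filterlim L at_top sequentially" unfolding L_def by (rule ln_ns_top)
  have L0: "eventually (\<lambda>j. 0 < L j) sequentially" unfolding L_def by (rule eventually_ns_gt)
  have Q: "Q \<longlonglongrightarrow> 1 / lam" unfolding Q_def L_def lam_def by (rule level_ratio_tendsto[OF m t])
  have sL: "filterlim (\<lambda>j. sqrt (L j)) at_top sequentially"
    by (rule filterlim_compose[OF sqrt_at_top L_top])
  have "(\<lambda>j. ys j / sqrt (L j)) \<longlonglongrightarrow> 0" by (rule real_tendsto_divide_at_top[OF y sL])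
  then have "(\<lambda>j. (Q j - sqrt (Q j) * (ys j / sqrt (L j))) / k) \<longlonglongrightarrow> (1 / lam - sqrt (1 / lam) * 0) / k"
    by (intro tendsto_divide tendsto_diff tendsto_mult tendsto_real_sqrt Q tendsto_const) (use k in simp_all)
  moreover have "eventually (\<lambda>j. (Q j - sqrt (Q j) * (ys j / sqrt (L j))) / k = x j / L j) sequentially"
    using L0
  proof eventually_elim
    case (elim j)
    have "sqrt (Q j) / sqrt (L j) = sqrt (real (Suc (m j))) / L j"
      unfolding Q_def real_sqrt_divide using elim by simp
    then have "sqrt (Q j) * (ys j / sqrt (L j)) = sqrt (real (Suc (m j))) * ys j / L j"
      by (metis (no_types, lifting) mult.commute times_divide_eq_left times_divide_eq_right)
    then show ?case unfolding x_def Q_def k_def[symmetric] by (simp add: diff_divide_distrib mult.commute)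
  qed
  ultimately have xL: "(\<lambda>j. x j / L j) \<longlonglongrightarrow> 1 / (lam * k)"
    using Lim_transform_eventually by fastforce
  have x0: "eventually (\<lambda>j. 0 \<le> x j) sequentially"
  proof -
    have "eventually (\<lambda>j. 0 < x j / L j) sequentially"
      by (rule order_tendstoD(1)[OF xL]) (use lam k in simp)
    with L0 show ?thesis by eventually_elim (simp add: zero_less_divide_iff)
  qed
  \<comment> \<open>Here \<open>h < loc e\<close> enters: \<open>x j / L j\<close> tends to
    \<open>1 - loc e\<close>, which is below \<open>1 - h\<close>, so the label exceeds
    \<open>n powr h\<close>.\<close>
  have xh: "eventually (\<lambda>j. h * L j < L j - x j) sequentially"
  proof -
    have "1 / (lam * k) < 1 - h" using h_less loc by simp
    from order_tendstoD(2)[OF xL this] L0 show ?thesis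
    proof eventually_elim
      case (elim j)
      then have "x j < (1 - h) * L j" by (simp add: pos_divide_less_eq)
      then show ?case by (simp add: algebra_simps)
    qed
  qed
  define u where "u j = exp (L j - x j)" for j
  have u_eq: "eventually (\<lambda>j. u j = real (ns j) * exp (- x j)) sequentially"
    using eventually_ns_ge[of 1]
  proof eventually_elim
    case (elim j)
    then have "exp (L j) = real (ns j)" unfolding L_def by simp
    then show ?case unfolding u_def by (simp add: exp_diff exp_minus divide_inverse)
  qed
  have lab_u: "eventually (\<lambda>j. u j \<le> real (lab (ns j) (x j)) \<and> real (lab (ns j) (x j)) \<le> u j + 1) sequentially"
    using u_eq
  proof eventually_elim
    case (elim j)
    have "0 < u j" unfolding u_def by simp
    then have "real (lab (ns j) (x j)) = of_int \<lceil>u j\<rceil>" unfolding lab_def elim[symmetric] by (simp add: of_nat_nat)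
    then show ?case using ceiling_correct[of "u j"] by linarith
  qed
  show "eventually (\<lambda>j. 0 \<le> x j \<and> lab (ns j) (x j) \<in> window j) sequentially"
    using x0 xh u_eq lab_u a_le eventually_ns_ge[of 1]
  proof eventually_elim
    case (elim j)
    have "real (ns j) powr h = exp (h * L j)" using elim(6) unfolding L_def powr_def by simp
    also have "\<dots> < u j" unfolding u_def using elim(2) by simp
    finally have "a j < lab (ns j) (x j)" using elim(4,5) by linarith
    moreover have "real (ns j) * exp (- x j) \<le> real (ns j)" using elim(1) by (simp add: mult_left_le)
    then have "\<lceil>real (ns j) * exp (- x j)\<rceil> \<le> int (ns j)" by (simp add: ceiling_le_iff)
    then have "lab (ns j) (x j) \<le> ns j" unfolding lab_def by (simp add: nat_le_iff)
    ultimately show ?case using elim(1) by simp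
  qed
  have u_top: "filterlim (\<lambda>j. L j - x j) at_top sequentially"
  proof (rule filterlim_at_top_mono)
    show "filterlim (\<lambda>j. h * L j) at_top sequentially"
      by (rule filterlim_tendsto_pos_mult_at_top[OF tendsto_const h_pos L_top])
    show "eventually (\<lambda>j. h * L j \<le> L j - x j) sequentially" using xh by eventually_elim simp
  qed
  \<comment> \<open>The effect of the ceiling in \<open>lab\<close> on the logarithm; it is at most
    the reciprocal of the value before rounding.\<close>
  define r where "r j = ln (real (lab (ns j) (x j))) - (L j - x j)" for j
  have r0: "r \<longlonglongrightarrow> 0"
  proof (rule tendsto_sandwich[where f = "\<lambda>_. 0" and h = "\<lambda>j. exp (- (L j - x j))"])
    show "eventually (\<lambda>j. 0 \<le> r j) sequentially"
      using lab_u
    proof eventually_elim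
      case (elim j)
      have "0 < u j" unfolding u_def by simp
      then have "ln (u j) \<le> ln (real (lab (ns j) (x j)))" using elim by simp
      then show ?case by (simp add: r_def u_def)
    qed
    show "eventually (\<lambda>j. r j \<le> exp (- (L j - x j))) sequentially"
      using lab_u
    proof eventually_elim
      case (elim j)
      have u0: "0 < u j" unfolding u_def by simp
      have "ln (real (lab (ns j) (x j))) \<le> ln (u j + 1)" using elim u0 by (subst ln_le_cancel_iff) linarith+
      also have "u j + 1 = u j * (1 + 1 / u j)" using u0 by (simp add: field_simps)
      also have "ln (u j * (1 + 1 / u j)) = ln (u j) + ln (1 + 1 / u j)" using u0 by (intro ln_mult_pos) (auto intro: add_pos_pos)
      also have "ln (1 + 1 / u j) \<le> 1 / u j" using u0 by (intro ln_add_one_self_le_self) auto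
      also have "1 / u j = exp (- (L j - x j))" unfolding u_def by (simp only: exp_minus divide_inverse mult_1_left)
      finally show ?case by (simp add: r_def u_def)
    qed
    show "(\<lambda>j. exp (- (L j - x j))) \<longlonglongrightarrow> 0"
      by (rule filterlim_compose[OF exp_at_bot filterlim_compose[OF filterlim_uminus_at_bot_at_top u_top]])
  qed simp
  have "(\<lambda>j. k * sqrt lam * (r j / sqrt (L j) + (gap m j / lam / k) / sqrt (L j) + sqrt (Q j) * ys j / k))
      \<longlonglongrightarrow> k * sqrt lam * (0 + 0 + sqrt (1 / lam) * y / k)"
    by (intro tendsto_mult tendsto_add tendsto_divide tendsto_const tendsto_real_sqrt Q y
        real_tendsto_divide_at_top[OF r0 sL]
        real_tendsto_divide_at_top[OF tendsto_divide[OF tendsto_divide[OF gap_tendsto[OF m t] tendsto_const] tendsto_const] sL])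
      (use k lam in simp_all)
  moreover have "k * sqrt lam * (0 + 0 + sqrt (1 / lam) * y / k) = y"
    using k lam by (simp add: real_sqrt_divide)
  moreover have "eventually (\<lambda>j. k * sqrt lam * (r j / sqrt (L j) + (gap m j / lam / k) / sqrt (L j) + sqrt (Q j) * ys j / k)
     = std_label e (ns j) (lab (ns j) (x j))) sequentially"
    using L0
  proof eventually_elim
    case (elim j)
    define N where "N = real (Suc (m j))"
    have N0: "0 \<le> N" unfolding N_def by simp
    have s: "sqrt (e\<^sup>2 / ((1 + e)\<^sup>2 * ln (1 + e)) * L j) = sqrt (L j) / (k * sqrt lam)"
    proof -
      have "e\<^sup>2 / ((1 + e)\<^sup>2 * ln (1 + e)) = (1 / k)\<^sup>2 / lam"
        unfolding k_def lam_def by (simp add: power_divide)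
      then show ?thesis using k by (simp add: real_sqrt_mult real_sqrt_divide power_divide)
    qed
    \<comment> \<open>Rounding, deviation of the level from its typical value, and normal
      fluctuation; only the last survives division by \<open>sqrt (L j)\<close>.\<close>
    have num: "ln (real (lab (ns j) (x j))) - loc e * L j = r j + gap m j / lam / k + sqrt N * ys j / k"
    proof -
      have g: "gap m j = L j - N * lam" unfolding gap_def L_def N_def lam_def ..
      have xj: "x j = N / k - sqrt N * ys j / k" unfolding x_def N_def k_def[symmetric] by (simp add: diff_divide_distrib)
      have "gap m j / lam / k = L j / (lam * k) - N / k" unfolding g using lam by (simp add: diff_divide_distrib)
      then show ?thesis unfolding r_def loc xj by (simp add: algebra_simps)
    qed
    have sq: "sqrt (Q j) = sqrt N / sqrt (L j)" unfolding Q_def N_def by (rule real_sqrt_divide)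
    have "sqrt (L j) \<noteq> 0" using elim by simp
    then show ?case
      unfolding std_label_def L_def[symmetric] s num sq by (simp add: add_divide_distrib algebra_simps)
  qed
  ultimately show "(\<lambda>j. std_label e (ns j) (lab (ns j) (x j))) \<longlonglongrightarrow> y"
    using Lim_transform_eventually by fastforce
qed

text \<open>The functions \<open>psi j\<close> vary with \<open>j\<close> and are required to
  converge only along label sequences whose standardised labels converge. This suffices on the
  Skorohod space, where labels converge pointwise, and it is what the later induction over tuples
  can provide.\<close>

lemma erlang_label_limit:
  fixes psi :: "nat \<Rightarrow> nat \<Rightarrow> real" and psi' :: "real \<Rightarrow> real"
  assumes m: "(\<lambda>j. real (ns j) * (1 / (1 + e)) ^ m j) \<longlonglongrightarrow> t" and t: "0 < t"
    and bd: "\<And>j l. \<bar>psi j l\<bar> \<le> B" and meas: "psi' \<in> borel_measurable borel"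
    and conv: "\<And>l x. eventually (\<lambda>j. l j \<in> window j) sequentially \<Longrightarrow> (\<lambda>j. std_label e (ns j) (l j)) \<longlonglongrightarrow> x
        \<Longrightarrow> (\<lambda>j. psi j (l j)) \<longlonglongrightarrow> psi' x"
  shows "(\<lambda>j. \<integral>x. erlang_density (m j) ((1 + e) / e) x * (if 0 \<le> x \<and> lab (ns j) x \<in> window j then psi j (lab (ns j) x) else 0) \<partial>lborel)
     \<longlonglongrightarrow> (\<integral>x. psi' x \<partial>std_normal_distribution)"
proof -
  define k where "k = (1 + e) / e"
  have k: "0 < k" unfolding k_def using e_pos by simp
  define F where "F j x = (if 0 \<le> x \<and> lab (ns j) x \<in> window j then psi j (lab (ns j) x) else 0)" for j x
  have FM: "F j \<in> borel_measurable borel" for j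
  proof -
    have 1: "(\<lambda>x. (\<lambda>l. if l \<in> window j then psi j l else 0) (lab (ns j) x)) \<in> borel_measurable borel"
      by (rule measurable_compose[OF lab_measurable]) simp
    have "(\<lambda>x. if 0 \<le> x then (\<lambda>l. if l \<in> window j then psi j l else 0) (lab (ns j) x) else 0) \<in> borel_measurable borel"
      by (rule measurable_If[OF 1]) simp_all
    moreover have "F j = (\<lambda>x. if 0 \<le> x then (\<lambda>l. if l \<in> window j then psi j l else 0) (lab (ns j) x) else 0)"
      by (rule ext) (simp add: F_def)
    ultimately show ?thesis by simp
  qed
  have FB: "\<bar>F j x\<bar> \<le> \<bar>B\<bar>" for j x
  proof -
    have "\<bar>psi j l\<bar> \<le> \<bar>B\<bar>" for l using bd[of j l] by linarith
    then show ?thesis by (simp add: F_def)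
  qed
  obtain \<Omega> :: "real measure" and Y Z where \<Omega>: "prob_space \<Omega>" "\<And>n. Y n \<in> borel_measurable \<Omega>" "Z \<in> borel_measurable \<Omega>"
    "distr \<Omega> borel Z = std_normal_distribution" "\<And>\<omega>. \<omega> \<in> space \<Omega> \<Longrightarrow> (\<lambda>n. Y n \<omega>) \<longlonglongrightarrow> Z \<omega>"
    and \<Omega>F: "\<And>n F. F \<in> borel_measurable borel \<Longrightarrow>
        (\<integral>\<omega>. F ((real (Suc n) - sqrt (real (Suc n)) * Y (Suc n) \<omega>) / k) \<partial>\<Omega>) = (\<integral>x. erlang_density n k x * (F x :: real) \<partial>lborel)"
    using erlang_Skorohod[OF k] by blast
  interpret \<Omega>: prob_space \<Omega> by fact
  note [measurable] = \<Omega>(2,3) meas FM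
  have mt: "filterlim (\<lambda>j. Suc (m j)) at_top sequentially"
    by (rule filterlim_compose[OF filterlim_Suc level_top[OF m t]])
  define X where "X j \<omega> = (real (Suc (m j)) - sqrt (real (Suc (m j))) * Y (Suc (m j)) \<omega>) / k" for j \<omega>
  have XM [measurable]: "X j \<in> borel_measurable \<Omega>" for j unfolding X_def by measurable
  have "(\<lambda>j. \<integral>\<omega>. F j (X j \<omega>) \<partial>\<Omega>) \<longlonglongrightarrow> (\<integral>\<omega>. psi' (Z \<omega>) \<partial>\<Omega>)"
  proof (rule integral_dominated_convergence[where w = "\<lambda>_. \<bar>B\<bar>"])
    show "AE \<omega> in \<Omega>. (\<lambda>j. F j (X j \<omega>)) \<longlonglongrightarrow> psi' (Z \<omega>)"
    proof (rule AE_I2)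
      fix \<omega> assume "\<omega> \<in> space \<Omega>"
      then have y: "(\<lambda>j. Y (Suc (m j)) \<omega>) \<longlonglongrightarrow> Z \<omega>"
        by (rule filterlim_compose[OF \<Omega>(5) mt])
      note sl = std_label_lab[OF m t y, folded k_def, folded X_def]
      have ev: "eventually (\<lambda>j. lab (ns j) (X j \<omega>) \<in> window j) sequentially"
        using sl(1) by eventually_elim simp
      have "(\<lambda>j. psi j (lab (ns j) (X j \<omega>))) \<longlonglongrightarrow> psi' (Z \<omega>)"
        by (rule conv[OF ev sl(2)])
      moreover have "eventually (\<lambda>j. psi j (lab (ns j) (X j \<omega>)) = F j (X j \<omega>)) sequentially"
        using sl(1) by eventually_elim (simp add: F_def)
      ultimately show "(\<lambda>j. F j (X j \<omega>)) \<longlonglongrightarrow> psi' (Z \<omega>)" by (rule Lim_transform_eventually)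
    qed
    show "AE \<omega> in \<Omega>. norm (F j (X j \<omega>)) \<le> \<bar>B\<bar>" for j using FB by (intro AE_I2) simp
  qed (simp_all add: measurable_compose[OF \<Omega>(3) meas] measurable_compose[OF XM FM])
  moreover have "(\<integral>\<omega>. F j (X j \<omega>) \<partial>\<Omega>) = (\<integral>x. erlang_density (m j) k x * F j x \<partial>lborel)" for j
    unfolding X_def by (rule \<Omega>F[OF FM])
  moreover have "(\<integral>\<omega>. psi' (Z \<omega>) \<partial>\<Omega>) = (\<integral>x. psi' x \<partial>std_normal_distribution)"
    unfolding \<Omega>(4)[symmetric] by (rule integral_distr[symmetric]) measurable
  ultimately show ?thesis unfolding F_def k_def by simp
qed

end

section \<open>Expected numbers of vertices with a given in-degree\<close>

locale tree_window = bounded_weight_tree M D W p e + label_window e h ns a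
  for M :: "'a measure" and D W p e h ns a
begin

text \<open>Isolates the atom of the weight law at 1, which alone contributes to the limit.\<close>

lemma gq_split:
  assumes "1 \<le> l" "l \<le> n"
  shows "gq e D n l m = measure D {1} * pois (1 * ln (real n / real l) / e) m
     + (\<integral>w. indicator {..<1} w * pois (w * ln (real n / real l) / e) m \<partial>D)"
proof -
  let ?p = "\<lambda>w. pois (w * ln (real n / real l) / e) m"
  have x: "0 \<le> ln (real n / real l)" using assms by simp
  have int: "integrable D ?p" by (rule pois_integrable[OF x])
  have i1: "integrable D (\<lambda>w. indicator {1} w * ?p 1)"
    by (rule integrable_D[where B = "\<bar>?p 1\<bar>"]) (auto simp: indicator_def)
  have i2: "integrable D (\<lambda>w. indicator {..<1} w * ?p w)"
    using integrable_mult_indicator[OF _ int, of "{..<1}"] by simp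
  have "gq e D n l m = (\<integral>w. indicator {1} w * ?p 1 + indicator {..<1} w * ?p w \<partial>D)"
    unfolding gq_def
  proof (rule integral_cong_AE)
    show "AE w in D. ?p w = indicator {1} w * ?p 1 + indicator {..<1} w * ?p w"
      using AE_D
    proof eventually_elim
      case (elim w)
      then show ?case by (cases "w = 1") (auto simp: indicator_def)
    qed
  qed (use int i1 i2 in simp_all)
  also have "\<dots> = (\<integral>w. indicator {1} w * ?p 1 \<partial>D) + (\<integral>w. indicator {..<1} w * ?p w \<partial>D)"
    by (rule Bochner_Integration.integral_add[OF i1 i2])
  also have "(\<integral>w. indicator {1} w * ?p 1 \<partial>D) = measure D {1} * ?p 1" by simp
  finally show ?thesis .
qed

text \<open>The stretched exponential bound beats \<open>n ^ k\<close>, the number of tuples over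
  which this probability will be summed.\<close>

lemma bad_tendsto: "(\<lambda>j. real (ns j) ^ k * bad (a j) (ns j)) \<longlonglongrightarrow> 0"
proof -
  have "(\<lambda>n. real n ^ k * (real n * (2 * exp (- 2 * sqrt (real n powr h / 2))))) \<longlonglongrightarrow> 0" using h_pos by real_asymp
  from filterlim_compose[OF this ns_top]
  have lim: "(\<lambda>j. real (ns j) ^ k * (real (ns j) * (2 * exp (- 2 * sqrt (real (ns j) powr h / 2))))) \<longlonglongrightarrow> 0" .
  show ?thesis
  proof (rule Lim_null_comparison[OF _ lim])
    show "eventually (\<lambda>j. norm (real (ns j) ^ k * bad (a j) (ns j)) \<le> real (ns j) ^ k * (real (ns j) * (2 * exp (- 2 * sqrt (real (ns j) powr h / 2))))) sequentially"
      using a_ge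
    proof eventually_elim
      case (elim j)
      have b0: "0 \<le> bad (a j) (ns j)" unfolding bad_def by simp
      have "bad (a j) (ns j) \<le> (\<Sum>i=a j..ns j. 2 * exp (- 2 * sqrt (real i)))" by (rule bad_le[OF a_pos])
      also have "\<dots> \<le> (\<Sum>i=a j..ns j. 2 * exp (- 2 * sqrt (real (ns j) powr h / 2)))"
      proof (rule sum_mono)
        fix i assume "i \<in> {a j..ns j}"
        then have "sqrt (real (ns j) powr h / 2) \<le> sqrt (real i)" using elim by simp
        then show "2 * exp (- 2 * sqrt (real i)) \<le> 2 * exp (- 2 * sqrt (real (ns j) powr h / 2))" by simp
      qed
      also have "\<dots> = real (card {a j..ns j}) * (2 * exp (- 2 * sqrt (real (ns j) powr h / 2)))" by simp
      also have "\<dots> \<le> real (ns j) * (2 * exp (- 2 * sqrt (real (ns j) powr h / 2)))"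
        using a_pos[of j] by (intro mult_right_mono) auto
      finally show ?case using b0 by (simp add: mult_left_mono)
    qed
  qed
qed

text \<open>Contribution of the weights below 1, relative to the order
  \<open>(1 / (1 + e)) ^ m\<close> of weight 1. The base is below 1 for each such weight, so
  dominated convergence makes this vanish as \<open>m\<close> grows.\<close>

definition rest :: "nat \<Rightarrow> real" where
  "rest m = (\<integral>w. indicator {..<1} w * ((1 + e) * (w / (w + e))) ^ m \<partial>D)"

lemma ratio_bounds:
  assumes "0 < w" "w \<le> 1"
  shows "0 \<le> (1 + e) * (w / (w + e))" "(1 + e) * (w / (w + e)) \<le> 1" "w < 1 \<Longrightarrow> (1 + e) * (w / (w + e)) < 1"
proof -
  have p: "0 < w + e" using assms e_pos by linarith
  have eq: "(1 + e) * (w / (w + e)) = (w + e * w) / (w + e)" by (simp add: algebra_simps)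
  have "e * w \<le> e * 1" using assms e_pos by (intro mult_left_mono) auto
  then show "(1 + e) * (w / (w + e)) \<le> 1" unfolding eq divide_le_eq_1_pos[OF p] by linarith
  show "0 \<le> (1 + e) * (w / (w + e))" using assms e_pos p by (intro mult_nonneg_nonneg divide_nonneg_pos) auto
  assume "w < 1"
  then have "e * w < e * 1" using e_pos by (intro mult_strict_left_mono) auto
  then show "(1 + e) * (w / (w + e)) < 1" unfolding eq divide_less_eq_1_pos[OF p] by linarith
qed

lemma ratio_integrable: "integrable D (\<lambda>w. indicator {..<1} w * ((1 + e) * (w / (w + e))) ^ m)"
proof (rule integrable_D[where B = 1])
  fix w :: real assume w: "0 < w" "w \<le> 1"
  have "((1 + e) * (w / (w + e))) ^ m \<le> 1" "0 \<le> ((1 + e) * (w / (w + e))) ^ m"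
    using ratio_bounds(1,2)[OF w] by (auto intro: power_le_one)
  then show "\<bar>indicator {..<1} w * ((1 + e) * (w / (w + e))) ^ m\<bar> \<le> 1" by (simp add: indicator_def)
qed measurable

lemma rest_tendsto: "rest \<longlonglongrightarrow> 0"
proof -
  have "(\<lambda>m. \<integral>w. indicator {..<1} w * ((1 + e) * (w / (w + e))) ^ m \<partial>D) \<longlonglongrightarrow> (\<integral>w. 0 \<partial>D)"
  proof (rule integral_dominated_convergence[where w = "\<lambda>_. 1"])
    show "AE w in D. (\<lambda>m. indicator {..<1} w * ((1 + e) * (w / (w + e))) ^ m) \<longlonglongrightarrow> 0"
      using AE_D
    proof eventually_elim
      case (elim w)
      show ?case
      proof (cases "w < 1")
        case True
        have "(\<lambda>m. ((1 + e) * (w / (w + e))) ^ m) \<longlonglongrightarrow> 0"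
          by (rule LIMSEQ_realpow_zero) (use ratio_bounds elim True in auto)
        then show ?thesis using True by simp
      qed simp
    qed
    show "AE w in D. norm (indicator {..<1} w * ((1 + e) * (w / (w + e))) ^ m) \<le> 1" for m
      using AE_D
    proof eventually_elim
      case (elim w)
      then have "((1 + e) * (w / (w + e))) ^ m \<le> 1" "0 \<le> ((1 + e) * (w / (w + e))) ^ m"
        using ratio_bounds(1,2)[of w] by (auto intro: power_le_one)
      then show ?case by (simp add: indicator_def)
    qed
    show "(\<lambda>w. indicator {..<1} w * ((1 + e) * (w / (w + e))) ^ m) \<in> borel_measurable D" for m
      using ratio_integrable by simp
  qed simp_all
  then show ?thesis unfolding rest_def[abs_def] by simp
qed

lemma light_weights_sum_le:
  assumes n: "1 \<le> n"
  shows "(\<Sum>l\<in>{a j<..n}. \<integral>w. indicator {..<1} w * pois (w * ln (real n / real l) / e) m \<partial>D)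
     \<le> real n * (1 / (1 + e)) ^ m * (rest m + cellerr e (a j) n)"
proof -
  let ?c = "cellerr e (a j) n"
  have c0: "0 \<le> ?c" unfolding cellerr_def using e_pos n by (intro mult_nonneg_nonneg divide_nonneg_nonneg) auto
  have int: "integrable D (\<lambda>w. indicator {..<1} w * pois (w * ln (real n / real l) / e) m)" if "l \<in> {a j<..n}" for l
  proof -
    have "0 \<le> ln (real n / real l)" using that a_pos[of j] by simp
    from integrable_mult_indicator[OF _ pois_integrable[OF this], of "{..<1}"] show ?thesis by simp
  qed
  have "(\<Sum>l\<in>{a j<..n}. \<integral>w. indicator {..<1} w * pois (w * ln (real n / real l) / e) m \<partial>D)
    = (\<integral>w. (\<Sum>l\<in>{a j<..n}. indicator {..<1} w * pois (w * ln (real n / real l) / e) m) \<partial>D)"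
    by (rule Bochner_Integration.integral_sum[symmetric]) (rule int)
  also have "\<dots> \<le> (\<integral>w. real n * (1 / (1 + e)) ^ m * (indicator {..<1} w * ((1 + e) * (w / (w + e))) ^ m + ?c) \<partial>D)"
  proof (rule integral_mono_AE)
    show "integrable D (\<lambda>w. \<Sum>l\<in>{a j<..n}. indicator {..<1} w * pois (w * ln (real n / real l) / e) m)"
      by (rule Bochner_Integration.integrable_sum) (rule int)
    show "integrable D (\<lambda>w. real n * (1 / (1 + e)) ^ m * (indicator {..<1} w * ((1 + e) * (w / (w + e))) ^ m + ?c))"
      by (intro integrable_mult_right Bochner_Integration.integrable_add ratio_integrable) simp
    show "AE w in D. (\<Sum>l\<in>{a j<..n}. indicator {..<1} w * pois (w * ln (real n / real l) / e) m)
       \<le> real n * (1 / (1 + e)) ^ m * (indicator {..<1} w * ((1 + e) * (w / (w + e))) ^ m + ?c)"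
      using AE_D
    proof eventually_elim
      case (elim w)
      show ?case
      proof (cases "w < 1")
        case False
        have "0 \<le> real n * (1 / (1 + e)) ^ m * ?c" using e_pos c0 by simp
        then show ?thesis using False by simp
      next
        case True
        have "(\<Sum>l\<in>{a j<..n}. pois (w * ln (real n / real l) / e) m)
          \<le> real n * (w / (w + e)) ^ m + (1 / (1 + e)) ^ m * real n * ?c"
          by (rule pois_sum_le[OF e_pos _ _ a_pos n]) (use elim in auto)
        also have "(w / (w + e)) ^ m = (1 / (1 + e)) ^ m * ((1 + e) * (w / (w + e))) ^ m"
        proof -
          have "w / (w + e) = 1 / (1 + e) * ((1 + e) * (w / (w + e)))" using e_pos by simp
          then show ?thesis by (metis power_mult_distrib)
        qed
        finally show ?thesis using True by (simp add: algebra_simps)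
      qed
    qed
  qed
  also have "\<dots> = real n * (1 / (1 + e)) ^ m * (rest m + ?c)"
    using ratio_integrable[of m] by (simp add: rest_def)
  finally show ?thesis .
qed

text \<open>The bound is uniform in \<open>m\<close>, unlike the asymptotics along one sequence of
  levels, and can therefore be summed over all higher in-degrees.\<close>

lemma gq_sum_le:
  assumes n: "1 \<le> n"
  shows "(\<Sum>l\<in>{a j<..n}. gq e D n l m) \<le> real n * (1 / (1 + e)) ^ m * (2 + 2 * cellerr e (a j) n)"
proof -
  let ?c = "cellerr e (a j) n"
  have "(\<Sum>l\<in>{a j<..n}. gq e D n l m) = measure D {1} * (\<Sum>l\<in>{a j<..n}. pois (1 * ln (real n / real l) / e) m)
     + (\<Sum>l\<in>{a j<..n}. \<integral>w. indicator {..<1} w * pois (w * ln (real n / real l) / e) m \<partial>D)"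
    unfolding sum_distrib_left sum.distrib[symmetric]
    by (rule sum.cong[OF refl], rule gq_split) (use a_pos[of j] in auto)
  also have "\<dots> \<le> 1 * (real n * (1 / (1 + e)) ^ m + (1 / (1 + e)) ^ m * real n * ?c) + real n * (1 / (1 + e)) ^ m * (rest m + ?c)"
  proof (intro add_mono mult_mono light_weights_sum_le[OF n])
    show "(\<Sum>l\<in>{a j<..n}. pois (1 * ln (real n / real l) / e) m) \<le> real n * (1 / (1 + e)) ^ m + (1 / (1 + e)) ^ m * real n * ?c"
      by (rule pois_sum_le[OF e_pos _ _ a_pos n]) simp_all
    show "0 \<le> (\<Sum>l\<in>{a j<..n}. pois (1 * ln (real n / real l) / e) m)"
      by (intro sum_nonneg pois_nonneg divide_nonneg_pos) (use e_pos a_pos[of j] in auto)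
  qed (auto intro: D.prob_le_1)
  also have "\<dots> = real n * (1 / (1 + e)) ^ m * (1 + rest m + 2 * ?c)" by (simp add: algebra_simps)
  also have "\<dots> \<le> real n * (1 / (1 + e)) ^ m * (2 + 2 * ?c)"
  proof (intro mult_left_mono add_right_mono)
    have "rest m \<le> (\<integral>w. 1 \<partial>D)" unfolding rest_def
    proof (rule integral_mono_AE[OF ratio_integrable])
      show "AE w in D. indicator {..<1} w * ((1 + e) * (w / (w + e))) ^ m \<le> 1"
        using AE_D
      proof eventually_elim
        case (elim w)
        then have "((1 + e) * (w / (w + e))) ^ m \<le> 1" "0 \<le> ((1 + e) * (w / (w + e))) ^ m"
          using ratio_bounds(1,2)[of w] by (auto intro: power_le_one)
        then show ?case by (simp add: indicator_def)
      qed
    qed simp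
    then show "1 + rest m \<le> 2" by simp
  qed (use e_pos in simp)
  finally show ?thesis .
qed

text \<open>The asymptotics for one vertex. Light weights drop out, the atom contributes
  \<open>measure D {1}\<close>, and \<open>e / (1 + e)\<close> is the constant left by the Erlang
  normalisation at weight 1.\<close>

lemma weighted_label_sum_tendsto:
  fixes psi :: "nat \<Rightarrow> nat \<Rightarrow> real" and psi' :: "real \<Rightarrow> real"
  assumes m: "(\<lambda>j. real (ns j) * (1 / (1 + e)) ^ m j) \<longlonglongrightarrow> t" and t: "0 < t"
    and bd: "\<And>j l. \<bar>psi j l\<bar> \<le> B" and meas: "psi' \<in> borel_measurable borel"
    and conv: "\<And>l x. eventually (\<lambda>j. l j \<in> window j) sequentially \<Longrightarrow> (\<lambda>j. std_label e (ns j) (l j)) \<longlonglongrightarrow> x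
        \<Longrightarrow> (\<lambda>j. psi j (l j)) \<longlonglongrightarrow> psi' x"
  shows "(\<lambda>j. \<Sum>l\<in>window j. gq e D (ns j) l (m j) * psi j l)
     \<longlonglongrightarrow> measure D {1} * t * (e / (1 + e)) * (\<integral>x. psi' x \<partial>std_normal_distribution)"
proof -
  define A where "A j = real (ns j) * (1 / (1 + e)) ^ m j" for j
  define c where "c j = cellerr e (a j) (ns j)" for j
  define I where "I j = (\<integral>x. erlang_density (m j) ((1 + e) / e) x * (if 0 \<le> x \<and> lab (ns j) x \<in> window j then psi j (lab (ns j) x) else 0) \<partial>lborel)" for j
  define P where "P j = (\<Sum>l\<in>window j. pois (1 * ln (real (ns j) / real l) / e) (m j) * psi j l)" for j
  define G where "G j = (\<Sum>l\<in>window j. gq e D (ns j) l (m j) * psi j l)" for j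
  define q where "q = measure D {1}"
  have A: "A \<longlonglongrightarrow> t" using m unfolding A_def .
  have c: "c \<longlonglongrightarrow> 0" using cellerr_tendsto unfolding c_def .
  have I: "I \<longlonglongrightarrow> (\<integral>x. psi' x \<partial>std_normal_distribution)"
    unfolding I_def by (rule erlang_label_limit[OF m t bd meas conv])
  have B0: "0 \<le> B" using bd[of 0 0] by linarith
  have P: "eventually (\<lambda>j. \<bar>P j - A j * (e / (1 + e)) * I j\<bar> \<le> B * (A j * c j)) sequentially"
    using eventually_ns_ge[of 1]
  proof eventually_elim
    case (elim j)
    have "\<bar>P j - real (ns j) * (1 / (1 + e)) ^ m j * (e / (1 + e)) * I j\<bar> \<le> B * ((1 / (1 + e)) ^ m j * real (ns j) * c j)"
      unfolding P_def I_def c_def by (rule cell_sum_erlang[OF e_pos _ _ a_pos elim bd]) simp_all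
    then show ?case by (simp only: A_def mult.commute mult.left_commute)
  qed
  have GP: "eventually (\<lambda>j. \<bar>G j - q * P j\<bar> \<le> B * (A j * (rest (m j) + c j))) sequentially"
    using eventually_ns_ge[of 1]
  proof eventually_elim
    case (elim j)
    let ?r = "\<lambda>l. \<integral>w. indicator {..<1} w * pois (w * ln (real (ns j) / real l) / e) (m j) \<partial>D"
    have r0: "0 \<le> ?r l" if "l \<in> window j" for l
    proof (rule integral_nonneg_AE)
      have "0 \<le> ln (real (ns j) / real l)" using that a_pos[of j] by simp
      then show "AE w in D. 0 \<le> indicator {..<1} w * pois (w * ln (real (ns j) / real l) / e) (m j)"
        by (intro eventually_mono[OF AE_D] mult_nonneg_nonneg pois_nonneg divide_nonneg_pos) (use e_pos in auto)
    qed
    have "G j - q * P j = (\<Sum>l\<in>window j. ?r l * psi j l)"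
      unfolding G_def P_def sum_distrib_left sum_subtractf[symmetric]
    proof (rule sum.cong[OF refl])
      fix l assume "l \<in> window j"
      then have "1 \<le> l" "l \<le> ns j" using a_pos[of j] by auto
      from gq_split[OF this, of "m j"] show "gq e D (ns j) l (m j) * psi j l - q * (pois (1 * ln (real (ns j) / real l) / e) (m j) * psi j l) = ?r l * psi j l"
        unfolding q_def by (simp only: distrib_right mult.assoc add_diff_cancel_left')
    qed
    then have "\<bar>G j - q * P j\<bar> \<le> (\<Sum>l\<in>window j. \<bar>?r l * psi j l\<bar>)" by (simp only: sum_abs)
    also have "\<dots> \<le> (\<Sum>l\<in>window j. ?r l * B)"
      by (rule sum_mono) (use r0 bd in \<open>simp add: abs_mult mult_left_mono\<close>)
    also have "\<dots> = (\<Sum>l\<in>window j. ?r l) * B" by (rule sum_distrib_right[symmetric])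
    also have "\<dots> \<le> (A j * (rest (m j) + c j)) * B"
      unfolding A_def c_def by (rule mult_right_mono[OF light_weights_sum_le[OF elim] B0])
    finally show ?case by (simp only: mult.commute)
  qed
  have rest: "(\<lambda>j. rest (m j)) \<longlonglongrightarrow> 0"
    by (rule filterlim_compose[OF rest_tendsto level_top[OF m t]])
  have "(\<lambda>j. B * (A j * c j)) \<longlonglongrightarrow> B * (t * 0)" by (intro tendsto_mult tendsto_const A c)
  then have "(\<lambda>j. B * (A j * c j)) \<longlonglongrightarrow> 0" by simp
  from Lim_null_comparison[OF _ this, of "\<lambda>j. P j - A j * (e / (1 + e)) * I j"] P
  have 1: "(\<lambda>j. P j - A j * (e / (1 + e)) * I j) \<longlonglongrightarrow> 0" by simp
  have "(\<lambda>j. B * (A j * (rest (m j) + c j))) \<longlonglongrightarrow> B * (t * (0 + 0))" by (intro tendsto_mult tendsto_add tendsto_const A c rest)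
  then have "(\<lambda>j. B * (A j * (rest (m j) + c j))) \<longlonglongrightarrow> 0" by simp
  from Lim_null_comparison[OF _ this, of "\<lambda>j. G j - q * P j"] GP
  have 2: "(\<lambda>j. G j - q * P j) \<longlonglongrightarrow> 0" by simp
  have "(\<lambda>j. (G j - q * P j) + q * ((P j - A j * (e / (1 + e)) * I j) + A j * (e / (1 + e)) * I j))
    \<longlonglongrightarrow> 0 + q * (0 + t * (e / (1 + e)) * (\<integral>x. psi' x \<partial>std_normal_distribution))"
    by (intro tendsto_add tendsto_mult 1 2 tendsto_const A I)
  then show ?thesis unfolding G_def[symmetric] q_def[symmetric] by (simp add: mult.assoc)
qed

end

section \<open>Tuples of distinct vertices and iterated normal integrals\<close>

definition dlists :: "'v set \<Rightarrow> nat \<Rightarrow> 'v list set" where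
  "dlists A k = {ls. length ls = k \<and> distinct ls \<and> set ls \<subseteq> A}"

lemma finite_dlists: "finite A \<Longrightarrow> finite (dlists A k)"
  by (rule finite_subset[OF _ finite_lists_length_eq[of A k]]) (auto simp: dlists_def)

lemma dlists_0 [simp]: "dlists A 0 = {[]}"
  by (auto simp: dlists_def)

lemma dlists_Suc: "dlists A (Suc k) = (\<lambda>(l, xs). l # xs) ` (SIGMA l:A. dlists (A - {l}) k)"
proof (rule set_eqI)
  fix ls
  show "ls \<in> dlists A (Suc k) \<longleftrightarrow> ls \<in> (\<lambda>(l, xs). l # xs) ` (SIGMA l:A. dlists (A - {l}) k)"
    by (cases ls) (auto simp: dlists_def image_iff)
qed

lemma sum_dlists_Suc:
  assumes "finite A"
  shows "(\<Sum>ls\<in>dlists A (Suc k). f ls) = (\<Sum>l\<in>A. \<Sum>xs\<in>dlists (A - {l}) k. f (l # xs))"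
proof -
  have "inj_on (\<lambda>(l, xs). l # xs) (SIGMA l:A. dlists (A - {l}) k)" by (auto simp: inj_on_def)
  then have "(\<Sum>ls\<in>dlists A (Suc k). f ls) = (\<Sum>(l, xs)\<in>(SIGMA l:A. dlists (A - {l}) k). f (l # xs))"
    unfolding dlists_Suc by (subst sum.reindex) (auto intro!: sum.cong)
  also have "\<dots> = (\<Sum>l\<in>A. \<Sum>xs\<in>dlists (A - {l}) k. f (l # xs))"
    by (rule sum.Sigma[symmetric]) (use assms in \<open>auto intro: finite_dlists\<close>)
  finally show ?thesis .
qed

text \<open>An iterated form of the sum over distinct tuples, each chosen vertex being removed
  before the next sum. In this form the asymptotics for one vertex can be applied
  repeatedly.\<close>

primrec dsum :: "('v \<Rightarrow> 'm \<Rightarrow> real) \<Rightarrow> 'v set \<Rightarrow> 'm list \<Rightarrow> ('v list \<Rightarrow> real) \<Rightarrow> real" where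
  "dsum g A [] f = f []"
| "dsum g A (m # ms) f = (\<Sum>l\<in>A. g l m * dsum g (A - {l}) ms (\<lambda>xs. f (l # xs)))"

lemma dsum_eq:
  assumes "finite A"
  shows "dsum g A ms f = (\<Sum>ls\<in>dlists A (length ms). (\<Prod>i<length ms. g (ls ! i) (ms ! i)) * f ls)"
  using assms
proof (induction ms arbitrary: A f)
  case (Cons m ms)
  have "dsum g A (m # ms) f = (\<Sum>l\<in>A. \<Sum>xs\<in>dlists (A - {l}) (length ms). g l m * ((\<Prod>i<length ms. g (xs ! i) (ms ! i)) * f (l # xs)))"
    using Cons by (simp add: sum_distrib_left)
  also have "\<dots> = (\<Sum>ls\<in>dlists A (length (m # ms)). (\<Prod>i<length (m # ms). g (ls ! i) ((m # ms) ! i)) * f ls)"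
    using Cons by (simp add: sum_dlists_Suc prod.lessThan_Suc_shift mult.assoc del: prod.lessThan_Suc)
  finally show ?case .
qed simp

text \<open>Giving up distinctness only enlarges the bound, as the weights \<open>g\<close> are
  nonnegative on \<open>A\<close>; the sums then factorise.\<close>

lemma dsum_bound:
  assumes "finite A" "\<And>l m. l \<in> A \<Longrightarrow> m \<in> set ms \<Longrightarrow> 0 \<le> g l m" "\<And>ls. \<bar>f ls\<bar> \<le> B"
  shows "\<bar>dsum g A ms f\<bar> \<le> B * prod_list (map (\<lambda>m. \<Sum>l\<in>A. g l m) ms)"
  using assms
proof (induction ms arbitrary: A f)
  case (Cons m ms)
  have B0: "0 \<le> B" using Cons.prems(3)[of "[]"] by linarith
  let ?K = "prod_list (map (\<lambda>m. \<Sum>l\<in>A. g l m) ms)"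
  have "\<bar>dsum g A (m # ms) f\<bar> \<le> (\<Sum>l\<in>A. \<bar>g l m * dsum g (A - {l}) ms (\<lambda>xs. f (l # xs))\<bar>)"
    by (simp only: dsum.simps sum_abs)
  also have "\<dots> \<le> (\<Sum>l\<in>A. g l m * (B * ?K))"
  proof (rule sum_mono)
    fix l assume l: "l \<in> A"
    have "\<bar>dsum g (A - {l}) ms (\<lambda>xs. f (l # xs))\<bar> \<le> B * prod_list (map (\<lambda>m. \<Sum>l\<in>A - {l}. g l m) ms)"
      by (rule Cons.IH) (use Cons.prems in auto)
    also have "prod_list (map (\<lambda>m. \<Sum>l\<in>A - {l}. g l m) ms) \<le> ?K"
    proof -
      have "0 \<le> prod_list (map (\<lambda>m. \<Sum>l\<in>A - {l}. g l m) ms') \<and>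
        prod_list (map (\<lambda>m. \<Sum>l\<in>A - {l}. g l m) ms') \<le> prod_list (map (\<lambda>m. \<Sum>l\<in>A. g l m) ms')"
        if "set ms' \<subseteq> set ms" for ms'
        using that
      proof (induction ms')
        case (Cons m' ms')
        have 1: "0 \<le> (\<Sum>l\<in>A - {l}. g l m')" by (rule sum_nonneg) (use Cons.prems \<open>\<And>m l. l \<in> A \<Longrightarrow> m \<in> set (_ # ms) \<Longrightarrow> 0 \<le> g l m\<close> in auto)
        have 2: "(\<Sum>l\<in>A - {l}. g l m') \<le> (\<Sum>l\<in>A. g l m')"
          by (rule sum_mono2) (use Cons.prems \<open>finite A\<close> \<open>\<And>m l. l \<in> A \<Longrightarrow> m \<in> set (_ # ms) \<Longrightarrow> 0 \<le> g l m\<close> in auto)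
        have IH: "0 \<le> prod_list (map (\<lambda>m. \<Sum>l\<in>A - {l}. g l m) ms')"
          "prod_list (map (\<lambda>m. \<Sum>l\<in>A - {l}. g l m) ms') \<le> prod_list (map (\<lambda>m. \<Sum>l\<in>A. g l m) ms')"
          using Cons by auto
        show ?case using mult_mono[OF 2 IH(2) order.trans[OF 1 2] IH(1)] mult_nonneg_nonneg[OF 1 IH(1)] by simp
      qed simp
      then show ?thesis by blast
    qed
    finally have "\<bar>dsum g (A - {l}) ms (\<lambda>xs. f (l # xs))\<bar> \<le> B * ?K" using B0 by (simp add: mult_left_mono)
    moreover have "0 \<le> g l m" using Cons.prems(2)[OF l] by simp
    ultimately show "\<bar>g l m * dsum g (A - {l}) ms (\<lambda>xs. f (l # xs))\<bar> \<le> g l m * (B * ?K)"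
      by (simp add: abs_mult mult_left_mono)
  qed
  also have "\<dots> = B * prod_list (map (\<lambda>m. \<Sum>l\<in>A. g l m) (m # ms))"
    unfolding sum_distrib_right[symmetric] by simp
  finally show ?case .
qed simp

text \<open>The expectation of \<open>f\<close> at \<open>k\<close> independent standard normal
  variables, built variable by variable in the order of \<open>dsum\<close>. The product measure
  appears in \<open>normal_integral_PiM\<close>.\<close>

primrec normal_integral :: "nat \<Rightarrow> (real list \<Rightarrow> real) \<Rightarrow> real" where
  "normal_integral 0 f = f []"
| "normal_integral (Suc k) f = (\<integral>x. normal_integral k (\<lambda>xs. f (x # xs)) \<partial>std_normal_distribution)"

interpretation std_normal: prob_space std_normal_distribution
  using real_dist_normal_dist by (simp add: real_distribution_def)

text \<open>Measurability of \<open>f\<close> does not enter: a non-integrable inner function has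
  integral 0, which also obeys the bound.\<close>

lemma normal_integral_bound: "(\<And>xs. \<bar>f xs\<bar> \<le> B) \<Longrightarrow> \<bar>normal_integral k f\<bar> \<le> B"
proof (induction k arbitrary: f)
  case (Suc k)
  define F where "F x = normal_integral k (\<lambda>xs. f (x # xs))" for x
  have F: "\<bar>F x\<bar> \<le> B" for x unfolding F_def by (rule Suc.IH) (rule Suc.prems)
  have B0: "0 \<le> B" using F[of 0] by linarith
  have "\<bar>\<integral>x. F x \<partial>std_normal_distribution\<bar> \<le> B"
  proof (cases "integrable std_normal_distribution F")
    case True
    have "\<bar>\<integral>x. F x \<partial>std_normal_distribution\<bar> \<le> (\<integral>x. \<bar>F x\<bar> \<partial>std_normal_distribution)" by (rule integral_abs_bound)
    also have "\<dots> \<le> (\<integral>x. B \<partial>std_normal_distribution)" by (rule integral_mono) (use True F in auto)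
    finally show ?thesis using std_normal.prob_space by simp
  next
    case False
    then show ?thesis using B0 by (simp add: not_integrable_integral_eq)
  qed
  then show ?case by (simp add: F_def)
qed simp

text \<open>Continuous convergence on lists of length \<open>k\<close>, expressed by coordinate
  sequences. For a constant sequence of functions it is sequential continuity, abbreviated below as
  \<open>list_cont\<close>.\<close>

definition list_conv :: "nat \<Rightarrow> (nat \<Rightarrow> real list \<Rightarrow> real) \<Rightarrow> (real list \<Rightarrow> real) \<Rightarrow> bool" where
  "list_conv k fs f \<longleftrightarrow> (\<forall>X xs. length xs = k \<longrightarrow> (\<forall>i<k. X i \<longlonglongrightarrow> xs ! i) \<longrightarrow> (\<lambda>j. fs j (map (\<lambda>i. X i j) [0..<k])) \<longlonglongrightarrow> f xs)"

lemma map_case_nat_upt: "map (\<lambda>i. (case i of 0 \<Rightarrow> l | Suc i \<Rightarrow> X i) j) [0..<Suc k] = l j # map (\<lambda>i. X i j) [0..<k]"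
  by (simp add: upt_conv_Cons map_Suc_upt[symmetric] comp_def del: upt_Suc)

lemma list_conv_Cons:
  assumes "list_conv (Suc k) fs f" "l \<longlonglongrightarrow> x"
  shows "list_conv k (\<lambda>j xs. fs j (l j # xs)) (\<lambda>xs. f (x # xs))"
  unfolding list_conv_def
proof (intro allI impI)
  fix X and xs :: "real list" assume xs: "length xs = k" "\<forall>i<k. X i \<longlonglongrightarrow> xs ! i"
  have "(\<lambda>j. fs j (map (\<lambda>i. (case i of 0 \<Rightarrow> l | Suc i \<Rightarrow> X i) j) [0..<Suc k])) \<longlonglongrightarrow> f (x # xs)"
  proof (rule assms(1)[unfolded list_conv_def, rule_format])
    fix i assume "i < Suc k"
    then show "(case i of 0 \<Rightarrow> l | Suc i \<Rightarrow> X i) \<longlonglongrightarrow> (x # xs) ! i"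
      using xs assms(2) by (cases i) auto
  qed (use xs in simp)
  then show "(\<lambda>j. fs j (l j # map (\<lambda>i. X i j) [0..<k])) \<longlonglongrightarrow> f (x # xs)"
    unfolding map_case_nat_upt .
qed

abbreviation "list_cont k f \<equiv> list_conv k (\<lambda>_. f) f"

text \<open>Dominated convergence in each variable. The inner integral is measurable because it is
  continuous in the first variable, which is itself an instance of the induction hypothesis.\<close>

lemma normal_integral_tendsto:
  assumes "\<And>j. list_cont k (fs j)" "list_cont k f" "list_conv k fs f" "\<And>j xs. \<bar>fs j xs\<bar> \<le> B" "\<And>xs. \<bar>f xs\<bar> \<le> B"
  shows "(\<lambda>j. normal_integral k (fs j)) \<longlonglongrightarrow> normal_integral k f"
  using assms
proof (induction k arbitrary: fs f)
  case 0
  then show ?case unfolding list_conv_def by simp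
next
  case (Suc k)
  have cont: "continuous_on UNIV (\<lambda>x. normal_integral k (\<lambda>xs. h (x # xs)))"
    if h: "list_cont (Suc k) h" "\<And>xs. \<bar>h xs\<bar> \<le> B" for h
    unfolding continuous_on_sequentially comp_def
  proof (intro ballI allI impI, elim conjE)
    fix X :: "nat \<Rightarrow> real" and x assume X: "X \<longlonglongrightarrow> x"
    show "(\<lambda>j. normal_integral k (\<lambda>xs. h (X j # xs))) \<longlonglongrightarrow> normal_integral k (\<lambda>xs. h (x # xs))"
      by (rule Suc.IH) (use h X in \<open>auto intro: list_conv_Cons\<close>)
  qed
  have meas: "(\<lambda>x. normal_integral k (\<lambda>xs. h (x # xs))) \<in> borel_measurable borel"
    if "list_cont (Suc k) h" "\<And>xs. \<bar>h xs\<bar> \<le> B" for h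
    using cont[OF that] by (rule borel_measurable_continuous_onI)
  have "(\<lambda>j. \<integral>x. normal_integral k (\<lambda>xs. fs j (x # xs)) \<partial>std_normal_distribution) \<longlonglongrightarrow> (\<integral>x. normal_integral k (\<lambda>xs. f (x # xs)) \<partial>std_normal_distribution)"
  proof (rule integral_dominated_convergence[where w = "\<lambda>_. B"])
    show "AE x in std_normal_distribution. (\<lambda>j. normal_integral k (\<lambda>xs. fs j (x # xs))) \<longlonglongrightarrow> normal_integral k (\<lambda>xs. f (x # xs))"
    proof (rule AE_I2)
      fix x
      show "(\<lambda>j. normal_integral k (\<lambda>xs. fs j (x # xs))) \<longlonglongrightarrow> normal_integral k (\<lambda>xs. f (x # xs))"
        by (rule Suc.IH) (use Suc.prems in \<open>auto intro: list_conv_Cons\<close>)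
    qed
    show "AE x in std_normal_distribution. norm (normal_integral k (\<lambda>xs. fs j (x # xs))) \<le> B" for j
      by (intro AE_I2) (use Suc.prems(4) in \<open>auto intro: normal_integral_bound\<close>)
    show "(\<lambda>x. normal_integral k (\<lambda>xs. f (x # xs))) \<in> borel_measurable std_normal_distribution"
      using meas[OF Suc.prems(2,5)] by simp
    show "(\<lambda>x. normal_integral k (\<lambda>xs. fs j (x # xs))) \<in> borel_measurable std_normal_distribution" for j
      using meas[OF Suc.prems(1,4)] by simp
  qed simp
  then show ?case by simp
qed

lemma normal_integral_measurable:
  assumes "list_cont (Suc k) f" "\<And>xs. \<bar>f xs\<bar> \<le> B"
  shows "(\<lambda>x. normal_integral k (\<lambda>xs. f (x # xs))) \<in> borel_measurable borel"
proof (rule borel_measurable_continuous_onI)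
  show "continuous_on UNIV (\<lambda>x. normal_integral k (\<lambda>xs. f (x # xs)))"
    unfolding continuous_on_sequentially comp_def
  proof (intro ballI allI impI, elim conjE)
    fix X :: "nat \<Rightarrow> real" and x assume X: "X \<longlonglongrightarrow> x"
    show "(\<lambda>j. normal_integral k (\<lambda>xs. f (X j # xs))) \<longlonglongrightarrow> normal_integral k (\<lambda>xs. f (x # xs))"
      by (rule normal_integral_tendsto) (use assms X in \<open>auto intro: list_conv_Cons\<close>)
  qed
qed

lemma normal_integral_take: "normal_integral (k + i) (\<lambda>xs. f (take k xs)) = normal_integral k f"
proof (induction k arbitrary: f)
  case 0
  have "normal_integral i (\<lambda>xs. c) = c" for c
    by (induction i) (use std_normal.prob_space in auto)
  then show ?case by simp
next
  case (Suc k)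
  have "normal_integral (k + i) (\<lambda>xs. f (x # take k xs)) = normal_integral k (\<lambda>xs. f (x # xs))" for x
    using Suc.IH[of "\<lambda>xs. f (x # xs)"] .
  then show ?case by simp
qed

context tree_window
begin

abbreviation gj :: "nat \<Rightarrow> nat \<Rightarrow> nat \<Rightarrow> real" where "gj j l m \<equiv> gq e D (ns j) l m"

text \<open>In-degrees at bounded distance from the logarithm of \<open>ns j\<close> to base
  \<open>1 + e\<close>; the parameter \<open>t\<close> records the offset.\<close>

definition level :: "(nat \<Rightarrow> nat) \<Rightarrow> real \<Rightarrow> bool" where
  "level m t \<longleftrightarrow> 0 < t \<and> (\<lambda>j. real (ns j) * (1 / (1 + e)) ^ m j) \<longlonglongrightarrow> t"

text \<open>The limiting expected number of window vertices at a level with parameter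
  \<open>t\<close>, as \<open>weighted_label_sum_tendsto\<close> shows for the constant function
  1.\<close>

definition intens :: "real \<Rightarrow> real" where
  "intens t = measure D {1} * t * (e / (1 + e))"

definition label_conv :: "nat \<Rightarrow> (nat \<Rightarrow> nat list \<Rightarrow> real) \<Rightarrow> (real list \<Rightarrow> real) \<Rightarrow> bool" where
  "label_conv k fs f \<longleftrightarrow> (\<forall>X xs. length xs = k \<longrightarrow>
     (\<forall>i<k. eventually (\<lambda>j. X i j \<in> window j) sequentially \<and> (\<lambda>j. std_label e (ns j) (X i j)) \<longlonglongrightarrow> xs ! i) \<longrightarrow>
     (\<lambda>j. fs j (map (\<lambda>i. X i j) [0..<k])) \<longlonglongrightarrow> f xs)"

lemma label_conv_Cons:
  assumes "label_conv (Suc k) fs f" "eventually (\<lambda>j. l j \<in> window j) sequentially" "(\<lambda>j. std_label e (ns j) (l j)) \<longlonglongrightarrow> x"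
  shows "label_conv k (\<lambda>j xs. fs j (l j # xs)) (\<lambda>xs. f (x # xs))"
  unfolding label_conv_def
proof (intro allI impI)
  fix X and xs :: "real list"
  assume xs: "length xs = k" "\<forall>i<k. eventually (\<lambda>j. X i j \<in> window j) sequentially \<and> (\<lambda>j. std_label e (ns j) (X i j)) \<longlonglongrightarrow> xs ! i"
  have "(\<lambda>j. fs j (map (\<lambda>i. (case i of 0 \<Rightarrow> l | Suc i \<Rightarrow> X i) j) [0..<Suc k])) \<longlonglongrightarrow> f (x # xs)"
  proof (rule assms(1)[unfolded label_conv_def, rule_format])
    fix i assume "i < Suc k"
    then show "eventually (\<lambda>j. (case i of 0 \<Rightarrow> l | Suc i \<Rightarrow> X i) j \<in> window j) sequentially \<and>
      (\<lambda>j. std_label e (ns j) ((case i of 0 \<Rightarrow> l | Suc i \<Rightarrow> X i) j)) \<longlonglongrightarrow> (x # xs) ! i"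
      using xs assms(2,3) by (cases i) auto
  qed (use xs in simp)
  then show "(\<lambda>j. fs j (l j # map (\<lambda>i. X i j) [0..<k])) \<longlonglongrightarrow> f (x # xs)"
    unfolding map_case_nat_upt .
qed

lemma gj_nonneg: "l \<in> window j \<Longrightarrow> 0 \<le> gj j l m"
  by (rule gq_bounds(1)) (use a_pos[of j] in auto)

lemma gj_sum_bound:
  assumes "level m t"
  shows "\<exists>K. \<forall>j. (\<Sum>l\<in>window j. gj j l (m j)) \<le> K"
proof -
  have "(\<lambda>j. \<Sum>l\<in>window j. gj j l (m j) * 1) \<longlonglongrightarrow> measure D {1} * t * (e / (1 + e)) * (\<integral>x. 1 \<partial>std_normal_distribution)"
    by (rule weighted_label_sum_tendsto[where B = 1]) (use assms in \<open>auto simp: level_def\<close>)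
  then have "Bseq (\<lambda>j. \<Sum>l\<in>window j. gj j l (m j) * 1)" by (intro convergent_imp_Bseq convergentI)
  then obtain K where K: "\<And>j. norm (\<Sum>l\<in>window j. gj j l (m j) * 1) \<le> K" unfolding Bseq_def by blast
  have "(\<Sum>l\<in>window j. gj j l (m j)) \<le> K" for j
    using K[of j] unfolding real_norm_def mult_1_right by (rule abs_le_D1)
  then show ?thesis by blast
qed

text \<open>Each single vertex of the window carries a vanishing share at a given level, so
  excluding boundedly many vertices does not affect the limits.\<close>

lemma gj_le:
  assumes "l \<in> window j"
  shows "gj j l m \<le> real (ns j) * (1 / (1 + e)) ^ m * (1 / real (a j))"
proof -
  have l: "1 \<le> l" "l \<le> ns j" "a j < l" using assms a_pos[of j] by auto
  have p: "0 < (1 + e) ^ m" using e_pos by simp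
  have "(1 + e) ^ m * gj j l m \<le> real (ns j) / real l" by (rule gq_bounds(2)[OF l(1,2)])
  also have "\<dots> \<le> real (ns j) * (1 / real (a j))"
    using l a_pos[of j] by (simp add: frac_le)
  finally have "gj j l m * (1 + e) ^ m \<le> real (ns j) * (1 / real (a j))" by (simp only: mult.commute)
  then have "gj j l m \<le> real (ns j) * (1 / real (a j)) / (1 + e) ^ m" by (simp only: pos_le_divide_eq[OF p])
  then show ?thesis by (simp add: power_divide mult.commute)
qed

text \<open>Induction on the tuple. Once the first vertex is chosen, the rest of the sum is a
  function of its label; the induction hypothesis, applied along an arbitrary label sequence, is
  exactly the convergence that \<open>weighted_label_sum_tendsto\<close> asks of \<open>psi\<close>.
  The sets \<open>U j\<close> absorb the vertices chosen before, whose number is bounded.\<close>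

lemma dsum_tendsto:
  assumes "list_all2 level ms ts" "\<And>j ls. \<bar>fs j ls\<bar> \<le> B" "\<And>xs. \<bar>f xs\<bar> \<le> B" "list_cont (length ms) f"
    and "label_conv (length ms) fs f" "\<And>j. finite (U j)" "\<And>j. card (U j) \<le> q"
  shows "(\<lambda>j. dsum (gj j) (window j - U j) (map (\<lambda>m. m j) ms) (fs j))
    \<longlonglongrightarrow> prod_list (map intens ts) * normal_integral (length ms) f"
  using assms
proof (induction ms ts arbitrary: fs f U q rule: list_all2_induct)
  case Nil
  then show ?case unfolding label_conv_def by simp
next
  case (Cons m ms t ts)
  note prems = Cons.prems
  have B0: "0 \<le> B" using prems(2)[of "[]"] by linarith
  have lev: "list_all2 level ms ts" using Cons.hyps by simp
  obtain Ks where Ks: "\<And>m' j. m' \<in> set ms \<Longrightarrow> (\<Sum>l\<in>window j. gj j l (m' j)) \<le> Ks m'"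
  proof -
    have "\<forall>m'\<in>set ms. \<exists>K. \<forall>j. (\<Sum>l\<in>window j. gj j l (m' j)) \<le> K"
      using lev gj_sum_bound by (metis in_set_conv_nth list_all2_conv_all_nth)
    then show ?thesis using that by metis
  qed
  define K where "K = prod_list (map (\<lambda>m. max 0 (Ks m)) ms)"
  have K0: "0 \<le> K" unfolding K_def by (induction ms) auto
  define R where "R j l = dsum (gj j) (window j - U j - {l}) (map (\<lambda>m. m j) ms) (\<lambda>xs. fs j (l # xs))" for j l
  define R' where "R' j l = (if l \<in> window j then R j l else 0)" for j l
  have Rb: "\<bar>R j l\<bar> \<le> B * K" for j l
  proof -
    have "\<bar>R j l\<bar> \<le> B * prod_list (map (\<lambda>m. \<Sum>l\<in>window j - U j - {l}. gj j l m) (map (\<lambda>m. m j) ms))"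
      unfolding R_def by (rule dsum_bound) (use prems(1) in \<open>auto intro: gj_nonneg\<close>)
    also have "\<dots> \<le> B * K"
    proof (rule mult_left_mono[OF _ B0])
      have "0 \<le> prod_list (map (\<lambda>m. \<Sum>l\<in>window j - U j - {l}. gj j l m) (map (\<lambda>m. m j) ms')) \<and>
        prod_list (map (\<lambda>m. \<Sum>l\<in>window j - U j - {l}. gj j l m) (map (\<lambda>m. m j) ms')) \<le> prod_list (map (\<lambda>m. max 0 (Ks m)) ms')"
        if "set ms' \<subseteq> set ms" for ms'
        using that
      proof (induction ms')
        case (Cons m' ms')
        have 1: "0 \<le> (\<Sum>l\<in>window j - U j - {l}. gj j l (m' j))" by (rule sum_nonneg) (auto intro: gj_nonneg)
        have "(\<Sum>l\<in>window j - U j - {l}. gj j l (m' j)) \<le> (\<Sum>l\<in>window j. gj j l (m' j))"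
          by (rule sum_mono2) (auto intro: gj_nonneg)
        also have "\<dots> \<le> max 0 (Ks m')" using Ks[of m' j] Cons.prems by auto
        finally have 2: "(\<Sum>l\<in>window j - U j - {l}. gj j l (m' j)) \<le> max 0 (Ks m')" .
        have IH: "0 \<le> prod_list (map (\<lambda>m. \<Sum>l\<in>window j - U j - {l}. gj j l m) (map (\<lambda>m. m j) ms'))"
          "prod_list (map (\<lambda>m. \<Sum>l\<in>window j - U j - {l}. gj j l m) (map (\<lambda>m. m j) ms')) \<le> prod_list (map (\<lambda>m. max 0 (Ks m)) ms')"
          using Cons.IH Cons.prems by auto
        show ?case using mult_mono[OF 2 IH(2) order.trans[OF 1 2] IH(1)] mult_nonneg_nonneg[OF 1 IH(1)] by (simp only: list.map prod_list.Cons)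
      qed simp
      then show "prod_list (map (\<lambda>m. \<Sum>l\<in>window j - U j - {l}. gj j l m) (map (\<lambda>m. m j) ms)) \<le> K" unfolding K_def by blast
    qed
    finally show ?thesis .
  qed
  have R'b: "\<bar>R' j l\<bar> \<le> B * K" for j l unfolding R'_def using Rb B0 K0 by simp
  define P where "P = prod_list (map intens ts)"
  define psi' where "psi' x = P * normal_integral (length ms) (\<lambda>xs. f (x # xs))" for x
  have m: "0 < t" "(\<lambda>j. real (ns j) * (1 / (1 + e)) ^ m j) \<longlonglongrightarrow> t" using Cons.hyps by (auto simp: level_def)
  have conv: "(\<lambda>j. R' j (l j)) \<longlonglongrightarrow> psi' x"
    if l: "eventually (\<lambda>j. l j \<in> window j) sequentially" "(\<lambda>j. std_label e (ns j) (l j)) \<longlonglongrightarrow> x" for l x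
  proof -
    have "(\<lambda>j. dsum (gj j) (window j - (insert (l j) (U j))) (map (\<lambda>m. m j) ms) (\<lambda>xs. fs j (l j # xs)))
       \<longlonglongrightarrow> P * normal_integral (length ms) (\<lambda>xs. f (x # xs))"
      unfolding P_def
    proof (rule Cons.IH)
      show "list_cont (length ms) (\<lambda>xs. f (x # xs))" using list_conv_Cons[of "length ms" "\<lambda>_. f" f "\<lambda>_. x" x] prems(3) by simp
      show "label_conv (length ms) (\<lambda>j xs. fs j (l j # xs)) (\<lambda>xs. f (x # xs))"
        by (rule label_conv_Cons) (use prems(4) l in auto)
      show "card (insert (l j) (U j)) \<le> Suc q" for j
        using prems(5,6)[of j] by (simp add: card_insert_if)
    qed (use prems in auto)
    moreover have "window j - insert (l j) (U j) = window j - U j - {l j}" for j by auto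
    ultimately have lim: "(\<lambda>j. R j (l j)) \<longlonglongrightarrow> psi' x" unfolding R_def psi'_def by simp
    show ?thesis
      by (rule Lim_transform_eventually[OF lim]) (use l(1) in \<open>eventually_elim, simp add: R'_def\<close>)
  qed
  have meas: "psi' \<in> borel_measurable borel"
    unfolding psi'_def by (intro borel_measurable_times borel_measurable_const normal_integral_measurable[where B = B])
      (use prems(2,3) in auto)
  have main: "(\<lambda>j. \<Sum>l\<in>window j. gj j l (m j) * R' j l) \<longlonglongrightarrow> measure D {1} * t * (e / (1 + e)) * (\<integral>x. psi' x \<partial>std_normal_distribution)"
    by (rule weighted_label_sum_tendsto[OF m(2,1) R'b meas conv])
  \<comment> \<open>The excluded vertices contribute at most \<open>q\<close> terms, each of order
    \<open>1 / a j\<close>.\<close>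
  have small: "(\<lambda>j. \<Sum>l\<in>window j \<inter> U j. gj j l (m j) * R' j l) \<longlonglongrightarrow> 0"
  proof (rule Lim_null_comparison)
    have "(\<lambda>j. real q * ((real (ns j) * (1 / (1 + e)) ^ m j) * (1 / real (a j)) * (B * K))) \<longlonglongrightarrow> real q * (t * 0 * (B * K))"
      by (intro tendsto_mult tendsto_const m inverse_a_tendsto)
    then show "(\<lambda>j. real q * ((real (ns j) * (1 / (1 + e)) ^ m j) * (1 / real (a j)) * (B * K))) \<longlonglongrightarrow> 0" by simp
    show "eventually (\<lambda>j. norm (\<Sum>l\<in>window j \<inter> U j. gj j l (m j) * R' j l) \<le> real q * ((real (ns j) * (1 / (1 + e)) ^ m j) * (1 / real (a j)) * (B * K))) sequentially"
    proof (rule always_eventually, rule allI)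
      fix j
      let ?b = "(real (ns j) * (1 / (1 + e)) ^ m j) * (1 / real (a j)) * (B * K)"
      have b0: "0 \<le> ?b" using e_pos B0 K0 by simp
      have "norm (\<Sum>l\<in>window j \<inter> U j. gj j l (m j) * R' j l) \<le> (\<Sum>l\<in>window j \<inter> U j. norm (gj j l (m j) * R' j l))" by (rule norm_sum)
      also have "\<dots> \<le> (\<Sum>l\<in>window j \<inter> U j. ?b)"
      proof (rule sum_mono)
        fix l assume l: "l \<in> window j \<inter> U j"
        have "norm (gj j l (m j) * R' j l) = gj j l (m j) * \<bar>R' j l\<bar>" using gj_nonneg[of l j "m j"] l by (simp add: abs_mult)
        also have "\<dots> \<le> ?b" by (rule mult_mono[OF gj_le R'b]) (use l e_pos in auto)
        finally show "norm (gj j l (m j) * R' j l) \<le> ?b" .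
      qed
      also have "\<dots> = real (card (window j \<inter> U j)) * ?b" by simp
      also have "\<dots> \<le> real q * ?b"
      proof (rule mult_right_mono[OF _ b0])
        have "card (window j \<inter> U j) \<le> card (U j)" by (rule card_mono) (use prems(5) in auto)
        then show "real (card (window j \<inter> U j)) \<le> real q" using prems(6)[of j] by linarith
      qed
      finally show "norm (\<Sum>l\<in>window j \<inter> U j. gj j l (m j) * R' j l) \<le> real q * ?b" .
    qed
  qed
  have eq: "dsum (gj j) (window j - U j) (map (\<lambda>m. m j) (m # ms)) (fs j)
     = (\<Sum>l\<in>window j. gj j l (m j) * R' j l) - (\<Sum>l\<in>window j \<inter> U j. gj j l (m j) * R' j l)" for j
  proof -
    have "(\<Sum>l\<in>window j. gj j l (m j) * R' j l) = (\<Sum>l\<in>window j - U j. gj j l (m j) * R' j l) + (\<Sum>l\<in>window j \<inter> U j. gj j l (m j) * R' j l)"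
      using sum.Int_Diff[of "window j" "\<lambda>l. gj j l (m j) * R' j l" "U j"] by simp
    moreover have "(\<Sum>l\<in>window j - U j. gj j l (m j) * R' j l) = dsum (gj j) (window j - U j) (map (\<lambda>m. m j) (m # ms)) (fs j)"
      unfolding list.map dsum.simps by (rule sum.cong[OF refl]) (simp add: R'_def R_def)
    ultimately show ?thesis by linarith
  qed
  have "(\<integral>x. psi' x \<partial>std_normal_distribution) = P * normal_integral (length (m # ms)) f"
    unfolding psi'_def by simp
  then have lim: "measure D {1} * t * (e / (1 + e)) * (\<integral>x. psi' x \<partial>std_normal_distribution)
     = prod_list (map intens (t # ts)) * normal_integral (length (m # ms)) f"
    by (simp add: intens_def P_def mult.assoc)
  from tendsto_diff[OF main small] show ?case unfolding eq lim by simp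
qed

end

section \<open>First-moment bounds\<close>

lemma bij_betw_nth_distinct: "distinct ls \<Longrightarrow> bij_betw (\<lambda>i. ls ! i) {..<length ls} (set ls)"
  by (rule bij_betw_nth) auto

lemma prod_list_tendsto:
  fixes F :: "'m \<Rightarrow> nat \<Rightarrow> real"
  assumes "list_all2 (\<lambda>m t. F m \<longlonglongrightarrow> G t) ms ts"
  shows "(\<lambda>j. prod_list (map (\<lambda>m. F m j) ms)) \<longlonglongrightarrow> prod_list (map G ts)"
  using assms by (induction rule: list_all2_induct) (auto intro: tendsto_mult)

lemma summable_exp_sqrt: "summable (\<lambda>j. 2 * exp (- 2 * sqrt (real j)))"
proof (rule summable_comparison_test_bigo)
  show "summable (\<lambda>n. norm (1 / real n ^ 2))"
    using inverse_power_summable[of 2, where ?'a = real] by (simp add: divide_inverse)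
  show "(\<lambda>j. 2 * exp (- 2 * sqrt (real j))) \<in> O(\<lambda>n. 1 / real n ^ 2)" by real_asymp
qed

context tree_window
begin

definition pdeg :: "nat \<Rightarrow> nat list \<Rightarrow> nat list \<Rightarrow> real" where
  "pdeg j ls ks = prob {\<omega> \<in> space M. \<forall>i<length ks. indeg (par \<omega>) (ns j) (ls ! i) = ks ! i}"

abbreviation err :: "nat \<Rightarrow> nat \<Rightarrow> real" where
  "err j k \<equiv> rho e k (real (a j) powr (-1/4) * (1 + ln (real (ns j))))"

lemma err_nonneg: "1 \<le> ns j \<Longrightarrow> 0 \<le> err j k"
  unfolding rho_def using e_pos by (intro mult_nonneg_nonneg add_nonneg_nonneg) auto

lemma bad_nonneg: "0 \<le> bad b n"
  unfolding bad_def by simp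

text \<open>The joint estimate rewritten for lists. Apart from \<open>bad\<close>, its error is a
  product over positions, so it can be summed over tuples by \<open>dsum\<close>.\<close>

lemma pdeg_close:
  assumes ls: "ls \<in> dlists (window j) k" and ks: "length ks = k" and n: "1 \<le> ns j" and a: "2 / e \<le> real (a j) powr (1/4)"
  shows "\<bar>pdeg j ls ks - (\<Prod>i<k. gj j (ls ! i) (ks ! i))\<bar>
    \<le> err j k * (\<Prod>i<k. (1 / (1 + e)) ^ (ks ! i) * (real (ns j) / real (ls ! i))) + 2 * bad (a j) (ns j)"
proof -
  \<comment> \<open>The prescribed in-degrees as a function of the vertex, read off from the two
    parallel lists; distinctness of \<open>ls\<close> makes this consistent.\<close>
  define m where "m v = the (map_of (zip ls ks) v)" for v
  have l: "length ls = k" "distinct ls" "set ls \<subseteq> window j" using ls by (auto simp: dlists_def)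
  have m: "m (ls ! i) = ks ! i" if "i < k" for i
    unfolding m_def using that l ks by (simp add: map_of_zip_nth)
  have reix: "(\<Prod>v\<in>set ls. F v) = (\<Prod>i<k. F (ls ! i))" for F :: "nat \<Rightarrow> real"
    using prod.reindex_bij_betw[OF bij_betw_nth_distinct[OF l(2)], of F] l(1) by simp
  have ev: "{\<omega> \<in> space M. \<forall>v\<in>set ls. indeg (par \<omega>) (ns j) v = m v}
     = {\<omega> \<in> space M. \<forall>i<length ks. indeg (par \<omega>) (ns j) (ls ! i) = ks ! i}"
    using m l(1) ks by (auto simp: all_set_conv_all_nth)
  have "\<bar>prob {\<omega> \<in> space M. \<forall>v\<in>set ls. indeg (par \<omega>) (ns j) v = m v} - (\<Prod>v\<in>set ls. gj j v (m v))\<bar>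
    \<le> (1 / (1 + e)) ^ (\<Sum>v\<in>set ls. m v) * (err j (card (set ls)) * (\<Prod>v\<in>set ls. real (ns j) / real v)) + 2 * bad (a j) (ns j)"
    by (rule joint_degree_estimate[OF a_pos a l(3) n])
  moreover have "(1 / (1 + e)) ^ (\<Sum>v\<in>set ls. m v) * (err j (card (set ls)) * (\<Prod>v\<in>set ls. real (ns j) / real v))
    = err j k * (\<Prod>v\<in>set ls. (1 / (1 + e)) ^ m v * (real (ns j) / real v))"
    by (simp only: distinct_card[OF l(2)] l(1) power_sum prod.distrib mult.left_commute)
  moreover have "(\<Prod>v\<in>set ls. gj j v (m v)) = (\<Prod>i<k. gj j (ls ! i) (ks ! i))"
    unfolding reix by (rule prod.cong) (auto simp: m)
  moreover have "(\<Prod>v\<in>set ls. (1 / (1 + e)) ^ m v * (real (ns j) / real v)) = (\<Prod>i<k. (1 / (1 + e)) ^ (ks ! i) * (real (ns j) / real (ls ! i)))"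
    unfolding reix by (rule prod.cong) (auto simp: m)
  ultimately show ?thesis unfolding pdeg_def ev by simp
qed

lemma eventually_a_large: "eventually (\<lambda>j. c \<le> real (a j) powr (1/4)) sequentially"
proof -
  have "filterlim (\<lambda>n. (real n powr h / 2) powr (1/4)) at_top sequentially" using h_pos by real_asymp
  from filterlim_compose[OF this ns_top]
  have "eventually (\<lambda>j. c \<le> (real (ns j) powr h / 2) powr (1/4)) sequentially" by (simp add: filterlim_at_top)
  with a_ge show ?thesis
  proof eventually_elim
    case (elim j)
    have "(real (ns j) powr h / 2) powr (1/4) \<le> real (a j) powr (1/4)"
      by (rule powr_mono2) (use elim in simp_all)
    then show ?case using elim by linarith
  qed
qed

lemma window_inverse_sum_le: "1 \<le> ns j \<Longrightarrow> (\<Sum>l\<in>window j. 1 / real l) \<le> 1 + ln (real (ns j))"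
proof -
  assume n: "1 \<le> ns j"
  have "(\<Sum>l\<in>window j. 1 / real l) \<le> (\<Sum>l=1..ns j. 1 / real l)"
    by (rule sum_mono2) (use a_pos[of j] in auto)
  then show ?thesis using inverse_sum_le[OF n] by linarith
qed

text \<open>Summed over all tuples, the first error is \<open>err\<close> times a bounded factor and
  a power of the logarithm, the second consists of at most \<open>n ^ k\<close> terms
  \<open>2 * bad\<close>. Both vanish.\<close>

lemma level_prob_tendsto:
  assumes lev: "list_all2 level ms ts" and fs: "\<And>j ls. \<bar>fs j ls\<bar> \<le> B" and f: "\<And>xs. \<bar>f xs\<bar> \<le> B" "list_cont (length ms) f"
    and conv: "label_conv (length ms) fs f"
  shows "(\<lambda>j. \<Sum>ls\<in>dlists (window j) (length ms). pdeg j ls (map (\<lambda>m. m j) ms) * fs j ls)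
    \<longlonglongrightarrow> prod_list (map intens ts) * normal_integral (length ms) f"
proof -
  let ?k = "length ms"
  define S where "S j = (\<Sum>ls\<in>dlists (window j) ?k. pdeg j ls (map (\<lambda>m. m j) ms) * fs j ls)" for j
  define T where "T j = dsum (gj j) (window j - {}) (map (\<lambda>m. m j) ms) (fs j)" for j
  define A where "A j = prod_list (map (\<lambda>m. real (ns j) * (1 / (1 + e)) ^ m j) ms)" for j
  have B0: "0 \<le> B" using fs[of 0 "[]"] by linarith
  have T: "T \<longlonglongrightarrow> prod_list (map intens ts) * normal_integral ?k f"
    unfolding T_def by (rule dsum_tendsto[OF lev fs f conv, where q = 0]) simp_all
  have A: "A \<longlonglongrightarrow> prod_list (map (\<lambda>t. t) ts)"
    unfolding A_def
  proof (rule prod_list_tendsto)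
    show "list_all2 (\<lambda>m t. (\<lambda>j. real (ns j) * (1 / (1 + e)) ^ m j) \<longlonglongrightarrow> t) ms ts"
      using lev by (rule list.rel_mono_strong) (simp add: level_def)
  qed
  define R where "R j = B * (A j * (err j ?k * (1 + ln (real (ns j))) ^ ?k)) + 2 * B * (real (ns j) ^ ?k * bad (a j) (ns j))" for j
  have "R \<longlonglongrightarrow> B * (prod_list (map (\<lambda>t. t) ts) * 0) + 2 * B * 0"
    unfolding R_def by (intro tendsto_add tendsto_mult tendsto_const A rho_tendsto bad_tendsto)
  then have R: "R \<longlonglongrightarrow> 0" by simp
  have "eventually (\<lambda>j. norm (S j - T j) \<le> R j) sequentially"
    using eventually_ns_ge[of 1] eventually_a_large[of "2 / e"]
  proof eventually_elim
    case (elim j)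
    define ks where "ks = map (\<lambda>m. m j) ms"
    define G where "G ls = (\<Prod>i<?k. gj j (ls ! i) (ks ! i))" for ls
    define E where "E ls = (\<Prod>i<?k. (1 / (1 + e)) ^ (ks ! i) * (real (ns j) / real (ls ! i)))" for ls
    let ?D = "dlists (window j) ?k"
    have fin: "finite ?D" by (rule finite_dlists) simp
    have lk: "length ks = ?k" unfolding ks_def by simp
    have T': "T j = (\<Sum>ls\<in>?D. G ls * fs j ls)"
      unfolding T_def G_def ks_def[symmetric] using dsum_eq[of "window j" "gj j" ks "fs j"] lk by simp
    have "S j - T j = (\<Sum>ls\<in>?D. (pdeg j ls ks - G ls) * fs j ls)"
      unfolding S_def T' ks_def[symmetric] sum_subtractf[symmetric] by (simp add: left_diff_distrib)
    then have "norm (S j - T j) \<le> (\<Sum>ls\<in>?D. norm ((pdeg j ls ks - G ls) * fs j ls))" by (simp only: norm_sum)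
    also have "\<dots> \<le> (\<Sum>ls\<in>?D. (err j ?k * E ls + 2 * bad (a j) (ns j)) * B)"
    proof (rule sum_mono)
      fix ls assume ls: "ls \<in> ?D"
      have 1: "\<bar>pdeg j ls ks - G ls\<bar> \<le> err j ?k * E ls + 2 * bad (a j) (ns j)"
        unfolding G_def E_def by (rule pdeg_close[OF ls lk elim])
      show "norm ((pdeg j ls ks - G ls) * fs j ls) \<le> (err j ?k * E ls + 2 * bad (a j) (ns j)) * B"
        unfolding real_norm_def abs_mult by (rule mult_mono[OF 1 fs order.trans[OF abs_ge_zero 1] abs_ge_zero])
    qed
    also have "\<dots> = B * (err j ?k * (\<Sum>ls\<in>?D. E ls)) + 2 * B * (real (card ?D) * bad (a j) (ns j))"
      by (simp add: sum.distrib sum_distrib_left sum_distrib_right algebra_simps)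
    also have "\<dots> \<le> B * (err j ?k * (A j * (1 + ln (real (ns j))) ^ ?k)) + 2 * B * (real (ns j) ^ ?k * bad (a j) (ns j))"
    proof (intro add_mono mult_left_mono mult_right_mono)
      have "(\<Sum>ls\<in>?D. E ls) = dsum (\<lambda>l m. (1 / (1 + e)) ^ m * (real (ns j) / real l)) (window j) ks (\<lambda>_. 1)"
        using dsum_eq[of "window j" "\<lambda>l m. (1 / (1 + e)) ^ m * (real (ns j) / real l)" ks "\<lambda>_. 1"] lk
        by (simp add: E_def)
      also have "\<dots> \<le> \<bar>dsum (\<lambda>l m. (1 / (1 + e)) ^ m * (real (ns j) / real l)) (window j) ks (\<lambda>_. 1)\<bar>" by simp
      also have "\<dots> \<le> 1 * prod_list (map (\<lambda>m. \<Sum>l\<in>window j. (1 / (1 + e)) ^ m * (real (ns j) / real l)) ks)"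
        by (rule dsum_bound) (use e_pos in auto)
      also have "prod_list (map (\<lambda>m. \<Sum>l\<in>window j. (1 / (1 + e)) ^ m * (real (ns j) / real l)) ks) \<le> A j * (1 + ln (real (ns j))) ^ ?k"
      proof -
        let ?s = "\<lambda>m. \<Sum>l\<in>window j. (1 / (1 + e)) ^ m * (real (ns j) / real l)"
        have s: "0 \<le> ?s m" "?s m \<le> real (ns j) * (1 / (1 + e)) ^ m * (1 + ln (real (ns j)))" for m
        proof -
          show "0 \<le> ?s m" using e_pos by (intro sum_nonneg) auto
          have "?s m = real (ns j) * (1 / (1 + e)) ^ m * (\<Sum>l\<in>window j. 1 / real l)"
            by (simp add: sum_distrib_left mult_ac)
          then show "?s m \<le> real (ns j) * (1 / (1 + e)) ^ m * (1 + ln (real (ns j)))"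
            using mult_left_mono[OF window_inverse_sum_le[OF elim(1)], of "real (ns j) * (1 / (1 + e)) ^ m"] e_pos by simp
        qed
        have "0 \<le> prod_list (map ?s (map (\<lambda>m. m j) ms')) \<and> prod_list (map ?s (map (\<lambda>m. m j) ms'))
           \<le> prod_list (map (\<lambda>m. real (ns j) * (1 / (1 + e)) ^ m j) ms') * (1 + ln (real (ns j))) ^ length ms'" for ms'
        proof (induction ms')
          case (Cons m ms')
          have "?s (m j) * prod_list (map ?s (map (\<lambda>m. m j) ms')) \<le> (real (ns j) * (1 / (1 + e)) ^ m j * (1 + ln (real (ns j)))) *
             (prod_list (map (\<lambda>m. real (ns j) * (1 / (1 + e)) ^ m j) ms') * (1 + ln (real (ns j))) ^ length ms')"
            by (rule mult_mono[OF s(2)[of "m j"]]) (use Cons s(2)[of "m j"] s(1)[of "m j"] in linarith)+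
          moreover have "0 \<le> ?s (m j) * prod_list (map ?s (map (\<lambda>m. m j) ms'))" using Cons s(1)[of "m j"] by simp
          ultimately show ?case by (simp only: list.map prod_list.Cons list.size power_Suc add_0_right add_Suc_right One_nat_def mult_ac)
        qed simp
        then show ?thesis unfolding A_def ks_def by blast
      qed
      finally show "(\<Sum>ls\<in>?D. E ls) \<le> A j * (1 + ln (real (ns j))) ^ ?k" by simp
      have "card ?D \<le> card {ls. set ls \<subseteq> window j \<and> length ls = ?k}"
        by (rule card_mono) (auto simp: dlists_def finite_lists_length_eq)
      also have "\<dots> = card (window j) ^ ?k" by (rule card_lists_length_eq) simp
      also have "\<dots> \<le> ns j ^ ?k" by (rule power_mono) auto
      finally show "real (card ?D) \<le> real (ns j) ^ ?k" by (metis of_nat_le_iff of_nat_power)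
    qed (use B0 bad_nonneg err_nonneg[OF elim(1)] in auto)
    also have "\<dots> = R j" unfolding R_def by (simp add: mult_ac)
    finally show "norm (S j - T j) \<le> R j" .
  qed
  from Lim_null_comparison[OF this R] have "(\<lambda>j. S j - T j) \<longlonglongrightarrow> 0" .
  from tendsto_add[OF this T] show ?thesis unfolding S_def by simp
qed

lemma indeg_event [measurable]: "{\<omega> \<in> space M. Q (indeg (par \<omega>) n)} \<in> sets M"
proof -
  have "(\<lambda>\<omega>. if Q (indeg (par \<omega>) n) then 1 else 0 :: real) \<in> borel_measurable M"
    by (rule indeg_measurable)
  then have "{\<omega> \<in> space M. (if Q (indeg (par \<omega>) n) then 1 else 0 :: real) = 1} \<in> sets M" by measurable
  moreover have "{\<omega> \<in> space M. (if Q (indeg (par \<omega>) n) then 1 else 0 :: real) = 1} = {\<omega> \<in> space M. Q (indeg (par \<omega>) n)}" by auto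
  ultimately show ?thesis by simp
qed

lemma power_tail_le: "(\<Sum>k=m..n. (1 / (1 + e)) ^ k) \<le> (1 / (1 + e)) ^ m * ((1 + e) / e)"
proof -
  have r: "norm (1 / (1 + e)) < 1" "0 \<le> 1 / (1 + e)" using e_pos by auto
  have "(\<Sum>k=m..n. (1 / (1 + e)) ^ k) \<le> (\<Sum>k\<in>{m..<m + Suc n}. (1 / (1 + e)) ^ k)"
    by (rule sum_mono2) (use r in auto)
  also have "\<dots> = (\<Sum>i<Suc n. (1 / (1 + e)) ^ (i + m))"
    by (rule sum.reindex_bij_witness[of _ "\<lambda>i. i + m" "\<lambda>k. k - m"]) auto
  also have "\<dots> = (1 / (1 + e)) ^ m * (\<Sum>i<Suc n. (1 / (1 + e)) ^ i)"
    by (simp only: power_add sum_distrib_left mult.commute)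
  also have "\<dots> \<le> (1 / (1 + e)) ^ m * (\<Sum>i. (1 / (1 + e)) ^ i)"
    by (intro mult_left_mono sum_le_suminf summable_geometric r) (use r in auto)
  also have "(\<Sum>i. (1 / (1 + e)) ^ i) = (1 + e) / e"
    unfolding suminf_geometric[OF r(1)] using e_pos by (simp add: field_simps)
  finally show ?thesis .
qed

text \<open>First moments summed over the labels and over all in-degrees from \<open>m j\<close>
  upwards. The geometric series gives \<open>(1 + e) / e\<close>; the 3 could be any constant above
  the 2 of \<open>gq_sum_le\<close>.\<close>

lemma high_degree_bound:
  assumes "level m t"
  shows "eventually (\<lambda>j. prob {\<omega> \<in> space M. \<exists>l\<in>window j. m j \<le> indeg (par \<omega>) (ns j) l} \<le> 3 * t * ((1 + e) / e)) sequentially"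
proof -
  define A where "A j = real (ns j) * (1 / (1 + e)) ^ m j" for j
  define H where "H j = A j * ((1 + e) / e) * (2 + 2 * cellerr e (a j) (ns j) + err j 1 * (1 + ln (real (ns j))) ^ 1)
     + 4 * (real (ns j) ^ 2 * bad (a j) (ns j))" for j
  have t: "0 < t" "A \<longlonglongrightarrow> t" using assms by (auto simp: level_def A_def[abs_def])
  have "H \<longlonglongrightarrow> t * ((1 + e) / e) * (2 + 2 * 0 + 0) + 4 * 0"
    unfolding H_def by (intro tendsto_add tendsto_mult tendsto_const t cellerr_tendsto rho_tendsto bad_tendsto)
  moreover have "0 < t * ((1 + e) / e)" using t e_pos by simp
  then have "t * ((1 + e) / e) * 2 < t * ((1 + e) / e) * 3" by (rule mult_strict_left_mono[rotated]) simp
  then have "t * ((1 + e) / e) * (2 + 2 * 0 + 0) + 4 * 0 < 3 * t * ((1 + e) / e)"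
    by (simp only: mult.commute mult.left_commute mult_zero_left mult_zero_right add_0_right)
  ultimately have "eventually (\<lambda>j. H j < 3 * t * ((1 + e) / e)) sequentially" by (rule order_tendstoD(2))
  with eventually_ns_ge[of 1] eventually_a_large[of "2 / e"] show ?thesis
  proof eventually_elim
    case (elim j)
    let ?n = "ns j"
    let ?E = "\<lambda>l k. {\<omega> \<in> space M. indeg (par \<omega>) ?n l = k}"
    have pd: "prob (?E l k) = pdeg j [l] [k]" for l k unfolding pdeg_def by simp
    have EM: "?E l k \<in> sets M" for l k by (rule indeg_event[of "\<lambda>x. x l = k"])
    have "prob {\<omega> \<in> space M. \<exists>l\<in>window j. m j \<le> indeg (par \<omega>) ?n l} \<le> prob (\<Union>(l, k)\<in>window j \<times> {m j..?n}. ?E l k)"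
    proof (rule finite_measure_mono)
      show "{\<omega> \<in> space M. \<exists>l\<in>window j. m j \<le> indeg (par \<omega>) ?n l} \<subseteq> (\<Union>(l, k)\<in>window j \<times> {m j..?n}. ?E l k)"
        using indeg_le by fastforce
      show "(\<Union>(l, k)\<in>window j \<times> {m j..?n}. ?E l k) \<in> sets M"
        by (intro sets.finite_UN) (auto intro: indeg_event)
    qed
    also have "\<dots> \<le> (\<Sum>(l, k)\<in>window j \<times> {m j..?n}. prob (?E l k))"
    proof -
      have "prob (\<Union>p\<in>window j \<times> {m j..?n}. case p of (l, k) \<Rightarrow> ?E l k) \<le> (\<Sum>p\<in>window j \<times> {m j..?n}. prob (case p of (l, k) \<Rightarrow> ?E l k))"
        by (rule finite_measure_subadditive_finite) (use EM in \<open>simp_all add: image_subset_iff split: prod.split\<close>)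
      also have "\<dots> = (\<Sum>(l, k)\<in>window j \<times> {m j..?n}. prob (?E l k))" by (rule sum.cong) auto
      finally show ?thesis .
    qed
    also have "\<dots> \<le> (\<Sum>(l, k)\<in>window j \<times> {m j..?n}. gj j l k + err j 1 * ((1 / (1 + e)) ^ k * (real ?n / real l)) + 2 * bad (a j) ?n)"
    proof (rule sum_mono, clarify)
      fix l k assume "l \<in> window j" "k \<in> {m j..?n}"
      then have "[l] \<in> dlists (window j) 1" by (simp add: dlists_def)
      from pdeg_close[OF this _ elim(1,2), of "[k]"]
      show "prob (?E l k) \<le> gj j l k + err j 1 * ((1 / (1 + e)) ^ k * (real ?n / real l)) + 2 * bad (a j) ?n"
        unfolding pd by simp
    qed
    also have "\<dots> = (\<Sum>k=m j..?n. \<Sum>l\<in>window j. gj j l k + err j 1 * ((1 / (1 + e)) ^ k * (real ?n / real l)) + 2 * bad (a j) ?n)"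
      unfolding sum.cartesian_product[symmetric] by (rule sum.swap)
    also have "\<dots> \<le> (\<Sum>k=m j..?n. real ?n * (1 / (1 + e)) ^ k * (2 + 2 * cellerr e (a j) ?n + err j 1 * (1 + ln (real ?n)) ^ 1) + real ?n * (2 * bad (a j) ?n))"
    proof (rule sum_mono)
      fix k
      have "(\<Sum>l\<in>window j. gj j l k + err j 1 * ((1 / (1 + e)) ^ k * (real ?n / real l)) + 2 * bad (a j) ?n)
        = (\<Sum>l\<in>window j. gj j l k) + err j 1 * (real ?n * (1 / (1 + e)) ^ k) * (\<Sum>l\<in>window j. 1 / real l) + real (card (window j)) * (2 * bad (a j) ?n)"
      proof -
        have "(\<Sum>l\<in>window j. err j 1 * ((1 / (1 + e)) ^ k * (real ?n / real l))) = err j 1 * (real ?n * (1 / (1 + e)) ^ k) * (\<Sum>l\<in>window j. 1 / real l)"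
          unfolding sum_distrib_left by (rule sum.cong[OF refl]) simp
        then show ?thesis by (simp only: sum.distrib sum_constant)
      qed
      also have "\<dots> \<le> real ?n * (1 / (1 + e)) ^ k * (2 + 2 * cellerr e (a j) ?n) + err j 1 * (real ?n * (1 / (1 + e)) ^ k) * (1 + ln (real ?n)) + real ?n * (2 * bad (a j) ?n)"
        by (intro add_mono gq_sum_le mult_left_mono mult_right_mono window_inverse_sum_le elim(1))
          (use err_nonneg[OF elim(1), of 1] e_pos bad_nonneg in \<open>auto intro!: mult_nonneg_nonneg\<close>)
      finally show "(\<Sum>l\<in>window j. gj j l k + err j 1 * ((1 / (1 + e)) ^ k * (real ?n / real l)) + 2 * bad (a j) ?n)
        \<le> real ?n * (1 / (1 + e)) ^ k * (2 + 2 * cellerr e (a j) ?n + err j 1 * (1 + ln (real ?n)) ^ 1) + real ?n * (2 * bad (a j) ?n)"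
        by (simp only: power_one_right distrib_left mult_ac add_ac)
    qed
    also have "\<dots> = real ?n * (2 + 2 * cellerr e (a j) ?n + err j 1 * (1 + ln (real ?n)) ^ 1) * (\<Sum>k=m j..?n. (1 / (1 + e)) ^ k)
       + real (card {m j..?n}) * (real ?n * (2 * bad (a j) ?n))"
    proof -
      have "(\<Sum>k=m j..?n. real ?n * (1 / (1 + e)) ^ k * C) = real ?n * C * (\<Sum>k=m j..?n. (1 / (1 + e)) ^ k)" for C
        unfolding sum_distrib_left by (rule sum.cong[OF refl]) simp
      then show ?thesis by (simp only: sum.distrib sum_constant)
    qed
    also have "\<dots> \<le> real ?n * (2 + 2 * cellerr e (a j) ?n + err j 1 * (1 + ln (real ?n)) ^ 1) * ((1 / (1 + e)) ^ m j * ((1 + e) / e))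
       + 2 * real ?n * (real ?n * (2 * bad (a j) ?n))"
    proof (intro add_mono mult_left_mono mult_right_mono power_tail_le)
      show "real (card {m j..?n}) \<le> 2 * real ?n" using elim(1) by simp
      have "0 \<le> cellerr e (a j) ?n" unfolding cellerr_def using e_pos elim(1) by (intro mult_nonneg_nonneg divide_nonneg_nonneg) auto
      then show "0 \<le> real ?n * (2 + 2 * cellerr e (a j) ?n + err j 1 * (1 + ln (real ?n)) ^ 1)"
        using err_nonneg[OF elim(1), of 1] elim(1) by (intro mult_nonneg_nonneg add_nonneg_nonneg) auto
    qed (use bad_nonneg in simp)
    also have "\<dots> = H j" unfolding H_def A_def by (simp add: power2_eq_square algebra_simps)
    finally show ?case using elim(3) by linarith
  qed
qed

section \<open>Vertices older than the window\<close>

text \<open>Before time \<open>b\<close> each factor is at most \<open>z\<close>, as attachment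
  probabilities are at most 1. From \<open>b\<close> on the weight sums are at least
  \<open>beta * j\<close>, and \<open>1 + y \<le> exp y\<close> leaves a harmonic sum in the
  exponent.\<close>

lemma tilted_product_le:
  assumes w: "\<And>k. k \<ge> 1 \<Longrightarrow> 0 < w k" "\<And>k. k \<ge> 1 \<Longrightarrow> w k \<le> 1" and good: "good_weights e b n w"
    and z: "1 \<le> z" and beta: "0 < beta" "beta < e" and b: "1 \<le> b" "1 / (e - beta) \<le> real b powr (1/4)"
    and n: "1 \<le> n" and v: "1 \<le> v"
  shows "(\<Prod>j<n. 1 + (z - 1) * attach w j v) \<le> z ^ b * exp ((z - 1) / beta * (1 + ln (real n)))"
proof -
  have A: "0 \<le> attach w j v" "attach w j v \<le> 1" for j
    using attach_nonneg[of w v j] sum_attach_le_1[of w "{v}" j] w v by auto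
  have B: "attach w j v \<le> 1 / (beta * real j)" if j: "b \<le> j" "j < n" for j
  proof -
    have j0: "0 < real j" using j b by linarith
    let ?S = "\<Sum>k=1..j. w k"
    have "1 / (e - beta) \<le> real j powr (1/4)"
      using b(2) powr_mono2[of "1/4" "real b" "real j"] j by linarith
    then have 1: "1 \<le> (e - beta) * real j powr (1/4)" using beta by (simp add: pos_divide_le_eq mult.commute)
    have "real j powr (3/4) * 1 \<le> real j powr (3/4) * ((e - beta) * real j powr (1/4))"
      by (rule mult_left_mono[OF 1]) simp
    also have "\<dots> = (e - beta) * (real j powr (3/4) * real j powr (1/4))" by (rule mult.left_commute)
    also have "real j powr (3/4) * real j powr (1/4) = real j" using powr_add[of "real j" "3/4" "1/4"] j0 by simp
    finally have "real j powr (3/4) \<le> e * real j - beta * real j" by (simp add: left_diff_distrib)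
    moreover have "\<bar>?S - e * real j\<bar> \<le> real j powr (3/4)"
      using good j unfolding good_weights_def by simp
    ultimately have S: "beta * real j \<le> ?S" by linarith
    have "0 < beta * real j" using beta j0 by simp
    with S have "w v / ?S \<le> 1 / (beta * real j)" using w v by (intro frac_le) auto
    moreover have "0 \<le> 1 / (beta * real j)" using beta j0 by simp
    ultimately show ?thesis unfolding attach_def by simp
  qed
  have "(\<Prod>j<n. 1 + (z - 1) * attach w j v) \<le> (\<Prod>j<n. (if j < b then z else 1) * exp (if j < b then 0 else (z - 1) / beta * (1 / real j)))"
  proof (rule prod_mono, rule conjI)
    fix j assume "j \<in> {..<n}"
    then have jn: "j < n" by simp
    show "0 \<le> 1 + (z - 1) * attach w j v" using A z by (intro add_nonneg_nonneg mult_nonneg_nonneg) auto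
    show "1 + (z - 1) * attach w j v \<le> (if j < b then z else 1) * exp (if j < b then 0 else (z - 1) / beta * (1 / real j))"
    proof (cases "j < b")
      case True
      have "(z - 1) * attach w j v \<le> (z - 1) * 1" using A(2) z by (intro mult_left_mono) auto
      then show ?thesis using True by simp
    next
      case False
      have "1 + (z - 1) * attach w j v \<le> 1 + (z - 1) * (1 / (beta * real j))"
        using B[of j] jn False z by (intro add_left_mono mult_left_mono) auto
      also have "\<dots> \<le> exp ((z - 1) * (1 / (beta * real j)))" by (rule exp_ge_add_one_self)
      finally show ?thesis using False by simp
    qed
  qed
  also have "\<dots> = (\<Prod>j<n. if j < b then z else 1) * exp (\<Sum>j<n. if j < b then 0 else (z - 1) / beta * (1 / real j))"
    by (simp add: prod.distrib exp_sum)
  also have "\<dots> \<le> z ^ b * exp ((z - 1) / beta * (1 + ln (real n)))"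
  proof (rule mult_mono)
    have "(\<Prod>j<n. if j < b then z else 1) = (\<Prod>j\<in>{..<n} \<inter> {j. j < b}. z)"
      by (subst prod.inter_restrict) auto
    also have "\<dots> = z ^ card ({..<n} \<inter> {j. j < b})" by simp
    also have "\<dots> \<le> z ^ b"
    proof (rule power_increasing[OF _ z])
      have "card ({..<n} \<inter> {j. j < b}) \<le> card {..<b}" by (rule card_mono) auto
      then show "card ({..<n} \<inter> {j. j < b}) \<le> b" by simp
    qed
    finally show "(\<Prod>j<n. if j < b then z else 1) \<le> z ^ b" .
    have "(\<Sum>j<n. if j < b then 0 else (z - 1) / beta * (1 / real j)) \<le> (\<Sum>j<n. (z - 1) / beta * (1 / real j))"
      by (rule sum_mono) (use z beta in auto)
    also have "\<dots> = (z - 1) / beta * (\<Sum>j<n. 1 / real j)" by (rule sum_distrib_left[symmetric])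
    also have "\<dots> \<le> (z - 1) / beta * (1 + ln (real n))"
    proof (rule mult_left_mono)
      have "(\<Sum>j<n. 1 / real j) = (\<Sum>j\<in>{..<n} - {0}. 1 / real j)" using n by (subst sum.remove[of _ 0]) auto
      also have "\<dots> \<le> (\<Sum>j=1..n. 1 / real j)" by (rule sum_mono2) auto
      finally show "(\<Sum>j<n. 1 / real j) \<le> 1 + ln (real n)" using inverse_sum_le[OF n] by linarith
    qed (use z beta in simp)
    finally show "exp (\<Sum>j<n. if j < b then 0 else (z - 1) / beta * (1 / real j)) \<le> exp ((z - 1) / beta * (1 + ln (real n)))"
      by simp
  qed (use z in auto)
  finally show ?thesis .
qed

text \<open>A Chernoff bound with tilt \<open>z\<close>, restricted to good weights. The threshold
  \<open>b\<close> from which the weights are controlled is not tied to the start of the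
  window.\<close>

lemma low_label_prob_le:
  assumes z: "1 \<le> z" and beta: "0 < beta" "beta < e" and b: "1 \<le> b" "1 / (e - beta) \<le> real b powr (1/4)"
    and n: "1 \<le> n" and v: "1 \<le> v"
  shows "prob {\<omega> \<in> space M. m \<le> indeg (par \<omega>) n v \<and> good_weights e b n (wt \<omega>)}
    \<le> (1 / z) ^ m * (z ^ b * exp ((z - 1) / beta * (1 + ln (real n))))"
proof -
  define G where "G \<omega> = (if good_weights e b n (wt \<omega>) then 1 else 0 :: real)" for \<omega>
  define K where "K = z ^ b * exp ((z - 1) / beta * (1 + ln (real n)))"
  have Gh: "G \<in> borel_measurable (history M W p k)" for k
    unfolding G_def by (rule good_weights_measurable_history[OF b(1)])
  have [measurable]: "G \<in> borel_measurable M" by (rule measurable_from_subalg[OF subalgebra_history Gh])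
  have [measurable]: "(\<lambda>\<omega>. z ^ indeg (par \<omega>) n v) \<in> borel_measurable M" by (rule indeg_measurable[where F = "\<lambda>x. z ^ x v"])
  have G01: "0 \<le> G \<omega>" "G \<omega> \<le> 1" for \<omega> by (auto simp: G_def)
  let ?E = "{\<omega> \<in> space M. m \<le> indeg (par \<omega>) n v \<and> good_weights e b n (wt \<omega>)}"
  have EM: "?E \<in> sets M"
  proof -
    have "?E = {\<omega> \<in> space M. m \<le> indeg (par \<omega>) n v} - {\<omega> \<in> space M. \<not> good_weights e b n (wt \<omega>)}" by auto
    then show ?thesis using indeg_event[of "\<lambda>x. m \<le> x v" n] good_event[OF b(1), of n] by simp
  qed
  have K0: "0 \<le> K" unfolding K_def using z by simp
  have int: "integrable M (\<lambda>\<omega>. G \<omega> * z ^ indeg (par \<omega>) n v)"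
  proof (rule AE_bounded_integrable[where B = "z ^ n"])
    show "AE \<omega> in M. \<bar>G \<omega> * z ^ indeg (par \<omega>) n v\<bar> \<le> z ^ n"
    proof (rule AE_I2)
      fix \<omega>
      have "G \<omega> * z ^ indeg (par \<omega>) n v \<le> 1 * z ^ n"
        by (intro mult_mono G01 power_increasing indeg_le) (use z in auto)
      then show "\<bar>G \<omega> * z ^ indeg (par \<omega>) n v\<bar> \<le> z ^ n" using G01 z by simp
    qed
  qed measurable
  have "prob ?E = expectation (indicator ?E)" using EM by simp
  also have "\<dots> \<le> expectation (\<lambda>\<omega>. (1 / z) ^ m * (G \<omega> * z ^ indeg (par \<omega>) n v))"
  proof (rule integral_mono)
    fix \<omega> assume "\<omega> \<in> space M"
    show "indicator ?E \<omega> \<le> (1 / z) ^ m * (G \<omega> * z ^ indeg (par \<omega>) n v)"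
    proof (cases "\<omega> \<in> ?E")
      case True
      then have "m \<le> indeg (par \<omega>) n v" "G \<omega> = 1" by (simp_all add: G_def)
      then have "1 \<le> (1 / z) ^ m * (G \<omega> * z ^ indeg (par \<omega>) n v)"
        using power_increasing[of m "indeg (par \<omega>) n v" z] z by (simp add: power_divide)
      then show ?thesis using True by simp
    next
      case False
      have "0 \<le> (1 / z) ^ m * (G \<omega> * z ^ indeg (par \<omega>) n v)" using G01 z by simp
      then show ?thesis using False by simp
    qed
  next
    show "integrable M (indicator ?E :: 'a \<Rightarrow> real)"
      by (rule AE_bounded_integrable[where B = 1]) (use EM in \<open>simp_all add: indicator_def\<close>)
  qed (use int in simp)
  also have "\<dots> = (1 / z) ^ m * expectation (\<lambda>\<omega>. G \<omega> * z ^ indeg (par \<omega>) n v)" by simp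
  also have "expectation (\<lambda>\<omega>. G \<omega> * z ^ indeg (par \<omega>) n v) = expectation (\<lambda>\<omega>. G \<omega> * (\<Prod>j<n. 1 + (z - 1) * attach (wt \<omega>) j v))"
    by (rule expectation_tilt[OF v Gh _ z, where B = 1]) (simp add: G_def)
  also have "\<dots> \<le> expectation (\<lambda>\<omega>. K)"
  proof (rule integral_mono_AE')
    show "AE \<omega> in M. G \<omega> * (\<Prod>j<n. 1 + (z - 1) * attach (wt \<omega>) j v) \<le> K"
      using AE_weights
    proof eventually_elim
      case (elim \<omega>)
      show ?case
      proof (cases "good_weights e b n (wt \<omega>)")
        case True
        have "(\<Prod>j<n. 1 + (z - 1) * attach (wt \<omega>) j v) \<le> K"
          unfolding K_def by (rule tilted_product_le[OF _ _ True z beta b n v]) (use elim in auto)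
        then show ?thesis using True by (simp add: G_def)
      qed (simp add: G_def K0)
    qed
    show "AE \<omega> in M. 0 \<le> K" using K0 by simp
  qed simp
  finally show ?thesis using z by (simp add: prob_space K_def mult_left_mono)
qed

text \<open>There are at most about \<open>n powr h\<close> such vertices. With
  \<open>z = sqrt (1 + e)\<close> the factor \<open>(1 / z) ^ m\<close> is of order
  \<open>n powr (-1/2)\<close>, and the tilted product adds \<open>n powr (2 / (z + 3))\<close> up
  to smaller factors. The hypothesis on \<open>h\<close> says precisely that the total exponent is
  negative.\<close>

lemma low_labels_negligible:
  assumes lev: "level m t" and h: "h < (sqrt (1 + e) - 1) / (2 * (sqrt (1 + e) + 3))"
  shows "(\<lambda>j. prob {\<omega> \<in> space M. \<exists>l\<in>{1..a j}. m j \<le> indeg (par \<omega>) (ns j) l}) \<longlonglongrightarrow> 0"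
proof -
  define z where "z = sqrt (1 + e)"
  \<comment> \<open>Halfway between \<open>2 * (z - 1)\<close> and
    \<open>(z - 1) * (z + 1) = e\<close>: above the former, so that
    \<open>(z - 1) / beta < 1 / 2\<close>, and below the latter, as \<open>tilted_product_le\<close>
    requires.\<close>
  define beta where "beta = (z - 1) * (z + 3) / 2"
  define d where "d = 1 / 2 - 2 / (z + 3) - h"
  have z: "1 < z" unfolding z_def using e_pos by simp
  have z2: "z * z = 1 + e" unfolding z_def using e_pos by simp
  have beta: "0 < beta" "beta < e"
  proof -
    show "0 < beta" unfolding beta_def using z by simp
    have "(z - 1) * ((z + 3) / 2) < (z - 1) * (z + 1)" using z by (intro mult_strict_left_mono) simp_all
    then have "(z - 1) * (z + 3) / 2 < (z - 1) * (z + 1)" by simp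
    also have "(z - 1) * (z + 1) = e" using z2 by (simp add: algebra_simps)
    finally show "beta < e" unfolding beta_def .
  qed
  have "u / (u * v / 2) = 2 / v" if "u \<noteq> 0" for u v :: real using that by simp
  from this[of "z - 1" "z + 3"] have zb: "(z - 1) / beta = 2 / (z + 3)" unfolding beta_def using z by simp
  have d: "0 < d"
  proof -
    have "(z - 1) / (2 * (z + 3)) = 1 / 2 - 2 / (z + 3)" using z by (simp add: field_simps)
    then show ?thesis using h unfolding d_def z_def[symmetric] by linarith
  qed
  define A where "A j = real (ns j) * (1 / (1 + e)) ^ m j" for j
  have A: "A \<longlonglongrightarrow> t" using lev unfolding level_def A_def[abs_def] by simp
  \<comment> \<open>A slowly growing threshold: it tends to infinity, so
    \<open>bad (b j) (ns j)\<close> vanishes like the tail of a convergent series, but slowly enough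
    that \<open>z ^ b j\<close> stays below every positive power of \<open>n\<close>.\<close>
  define b where "b j = nat \<lceil>sqrt (ln (real (ns j)))\<rceil> + 1" for j
  have b1: "1 \<le> b j" for j unfolding b_def by simp
  have b_le: "eventually (\<lambda>j. real (b j) \<le> sqrt (ln (real (ns j))) + 2) sequentially"
    using eventually_ns_gt[of 0]
  proof eventually_elim
    case (elim j)
    have "0 \<le> sqrt (ln (real (ns j)))" using elim by simp
    then have "-1 < sqrt (ln (real (ns j)))" by (rule less_le_trans[rotated]) simp
    then have "0 \<le> \<lceil>sqrt (ln (real (ns j)))\<rceil>" by (simp only: zero_le_ceiling)
    then have "real (nat \<lceil>sqrt (ln (real (ns j)))\<rceil>) = of_int \<lceil>sqrt (ln (real (ns j)))\<rceil>" by (rule of_nat_nat)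
    then show ?case unfolding b_def using ceiling_correct[of "sqrt (ln (real (ns j)))"] by linarith
  qed
  have b_ge: "sqrt (ln (real (ns j))) \<le> real (b j)" for j
    unfolding b_def using real_nat_ceiling_ge[of "sqrt (ln (real (ns j)))"] by linarith
  have b_top: "filterlim b at_top sequentially"
    unfolding filterlim_sequentially_iff_filterlim_real
    by (rule filterlim_at_top_mono[OF filterlim_compose[OF sqrt_at_top ln_ns_top] always_eventually]) (use b_ge in blast)
  have badb: "(\<lambda>j. bad (b j) (ns j)) \<longlonglongrightarrow> 0"
  proof -
    define S where "S k = (\<Sum>i<k. 2 * exp (- 2 * sqrt (real i)))" for k
    have "S \<longlonglongrightarrow> (\<Sum>i. 2 * exp (- 2 * sqrt (real i)))"
      unfolding S_def using summable_LIMSEQ[OF summable_exp_sqrt] .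
    then have "(\<lambda>j. S (Suc (ns j)) - S (b j)) \<longlonglongrightarrow> (\<Sum>i. 2 * exp (- 2 * sqrt (real i))) - (\<Sum>i. 2 * exp (- 2 * sqrt (real i)))"
      by (intro tendsto_diff; rule filterlim_compose) (auto intro: filterlim_compose[OF filterlim_Suc ns_top] b_top)
    then have lim: "(\<lambda>j. S (Suc (ns j)) - S (b j)) \<longlonglongrightarrow> 0" by simp
    have "eventually (\<lambda>n::nat. sqrt (ln (real n)) + 2 \<le> real n) sequentially" by real_asymp
    then have ev: "eventually (\<lambda>j. sqrt (ln (real (ns j))) + 2 \<le> real (ns j)) sequentially"
      using ns_top by (rule eventually_compose_filterlim)
    show ?thesis
    proof (rule Lim_null_comparison[OF _ lim])
      show "eventually (\<lambda>j. norm (bad (b j) (ns j)) \<le> S (Suc (ns j)) - S (b j)) sequentially"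
        using b_le ev
      proof eventually_elim
        case (elim j)
        then have "b j \<le> Suc (ns j)" by linarith
        then have "S (Suc (ns j)) - S (b j) = (\<Sum>i=b j..<Suc (ns j). 2 * exp (- 2 * sqrt (real i)))"
          unfolding S_def lessThan_atLeast0
          using sum.atLeastLessThan_concat[of 0 "b j" "Suc (ns j)" "\<lambda>i. 2 * exp (- 2 * sqrt (real i))"] by linarith
        then show ?case using bad_le[OF b1, of j "ns j"] bad_nonneg by (simp add: atLeastLessThanSuc_atLeastAtMost)
      qed
    qed
  qed
  define L where "L = ln z"
  have Lp: "0 < L" unfolding L_def using z by simp
  define R where "R n = real n powr (- d) * exp ((sqrt (ln (real n)) + 2) * L) * exp (2 / (z + 3))" for n :: nat
  have "R \<longlonglongrightarrow> 0"
  proof -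
    have "(\<lambda>n::nat. real n powr (- d) * exp ((sqrt (ln (real n)) + 2) * L)) \<longlonglongrightarrow> 0" using d Lp by real_asymp
    from tendsto_mult_right[OF this, of "exp (2 / (z + 3))"] show ?thesis unfolding R_def by simp
  qed
  from filterlim_compose[OF this ns_top] have R: "(\<lambda>j. R (ns j)) \<longlonglongrightarrow> 0" .
  have "(\<lambda>j. sqrt (A j) * R (ns j) + bad (b j) (ns j)) \<longlonglongrightarrow> sqrt t * 0 + 0"
    by (intro tendsto_add tendsto_mult tendsto_real_sqrt A R badb)
  then have lim: "(\<lambda>j. sqrt (A j) * R (ns j) + bad (b j) (ns j)) \<longlonglongrightarrow> 0" by simp
  have bl: "eventually (\<lambda>j. 1 / (e - beta) \<le> real (b j) powr (1/4)) sequentially"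
  proof -
    have "filterlim (\<lambda>n. real n powr (1/4)) at_top sequentially" by real_asymp
    from filterlim_compose[OF this b_top] show ?thesis by (simp add: filterlim_at_top)
  qed
  show ?thesis
  proof (rule Lim_null_comparison[OF _ lim])
    show "eventually (\<lambda>j. norm (prob {\<omega> \<in> space M. \<exists>l\<in>{1..a j}. m j \<le> indeg (par \<omega>) (ns j) l}) \<le> sqrt (A j) * R (ns j) + bad (b j) (ns j)) sequentially"
      using eventually_ns_ge[of 1] eventually_ns_gt[of 0] a_le b_le bl
    proof eventually_elim
      case (elim j)
      let ?n = "ns j"
      let ?K = "(1 / z) ^ m j * (z ^ b j * exp ((z - 1) / beta * (1 + ln (real ?n))))"
      let ?E = "\<lambda>l. {\<omega> \<in> space M. m j \<le> indeg (par \<omega>) ?n l \<and> good_weights e (b j) ?n (wt \<omega>)}"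
      let ?B = "{\<omega> \<in> space M. \<not> good_weights e (b j) ?n (wt \<omega>)}"
      have EM: "?E l \<in> sets M" for l
      proof -
        have "?E l = {\<omega> \<in> space M. m j \<le> indeg (par \<omega>) ?n l} - ?B" by auto
        then show ?thesis using indeg_event[of "\<lambda>x. m j \<le> x l" ?n] good_event[OF b1, of j ?n] by simp
      qed
      have UM: "(\<Union>l\<in>{1..a j}. ?E l) \<in> sets M" using EM by (intro sets.finite_UN) auto
      have "prob {\<omega> \<in> space M. \<exists>l\<in>{1..a j}. m j \<le> indeg (par \<omega>) ?n l} \<le> prob ((\<Union>l\<in>{1..a j}. ?E l) \<union> ?B)"
        by (rule finite_measure_mono) (use UM good_event[OF b1] in auto)
      also have "\<dots> \<le> prob (\<Union>l\<in>{1..a j}. ?E l) + prob ?B"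
        by (rule measure_Un_le[OF UM good_event[OF b1]])
      also have "\<dots> \<le> (\<Sum>l=1..a j. prob (?E l)) + bad (b j) ?n"
        unfolding bad_def by (intro add_right_mono finite_measure_subadditive_finite) (use EM in auto)
      also have "(\<Sum>l=1..a j. prob (?E l)) \<le> (\<Sum>l=1..a j. ?K)"
        by (intro sum_mono low_label_prob_le less_imp_le[OF z] beta b1 elim(5) elim(1)) simp
      also have "(\<Sum>l=1..a j. ?K) = real (a j) * ?K" by simp
      also have "real (a j) * ?K \<le> real ?n powr h * ?K"
        by (rule mult_right_mono[OF elim(3)]) (use z in simp)
      also have "real ?n powr h * ?K \<le> sqrt (A j) * R ?n"
      proof -
        define l where "l = ln (real ?n)"
        have np: "0 < real ?n" using elim(1) by simp
        have en: "real ?n powr x = exp (x * l)" for x unfolding l_def powr_def using np by simp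
        have zm: "(1 / z) ^ m j = sqrt (A j) * exp (- (1 / 2) * l)"
        proof -
          have "(1 / z) ^ m j = sqrt ((1 / (1 + e)) ^ m j)"
            unfolding z_def by (simp add: real_sqrt_power real_sqrt_divide)
          also have "(1 / (1 + e)) ^ m j = A j / real ?n" unfolding A_def using np by simp
          also have "sqrt (A j / real ?n) = sqrt (A j) * (1 / sqrt (real ?n))" by (simp add: real_sqrt_divide)
          also have "1 / sqrt (real ?n) = real ?n powr (- (1 / 2))"
            by (simp only: powr_minus_divide powr_half_sqrt[OF less_imp_le[OF np]])
          finally show ?thesis unfolding en .
        qed
        have zb': "z ^ b j \<le> exp ((sqrt l + 2) * L)"
        proof -
          have "z ^ b j = exp (real (b j) * L)" unfolding L_def using z by (simp add: exp_of_nat_mult)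
          also have "\<dots> \<le> exp ((sqrt l + 2) * L)" using elim(4) Lp by (simp add: l_def)
          finally show ?thesis .
        qed
        have "real ?n powr h * ?K = sqrt (A j) * (exp (h * l) * exp (- (1 / 2) * l) * exp (2 / (z + 3) * l)) * exp (2 / (z + 3)) * z ^ b j"
        proof -
          have "exp (c * (1 + l)) = exp (c * l) * exp c" for c :: real
            by (simp add: distrib_left exp_add)
          from this[of "2 / (z + 3)"] show ?thesis unfolding en zm zb l_def[symmetric] by (simp only: mult_ac)
        qed
        also have "exp (h * l) * exp (- (1 / 2) * l) * exp (2 / (z + 3) * l) = exp (- d * l)"
          unfolding exp_add[symmetric] d_def by (simp add: algebra_simps)
        also have "sqrt (A j) * exp (- d * l) * exp (2 / (z + 3)) * z ^ b j \<le> sqrt (A j) * exp (- d * l) * exp (2 / (z + 3)) * exp ((sqrt l + 2) * L)"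
        proof (rule mult_left_mono[OF zb'])
          have "0 \<le> A j" unfolding A_def using e_pos by simp
          then show "0 \<le> sqrt (A j) * exp (- d * l) * exp (2 / (z + 3))" by simp
        qed
        also have "\<dots> = sqrt (A j) * R ?n" unfolding R_def en l_def[symmetric] by (simp add: mult_ac)
        finally show ?thesis .
      qed
      finally show ?case by simp
    qed
  qed
qed

end

section \<open>Joint law of in-degrees and labels\<close>

lemma alternating_binomial_sum:
  "(\<Sum>i<Suc J. (-1) ^ i * real (Suc N choose i)) = (-1) ^ J * real (N choose J)"
  by (induction J) (simp_all add: algebra_simps)

text \<open>Bonferroni's inequality for the indicator of \<open>N = 0\<close>; for positive
  \<open>N\<close> it follows from the closed form of the truncated alternating sum.\<close>

lemma inclusion_exclusion_bound:
  "\<bar>(if N = 0 then 1 else 0) - (\<Sum>i<J. (-1) ^ i * real (N choose i))\<bar> \<le> real (N choose J)"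
proof (cases N)
  case 0
  have "(\<Sum>i<Suc J. (-1) ^ i * real (0 choose i)) = 1" for J by (induction J) simp_all
  then show ?thesis using 0 by (cases J) (simp_all del: sum.lessThan_Suc)
next
  case (Suc N')
  show ?thesis
  proof (cases J)
    case 0
    then show ?thesis using Suc by simp
  next
    case (Suc J')
    then show ?thesis using \<open>N = Suc N'\<close> alternating_binomial_sum[of N' J'] by (simp add: abs_mult power_abs del: sum.lessThan_Suc)
  qed
qed

lemma card_dlists: "finite A \<Longrightarrow> card (dlists A k) = fact k * (card A choose k)"
proof (induction k arbitrary: A)
  case (Suc k)
  have "card (dlists A (Suc k)) = (\<Sum>l\<in>A. card (dlists (A - {l}) k))"
    using sum_dlists_Suc[OF Suc.prems, of "\<lambda>_. 1::nat" k] by simp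
  also have "\<dots> = (\<Sum>l\<in>A. fact k * ((card A - 1) choose k))"
    by (rule sum.cong[OF refl]) (use Suc in \<open>simp add: card_Diff_singleton\<close>)
  also have "\<dots> = fact k * (card A * ((card A - 1) choose k))" by simp
  also have "card A * ((card A - 1) choose k) = Suc k * (card A choose Suc k)"
    by (cases "card A") (simp_all only: diff_Suc_1 Suc_times_binomial_eq mult.commute binomial_0_Suc mult_0 mult_0_right)
  finally show ?case by (simp add: algebra_simps)
qed simp

lemma sum_dlists_append:
  assumes "finite A"
  shows "(\<Sum>xs\<in>dlists A (k + i). f (take k xs) (drop k xs)) = (\<Sum>ls\<in>dlists A k. \<Sum>ls'\<in>dlists (A - set ls) i. f ls ls')"
proof -
  have inj: "inj_on (\<lambda>(ls, ls'). ls @ ls') (SIGMA ls:dlists A k. dlists (A - set ls) i)"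
    by (auto simp: inj_on_def dlists_def)
  have img: "dlists A (k + i) = (\<lambda>(ls, ls'). ls @ ls') ` (SIGMA ls:dlists A k. dlists (A - set ls) i)"
  proof (rule set_eqI, rule iffI)
    fix xs assume xs: "xs \<in> dlists A (k + i)"
    have d: "distinct xs" "set xs \<subseteq> A" "length xs = k + i" using xs by (simp_all add: dlists_def)
    have disj: "set (take k xs) \<inter> set (drop k xs) = {}"
      by (rule set_take_disj_set_drop_if_distinct[OF d(1) order_refl])
    have "take k xs \<in> dlists A k"
      unfolding dlists_def using d set_take_subset[of k xs] by simp
    moreover have "drop k xs \<in> dlists (A - set (take k xs)) i"
    proof -
      have "set (drop k xs) \<subseteq> A - set (take k xs)" using d(2) disj set_drop_subset[of k xs] by blast
      then show ?thesis unfolding dlists_def using d by simp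
    qed
    ultimately have "(take k xs, drop k xs) \<in> (SIGMA ls:dlists A k. dlists (A - set ls) i)" by (rule SigmaI)
    then show "xs \<in> (\<lambda>(ls, ls'). ls @ ls') ` (SIGMA ls:dlists A k. dlists (A - set ls) i)"
      by (rule rev_image_eqI) simp
  next
    fix xs assume "xs \<in> (\<lambda>(ls, ls'). ls @ ls') ` (SIGMA ls:dlists A k. dlists (A - set ls) i)"
    then show "xs \<in> dlists A (k + i)" by (auto simp: dlists_def)
  qed
  have "(\<Sum>xs\<in>dlists A (k + i). f (take k xs) (drop k xs)) = (\<Sum>(ls, ls')\<in>(SIGMA ls:dlists A k. dlists (A - set ls) i). f ls ls')"
    unfolding img by (subst sum.reindex[OF inj]) (auto intro!: sum.cong simp: dlists_def)
  also have "\<dots> = (\<Sum>ls\<in>dlists A k. \<Sum>ls'\<in>dlists (A - set ls) i. f ls ls')"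
    by (rule sum.Sigma[symmetric]) (use assms in \<open>auto intro: finite_dlists\<close>)
  finally show ?thesis .
qed

lemma sum_prod_lists:
  fixes lam :: "'r \<Rightarrow> real"
  assumes "finite S"
  shows "(\<Sum>rs\<in>{rs. set rs \<subseteq> S \<and> length rs = i}. prod_list (map lam rs)) = (\<Sum>r\<in>S. lam r) ^ i"
proof (induction i)
  case 0
  have "{rs. set rs \<subseteq> S \<and> length rs = 0} = {[]}" by auto
  then show ?case by simp
next
  case (Suc i)
  let ?L = "{rs. set rs \<subseteq> S \<and> length rs = i}"
  have fin: "finite ?L" using finite_lists_length_eq[OF assms] .
  have "{rs. set rs \<subseteq> S \<and> length rs = Suc i} = (\<lambda>(r, rs). r # rs) ` (S \<times> ?L)"
    by (auto simp: length_Suc_conv image_iff)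
  moreover have "inj_on (\<lambda>(r, rs). r # rs) (S \<times> ?L)" by (auto simp: inj_on_def)
  ultimately have "(\<Sum>rs\<in>{rs. set rs \<subseteq> S \<and> length rs = Suc i}. prod_list (map lam rs)) = (\<Sum>(r, rs)\<in>S \<times> ?L. lam r * prod_list (map lam rs))"
    by (simp add: sum.reindex case_prod_unfold comp_def)
  also have "\<dots> = (\<Sum>r\<in>S. \<Sum>rs\<in>?L. lam r * prod_list (map lam rs))" by (rule sum.cartesian_product[symmetric])
  also have "\<dots> = (\<Sum>r\<in>S. lam r) * (\<Sum>r\<in>S. lam r) ^ i"
    unfolding sum_distrib_left[symmetric] Suc sum_distrib_right ..
  finally show ?case by simp
qed

text \<open>Interchange of limits: \<open>j\<close> goes to infinity for each cut-off
  \<open>J\<close>, and only then \<open>J\<close>.\<close>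

lemma tendsto_approx:
  fixes x :: "nat \<Rightarrow> real"
  assumes y: "\<And>J. y J \<longlonglongrightarrow> Y J" and z: "\<And>J. z J \<longlonglongrightarrow> Z J" and Y: "Y \<longlonglongrightarrow> L" and Z: "Z \<longlonglongrightarrow> 0"
    and le: "\<And>J. eventually (\<lambda>j. \<bar>x j - y J j\<bar> \<le> z J j) sequentially"
  shows "x \<longlonglongrightarrow> L"
proof (rule LIMSEQ_I)
  fix r :: real assume r: "0 < r"
  have r4: "0 < r / 4" using r by simp
  have "eventually (\<lambda>J. \<bar>Y J - L\<bar> < r / 4) sequentially" "eventually (\<lambda>J. \<bar>Z J\<bar> < r / 4) sequentially"
    using tendstoD[OF Y r4] tendstoD[OF Z r4] by (simp_all only: dist_real_def diff_0_right)
  then have "eventually (\<lambda>J. \<bar>Y J - L\<bar> < r / 4 \<and> \<bar>Z J\<bar> < r / 4) sequentially" by (rule eventually_conj)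
  then obtain J where J: "\<bar>Y J - L\<bar> < r / 4" "\<bar>Z J\<bar> < r / 4" unfolding eventually_sequentially by blast
  have "eventually (\<lambda>j. \<bar>y J j - Y J\<bar> < r / 4) sequentially" "eventually (\<lambda>j. \<bar>z J j - Z J\<bar> < r / 4) sequentially"
    using tendstoD[OF y[of J] r4] tendstoD[OF z[of J] r4] by (simp_all only: dist_real_def)
  with le[of J] have "eventually (\<lambda>j. norm (x j - L) < r) sequentially"
  proof eventually_elim
    case (elim j)
    then show ?case using J unfolding real_norm_def by linarith
  qed
  then show "\<exists>no. \<forall>n\<ge>no. norm (x n - L) < r" by (simp add: eventually_sequentially)
qed

lemma list_conv_take:
  assumes "list_cont k f"
  shows "list_cont (k + i) (\<lambda>xs. f (take k xs))"
  unfolding list_conv_def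
proof (intro allI impI)
  fix X and xs :: "real list" assume xs: "length xs = k + i" "\<forall>u<k + i. X u \<longlonglongrightarrow> xs ! u"
  have "(\<lambda>j. f (map (\<lambda>i. X i j) [0..<k])) \<longlonglongrightarrow> f (take k xs)"
    by (rule assms[unfolded list_conv_def, rule_format]) (use xs in auto)
  then show "(\<lambda>j. f (take k (map (\<lambda>i. X i j) [0..<k + i]))) \<longlonglongrightarrow> f (take k xs)"
    by (simp add: take_map)
qed

section \<open>In-degree profiles in a bounded range\<close>

text \<open>To be used with \<open>d j\<close> the integer part of the logarithm of
  \<open>ns j\<close> to base \<open>1 + e\<close>; then \<open>tau\<close> is \<open>1 + e\<close>
  raised to the limiting fractional part.\<close>

locale poisson_window = tree_window M D W p e h ns a
  for M :: "'a measure" and D W p e h ns a +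
  fixes d :: "nat \<Rightarrow> int" and tau :: real
  assumes tau_pos: "0 < tau" and d_top: "filterlim d at_top sequentially"
    and d_tau: "(\<lambda>j. real (ns j) * (1 + e) powr (- real_of_int (d j))) \<longlonglongrightarrow> tau"
begin

text \<open>The truncation at 0 is eventually inactive for each \<open>r\<close>, by
  \<open>d_top\<close>.\<close>

definition lev :: "int \<Rightarrow> nat \<Rightarrow> nat" where "lev r j = nat (d j + r)"

definition lam :: "int \<Rightarrow> real" where "lam r = intens (tau * (1 + e) powr (- real_of_int r))"

definition dev :: "nat \<Rightarrow> 'a \<Rightarrow> nat \<Rightarrow> int" where
  "dev j \<omega> l = int (indeg (par \<omega>) (ns j) l) - d j"

definition verts_in :: "int \<Rightarrow> int \<Rightarrow> nat \<Rightarrow> 'a \<Rightarrow> nat set" where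
  "verts_in c R j \<omega> = {l \<in> window j. dev j \<omega> l \<in> {c..<R}}"

text \<open>The in-degrees in the range are compared as a multiset, since ties leave the order of
  the vertices open.\<close>

definition has_profile :: "int \<Rightarrow> int \<Rightarrow> int list \<Rightarrow> nat \<Rightarrow> 'a \<Rightarrow> bool" where
  "has_profile c R rs j \<omega> \<longleftrightarrow> image_mset (dev j \<omega>) (mset_set (verts_in c R j \<omega>)) = mset rs"

text \<open>A sum over ordered tuples: a set of vertices whose in-degrees match \<open>rs\<close>
  occurs once for each of its arrangements along \<open>rs\<close>.\<close>

definition profile_sum :: "int list \<Rightarrow> nat \<Rightarrow> (nat list \<Rightarrow> real) \<Rightarrow> 'a \<Rightarrow> real" where
  "profile_sum rs j f \<omega> = (\<Sum>ls\<in>dlists (window j) (length rs). if map (dev j \<omega>) ls = rs then f ls else 0)"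

lemma eventually_d_ge: "eventually (\<lambda>j. k \<le> d j) sequentially"
  using d_top by (simp add: filterlim_at_top)

lemma level_lev: "level (lev r) (tau * (1 + e) powr (- real_of_int r))"
  unfolding level_def
proof (rule conjI)
  have "(\<lambda>j. real (ns j) * (1 + e) powr (- real_of_int (d j)) * (1 + e) powr (- real_of_int r)) \<longlonglongrightarrow> tau * (1 + e) powr (- real_of_int r)"
    by (rule tendsto_mult_right[OF d_tau])
  moreover have "eventually (\<lambda>j. real (ns j) * (1 + e) powr (- real_of_int (d j)) * (1 + e) powr (- real_of_int r) = real (ns j) * (1 / (1 + e)) ^ lev r j) sequentially"
    using eventually_d_ge[of "- r"]
  proof eventually_elim
    case (elim j)
    have n: "real (lev r j) = real_of_int (d j) + real_of_int r" unfolding lev_def using elim by simp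
    have "(1 / (1 + e)) ^ lev r j = (1 + e) powr (- real (lev r j))"
      using e_pos by (simp add: powr_minus powr_realpow power_divide divide_inverse power_inverse)
    also have "\<dots> = (1 + e) powr (- real_of_int (d j) + - real_of_int r)" unfolding n by simp
    also have "\<dots> = (1 + e) powr (- real_of_int (d j)) * (1 + e) powr (- real_of_int r)" by (rule powr_add)
    finally show ?case by simp
  qed
  ultimately show "(\<lambda>j. real (ns j) * (1 / (1 + e)) ^ lev r j) \<longlonglongrightarrow> tau * (1 + e) powr (- real_of_int r)"
    by (rule Lim_transform_eventually)
qed (use tau_pos e_pos in simp)

lemma fun_dev_measurable: "(\<lambda>\<omega>. F (dev j \<omega>)) \<in> borel_measurable M" for F :: "(nat \<Rightarrow> int) \<Rightarrow> real"
  unfolding dev_def by (rule indeg_measurable[where F = "\<lambda>x. F (\<lambda>l. int (x l) - d j)"])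

text \<open>Factorial moments weighted by labels. Equality of the two descriptions of the event
  begins once \<open>d j + r\<close> is nonnegative for every entry \<open>r\<close> of
  \<open>rs\<close>.\<close>

lemma profile_prob_tendsto:
  fixes fs :: "nat \<Rightarrow> nat list \<Rightarrow> real"
  assumes fs: "\<And>j ls. \<bar>fs j ls\<bar> \<le> B" and f: "\<And>xs. \<bar>f xs\<bar> \<le> B" "list_cont (length rs) f"
    and conv: "label_conv (length rs) fs f"
  shows "(\<lambda>j. expectation (profile_sum rs j (fs j))) \<longlonglongrightarrow> prod_list (map lam rs) * normal_integral (length rs) f"
proof -
  have lv: "list_all2 level (map lev rs) (map (\<lambda>r. tau * (1 + e) powr (- real_of_int r)) rs)"
    by (simp add: list_all2_conv_all_nth level_lev)
  have lim: "(\<lambda>j. \<Sum>ls\<in>dlists (window j) (length rs). pdeg j ls (map (\<lambda>m. m j) (map lev rs)) * fs j ls)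
    \<longlonglongrightarrow> prod_list (map lam rs) * normal_integral (length rs) f"
    using level_prob_tendsto[OF lv fs f(1)] f(2) conv by (simp add: lam_def[abs_def] comp_def)
  obtain c where c: "\<And>r. r \<in> set rs \<Longrightarrow> c \<le> r"
    by (metis Min_le finite_set)
  have "eventually (\<lambda>j. (\<Sum>ls\<in>dlists (window j) (length rs). pdeg j ls (map (\<lambda>m. m j) (map lev rs)) * fs j ls) = expectation (profile_sum rs j (fs j))) sequentially"
    using eventually_d_ge[of "- c"]
  proof eventually_elim
    case (elim j)
    have "expectation (profile_sum rs j (fs j)) = (\<Sum>ls\<in>dlists (window j) (length rs). expectation (\<lambda>\<omega>. if map (dev j \<omega>) ls = rs then fs j ls else 0))"
      unfolding profile_sum_def
    proof (rule Bochner_Integration.integral_sum)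
      fix ls
      show "integrable M (\<lambda>\<omega>. if map (dev j \<omega>) ls = rs then fs j ls else 0)"
        by (rule AE_bounded_integrable[where B = "\<bar>fs j ls\<bar>"]) (auto intro: fun_dev_measurable[where F = "\<lambda>x. if map x ls = rs then fs j ls else 0"])
    qed
    also have "\<dots> = (\<Sum>ls\<in>dlists (window j) (length rs). pdeg j ls (map (\<lambda>m. m j) (map lev rs)) * fs j ls)"
    proof (rule sum.cong[OF refl])
      fix ls assume ls: "ls \<in> dlists (window j) (length rs)"
      let ?E = "{\<omega> \<in> space M. \<forall>i<length rs. indeg (par \<omega>) (ns j) (ls ! i) = lev (rs ! i) j}"
      have ll: "length ls = length rs" using ls by (simp add: dlists_def)
      have EM: "?E \<in> sets M" by (rule indeg_event[of "\<lambda>x. \<forall>i<length rs. x (ls ! i) = lev (rs ! i) j"])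
      have "map (dev j \<omega>) ls = rs \<longleftrightarrow> (\<forall>i<length rs. indeg (par \<omega>) (ns j) (ls ! i) = lev (rs ! i) j)" for \<omega>
      proof -
        have "map (dev j \<omega>) ls = rs \<longleftrightarrow> (\<forall>i<length rs. dev j \<omega> (ls ! i) = rs ! i)" using ll by (simp add: list_eq_iff_nth_eq)
        also have "\<dots> \<longleftrightarrow> (\<forall>i<length rs. indeg (par \<omega>) (ns j) (ls ! i) = lev (rs ! i) j)"
        proof (intro iff_allI imp_cong refl)
          fix i assume "i < length rs"
          then have "0 \<le> d j + rs ! i" using c[of "rs ! i"] elim by auto
          then show "dev j \<omega> (ls ! i) = rs ! i \<longleftrightarrow> indeg (par \<omega>) (ns j) (ls ! i) = lev (rs ! i) j"
            unfolding dev_def lev_def by auto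
        qed
        finally show ?thesis .
      qed
      then have "expectation (\<lambda>\<omega>. if map (dev j \<omega>) ls = rs then fs j ls else 0) = expectation (\<lambda>\<omega>. indicator ?E \<omega> * fs j ls)"
        by (intro Bochner_Integration.integral_cong refl) (auto simp: indicator_def)
      also have "\<dots> = prob ?E * fs j ls" using EM by simp
      also have "prob ?E = pdeg j ls (map (\<lambda>m. m j) (map lev rs))"
        unfolding pdeg_def by (rule arg_cong[where f = prob]) auto
      finally show "expectation (\<lambda>\<omega>. if map (dev j \<omega>) ls = rs then fs j ls else 0) = pdeg j ls (map (\<lambda>m. m j) (map lev rs)) * fs j ls" .
    qed
    finally show ?case by simp
  qed
  from Lim_transform_eventually[OF lim this] show ?thesis .
qed

lemma finite_verts_in [simp]: "finite (verts_in c R j \<omega>)"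
  by (simp add: verts_in_def)

text \<open>Given a tuple that realises \<open>rs\<close>, the profile is \<open>rs\<close> if and
  only if the range contains no further vertex. This emptiness is what inclusion-exclusion
  expands.\<close>

lemma has_profile_iff:
  assumes ls: "ls \<in> dlists (window j) (length rs)" and m: "map (dev j \<omega>) ls = rs" and rs: "set rs \<subseteq> {c..<R}"
  shows "set ls \<subseteq> verts_in c R j \<omega>" and "has_profile c R rs j \<omega> \<longleftrightarrow> card (verts_in c R j \<omega>) - length rs = 0"
proof -
  have l: "length ls = length rs" "distinct ls" "set ls \<subseteq> window j" using ls by (auto simp: dlists_def)
  have "dev j \<omega> x \<in> {c..<R}" if "x \<in> set ls" for x
  proof -
    have "dev j \<omega> x \<in> set (map (dev j \<omega>) ls)" using that by simp
    then show ?thesis unfolding m using rs by blast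
  qed
  then show sub: "set ls \<subseteq> verts_in c R j \<omega>" using l by (auto simp: verts_in_def)
  have cs: "card (set ls) = length rs" using distinct_card[OF l(2)] l(1) by simp
  have ms: "image_mset (dev j \<omega>) (mset_set (set ls)) = mset rs"
    unfolding mset_set_set[OF l(2)] m[symmetric] by simp
  show "has_profile c R rs j \<omega> \<longleftrightarrow> card (verts_in c R j \<omega>) - length rs = 0"
  proof
    assume "has_profile c R rs j \<omega>"
    then have "size (image_mset (dev j \<omega>) (mset_set (verts_in c R j \<omega>))) = size (mset rs)" unfolding has_profile_def by simp
    then show "card (verts_in c R j \<omega>) - length rs = 0" by simp
  next
    assume "card (verts_in c R j \<omega>) - length rs = 0"
    then have "card (verts_in c R j \<omega>) \<le> card (set ls)" using cs by simp
    then have "set ls = verts_in c R j \<omega>" by (intro card_seteq sub) auto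
    then show "has_profile c R rs j \<omega>" unfolding has_profile_def using ms by simp
  qed
qed

text \<open>Choosing \<open>i\<close> further vertices of the range in order, with in-degrees listed
  by \<open>rs'\<close>, extends the tuple; each unordered choice is met \<open>fact i\<close>
  times.\<close>

lemma profile_sum_choose:
  assumes rs: "set rs \<subseteq> {c..<R}"
  shows "(\<Sum>ls\<in>dlists (window j) (length rs). (if map (dev j \<omega>) ls = rs then f ls else 0) * real ((card (verts_in c R j \<omega>) - length rs) choose i))
    = (\<Sum>rs'\<in>{rs'. set rs' \<subseteq> {c..<R} \<and> length rs' = i}. profile_sum (rs @ rs') j (\<lambda>xs. f (take (length rs) xs)) \<omega>) / fact i"
proof -
  let ?W = "window j" and ?k = "length rs" and ?L = "{rs'. set rs' \<subseteq> {c..<R} \<and> length rs' = i}"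
  let ?V = "verts_in c R j \<omega>"
  have finL: "finite ?L" by (rule finite_lists_length_eq) simp
  have step: "(\<Sum>rs'\<in>?L. \<Sum>ls'\<in>dlists (?W - set ls) i. if map (dev j \<omega>) ls' = rs' then 1 else 0 :: real) = fact i * real ((card ?V - ?k) choose i)"
    if ls: "ls \<in> dlists ?W ?k" "map (dev j \<omega>) ls = rs" for ls
  proof -
    have sub: "set ls \<subseteq> ?V" by (rule has_profile_iff(1)[OF ls rs])
    have "length ls = ?k" "distinct ls" using ls(1) by (simp_all add: dlists_def)
    then have cs: "card (set ls) = ?k" by (simp add: distinct_card)
    have "(\<Sum>rs'\<in>?L. \<Sum>ls'\<in>dlists (?W - set ls) i. if map (dev j \<omega>) ls' = rs' then 1 else 0 :: real)
      = (\<Sum>ls'\<in>dlists (?W - set ls) i. \<Sum>rs'\<in>?L. if map (dev j \<omega>) ls' = rs' then 1 else 0)" by (rule sum.swap)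
    also have "\<dots> = (\<Sum>ls'\<in>dlists (?W - set ls) i. if map (dev j \<omega>) ls' \<in> ?L then 1 else 0)"
      by (rule sum.cong[OF refl]) (subst sum.delta'[OF finL], rule refl)
    also have "\<dots> = real (card (dlists (?W - set ls) i \<inter> {ls'. map (dev j \<omega>) ls' \<in> ?L}))"
      by (subst sum.If_cases) (auto intro: finite_dlists)
    also have "dlists (?W - set ls) i \<inter> {ls'. map (dev j \<omega>) ls' \<in> ?L} = dlists (?V - set ls) i"
      by (auto simp: dlists_def verts_in_def subset_iff)
    also have "card (dlists (?V - set ls) i) = fact i * ((card ?V - ?k) choose i)"
      using sub cs by (simp add: card_dlists card_Diff_subset)
    finally show ?thesis by simp
  qed
  have "(\<Sum>rs'\<in>?L. profile_sum (rs @ rs') j (\<lambda>xs. f (take ?k xs)) \<omega>)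
    = (\<Sum>rs'\<in>?L. \<Sum>ls\<in>dlists ?W ?k. \<Sum>ls'\<in>dlists (?W - set ls) i. (if map (dev j \<omega>) ls = rs then f ls else 0) * (if map (dev j \<omega>) ls' = rs' then 1 else 0))"
  proof (rule sum.cong[OF refl])
    fix rs' assume rs': "rs' \<in> ?L"
    have "profile_sum (rs @ rs') j (\<lambda>xs. f (take ?k xs)) \<omega> = (\<Sum>xs\<in>dlists ?W (?k + i).
        (if map (dev j \<omega>) (take ?k xs) = rs then f (take ?k xs) else 0) * (if map (dev j \<omega>) (drop ?k xs) = rs' then 1 else 0))"
      unfolding profile_sum_def length_append
    proof (rule sum.cong)
      fix xs assume "xs \<in> dlists ?W (?k + i)"
      then have lx: "length xs = ?k + i" by (simp add: dlists_def)
      have "map (dev j \<omega>) xs = map (dev j \<omega>) (take ?k xs) @ map (dev j \<omega>) (drop ?k xs)"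
        by (metis append_take_drop_id map_append)
      then have "map (dev j \<omega>) xs = rs @ rs' \<longleftrightarrow> map (dev j \<omega>) (take ?k xs) = rs \<and> map (dev j \<omega>) (drop ?k xs) = rs'"
        using lx by (simp add: append_eq_append_conv)
      then show "(if map (dev j \<omega>) xs = rs @ rs' then f (take ?k xs) else 0)
        = (if map (dev j \<omega>) (take ?k xs) = rs then f (take ?k xs) else 0) * (if map (dev j \<omega>) (drop ?k xs) = rs' then 1 else 0)" by simp
    qed (use rs' in simp)
    also have "\<dots> = (\<Sum>ls\<in>dlists ?W ?k. \<Sum>ls'\<in>dlists (?W - set ls) i. (if map (dev j \<omega>) ls = rs then f ls else 0) * (if map (dev j \<omega>) ls' = rs' then 1 else 0))"
      by (rule sum_dlists_append) simp
    finally show "profile_sum (rs @ rs') j (\<lambda>xs. f (take ?k xs)) \<omega> = \<dots>" .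
  qed
  also have "\<dots> = (\<Sum>ls\<in>dlists ?W ?k. \<Sum>rs'\<in>?L. \<Sum>ls'\<in>dlists (?W - set ls) i. (if map (dev j \<omega>) ls = rs then f ls else 0) * (if map (dev j \<omega>) ls' = rs' then 1 else 0))"
    by (rule sum.swap)
  also have "\<dots> = (\<Sum>ls\<in>dlists ?W ?k. (if map (dev j \<omega>) ls = rs then f ls else 0) * (fact i * real ((card ?V - ?k) choose i)))"
  proof (rule sum.cong[OF refl])
    fix ls assume ls: "ls \<in> dlists ?W ?k"
    show "(\<Sum>rs'\<in>?L. \<Sum>ls'\<in>dlists (?W - set ls) i. (if map (dev j \<omega>) ls = rs then f ls else 0) * (if map (dev j \<omega>) ls' = rs' then 1 else 0))
      = (if map (dev j \<omega>) ls = rs then f ls else 0) * (fact i * real ((card ?V - ?k) choose i))"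
    proof (cases "map (dev j \<omega>) ls = rs")
      case True
      show ?thesis unfolding sum_distrib_left[symmetric] step[OF ls True] ..
    qed simp
  qed
  finally show ?thesis by (simp add: sum_divide_distrib)
qed

lemma profile_sum_bound: "(\<And>ls. \<bar>f ls\<bar> \<le> B) \<Longrightarrow> \<bar>profile_sum rs j f \<omega>\<bar> \<le> real (card (dlists (window j) (length rs))) * B"
  unfolding profile_sum_def
proof (rule order.trans[OF sum_abs sum_bounded_above])
  fix ls assume "\<And>ls. \<bar>f ls\<bar> \<le> B"
  moreover from this[of ls] have "0 \<le> B" by linarith
  ultimately show "\<bar>if map (dev j \<omega>) ls = rs then f ls else 0\<bar> \<le> B" by simp
qed

lemma profile_sum_integrable:
  assumes "\<And>ls. \<bar>f ls\<bar> \<le> B"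
  shows "integrable M (profile_sum rs j f)"
proof (rule AE_bounded_integrable[where B = "real (card (dlists (window j) (length rs))) * B"])
  show "profile_sum rs j f \<in> borel_measurable M"
    using fun_dev_measurable[where F = "\<lambda>x. \<Sum>ls\<in>dlists (window j) (length rs). if map x ls = rs then f ls else 0"]
    unfolding profile_sum_def .
qed (use profile_sum_bound[OF assms] in simp)

definition profile_part :: "int \<Rightarrow> int \<Rightarrow> int list \<Rightarrow> nat \<Rightarrow> (nat list \<Rightarrow> real) \<Rightarrow> 'a \<Rightarrow> real" where
  "profile_part c R rs j f \<omega> = (if has_profile c R rs j \<omega> then profile_sum rs j f \<omega> else 0)"

lemma profile_part_measurable: "profile_part c R rs j f \<in> borel_measurable M"
  using fun_dev_measurable[where F = "\<lambda>x. if image_mset x (mset_set {l \<in> window j. x l \<in> {c..<R}}) = mset rs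
      then \<Sum>ls\<in>dlists (window j) (length rs). if map x ls = rs then f ls else 0 else 0"]
  unfolding profile_part_def profile_sum_def has_profile_def verts_in_def .

lemma profile_part_integrable:
  assumes "\<And>ls. \<bar>f ls\<bar> \<le> B"
  shows "integrable M (profile_part c R rs j f)"
proof (rule Bochner_Integration.integrable_bound[OF profile_sum_integrable[OF assms] profile_part_measurable])
  show "AE \<omega> in M. norm (profile_part c R rs j f \<omega>) \<le> norm (profile_sum rs j f \<omega>)"
    by (rule AE_I2) (simp add: profile_part_def)
qed

text \<open>Inclusion-exclusion over the number \<open>i\<close> of additional vertices in the
  range. The term of order \<open>i\<close> tends to the main term times
  \<open>?La ^ i / fact i\<close>, and the alternating series sums to
  \<open>exp (- ?La)\<close>.\<close>

lemma profile_part_tendsto: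
  fixes fs :: "nat \<Rightarrow> nat list \<Rightarrow> real"
  assumes rs: "set rs \<subseteq> {c..<R}"
    and fs: "\<And>j ls. \<bar>fs j ls\<bar> \<le> B" and f: "\<And>xs. \<bar>f xs\<bar> \<le> B" "list_cont (length rs) f"
    and conv: "label_conv (length rs) fs f"
  shows "(\<lambda>j. expectation (profile_part c R rs j (fs j)))
     \<longlonglongrightarrow> prod_list (map lam rs) * exp (- (\<Sum>r\<in>{c..<R}. lam r)) * normal_integral (length rs) f"
proof -
  let ?k = "length rs" and ?La = "\<Sum>r\<in>{c..<R}. lam r"
  let ?L = "\<lambda>i. {rs'. set rs' \<subseteq> {c..<R} \<and> length rs' = i}"
  define P where "P = prod_list (map lam rs)"
  \<comment> \<open>The inclusion-exclusion term of order \<open>i\<close>, its binomial coefficient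
    already expanded into tuples of length \<open>?k + i\<close>.\<close>
  define T where "T i j g \<omega> = (\<Sum>rs'\<in>?L i. profile_sum (rs @ rs') j (\<lambda>xs. g (take ?k xs)) \<omega>) / fact i" for i j and g :: "nat list \<Rightarrow> real" and \<omega>
  have T_tendsto: "(\<lambda>j. expectation (T i j (gs j))) \<longlonglongrightarrow> P * normal_integral ?k g * (?La ^ i / fact i)"
    if gs: "\<And>j ls. \<bar>gs j ls\<bar> \<le> B'" and g: "\<And>xs. \<bar>g xs\<bar> \<le> B'" "list_cont ?k g" and gconv: "label_conv ?k gs g" for i gs g B'
  proof -
    have E: "expectation (T i j (gs j)) = (\<Sum>rs'\<in>?L i. expectation (profile_sum (rs @ rs') j (\<lambda>xs. gs j (take ?k xs)))) / fact i" for j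
      unfolding T_def integral_divide_zero
      by (intro arg_cong[where f = "\<lambda>x. x / fact i"] Bochner_Integration.integral_sum profile_sum_integrable[where B = B'] gs)
    have "(\<lambda>j. (\<Sum>rs'\<in>?L i. expectation (profile_sum (rs @ rs') j (\<lambda>xs. gs j (take ?k xs)))) / fact i)
      \<longlonglongrightarrow> (\<Sum>rs'\<in>?L i. prod_list (map lam (rs @ rs')) * normal_integral ?k g) / fact i"
    proof (intro tendsto_divide tendsto_sum tendsto_const)
      fix rs' assume rs': "rs' \<in> ?L i"
      then have len: "length (rs @ rs') = ?k + i" by simp
      have lc: "label_conv (?k + i) (\<lambda>j xs. gs j (take ?k xs)) (\<lambda>xs. g (take ?k xs))"
        unfolding label_conv_def
      proof (intro allI impI)
        fix X and xs :: "real list"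
        assume A: "length xs = ?k + i" "\<forall>u<?k + i. eventually (\<lambda>j. X u j \<in> window j) sequentially \<and> (\<lambda>j. std_label e (ns j) (X u j)) \<longlonglongrightarrow> xs ! u"
        have "(\<lambda>j. gs j (map (\<lambda>i. X i j) [0..<?k])) \<longlonglongrightarrow> g (take ?k xs)"
          by (rule gconv[unfolded label_conv_def, rule_format]) (use A in auto)
        then show "(\<lambda>j. gs j (take ?k (map (\<lambda>i. X i j) [0..<?k + i]))) \<longlonglongrightarrow> g (take ?k xs)" by (simp add: take_map)
      qed
      have "(\<lambda>j. expectation (profile_sum (rs @ rs') j (\<lambda>xs. gs j (take ?k xs)))) \<longlonglongrightarrow> prod_list (map lam (rs @ rs')) * normal_integral (length (rs @ rs')) (\<lambda>xs. g (take ?k xs))"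
        by (rule profile_prob_tendsto[where B = B']) (use gs g lc list_conv_take[OF g(2)] len in auto)
      then show "(\<lambda>j. expectation (profile_sum (rs @ rs') j (\<lambda>xs. gs j (take ?k xs)))) \<longlonglongrightarrow> prod_list (map lam (rs @ rs')) * normal_integral ?k g"
        unfolding len normal_integral_take .
    qed simp
    also have "(\<Sum>rs'\<in>?L i. prod_list (map lam (rs @ rs')) * normal_integral ?k g) = P * normal_integral ?k g * (\<Sum>rs'\<in>?L i. prod_list (map lam rs'))"
      unfolding sum_distrib_left P_def by (rule sum.cong[OF refl]) simp
    also have "(\<Sum>rs'\<in>?L i. prod_list (map lam rs')) = ?La ^ i" by (rule sum_prod_lists) simp
    finally show ?thesis unfolding E by simp
  qed
  have T_int: "integrable M (T i j g)" if "\<And>ls. \<bar>g ls\<bar> \<le> B'" for i j g B'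
    unfolding T_def by (intro integrable_divide Bochner_Integration.integrable_sum profile_sum_integrable[where B = B'] that)
  have B0: "0 \<le> B" using f(1)[of "[]"] by linarith
  have one: "label_conv ?k (\<lambda>_ _. 1) (\<lambda>_. 1)" "list_cont ?k (\<lambda>_. 1)" "normal_integral ?k (\<lambda>_. 1) = 1"
    using normal_integral_take[of 0 ?k "\<lambda>_. 1"] by (auto simp: label_conv_def list_conv_def)
  \<comment> \<open>Bonferroni's inequality for the number of further vertices, applied to every
    tuple that realises \<open>rs\<close> and summed over the tuples.\<close>
  have bound: "\<bar>profile_part c R rs j (fs j) \<omega> - (\<Sum>i<J. (-1) ^ i * T i j (fs j) \<omega>)\<bar> \<le> B * T J j (\<lambda>_. 1) \<omega>" for J j \<omega>
  proof -
    let ?C = "card (verts_in c R j \<omega>) - ?k"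
    let ?D = "dlists (window j) ?k"
    let ?I = "\<lambda>ls. map (dev j \<omega>) ls = rs"
    have Tc: "T i j g \<omega> = (\<Sum>ls\<in>?D. (if ?I ls then g ls else 0) * real (?C choose i))" for i g
      unfolding T_def by (rule profile_sum_choose[OF rs, symmetric])
    have pp: "profile_part c R rs j (fs j) \<omega> = (\<Sum>ls\<in>?D. (if ?I ls then fs j ls else 0) * (if ?C = 0 then 1 else 0))"
      unfolding profile_part_def profile_sum_def
    proof (cases "has_profile c R rs j \<omega>")
      case True
      have "(if ?I ls then fs j ls else 0) = (if ?I ls then fs j ls else 0) * (if ?C = 0 then 1 else 0)" if "ls \<in> ?D" for ls
        using has_profile_iff(2)[OF that _ rs, of \<omega>] True by auto
      then show "(if has_profile c R rs j \<omega> then \<Sum>ls\<in>?D. if ?I ls then fs j ls else 0 else 0) = (\<Sum>ls\<in>?D. (if ?I ls then fs j ls else 0) * (if ?C = 0 then 1 else 0))"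
        unfolding if_P[OF True] by (rule sum.cong[OF refl])
    next
      case False
      have "(if ?I ls then fs j ls else 0) * (if ?C = 0 then 1 else 0) = 0" if "ls \<in> ?D" for ls
        using has_profile_iff(2)[OF that _ rs, of \<omega>] False by auto
      then show "(if has_profile c R rs j \<omega> then \<Sum>ls\<in>?D. if ?I ls then fs j ls else 0 else 0) = (\<Sum>ls\<in>?D. (if ?I ls then fs j ls else 0) * (if ?C = 0 then 1 else 0))"
        unfolding if_not_P[OF False] by (rule sum.neutral[symmetric, rule_format])
    qed
    have eq: "profile_part c R rs j (fs j) \<omega> - (\<Sum>i<J. (-1) ^ i * T i j (fs j) \<omega>)
      = (\<Sum>ls\<in>?D. (if ?I ls then fs j ls else 0) * ((if ?C = 0 then 1 else 0) - (\<Sum>i<J. (-1) ^ i * real (?C choose i))))"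
    proof -
      have "(\<Sum>i<J. (-1) ^ i * T i j (fs j) \<omega>) = (\<Sum>i<J. \<Sum>ls\<in>?D. (if ?I ls then fs j ls else 0) * ((-1) ^ i * real (?C choose i)))"
        unfolding Tc sum_distrib_left by (simp only: mult.left_commute)
      also have "\<dots> = (\<Sum>ls\<in>?D. \<Sum>i<J. (if ?I ls then fs j ls else 0) * ((-1) ^ i * real (?C choose i)))" by (rule sum.swap)
      also have "\<dots> = (\<Sum>ls\<in>?D. (if ?I ls then fs j ls else 0) * (\<Sum>i<J. (-1) ^ i * real (?C choose i)))" by (simp only: sum_distrib_left)
      finally show ?thesis unfolding pp by (simp only: right_diff_distrib sum_subtractf)
    qed
    have "\<bar>profile_part c R rs j (fs j) \<omega> - (\<Sum>i<J. (-1) ^ i * T i j (fs j) \<omega>)\<bar>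
      \<le> (\<Sum>ls\<in>?D. B * ((if ?I ls then 1 else 0) * real (?C choose J)))"
      unfolding eq
    proof (intro order.trans[OF sum_abs] sum_mono)
      fix ls
      have "\<bar>if ?I ls then fs j ls else 0\<bar> * \<bar>(if ?C = 0 then 1 else 0) - (\<Sum>i<J. (-1) ^ i * real (?C choose i))\<bar>
         \<le> (if ?I ls then B else 0) * real (?C choose J)"
        by (rule mult_mono[OF _ inclusion_exclusion_bound]) (use fs B0 in auto)
      then show "\<bar>(if ?I ls then fs j ls else 0) * ((if ?C = 0 then 1 else 0) - (\<Sum>i<J. (-1) ^ i * real (?C choose i)))\<bar> \<le> B * ((if ?I ls then 1 else 0) * real (?C choose J))"
        unfolding abs_mult by (simp split: if_splits)
    qed
    also have "\<dots> = B * T J j (\<lambda>_. 1) \<omega>" unfolding Tc sum_distrib_left ..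
    finally show ?thesis .
  qed
  show ?thesis
  \<comment> \<open>The cut-off \<open>J\<close> truncates inclusion-exclusion; the error is the
    term of order \<open>J\<close>, whose limit in \<open>j\<close> contains
    \<open>?La ^ J / fact J\<close>.\<close>
  proof (rule tendsto_approx)
    show "(\<lambda>j. \<Sum>i<J. (-1) ^ i * expectation (T i j (fs j))) \<longlonglongrightarrow> (\<Sum>i<J. (-1) ^ i * (P * normal_integral ?k f * (?La ^ i / fact i)))" for J
      by (intro tendsto_sum tendsto_mult tendsto_const T_tendsto[OF fs f conv])
    show "(\<lambda>j. B * expectation (T J j (\<lambda>_. 1))) \<longlonglongrightarrow> B * (P * 1 * (?La ^ J / fact J))" for J
      using T_tendsto[of "\<lambda>_ _. 1" 1 "\<lambda>_. 1" J] one by (intro tendsto_mult tendsto_const) auto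
    have es: "(\<lambda>i. x ^ i / fact i) sums exp x" for x :: real
      using exp_converges[of x] by (simp add: divide_inverse mult.commute)
    show "(\<lambda>J. \<Sum>i<J. (-1) ^ i * (P * normal_integral ?k f * (?La ^ i / fact i))) \<longlonglongrightarrow> prod_list (map lam rs) * exp (- ?La) * normal_integral ?k f"
    proof -
      have s1: "(\<lambda>i. P * normal_integral ?k f * ((- ?La) ^ i / fact i)) sums (P * normal_integral ?k f * exp (- ?La))"
        by (rule sums_mult[OF es])
      have s2: "P * normal_integral ?k f * ((- ?La) ^ i / fact i) = (-1) ^ i * (P * normal_integral ?k f * (?La ^ i / fact i))" for i
        by (subst power_minus) simp
      have s3: "prod_list (map lam rs) * exp (- ?La) * normal_integral ?k f = P * normal_integral ?k f * exp (- ?La)"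
        unfolding P_def by (simp only: mult_ac)
      show ?thesis using s1 unfolding s2 s3 sums_def .
    qed
    have "(\<lambda>J. B * (P * 1 * (?La ^ J / fact J))) \<longlonglongrightarrow> B * (P * 1 * 0)"
      by (intro tendsto_mult tendsto_const summable_LIMSEQ_zero sums_summable[OF es])
    then show "(\<lambda>J. B * (P * 1 * (?La ^ J / fact J))) \<longlonglongrightarrow> 0" by simp
    show "eventually (\<lambda>j. \<bar>expectation (profile_part c R rs j (fs j)) - (\<Sum>i<J. (-1) ^ i * expectation (T i j (fs j)))\<bar> \<le> B * expectation (T J j (\<lambda>_. 1))) sequentially" for J
    proof (rule always_eventually, rule allI)
      fix j
      have i1: "integrable M (profile_part c R rs j (fs j))" by (rule profile_part_integrable[where B = B]) (rule fs)
      have i2: "integrable M (\<lambda>\<omega>. (-1) ^ i * T i j (fs j) \<omega>)" for i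
        by (rule integrable_mult_right, rule T_int) (rule fs)
      have i3: "integrable M (T J j (\<lambda>_. 1))" by (rule T_int) (rule eq_refl, rule abs_one)
      let ?S = "\<lambda>\<omega>. \<Sum>i<J. (-1) ^ i * T i j (fs j) \<omega>"
      let ?d = "\<lambda>\<omega>. profile_part c R rs j (fs j) \<omega> - ?S \<omega>"
      have i4: "integrable M ?S" by (rule Bochner_Integration.integrable_sum) (rule i2)
      have i5: "integrable M ?d" by (rule Bochner_Integration.integrable_diff[OF i1 i4])
      have s: "expectation ?S = (\<Sum>i<J. (-1) ^ i * expectation (T i j (fs j)))"
        by (subst Bochner_Integration.integral_sum[OF i2]) (rule sum.cong[OF refl], rule integral_mult_right_zero)
      have 1: "expectation (profile_part c R rs j (fs j)) - (\<Sum>i<J. (-1) ^ i * expectation (T i j (fs j))) = expectation ?d"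
        unfolding s[symmetric] by (rule Bochner_Integration.integral_diff[OF i1 i4, symmetric])
      have 2: "\<bar>expectation ?d\<bar> \<le> expectation (\<lambda>\<omega>. \<bar>?d \<omega>\<bar>)" by (rule integral_abs_bound)
      have 3: "expectation (\<lambda>\<omega>. \<bar>?d \<omega>\<bar>) \<le> expectation (\<lambda>\<omega>. B * T J j (\<lambda>_. 1) \<omega>)"
        by (rule integral_mono[OF integrable_abs[OF i5] integrable_mult_right[OF i3] bound])
      have 4: "expectation (\<lambda>\<omega>. B * T J j (\<lambda>_. 1) \<omega>) = B * expectation (T J j (\<lambda>_. 1))" by (rule integral_mult_right_zero)
      show "\<bar>expectation (profile_part c R rs j (fs j)) - (\<Sum>i<J. (-1) ^ i * expectation (T i j (fs j)))\<bar> \<le> B * expectation (T J j (\<lambda>_. 1))"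
        unfolding 1 4[symmetric] by (rule order.trans[OF 2 3])
    qed
  qed
qed

end

section \<open>Uniform tie-breaking\<close>

text \<open>\<open>degree_orderings\<close> with an arbitrary key in place of the in-degree; it is
  also applied to subsets of the vertices and to the shifted in-degrees \<open>dev\<close>.\<close>

definition sorted_orders :: "'v set \<Rightarrow> ('v \<Rightarrow> 'r::linorder) \<Rightarrow> 'v list set" where
  "sorted_orders A g = {vs \<in> permutations_of_set A. sorted_wrt (\<lambda>u v. g v \<le> g u) vs}"

lemma finite_sorted_orders: "finite A \<Longrightarrow> finite (sorted_orders A g)"
  unfolding sorted_orders_def by simp

lemma sorted_orders_nonempty:
  assumes "finite A"
  shows "sorted_orders A g \<noteq> {}"
proof -
  obtain xs where xs: "set xs = A" "distinct xs" using finite_distinct_list[OF assms] by blast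
  let ?ys = "rev (sort_key g xs)"
  have "sorted (map g (sort_key g xs))" by simp
  then have "sorted_wrt (\<lambda>u v. g u \<le> g v) (sort_key g xs)" by (simp add: sorted_wrt_map)
  then have "sorted_wrt (\<lambda>u v. g v \<le> g u) ?ys" by (simp add: sorted_wrt_rev)
  then have "?ys \<in> sorted_orders A g" unfolding sorted_orders_def using xs by (auto simp: permutations_of_set_def)
  then show ?thesis by blast
qed

text \<open>The number of ways to arrange a set whose multiset of keys is \<open>mset rs\<close> along the key list \<open>rs\<close>.\<close>

fun arrangements :: "'r list \<Rightarrow> nat" where
  "arrangements [] = 1"
| "arrangements (r # rs) = arrangements rs * count_list (r # rs) r"

lemma arrangements_pos: "0 < arrangements rs"
  by (induction rs) auto

lemma count_list_mset: "count_list xs x = count (mset xs) x"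
  by (induction xs) auto

text \<open>The first entry may be any element with key \<open>r\<close>, which gives the factor
  \<open>count_list (r # rs) r\<close>; removing it leaves the same problem for
  \<open>rs\<close>.\<close>

lemma card_arrangements:
  fixes g :: "'v \<Rightarrow> 'r"
  assumes "finite A" "image_mset g (mset_set A) = mset rs"
  shows "card {ls \<in> dlists A (length rs). map g ls = rs} = arrangements rs"
  using assms
proof (induction rs arbitrary: A)
  case Nil
  have "{ls \<in> dlists A (length []). map g ls = []} = {[]}" by auto
  then show ?case by simp
next
  case (Cons r rs)
  let ?B = "{l \<in> A. g l = r}"
  have finB: "finite ?B" using Cons.prems by simp
  have cB: "card ?B = count_list (r # rs) r"
  proof -
    have "count (image_mset g (mset_set A)) r = card ?B"
      using Cons.prems(1) by (simp add: count_image_mset vimage_def Int_def conj_commute)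
    then show ?thesis unfolding Cons.prems(2) count_list_mset by simp
  qed
  have eq: "{ls \<in> dlists A (length (r # rs)). map g ls = r # rs} = (\<Union>l\<in>?B. (#) l ` {xs \<in> dlists (A - {l}) (length rs). map g xs = rs})"
    (is "?L = ?R")
  proof (rule set_eqI)
    fix ls show "ls \<in> ?L \<longleftrightarrow> ls \<in> ?R"
      by (cases ls) (auto simp: dlists_def)
  qed
  have "card ?L = (\<Sum>l\<in>?B. card ((#) l ` {xs \<in> dlists (A - {l}) (length rs). map g xs = rs}))"
    unfolding eq
  proof (rule card_UN_disjoint[OF finB])
    show "\<forall>i\<in>?B. finite ((#) i ` {xs \<in> dlists (A - {i}) (length rs). map g xs = rs})"
      using Cons.prems(1) by (simp add: finite_dlists)
  qed auto
  also have "\<dots> = (\<Sum>l\<in>?B. arrangements rs)"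
  proof (rule sum.cong[OF refl])
    fix l assume l: "l \<in> ?B"
    have "card ((#) l ` {xs \<in> dlists (A - {l}) (length rs). map g xs = rs}) = card {xs \<in> dlists (A - {l}) (length rs). map g xs = rs}"
      by (rule card_image) auto
    also have "\<dots> = arrangements rs"
    proof (rule Cons.IH)
      have "mset_set A = add_mset l (mset_set (A - {l}))"
        using l Cons.prems(1) by (simp add: mset_set.remove)
      then show "image_mset g (mset_set (A - {l})) = mset rs" using Cons.prems(2) l by simp
    qed (use Cons.prems in simp)
    finally show "card ((#) l ` {xs \<in> dlists (A - {l}) (length rs). map g xs = rs}) = arrangements rs" .
  qed
  also have "\<dots> = arrangements (r # rs)" using cB by simp
  finally show ?case .
qed

lemma dlists_full:
  assumes "finite A" "card A = k"
  shows "dlists A k = permutations_of_set A"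
proof (rule set_eqI)
  fix ls
  show "ls \<in> dlists A k \<longleftrightarrow> ls \<in> permutations_of_set A"
    unfolding dlists_def permutations_of_set_def using assms
    by (auto simp: distinct_card) (metis card_subset_eq distinct_card subsetD)
qed

text \<open>A decreasing list is determined by its multiset, so a sorted ordering must show exactly
  the keys \<open>rs\<close>.\<close>

lemma map_key_sorted_orders:
  fixes g :: "'v \<Rightarrow> 'r::linorder"
  assumes A: "finite A" and m: "image_mset g (mset_set A) = mset rs" and rs: "sorted_wrt (\<ge>) rs"
  shows "sorted_orders A g = {ls \<in> dlists A (length rs). map g ls = rs}"
proof -
  have cA: "card A = length rs" using arg_cong[OF m, of size] by simp
  have "sorted_wrt (\<lambda>u v. g v \<le> g u) ls \<longleftrightarrow> map g ls = rs" if ls: "ls \<in> permutations_of_set A" for ls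
  proof
    assume s: "sorted_wrt (\<lambda>u v. g v \<le> g u) ls"
    have "mset ls = mset_set A" using ls by (metis mset_set_set permutations_of_setD)
    then have "mset (map g ls) = mset rs" using m by simp
    then have mr: "mset (rev (map g ls)) = mset (rev rs)" by simp
    have s1: "sorted (rev (map g ls))" using s by (simp add: sorted_wrt_rev sorted_wrt_map)
    have s2: "sorted (rev rs)" using rs by (simp add: sorted_wrt_rev)
    have "rev (map g ls) = rev rs" using properties_for_sort[OF mr s1] properties_for_sort[OF refl s2] by simp
    then show "map g ls = rs" by simp
  next
    assume "map g ls = rs"
    then show "sorted_wrt (\<lambda>u v. g v \<le> g u) ls" using rs by (auto simp: sorted_wrt_map)
  qed
  then show ?thesis unfolding sorted_orders_def dlists_full[OF A cA] by blast
qed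

text \<open>Keys in \<open>V\<close> are at least \<open>c\<close> and all others are below, so a
  decreasing ordering lists \<open>V\<close> first, and the two blocks can be ordered
  independently.\<close>

lemma sorted_orders_split:
  fixes g :: "'v \<Rightarrow> 'r::linorder"
  assumes A: "finite A" and V: "V = {a \<in> A. c \<le> g a}"
  shows "bij_betw (\<lambda>(xs, ys). xs @ ys) (sorted_orders V g \<times> sorted_orders (A - V) g) (sorted_orders A g)"
proof (rule bij_betwI[where g = "\<lambda>vs. (take (card V) vs, drop (card V) vs)"])
  have finV: "finite V" using A V by simp
  have len: "length xs = card V" if "xs \<in> sorted_orders V g" for xs
    using that length_finite_permutations_of_set unfolding sorted_orders_def by blast
  show "(\<lambda>(xs, ys). xs @ ys) \<in> sorted_orders V g \<times> sorted_orders (A - V) g \<rightarrow> sorted_orders A g"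
  proof (clarsimp)
    fix xs ys assume xs: "xs \<in> sorted_orders V g" and ys: "ys \<in> sorted_orders (A - V) g"
    have "set xs = V" "distinct xs" "set ys = A - V" "distinct ys"
      "sorted_wrt (\<lambda>u v. g v \<le> g u) xs" "sorted_wrt (\<lambda>u v. g v \<le> g u) ys"
      using xs ys by (auto simp: sorted_orders_def permutations_of_set_def)
    moreover have "g y \<le> g x" if "x \<in> V" "y \<in> A - V" for x y
      using that V by (auto simp: not_le intro: less_imp_le less_le_trans)
    ultimately show "xs @ ys \<in> sorted_orders A g"
      using V by (auto simp: sorted_orders_def permutations_of_set_def sorted_wrt_append)
  qed
  show "(\<lambda>vs. (take (card V) vs, drop (card V) vs)) \<in> sorted_orders A g \<rightarrow> sorted_orders V g \<times> sorted_orders (A - V) g"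
  proof (rule funcsetI)
    fix vs assume "vs \<in> sorted_orders A g"
    then have vs: "set vs = A" "distinct vs" "sorted_wrt (\<lambda>u v. g v \<le> g u) vs"
      by (auto simp: sorted_orders_def permutations_of_set_def)
    \<comment> \<open>As the keys decrease along \<open>vs\<close>, the entries with key at least
      \<open>c\<close> form an initial segment.\<close>
    define xs where "xs = takeWhile (\<lambda>v. c \<le> g v) vs"
    define ys where "ys = dropWhile (\<lambda>v. c \<le> g v) vs"
    have app: "vs = xs @ ys" unfolding xs_def ys_def by simp
    have s: "sorted_wrt (\<lambda>u v. g v \<le> g u) xs" "sorted_wrt (\<lambda>u v. g v \<le> g u) ys" and d: "distinct xs" "distinct ys" "set xs \<inter> set ys = {}"
      using vs app by (auto simp: sorted_wrt_append)
    have xV: "set xs \<subseteq> V" unfolding xs_def using vs(1) V by (auto dest: set_takeWhileD)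
    have yV: "\<not> c \<le> g y" if "y \<in> set ys" for y
    proof (cases ys)
      case (Cons y0 ys')
      have "\<not> c \<le> g y0" using hd_dropWhile[of "\<lambda>v. c \<le> g v" vs] Cons unfolding ys_def by simp
      moreover have "g y \<le> g y0" using s(2) that Cons by auto
      ultimately show ?thesis by (meson order.trans)
    qed (use that in simp)
    have sx: "set xs = V"
    proof
      show "V \<subseteq> set xs"
      proof
        fix x assume x: "x \<in> V"
        then have "x \<in> set vs" using V vs(1) by simp
        then show "x \<in> set xs" using yV[of x] x V unfolding app by auto
      qed
    qed (rule xV)
    have sy: "set ys = A - V" using sx d(3) vs(1) app by auto
    have "length xs = card V" using sx distinct_card[OF d(1)] by simp
    then have "take (card V) vs = xs" "drop (card V) vs = ys" unfolding app by simp_all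
    then show "(take (card V) vs, drop (card V) vs) \<in> sorted_orders V g \<times> sorted_orders (A - V) g"
      using sx sy s d by (simp add: sorted_orders_def permutations_of_set_def)
  qed
  show "\<And>x. x \<in> sorted_orders V g \<times> sorted_orders (A - V) g \<Longrightarrow> (take (card V) ((\<lambda>(xs, ys). xs @ ys) x), drop (card V) ((\<lambda>(xs, ys). xs @ ys) x)) = x"
    using len by auto
  show "\<And>y. y \<in> sorted_orders A g \<Longrightarrow> (\<lambda>(xs, ys). xs @ ys) (take (card V) y, drop (card V) y) = y" by simp
qed

text \<open>By the splitting, the first block of a uniform ordering is uniform among the orderings
  of \<open>V\<close>, whatever happens below.\<close>

lemma average_sorted_orders:
  fixes g :: "'v \<Rightarrow> 'r::linorder" and f :: "'v list \<Rightarrow> real"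
  assumes A: "finite A" and V: "V = {a \<in> A. c \<le> g a}" and m: "image_mset g (mset_set V) = mset rs" and rs: "sorted_wrt (\<ge>) rs"
  shows "(\<Sum>vs\<in>sorted_orders A g. f (take (length rs) vs)) / real (card (sorted_orders A g))
    = (\<Sum>ls\<in>dlists V (length rs). if map g ls = rs then f ls else 0) / real (arrangements rs)"
proof -
  let ?X = "sorted_orders V g" and ?Y = "sorted_orders (A - V) g"
  have finV: "finite V" using A V by simp
  note bij = sorted_orders_split[OF A V]
  have X: "?X = {ls \<in> dlists V (length rs). map g ls = rs}" by (rule map_key_sorted_orders[OF finV m rs])
  have cX: "card ?X = arrangements rs" unfolding X by (rule card_arrangements[OF finV m])
  have finX: "finite ?X" and finY: "finite ?Y" using A finV by (auto intro: finite_sorted_orders)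
  have cY: "card ?Y \<noteq> 0" using finY sorted_orders_nonempty[of "A - V" g] A by simp
  have "card (sorted_orders A g) = card (?X \<times> ?Y)" using bij_betw_same_card[OF bij] by simp
  then have card: "card (sorted_orders A g) = arrangements rs * card ?Y" using cX by (simp add: card_cartesian_product)
  have "(\<Sum>vs\<in>sorted_orders A g. f (take (length rs) vs)) = (\<Sum>p\<in>?X \<times> ?Y. f (take (length rs) ((\<lambda>(xs, ys). xs @ ys) p)))"
    by (rule sum.reindex_bij_betw[OF bij, symmetric])
  also have "\<dots> = (\<Sum>(xs, ys)\<in>?X \<times> ?Y. f xs)"
    by (rule sum.cong[OF refl]) (auto simp: X dlists_def)
  also have "\<dots> = (\<Sum>xs\<in>?X. \<Sum>ys\<in>?Y. f xs)" by (rule sum.cartesian_product[symmetric])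
  also have "\<dots> = (\<Sum>xs\<in>?X. f xs) * real (card ?Y)" by (simp add: sum_distrib_right mult.commute)
  finally have "(\<Sum>vs\<in>sorted_orders A g. f (take (length rs) vs)) / real (card (sorted_orders A g)) = (\<Sum>xs\<in>?X. f xs) / real (arrangements rs)"
    unfolding card using cY by simp
  also have "(\<Sum>xs\<in>?X. f xs) = (\<Sum>ls\<in>dlists V (length rs). if map g ls = rs then f ls else 0)"
    unfolding X by (rule sum.inter_filter) (rule finite_dlists[OF finV])
  finally show ?thesis .
qed

lemma degree_orderings_eq: "degree_orderings (tree_of x n) = sorted_orders {1..n} (indeg x n)"
  unfolding degree_orderings_def sorted_orders_def in_degree_tree_of by (simp add: tree_of_def)

lemma sorted_orders_shift: "sorted_orders A (\<lambda>v. int (g v) - d) = sorted_orders A g"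
  unfolding sorted_orders_def by simp

context weighted_recursive_tree
begin

text \<open>The conditional law of the ordering is tested against functions of the in-degrees, one
  permutation at a time.\<close>

lemma ordering_expectation:
  fixes f :: "(nat \<Rightarrow> nat) \<Rightarrow> nat list \<Rightarrow> real"
  assumes n: "1 \<le> n" and v: "uniform_degree_ordering M W p n v"
    and fb: "\<And>x vs. \<bar>f x vs\<bar> \<le> B"
  shows "expectation (\<lambda>\<omega>. f (indeg (par \<omega>) n) (v \<omega>))
    = expectation (\<lambda>\<omega>. (\<Sum>vs\<in>sorted_orders {1..n} (indeg (par \<omega>) n). f (indeg (par \<omega>) n) vs) / real (card (sorted_orders {1..n} (indeg (par \<omega>) n))))"
proof -
  let ?P = "permutations_of_set {1..n}"
  let ?S = "\<lambda>\<omega>. sorted_orders {1..n} (indeg (par \<omega>) n)"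
  let ?I = "\<lambda>vs. indicator {\<omega> \<in> space M. v \<omega> = vs} :: 'a \<Rightarrow> real"
  let ?q = "\<lambda>\<omega> vs. (if vs \<in> ?S \<omega> then 1 else 0) / real (card (?S \<omega>))"
  have vM [measurable]: "v \<in> measurable M (count_space UNIV)" using v by (simp add: uniform_degree_ordering_def)
  have finS: "finite (?S \<omega>)" "?S \<omega> \<noteq> {}" "?S \<omega> \<subseteq> ?P" for \<omega>
  proof -
    show "finite (?S \<omega>)" by (rule finite_sorted_orders) simp
    show "?S \<omega> \<noteq> {}" by (rule sorted_orders_nonempty) simp
    show "?S \<omega> \<subseteq> ?P" unfolding sorted_orders_def by blast
  qed
  have cond: "AE \<omega> in M. real_cond_exp M (history M W p n) (?I vs) \<omega> = ?q \<omega> vs" for vs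
  proof -
    have eq: "pmf (pmf_of_set (degree_orderings (tree_of (par \<omega>) n))) vs = ?q \<omega> vs" for \<omega>
      unfolding degree_orderings_eq using finS by (subst pmf_of_set) (auto simp: indicator_def)
    have "AE \<omega> in M. real_cond_exp M (history M W p n) (?I vs) \<omega> = pmf (pmf_of_set (degree_orderings (tree_of (par \<omega>) n))) vs"
      using v unfolding uniform_degree_ordering_def by blast
    then show ?thesis unfolding eq .
  qed
  have step: "expectation (\<lambda>\<omega>. F (indeg (par \<omega>) n) * ?I vs \<omega>) = expectation (\<lambda>\<omega>. F (indeg (par \<omega>) n) * ?q \<omega> vs)"
    if F: "\<And>x. \<bar>F x\<bar> \<le> B'" for F :: "(nat \<Rightarrow> nat) \<Rightarrow> real" and vs B'
  proof -
    have Fh: "(\<lambda>\<omega>. F (indeg (par \<omega>) n)) \<in> borel_measurable (history M W p n)" by (rule indeg_measurable_history)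
    have FM [measurable]: "(\<lambda>\<omega>. F (indeg (par \<omega>) n)) \<in> borel_measurable M" by (rule indeg_measurable)
    have IM: "?I vs \<in> borel_measurable M" by measurable
    have qM [measurable]: "(\<lambda>\<omega>. ?q \<omega> vs) \<in> borel_measurable M"
      by (rule indeg_measurable[where F = "\<lambda>x. (if vs \<in> sorted_orders {1..n} x then 1 else 0) / real (card (sorted_orders {1..n} x))"])
    have int: "integrable M (\<lambda>\<omega>. F (indeg (par \<omega>) n) * ?I vs \<omega>)"
    proof (rule AE_bounded_integrable[where B = "\<bar>B'\<bar>"])
      show "AE \<omega> in M. \<bar>F (indeg (par \<omega>) n) * ?I vs \<omega>\<bar> \<le> \<bar>B'\<bar>"
        by (rule AE_I2) (use F in \<open>auto simp: indicator_def intro: order.trans[OF F abs_ge_self]\<close>)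
    qed (use IM in measurable)
    have "expectation (\<lambda>\<omega>. F (indeg (par \<omega>) n) * ?I vs \<omega>) = expectation (\<lambda>\<omega>. F (indeg (par \<omega>) n) * real_cond_exp M (history M W p n) (?I vs) \<omega>)"
      using hist.real_cond_exp_intg(2)[OF int Fh IM] by simp
    also have "\<dots> = expectation (\<lambda>\<omega>. F (indeg (par \<omega>) n) * ?q \<omega> vs)"
      by (rule integral_cong_AE, measurable) (rule eventually_mono[OF cond[of vs]], simp)
    finally show ?thesis .
  qed
  have sumq: "(\<Sum>vs\<in>?P. f' vs * ?q \<omega> vs) = (\<Sum>vs\<in>?S \<omega>. f' vs) / real (card (?S \<omega>))" for f' and \<omega>
  proof -
    have "(\<Sum>vs\<in>?P. f' vs * ?q \<omega> vs) = (\<Sum>vs\<in>?P. if vs \<in> ?S \<omega> then f' vs else 0) / real (card (?S \<omega>))"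
      unfolding sum_divide_distrib by (rule sum.cong[OF refl]) simp
    also have "(\<Sum>vs\<in>?P. if vs \<in> ?S \<omega> then f' vs else 0) = (\<Sum>vs\<in>?P \<inter> ?S \<omega>. f' vs)"
      by (rule sum.inter_restrict[symmetric]) simp
    also have "?P \<inter> ?S \<omega> = ?S \<omega>" using finS(3) by blast
    finally show ?thesis .
  qed
  have main: "expectation (\<lambda>\<omega>. \<Sum>vs\<in>?P. F (indeg (par \<omega>) n) vs * ?I vs \<omega>)
     = expectation (\<lambda>\<omega>. (\<Sum>vs\<in>?S \<omega>. F (indeg (par \<omega>) n) vs) / real (card (?S \<omega>)))"
    if F: "\<And>x vs. \<bar>F x vs\<bar> \<le> B'" for F :: "(nat \<Rightarrow> nat) \<Rightarrow> nat list \<Rightarrow> real" and B'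
  proof -
    have FM [measurable]: "(\<lambda>\<omega>. F (indeg (par \<omega>) n) vs) \<in> borel_measurable M" for vs by (rule indeg_measurable)
    have qM [measurable]: "(\<lambda>\<omega>. ?q \<omega> vs) \<in> borel_measurable M" for vs
      by (rule indeg_measurable[where F = "\<lambda>x. (if vs \<in> sorted_orders {1..n} x then 1 else 0) / real (card (sorted_orders {1..n} x))"])
    have i1: "integrable M (\<lambda>\<omega>. F (indeg (par \<omega>) n) vs * ?I vs \<omega>)" for vs
    proof (rule AE_bounded_integrable[where B = "\<bar>B'\<bar>"])
      show "AE \<omega> in M. \<bar>F (indeg (par \<omega>) n) vs * ?I vs \<omega>\<bar> \<le> \<bar>B'\<bar>"
        by (rule AE_I2) (use F in \<open>auto simp: indicator_def intro: order.trans[OF F abs_ge_self]\<close>)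
    qed measurable
    have i2: "integrable M (\<lambda>\<omega>. F (indeg (par \<omega>) n) vs * ?q \<omega> vs)" for vs
    proof (rule AE_bounded_integrable[where B = "\<bar>B'\<bar> * 1"])
      show "AE \<omega> in M. \<bar>F (indeg (par \<omega>) n) vs * ?q \<omega> vs\<bar> \<le> \<bar>B'\<bar> * 1"
      proof (rule AE_I2)
        fix \<omega>
        have "\<bar>?q \<omega> vs\<bar> \<le> 1" using finS[of \<omega>] by (auto simp: Suc_le_eq card_gt_0_iff)
        then show "\<bar>F (indeg (par \<omega>) n) vs * ?q \<omega> vs\<bar> \<le> \<bar>B'\<bar> * 1"
          unfolding abs_mult by (intro mult_mono order.trans[OF F abs_ge_self]) auto
      qed
    qed measurable
    have "expectation (\<lambda>\<omega>. \<Sum>vs\<in>?P. F (indeg (par \<omega>) n) vs * ?I vs \<omega>) = (\<Sum>vs\<in>?P. expectation (\<lambda>\<omega>. F (indeg (par \<omega>) n) vs * ?I vs \<omega>))"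
      by (rule Bochner_Integration.integral_sum) (rule i1)
    also have "\<dots> = (\<Sum>vs\<in>?P. expectation (\<lambda>\<omega>. F (indeg (par \<omega>) n) vs * ?q \<omega> vs))"
    proof (rule sum.cong[OF refl])
      fix vs
      show "expectation (\<lambda>\<omega>. F (indeg (par \<omega>) n) vs * ?I vs \<omega>) = expectation (\<lambda>\<omega>. F (indeg (par \<omega>) n) vs * ?q \<omega> vs)"
        using step[of "\<lambda>x. F x vs", OF F] .
    qed
    also have "\<dots> = expectation (\<lambda>\<omega>. \<Sum>vs\<in>?P. F (indeg (par \<omega>) n) vs * ?q \<omega> vs)"
      by (rule Bochner_Integration.integral_sum[symmetric]) (rule i2)
    finally show ?thesis unfolding sumq .
  qed
  \<comment> \<open>That \<open>v\<close> is almost surely a permutation follows from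
    \<open>main\<close> with the constant function 1: the prescribed conditional probabilities of
    the permutations add up to 1.\<close>
  have "prob {\<omega> \<in> space M. v \<omega> \<in> ?P} = 1"
  proof -
    have "prob {\<omega> \<in> space M. v \<omega> \<in> ?P} = expectation (indicator {\<omega> \<in> space M. v \<omega> \<in> ?P})" by simp
    also have "\<dots> = expectation (\<lambda>\<omega>. \<Sum>vs\<in>?P. 1 * ?I vs \<omega>)"
    proof (rule Bochner_Integration.integral_cong[OF refl])
      fix \<omega> assume "\<omega> \<in> space M"
      then have "(\<Sum>vs\<in>?P. 1 * ?I vs \<omega>) = (\<Sum>vs\<in>?P. if v \<omega> = vs then 1 else 0)" by (intro sum.cong refl) (auto simp: indicator_def)
      also have "\<dots> = indicator {\<omega> \<in> space M. v \<omega> \<in> ?P} \<omega>" using \<open>\<omega> \<in> space M\<close> by (subst sum.delta') (auto simp: indicator_def)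
      finally show "indicator {\<omega> \<in> space M. v \<omega> \<in> ?P} \<omega> = (\<Sum>vs\<in>?P. 1 * ?I vs \<omega>)" by simp
    qed
    also have "\<dots> = expectation (\<lambda>\<omega>. (\<Sum>vs\<in>?S \<omega>. 1) / real (card (?S \<omega>)))"
      using main[of "\<lambda>_ _. 1" 1] by simp
    also have "(\<lambda>\<omega>. (\<Sum>vs\<in>?S \<omega>. 1) / real (card (?S \<omega>))) = (\<lambda>\<omega>. 1)" using finS by (intro ext) simp
    finally show ?thesis by (simp add: prob_space)
  qed
  then have "AE \<omega> in M. \<omega> \<in> {\<omega> \<in> space M. v \<omega> \<in> ?P}" by (rule AE_prob_1)
  then have vP: "AE \<omega> in M. v \<omega> \<in> ?P" by (rule eventually_mono) simp
  have fvM: "(\<lambda>\<omega>. f (indeg (par \<omega>) n) (v \<omega>)) \<in> borel_measurable M"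
    by (rule measurable_compose_countable'[OF indeg_measurable vM]) simp
  have "expectation (\<lambda>\<omega>. f (indeg (par \<omega>) n) (v \<omega>)) = expectation (\<lambda>\<omega>. \<Sum>vs\<in>?P. f (indeg (par \<omega>) n) vs * ?I vs \<omega>)"
  proof (rule integral_cong_AE[OF fvM])
    have [measurable]: "(\<lambda>\<omega>. f (indeg (par \<omega>) n) vs) \<in> borel_measurable M" for vs by (rule indeg_measurable)
    show "(\<lambda>\<omega>. \<Sum>vs\<in>?P. f (indeg (par \<omega>) n) vs * ?I vs \<omega>) \<in> borel_measurable M" by measurable
    show "AE \<omega> in M. f (indeg (par \<omega>) n) (v \<omega>) = (\<Sum>vs\<in>?P. f (indeg (par \<omega>) n) vs * ?I vs \<omega>)"
      using vP AE_space
    proof eventually_elim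
      case (elim \<omega>)
      have "(\<Sum>vs\<in>?P. f (indeg (par \<omega>) n) vs * ?I vs \<omega>) = (\<Sum>vs\<in>?P. if v \<omega> = vs then f (indeg (par \<omega>) n) vs else 0)"
        using elim by (intro sum.cong refl) (auto simp: indicator_def)
      also have "\<dots> = f (indeg (par \<omega>) n) (v \<omega>)" using elim by (subst sum.delta') auto
      finally show ?case by simp
    qed
  qed
  also have "\<dots> = expectation (\<lambda>\<omega>. (\<Sum>vs\<in>?S \<omega>. f (indeg (par \<omega>) n) vs) / real (card (?S \<omega>)))"
    by (rule main[OF fb])
  finally show ?thesis .
qed

end

section \<open>The marked Poisson process\<close>

text \<open>\<open>normal_integral\<close> peels off the first variable, whereas the product
  integral over \<open>{1..k}\<close> is extended by the last one. This reconciles the two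
  orders.\<close>

lemma normal_integral_snoc:
  "normal_integral (Suc k) f = normal_integral k (\<lambda>xs. \<integral>y. f (xs @ [y]) \<partial>std_normal_distribution)"
proof (induction k arbitrary: f)
  case (Suc k)
  have "normal_integral (Suc (Suc k)) f = (\<integral>x. normal_integral (Suc k) (\<lambda>xs. f (x # xs)) \<partial>std_normal_distribution)"
    by (rule normal_integral.simps(2))
  also have "\<dots> = (\<integral>x. normal_integral k (\<lambda>xs. \<integral>y. f (x # (xs @ [y])) \<partial>std_normal_distribution) \<partial>std_normal_distribution)"
    by (simp only: Suc.IH)
  finally show ?case by simp
qed simp

text \<open>After extension by 0 outside \<open>{1..k}\<close> the function is continuous on the
  full sequence space, and measurability into that space can be checked coordinatewise.\<close>

lemma list_cont_measurable:
  assumes "list_cont k f"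
  shows "(\<lambda>x. f (map x [1..<Suc k])) \<in> borel_measurable (Pi\<^sub>M {1..k} (\<lambda>_. borel))"
proof -
  let ?g = "\<lambda>x :: nat \<Rightarrow> real. f (map x [1..<Suc k])"
  have "continuous_on UNIV ?g"
    unfolding continuous_on_sequentially comp_def
  proof (intro ballI allI impI, elim conjE)
    fix X :: "nat \<Rightarrow> nat \<Rightarrow> real" and x assume X: "X \<longlonglongrightarrow> x"
    have Xi: "(\<lambda>j. X j i) \<longlonglongrightarrow> x i" for i
      using continuous_on_tendsto_compose[OF continuous_on_product_coordinates X, of i] by simp
    have "(\<lambda>j. f (map (\<lambda>i. X j (Suc i)) [0..<k])) \<longlonglongrightarrow> f (map x [1..<Suc k])"
      by (rule assms[unfolded list_conv_def, rule_format, of "map x [1..<Suc k]" "\<lambda>i j. X j (Suc i)"])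
        (use Xi in \<open>auto simp del: upt_Suc\<close>)
    moreover have "map (\<lambda>i. X j (Suc i)) [0..<k] = map (X j) [1..<Suc k]" for j
      by (rule nth_equalityI) (auto simp del: upt_Suc)
    ultimately show "(\<lambda>j. f (map (X j) [1..<Suc k])) \<longlonglongrightarrow> f (map x [1..<Suc k])" by simp
  qed
  then have g: "?g \<in> borel_measurable borel" by (rule borel_measurable_continuous_onI)
  have "(\<lambda>x i. if i \<in> {1..k} then x i else 0) \<in> measurable (Pi\<^sub>M {1..k} (\<lambda>_. borel)) (borel :: (nat \<Rightarrow> real) measure)"
  proof (rule measurable_coordinatewise_then_product)
    fix i :: nat
    show "(\<lambda>x. if i \<in> {1..k} then x i else 0) \<in> borel_measurable (Pi\<^sub>M {1..k} (\<lambda>_. borel))"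
      by (cases "i \<in> {1..k}") auto
  qed
  from measurable_compose[OF this g]
  have "(\<lambda>x. ?g (\<lambda>i. if i \<in> {1..k} then x i else 0)) \<in> borel_measurable (Pi\<^sub>M {1..k} (\<lambda>_. borel))" .
  moreover have "?g (\<lambda>i. if i \<in> {1..k} then x i else 0) = ?g x" for x
    by (intro arg_cong[where f = f] map_cong) auto
  ultimately show ?thesis by (simp only:)
qed

lemma list_cont_snoc:
  assumes "list_cont (Suc k) f" "\<And>xs. \<bar>f xs\<bar> \<le> B"
  shows "list_cont k (\<lambda>xs. \<integral>y. f (xs @ [y]) \<partial>std_normal_distribution)"
  unfolding list_conv_def
proof (intro allI impI)
  fix X and xs :: "real list" assume xs: "length xs = k" "\<forall>i<k. X i \<longlonglongrightarrow> xs ! i"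
  have lim: "(\<lambda>j. f (zs j @ [y j])) \<longlonglongrightarrow> f (zs' @ [y'])"
    if "\<And>j. length (zs j) = k" "length zs' = k" "\<And>i. i < k \<Longrightarrow> (\<lambda>j. zs j ! i) \<longlonglongrightarrow> zs' ! i" "y \<longlonglongrightarrow> y'" for zs y zs' y'
  proof -
    have "(\<lambda>j. f (map (\<lambda>i. (zs j @ [y j]) ! i) [0..<Suc k])) \<longlonglongrightarrow> f (zs' @ [y'])"
      by (rule assms(1)[unfolded list_conv_def, rule_format]) (use that in \<open>auto simp: nth_append less_Suc_eq\<close>)
    moreover have "map (\<lambda>i. (zs j @ [y j]) ! i) [0..<Suc k] = zs j @ [y j]" for j
      using map_nth[of "zs j @ [y j]"] that(1)[of j] by simp
    ultimately show ?thesis by simp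
  qed
  have meas: "(\<lambda>y. f (zs @ [y])) \<in> borel_measurable borel" if "length zs = k" for zs
  proof (rule borel_measurable_continuous_onI)
    show "continuous_on UNIV (\<lambda>y. f (zs @ [y]))"
      unfolding continuous_on_sequentially comp_def by (auto intro!: lim simp: that)
  qed
  show "(\<lambda>j. \<integral>y. f (map (\<lambda>i. X i j) [0..<k] @ [y]) \<partial>std_normal_distribution) \<longlonglongrightarrow> (\<integral>y. f (xs @ [y]) \<partial>std_normal_distribution)"
  proof (rule integral_dominated_convergence[where w = "\<lambda>_. B"])
    show "AE y in std_normal_distribution. (\<lambda>j. f (map (\<lambda>i. X i j) [0..<k] @ [y])) \<longlonglongrightarrow> f (xs @ [y])"
      by (intro AE_I2 lim) (use xs in auto)
    show "(\<lambda>y. f (map (\<lambda>i. X i j) [0..<k] @ [y])) \<in> borel_measurable std_normal_distribution" for j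
      using meas[of "map (\<lambda>i. X i j) [0..<k]"] by simp
  qed (use assms(2) meas xs in auto)
qed

lemma normal_integral_PiM:
  assumes "list_cont k f" "\<And>xs. \<bar>f xs\<bar> \<le> B"
  shows "(\<integral>x. f (map x [1..<Suc k]) \<partial>Pi\<^sub>M {1..k} (\<lambda>_. std_normal_distribution)) = normal_integral k f"
  using assms
proof (induction k arbitrary: f)
  case 0
  interpret product_prob_space "\<lambda>_ :: nat. std_normal_distribution" by unfold_locales
  show ?case using prob_space.prob_space[OF prob_space_PiM[of "{1..0::nat}" "\<lambda>_. std_normal_distribution"]]
    by (simp add: std_normal.prob_space_axioms)
next
  case (Suc k)
  interpret product_prob_space "\<lambda>_ :: nat. std_normal_distribution" by unfold_locales
  have sets_eq: "sets (Pi\<^sub>M I (\<lambda>_. std_normal_distribution)) = sets (Pi\<^sub>M I (\<lambda>_. borel))" for I :: "nat set"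
    by (rule sets_PiM_cong) auto
  have ins: "{1..Suc k} = insert (Suc k) {1..k}" by auto
  interpret S: prob_space "Pi\<^sub>M (insert (Suc k) {1..k}) (\<lambda>_. std_normal_distribution)"
    by (rule prob_space_PiM) (rule std_normal.prob_space_axioms)
  have int: "integrable (Pi\<^sub>M (insert (Suc k) {1..k}) (\<lambda>_. std_normal_distribution)) (\<lambda>x. f (map x [1..<Suc (Suc k)]))"
  proof (rule S.integrable_const_bound[where B = B])
    show "(\<lambda>x. f (map x [1..<Suc (Suc k)])) \<in> borel_measurable (Pi\<^sub>M (insert (Suc k) {1..k}) (\<lambda>_. std_normal_distribution))"
      unfolding measurable_cong_sets[OF sets_eq refl] ins[symmetric] by (rule list_cont_measurable) (rule Suc.prems)
  qed (use Suc.prems in auto)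
  have upd: "map (x(Suc k := y)) [1..<Suc (Suc k)] = map x [1..<Suc k] @ [y]" for x :: "nat \<Rightarrow> real" and y
    by (simp add: upt_Suc)
  have b: "\<bar>\<integral>y. f (xs @ [y]) \<partial>std_normal_distribution\<bar> \<le> B" for xs
    using normal_integral_bound[of "\<lambda>ys. f (xs @ ys)" B 1] Suc.prems(2) by simp
  have "(\<integral>x. f (map x [1..<Suc (Suc k)]) \<partial>Pi\<^sub>M {1..Suc k} (\<lambda>_. std_normal_distribution))
      = (\<integral>x. (\<integral>y. f (map x [1..<Suc k] @ [y]) \<partial>std_normal_distribution) \<partial>Pi\<^sub>M {1..k} (\<lambda>_. std_normal_distribution))"
    unfolding ins using product_integral_insert[OF _ _ int] unfolding upd by simp
  also have "\<dots> = normal_integral k (\<lambda>xs. \<integral>y. f (xs @ [y]) \<partial>std_normal_distribution)"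
    by (rule Suc.IH[OF list_cont_snoc[OF Suc.prems] b])
  finally show ?case unfolding normal_integral_snoc .
qed

lemma (in prob_space) expectation_iid_normal:
  assumes Z: "indep_vars (\<lambda>_. borel) Z {1..}" "\<And>i. i \<ge> 1 \<Longrightarrow> distr M borel (Z i) = std_normal_distribution"
    and f: "list_cont k f" "\<And>xs. \<bar>f xs\<bar> \<le> B"
  shows "expectation (\<lambda>\<omega>. f (map (\<lambda>i. Z i \<omega>) [1..<Suc k])) = normal_integral k f"
proof (cases "k = 0")
  case True
  then show ?thesis using prob_space by simp
next
  case False
  have rv: "\<And>i. i \<in> {1..k} \<Longrightarrow> random_variable borel (Z i)" using Z(1) unfolding indep_vars_def by auto
  have "indep_vars (\<lambda>_. borel) Z {1..k}" by (rule indep_vars_subset[OF Z(1)]) auto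
  then have "distr M (Pi\<^sub>M {1..k} (\<lambda>_. borel)) (\<lambda>\<omega>. \<lambda>i\<in>{1..k}. Z i \<omega>) = Pi\<^sub>M {1..k} (\<lambda>i. distr M borel (Z i))"
    using indep_vars_iff_distr_eq_PiM'[where I = "{1..k}" and M' = "\<lambda>_. borel" and X = Z] rv False by simp
  also have "\<dots> = Pi\<^sub>M {1..k} (\<lambda>_. std_normal_distribution)" by (rule PiM_cong) (use Z(2) in auto)
  finally have d: "distr M (Pi\<^sub>M {1..k} (\<lambda>_. borel)) (\<lambda>\<omega>. \<lambda>i\<in>{1..k}. Z i \<omega>) = Pi\<^sub>M {1..k} (\<lambda>_. std_normal_distribution)" .
  have "normal_integral k f = expectation (\<lambda>\<omega>. f (map (\<lambda>i\<in>{1..k}. Z i \<omega>) [1..<Suc k]))"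
    unfolding normal_integral_PiM[OF f, symmetric] d[symmetric]
    by (rule integral_distr) (use rv list_cont_measurable[OF f(1)] in \<open>auto intro!: measurable_restrict\<close>)
  moreover have "map (\<lambda>i\<in>{1..k}. Z i \<omega>) [1..<Suc k] = map (\<lambda>i. Z i \<omega>) [1..<Suc k]" for \<omega>
    by (rule map_cong) auto
  ultimately show ?thesis by (simp only:)
qed

section \<open>Topology and measurability of finite sequences\<close>

lemma continuous_map_restrict_tendsto:
  assumes "continuous_map (product_topology (\<lambda>_. euclidean) I) euclideanreal f" "\<And>i. i \<in> I \<Longrightarrow> (X i \<longlongrightarrow> x i) F"
  shows "((\<lambda>j. f (\<lambda>i\<in>I. X i j)) \<longlongrightarrow> f (\<lambda>i\<in>I. x i)) F"
proof -
  have "limitin (product_topology (\<lambda>_. euclidean) I) (\<lambda>j. \<lambda>i\<in>I. X i j) (\<lambda>i\<in>I. x i) F"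
    unfolding limitin_componentwise using assms(2) by (auto simp: cong: tendsto_cong)
  from continuous_map_limit[OF assms(1) this] show ?thesis by (simp add: comp_def)
qed

text \<open>Restriction is continuous from the full function space, whose Borel sets are generated
  by the coordinates because the index type is countable and the values are second
  countable.\<close>

lemma borel_of_restrict_measurable:
  fixes Y :: "'i::countable \<Rightarrow> 'a \<Rightarrow> 'c::second_countable_topology"
  assumes "\<And>i. i \<in> I \<Longrightarrow> Y i \<in> borel_measurable M"
  shows "(\<lambda>\<omega>. \<lambda>i\<in>I. Y i \<omega>) \<in> measurable M (borel_of (product_topology (\<lambda>_. euclidean) I))"
proof -
  let ?T = "product_topology (\<lambda>_. euclidean) I :: ('i \<Rightarrow> 'c) topology"
  let ?h = "\<lambda>x :: 'i \<Rightarrow> 'c. restrict x I"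
  have c: "continuous_map euclidean ?T ?h"
    unfolding continuous_map_componentwise by (auto intro: continuous_on_product_coordinates)
  have top: "topspace ?T = Pi\<^sub>E I (\<lambda>_. UNIV)" by simp
  have "?h \<in> measurable borel (borel_of ?T)"
    unfolding borel_of_def
  proof (rule measurable_sigma_sets[OF _ ])
    show "sets (sigma (topspace ?T) {U. openin ?T U}) = sigma_sets (topspace ?T) {U. openin ?T U}"
      by (rule sets_measure_of) (use openin_subset in blast)
    show "{U. openin ?T U} \<subseteq> Pow (topspace ?T)" using openin_subset by blast
    show "?h \<in> space borel \<rightarrow> topspace ?T" by auto
    fix U assume "U \<in> {U. openin ?T U}"
    then have "openin euclidean {x \<in> topspace euclidean. ?h x \<in> U}" using openin_continuous_map_preimage[OF c] by blast
    then show "?h -` U \<inter> space borel \<in> sets borel" by (simp add: vimage_def)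
  qed
  moreover have "(\<lambda>\<omega> i. if i \<in> I then Y i \<omega> else (SOME c. True)) \<in> measurable M (borel :: ('i \<Rightarrow> 'c) measure)"
  proof (rule measurable_coordinatewise_then_product)
    fix i show "(\<lambda>\<omega>. if i \<in> I then Y i \<omega> else (SOME c. True)) \<in> borel_measurable M"
      by (cases "i \<in> I") (use assms in auto)
  qed
  ultimately have "(\<lambda>\<omega>. ?h (\<lambda>i. if i \<in> I then Y i \<omega> else (SOME c. True))) \<in> measurable M (borel_of ?T)"
    by (rule measurable_compose[rotated])
  moreover have "?h (\<lambda>i. if i \<in> I then Y i \<omega> else (SOME c. True)) = (\<lambda>i\<in>I. Y i \<omega>)" for \<omega> by auto
  ultimately show ?thesis by (simp only:)
qed

text \<open>Makes \<open>int \<times> real\<close>, the type of one entry of the sequence, second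
  countable, as \<open>borel_of_restrict_measurable\<close> demands.\<close>

instance int :: second_countable_topology
proof
  show "\<exists>B :: int set set. countable B \<and> open = generate_topology B"
    by (intro exI[of _ "range lessThan \<union> range greaterThan"]) (auto simp: open_int_def)
qed

section \<open>Decreasing sequences, counts and profiles\<close>

lemma decreasing_prefix:
  fixes b :: "nat \<Rightarrow> int"
  assumes dec: "\<And>i. 1 \<le> i \<Longrightarrow> b (Suc i) \<le> b i" and fin: "finite {i. 1 \<le> i \<and> c \<le> b i}"
  shows "{i. 1 \<le> i \<and> c \<le> b i} = {1..card {i. 1 \<le> i \<and> c \<le> b i}}"
proof -
  let ?S = "{i. 1 \<le> i \<and> c \<le> b i}"
  have anti: "b (i + k) \<le> b i" if "1 \<le> i" for i k
  proof (induction k)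
    case (Suc k)
    then show ?case using dec[of "i + k"] that by simp
  qed simp
  have down: "i \<in> ?S" if "j \<in> ?S" "1 \<le> i" "i \<le> j" for i j
    using anti[of i "j - i"] that by auto
  define m where "m = Max (insert 0 ?S)"
  have "?S = {1..m}"
  proof (cases "?S = {}")
    case True
    then show ?thesis unfolding m_def True by simp
  next
    case False
    have "m = Max ?S" unfolding m_def using fin False by simp
    have mS: "m \<in> ?S" unfolding \<open>m = Max ?S\<close> by (rule Max_in[OF fin False])
    have le: "j \<le> m" if "j \<in> ?S" for j unfolding \<open>m = Max ?S\<close> by (rule Max_ge[OF fin that])
    show ?thesis
    proof (rule set_eqI)
      fix i
      show "i \<in> ?S \<longleftrightarrow> i \<in> {1..m}"
        using le[of i] down[OF mS, of i] by (metis (no_types, lifting) atLeastAtMost_iff mem_Collect_eq)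
    qed
  qed
  then show ?thesis by simp
qed

lemma count_list_map_upt: "count_list (map b [1..<Suc k]) r = card {i \<in> {1..k}. b i = r}"
proof (induction k)
  case (Suc k)
  have "{i \<in> {1..Suc k}. b i = r} = (if b (Suc k) = r then insert (Suc k) {i \<in> {1..k}. b i = r} else {i \<in> {1..k}. b i = r})"
    by (auto simp: le_Suc_eq)
  then show ?case using Suc by (simp add: upt_Suc)
qed simp

lemma sorted_wrt_ge_unique:
  fixes xs ys :: "'r::linorder list"
  assumes "sorted_wrt (\<ge>) xs" "sorted_wrt (\<ge>) ys" "mset xs = mset ys"
  shows "xs = ys"
proof -
  have "sorted (rev xs)" "sorted (rev ys)" using assms by (auto simp: sorted_wrt_rev)
  moreover have "mset (rev xs) = mset (rev ys)" using assms by simp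
  ultimately have "rev xs = rev ys" by (metis properties_for_sort)
  then show ?thesis by simp
qed

lemma sorted_counts_unique:
  fixes xs ys :: "'r::linorder list"
  assumes "sorted_wrt (\<ge>) xs" "sorted_wrt (\<ge>) ys" "set xs \<subseteq> S" "set ys \<subseteq> S" "\<And>r. r \<in> S \<Longrightarrow> count_list xs r = count_list ys r"
  shows "xs = ys"
proof (rule sorted_wrt_ge_unique[OF assms(1,2)])
  show "mset xs = mset ys"
  proof (rule multiset_eqI)
    fix r
    show "count (mset xs) r = count (mset ys) r"
    proof (cases "r \<in> S")
      case True
      then show ?thesis using assms(5)[of r] by (simp add: count_list_mset)
    next
      case False
      then have "r \<notin> set xs" "r \<notin> set ys" using assms(3,4) by auto
      then show ?thesis by (simp add: count_list_mset[symmetric])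
    qed
  qed
qed

text \<open>\<open>arrangements rs\<close> is the product of the factorials of the multiplicities in
  \<open>rs\<close>. Hence the Poisson probabilities of cell counts take the same form as the limits
  on the tree side.\<close>

lemma prod_count_arrangements:
  fixes m :: "'r \<Rightarrow> real"
  assumes "finite S" "set rs \<subseteq> S"
  shows "(\<Prod>r\<in>S. m r ^ count_list rs r / fact (count_list rs r)) = prod_list (map m rs) / real (arrangements rs)"
  using assms(2)
proof (induction rs)
  case (Cons r rs)
  have r: "r \<in> S" using Cons.prems by simp
  let ?g = "\<lambda>rs s. m s ^ count_list rs s / fact (count_list rs s)"
  have "(\<Prod>s\<in>S. ?g (r # rs) s) = ?g (r # rs) r * (\<Prod>s\<in>S - {r}. ?g (r # rs) s)" by (rule prod.remove[OF assms(1) r])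
  also have "(\<Prod>s\<in>S - {r}. ?g (r # rs) s) = (\<Prod>s\<in>S - {r}. ?g rs s)" by (rule prod.cong) auto
  also have "?g (r # rs) r = m r / real (count_list (r # rs) r) * ?g rs r" by (simp add: field_simps)
  also have "m r / real (count_list (r # rs) r) * ?g rs r * (\<Prod>s\<in>S - {r}. ?g rs s)
      = m r / real (count_list (r # rs) r) * (\<Prod>s\<in>S. ?g rs s)"
    by (simp only: mult.assoc prod.remove[OF assms(1) r, of "?g rs"])
  also have "\<dots> = prod_list (map m (r # rs)) / real (arrangements (r # rs))"
    using Cons by (simp add: field_simps)
  finally show ?case .
qed simp

text \<open>At least \<open>K\<close> entries, so that the first \<open>K\<close> vertices can be
  read off; at most \<open>L\<close>, so that the set is finite; decreasing, so that each multiset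
  has one representative.\<close>

definition profiles :: "int \<Rightarrow> int \<Rightarrow> nat \<Rightarrow> nat \<Rightarrow> int list set" where
  "profiles c R K L = {rs. set rs \<subseteq> {c..<R} \<and> K \<le> length rs \<and> length rs \<le> L \<and> sorted_wrt (\<ge>) rs}"

lemma finite_profiles: "finite (profiles c R K L)"
  by (rule finite_subset[OF _ finite_lists_length_le[of "{c..<R}" L]]) (auto simp: profiles_def)

text \<open>Sequences are indexed from 1 and lists from 0, hence \<open>i - 1\<close>.\<close>

definition entries :: "nat \<Rightarrow> ((nat \<Rightarrow> int \<times> real) \<Rightarrow> real) \<Rightarrow> int list \<Rightarrow> real list \<Rightarrow> real" where
  "entries K f rs zs = f (\<lambda>i\<in>{1..K}. (rs ! (i - 1), zs ! (i - 1)))"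

lemma list_cont_entries:
  assumes "continuous_map (product_topology (\<lambda>_. euclidean) {1..K}) euclideanreal f" "K \<le> k"
  shows "list_cont k (entries K f rs)"
  unfolding list_conv_def entries_def
proof (intro allI impI)
  fix X and xs :: "real list" assume xs: "length xs = k" "\<forall>i<k. X i \<longlonglongrightarrow> xs ! i"
  show "(\<lambda>j. f (\<lambda>i\<in>{1..K}. (rs ! (i - 1), map (\<lambda>i. X i j) [0..<k] ! (i - 1)))) \<longlonglongrightarrow> f (\<lambda>i\<in>{1..K}. (rs ! (i - 1), xs ! (i - 1)))"
  proof (rule continuous_map_restrict_tendsto[OF assms(1)])
    fix i assume i: "i \<in> {1..K}"
    then have "i - 1 < k" using assms(2) by auto
    then have "X (i - 1) \<longlonglongrightarrow> xs ! (i - 1)" "\<And>j. map (\<lambda>i. X i j) [0..<k] ! (i - 1) = X (i - 1) j" using xs by auto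
    then show "(\<lambda>j. (rs ! (i - 1), map (\<lambda>i. X i j) [0..<k] ! (i - 1))) \<longlonglongrightarrow> (rs ! (i - 1), xs ! (i - 1))"
      by (intro tendsto_Pair tendsto_const) simp
  qed
qed

section \<open>Cell counts of the Poisson process\<close>

locale poisson_marks = prob_space N for N :: "'b measure" +
  fixes \<Xi> :: "'b \<Rightarrow> real measure" and P Z :: "nat \<Rightarrow> 'b \<Rightarrow> real" and q \<theta> \<epsilon> :: real
  assumes q_nonneg: "0 \<le> q" and theta: "1 < \<theta>"
    and ppp: "poisson_point_process N (density lborel (\<lambda>x. ennreal (q * \<theta> powr (- x) * ln \<theta>))) \<Xi>"
    and points: "decreasing_points N \<Xi> P"
    and marks_indep: "indep_vars (\<lambda>_. borel) Z {1..}"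
    and marks_law: "\<And>i. i \<ge> 1 \<Longrightarrow> distr N borel (Z i) = std_normal_distribution"
    and points_marks_indep: "indep_var
      (Pi\<^sub>M {1..} (\<lambda>_. borel)) (\<lambda>\<omega>. \<lambda>i\<in>{1..}. P i \<omega>)
      (Pi\<^sub>M {1..} (\<lambda>_. borel)) (\<lambda>\<omega>. \<lambda>i\<in>{1..}. Z i \<omega>)"
begin

abbreviation Lam :: "real measure" where "Lam \<equiv> density lborel (\<lambda>x. ennreal (q * \<theta> powr (- x) * ln \<theta>))"

definition cell :: "int \<Rightarrow> real set" where "cell r = {of_int r - \<epsilon> ..< of_int r + 1 - \<epsilon>}"

definition mass :: "int \<Rightarrow> real" where "mass r = q * (\<theta> powr (\<epsilon> - of_int r) - \<theta> powr (\<epsilon> - of_int r - 1))"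

lemma emeasure_Lam:
  assumes "a \<le> b"
  shows "emeasure Lam {a..<b} = ennreal (q * (\<theta> powr (- a) - \<theta> powr (- b)))"
proof -
  let ?f = "\<lambda>x. q * \<theta> powr (- x) * ln \<theta>"
  let ?F = "\<lambda>x. - (q * \<theta> powr (- x))"
  have "emeasure Lam {a..<b} = (\<integral>\<^sup>+x. ennreal (?f x) * indicator {a..<b} x \<partial>lborel)"
    by (rule emeasure_density) auto
  also have "\<dots> = (\<integral>\<^sup>+x. ennreal (?f x) * indicator {a..b} x \<partial>lborel)"
    by (rule nn_integral_cong_AE, rule AE_mp[OF AE_lborel_singleton[of b]], rule AE_I2) (auto simp: indicator_def)
  also have "\<dots> = ennreal (?F b - ?F a)"
  proof (rule nn_integral_FTC_Icc[OF _ _ _ assms])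
    fix x
    have "((\<lambda>x. - (q * exp (- x * ln \<theta>))) has_real_derivative q * exp (- x * ln \<theta>) * ln \<theta>) (at x)"
      by (auto intro!: derivative_eq_intros)
    then show "(?F has_real_derivative ?f x) (at x)" using theta by (simp add: powr_def)
    show "0 \<le> ?f x" using q_nonneg theta by simp
  qed measurable
  finally show ?thesis by (simp add: algebra_simps)
qed

lemma measure_Lam:
  assumes "a \<le> b"
  shows "measure Lam {a..<b} = q * (\<theta> powr (- a) - \<theta> powr (- b))" "emeasure Lam {a..<b} < \<infinity>"
proof -
  have "\<theta> powr (- b) \<le> \<theta> powr (- a)" using assms theta by simp
  then show "measure Lam {a..<b} = q * (\<theta> powr (- a) - \<theta> powr (- b))"
    unfolding measure_def emeasure_Lam[OF assms] using q_nonneg by simp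
  show "emeasure Lam {a..<b} < \<infinity>" unfolding emeasure_Lam[OF assms] by simp
qed

lemma measure_cell: "measure Lam (cell r) = mass r" "emeasure Lam (cell r) < \<infinity>"
  using measure_Lam[of "of_int r - \<epsilon>" "of_int r + 1 - \<epsilon>"] unfolding cell_def mass_def by (auto simp: algebra_simps)

lemma cell_sets: "cell r \<in> sets borel" unfolding cell_def by simp

lemma in_cell: "x \<in> cell r \<longleftrightarrow> \<lfloor>x + \<epsilon>\<rfloor> = r"
  unfolding cell_def by (auto simp: floor_eq_iff)

lemma count_measurable: "A \<in> sets borel \<Longrightarrow> (\<lambda>\<omega>. emeasure (\<Xi> \<omega>) A) \<in> borel_measurable N"
  using ppp unfolding poisson_point_process_def by auto

lemma count_law: "A \<in> sets borel \<Longrightarrow> emeasure Lam A < \<infinity> \<Longrightarrow>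
  prob {\<omega> \<in> space N. emeasure (\<Xi> \<omega>) A = of_nat k} = measure Lam A ^ k / fact k * exp (- measure Lam A)"
  using ppp unfolding poisson_point_process_def by auto

definition counts :: "int \<Rightarrow> int \<Rightarrow> int list \<Rightarrow> 'b set" where
  "counts c R rs = {\<omega> \<in> space N. \<forall>r\<in>{c..<R}. emeasure (\<Xi> \<omega>) (cell r) = of_nat (count_list rs r)}"

lemma counts_sets: "counts c R rs \<in> sets N"
  unfolding counts_def using count_measurable[OF cell_sets] by measurable

definition weight :: "int \<Rightarrow> int \<Rightarrow> int list \<Rightarrow> real" where
  "weight c R rs = prod_list (map mass rs) / real (arrangements rs) * exp (- (\<Sum>r\<in>{c..<R}. mass r))"

lemma prob_counts:
  assumes "set rs \<subseteq> {c..<R}"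
  shows "prob (counts c R rs) = weight c R rs"
proof (cases "c < R")
  case False
  then have "rs = []" "{c..<R} = {}" using assms by auto
  then show ?thesis using prob_space by (simp add: counts_def weight_def)
next
  case True
  \<comment> \<open>The cells are renumbered from 0, as independence in
    \<open>poisson_point_process\<close> is stated for index sets of natural numbers.\<close>
  define n where "n = nat (R - c)"
  have n: "n \<noteq> 0" using True by (simp add: n_def)
  have bij: "bij_betw (\<lambda>j. c + int j) {..<n} {c..<R}"
    by (rule bij_betwI[where g = "\<lambda>r. nat (r - c)"]) (auto simp: n_def)
  let ?X = "\<lambda>j \<omega>. emeasure (\<Xi> \<omega>) (cell (c + int j))"
  let ?Y = "\<lambda>j. {of_nat (count_list rs (c + int j)) :: ennreal}"
  have ind: "indep_vars (\<lambda>_. borel) ?X {..<n}"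
  proof -
    have "disjoint_family_on (\<lambda>j. cell (c + int j)) {..<n}"
      by (auto simp: disjoint_family_on_def in_cell)
    moreover have "(\<lambda>j. cell (c + int j)) ` {..<n} \<subseteq> sets Lam" using cell_sets by auto
    ultimately show ?thesis
      using ppp[unfolded poisson_point_process_def, THEN conjunct2, THEN conjunct2, THEN conjunct2, rule_format, of "{..<n}" "\<lambda>j. cell (c + int j)"]
      by simp
  qed
  have ev: "counts c R rs = (\<Inter>j\<in>{..<n}. ?X j -` ?Y j \<inter> space N)"
  proof (rule set_eqI)
    fix \<omega>
    have "\<omega> \<in> counts c R rs \<longleftrightarrow> \<omega> \<in> space N \<and> (\<forall>r\<in>(\<lambda>j. c + int j) ` {..<n}. emeasure (\<Xi> \<omega>) (cell r) = of_nat (count_list rs r))"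
      unfolding bij_betw_imp_surj_on[OF bij] counts_def by simp
    also have "\<dots> \<longleftrightarrow> \<omega> \<in> (\<Inter>j\<in>{..<n}. ?X j -` ?Y j \<inter> space N)" using n by auto
    finally show "\<omega> \<in> counts c R rs \<longleftrightarrow> \<omega> \<in> (\<Inter>j\<in>{..<n}. ?X j -` ?Y j \<inter> space N)" .
  qed
  have "prob (counts c R rs) = (\<Prod>j\<in>{..<n}. prob (?X j -` ?Y j \<inter> space N))"
    unfolding ev by (rule indep_varsD[OF ind]) (use n in auto)
  also have "\<dots> = (\<Prod>j\<in>{..<n}. mass (c + int j) ^ count_list rs (c + int j) / fact (count_list rs (c + int j)) * exp (- mass (c + int j)))"
  proof (rule prod.cong[OF refl])
    fix j
    have "?X j -` ?Y j \<inter> space N = {\<omega> \<in> space N. emeasure (\<Xi> \<omega>) (cell (c + int j)) = of_nat (count_list rs (c + int j))}" by auto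
    then show "prob (?X j -` ?Y j \<inter> space N) = mass (c + int j) ^ count_list rs (c + int j) / fact (count_list rs (c + int j)) * exp (- mass (c + int j))"
      using count_law[OF cell_sets measure_cell(2)] by (simp add: measure_cell)
  qed
  also have "\<dots> = (\<Prod>r\<in>{c..<R}. mass r ^ count_list rs r / fact (count_list rs r) * exp (- mass r))"
    by (rule prod.reindex_bij_betw[OF bij])
  also have "\<dots> = (\<Prod>r\<in>{c..<R}. mass r ^ count_list rs r / fact (count_list rs r)) * exp (- (\<Sum>r\<in>{c..<R}. mass r))"
    by (simp only: prod.distrib sum_negf[symmetric] exp_sum[OF finite_atLeastLessThan_int])
  finally show ?thesis unfolding prod_count_arrangements[OF finite_atLeastLessThan_int assms] weight_def .
qed

lemma P_measurable: "1 \<le> i \<Longrightarrow> P i \<in> borel_measurable N"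
  using points unfolding decreasing_points_def by auto

lemma Z_measurable: "1 \<le> i \<Longrightarrow> Z i \<in> borel_measurable N"
  using marks_indep unfolding indep_vars_def by auto

abbreviation b :: "nat \<Rightarrow> 'b \<Rightarrow> int" where "b i \<omega> \<equiv> \<lfloor>P i \<omega> + \<epsilon>\<rfloor>"

lemma emeasure_points:
  assumes "A \<in> sets borel"
  shows "emeasure (distr (count_space {1..}) borel x) A = emeasure (count_space {1..}) {i :: nat. 1 \<le> i \<and> x i \<in> A}"
proof -
  have "emeasure (distr (count_space {1..}) borel x) A = emeasure (count_space {1..}) (x -` A \<inter> {1..})"
    using emeasure_distr[of x "count_space {1..}" borel A] assms by simp
  also have "x -` A \<inter> {1..} = {i. 1 \<le> i \<and> x i \<in> A}" by auto
  finally show ?thesis .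
qed

text \<open>As a series the count is visibly a measurable function of the sequence of
  points.\<close>

lemma emeasure_points_suminf:
  assumes "A \<in> sets borel"
  shows "emeasure (distr (count_space {1..}) borel x) A = (\<Sum>i. indicator A (x (Suc i)))"
proof -
  have "emeasure (distr (count_space {1..}) borel x) A = (\<integral>\<^sup>+y. indicator A y \<partial>distr (count_space {1..}) borel x)"
    using assms by simp
  also have "\<dots> = (\<integral>\<^sup>+i. indicator A (x i) \<partial>count_space {1..})" by (rule nn_integral_distr) (use assms in auto)
  also have "\<dots> = (\<integral>\<^sup>+i. indicator A (x (Suc i)) \<partial>count_space UNIV)"
  proof (rule nn_integral_bij_count_space[symmetric])
    show "bij_betw Suc UNIV {1..}" by (rule bij_betwI[where g = "\<lambda>i. i - 1"]) auto
  qed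
  also have "\<dots> = (\<Sum>i. indicator A (x (Suc i)))" by (rule nn_integral_count_space_nat)
  finally show ?thesis .
qed

text \<open>The event \<open>counts\<close> expressed through the points instead of
  \<open>\<Xi>\<close>, because the marks are assumed independent of the points.\<close>

definition point_counts :: "int \<Rightarrow> int \<Rightarrow> int list \<Rightarrow> (nat \<Rightarrow> real) \<Rightarrow> real" where
  "point_counts c R rs x = (if \<forall>r\<in>{c..<R}. (\<Sum>i. indicator (cell r) (x (Suc i)) :: ennreal) = of_nat (count_list rs r) then 1 else 0)"

lemma point_counts_measurable: "point_counts c R rs \<in> borel_measurable (Pi\<^sub>M {1..} (\<lambda>_. borel))"
proof -
  have 1: "(\<lambda>x. \<Sum>i. indicator (cell r) (x (Suc i)) :: ennreal) \<in> borel_measurable (Pi\<^sub>M {1..} (\<lambda>_. borel))" for r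
  proof (rule borel_measurable_suminf_order)
    fix i
    show "(\<lambda>x. indicator (cell r) (x (Suc i)) :: ennreal) \<in> borel_measurable (Pi\<^sub>M {1..} (\<lambda>_. borel))"
      by (rule measurable_compose[OF measurable_component_singleton borel_measurable_indicator]) (auto simp: cell_sets)
  qed
  note [measurable] = 1
  show ?thesis unfolding point_counts_def by measurable
qed

lemma AE_points: "AE \<omega> in N. (\<forall>i\<ge>1. P (Suc i) \<omega> \<le> P i \<omega>) \<and> \<Xi> \<omega> = distr (count_space {1..}) borel (\<lambda>i. P i \<omega>)"
  using points unfolding decreasing_points_def by auto

text \<open>The two descriptions of the counts agree almost surely, and independence of points and
  marks then factorises the expectation.\<close>

lemma expectation_counts:
  assumes "set rs \<subseteq> {c..<R}" "list_cont k g" "\<And>xs. \<bar>g xs\<bar> \<le> B"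
  shows "expectation (\<lambda>\<omega>. indicator (counts c R rs) \<omega> * g (map (\<lambda>i. Z i \<omega>) [1..<Suc k])) = weight c R rs * normal_integral k g"
    and "(\<lambda>\<omega>. g (map (\<lambda>i. Z i \<omega>) [1..<Suc k])) \<in> borel_measurable N"
proof -
  let ?h = "\<lambda>z :: nat \<Rightarrow> real. g (map z [1..<Suc k])"
  let ?Pr = "\<lambda>\<omega>. \<lambda>i\<in>{1..}. P i \<omega>" and ?Zr = "\<lambda>\<omega>. \<lambda>i\<in>{1..}. Z i \<omega>"
  have hm: "?h \<in> borel_measurable (Pi\<^sub>M {1..} (\<lambda>_. borel))"
  proof -
    have "(\<lambda>z. restrict z {1..k}) \<in> measurable (Pi\<^sub>M {1..} (\<lambda>_. borel)) (Pi\<^sub>M {1..k} (\<lambda>_. borel))"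
      by (rule measurable_restrict_subset) auto
    from measurable_compose[OF this list_cont_measurable[OF assms(2)]]
    have "(\<lambda>z. ?h (restrict z {1..k})) \<in> borel_measurable (Pi\<^sub>M {1..} (\<lambda>_. borel))" .
    moreover have "?h (restrict z {1..k}) = ?h z" for z by (intro arg_cong[where f = g] map_cong) auto
    ultimately show ?thesis by (simp only:)
  qed
  have hZ: "?h (?Zr \<omega>) = g (map (\<lambda>i. Z i \<omega>) [1..<Suc k])" for \<omega> by (intro arg_cong[where f = g] map_cong) auto
  have "indep_var borel (point_counts c R rs \<circ> ?Pr) borel (?h \<circ> ?Zr)"
    by (rule indep_var_compose[OF points_marks_indep point_counts_measurable hm])
  note ind = this
  have m1: "(point_counts c R rs \<circ> ?Pr) \<in> borel_measurable N" and m2: "(?h \<circ> ?Zr) \<in> borel_measurable N"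
    using indep_var_rv1[OF ind] indep_var_rv2[OF ind] by auto
  show "(\<lambda>\<omega>. g (map (\<lambda>i. Z i \<omega>) [1..<Suc k])) \<in> borel_measurable N" using m2 by (simp only: comp_def hZ)
  have i1: "integrable N (point_counts c R rs \<circ> ?Pr)"
    by (rule integrable_const_bound[where B = 1]) (use m1 in \<open>auto simp: point_counts_def\<close>)
  have i2: "integrable N (?h \<circ> ?Zr)"
    by (rule integrable_const_bound[where B = B]) (use m2 assms(3) in auto)
  have AE: "AE \<omega> in N. (point_counts c R rs \<circ> ?Pr) \<omega> = indicator (counts c R rs) \<omega>"
    using AE_points AE_space
  proof eventually_elim
    case (elim \<omega>)
    have "emeasure (\<Xi> \<omega>) (cell r) = (\<Sum>i. indicator (cell r) (?Pr \<omega> (Suc i)))" for r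
      using elim(1) emeasure_points_suminf[OF cell_sets, of "\<lambda>i. P i \<omega>" r] by simp
    then show ?case using elim(2) by (simp add: point_counts_def counts_def comp_def)
  qed
  have 1: "expectation (\<lambda>\<omega>. indicator (counts c R rs) \<omega> * g (map (\<lambda>i. Z i \<omega>) [1..<Suc k])) = expectation (\<lambda>\<omega>. (point_counts c R rs \<circ> ?Pr) \<omega> * (?h \<circ> ?Zr) \<omega>)"
  proof (rule integral_cong_AE)
    show "AE \<omega> in N. indicator (counts c R rs) \<omega> * g (map (\<lambda>i. Z i \<omega>) [1..<Suc k]) = (point_counts c R rs \<circ> ?Pr) \<omega> * (?h \<circ> ?Zr) \<omega>"
      using AE by eventually_elim (simp only: comp_def hZ)
    have "(\<lambda>\<omega>. g (map (\<lambda>i. Z i \<omega>) [1..<Suc k])) \<in> borel_measurable N" using m2 by (simp only: comp_def hZ)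
    then show "(\<lambda>\<omega>. indicator (counts c R rs) \<omega> * g (map (\<lambda>i. Z i \<omega>) [1..<Suc k])) \<in> borel_measurable N"
      by (intro borel_measurable_times borel_measurable_indicator counts_sets)
  qed (intro borel_measurable_times m1 m2)
  have 2: "expectation (\<lambda>\<omega>. (point_counts c R rs \<circ> ?Pr) \<omega> * (?h \<circ> ?Zr) \<omega>) = expectation (point_counts c R rs \<circ> ?Pr) * expectation (?h \<circ> ?Zr)"
    by (rule indep_var_lebesgue_integral[OF ind i1 i2])
  have 3: "expectation (point_counts c R rs \<circ> ?Pr) = expectation (indicator (counts c R rs))"
  proof (rule integral_cong_AE[OF m1 _ AE])
    show "indicator (counts c R rs) \<in> borel_measurable N" by (rule borel_measurable_indicator[OF counts_sets])
  qed
  have 4: "expectation (indicator (counts c R rs)) = weight c R rs"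
    using prob_counts[OF assms(1)] sets.Int_space_eq2[OF counts_sets, of c R rs] by simp
  have 5: "expectation (?h \<circ> ?Zr) = normal_integral k g"
    unfolding comp_def hZ by (rule expectation_iid_normal[OF marks_indep marks_law assms(2,3)])
  show "expectation (\<lambda>\<omega>. indicator (counts c R rs) \<omega> * g (map (\<lambda>i. Z i \<omega>) [1..<Suc k])) = weight c R rs * normal_integral k g"
    unfolding 1 2 3 4 5 ..
qed

end

lemma continuous_map_borel_of:
  assumes "continuous_map T euclideanreal f"
  shows "f \<in> borel_measurable (borel_of T)"
proof (rule borel_measurableI)
  fix S :: "real set" assume S: "open S"
  have sp: "space (borel_of T) = topspace T" unfolding borel_of_def by (rule space_measure_of) (use openin_subset in blast)
  have st: "sets (borel_of T) = sigma_sets (topspace T) {U. openin T U}"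
    unfolding borel_of_def by (rule sets_measure_of) (use openin_subset in blast)
  have "openin T {x \<in> topspace T. f x \<in> S}" using openin_continuous_map_preimage[OF assms] S by (simp add: open_openin[symmetric])
  then have "{x \<in> topspace T. f x \<in> S} \<in> sets (borel_of T)" unfolding st by (intro sigma_sets.Basic) simp
  moreover have "f -` S \<inter> space (borel_of T) = {x \<in> topspace T. f x \<in> S}" unfolding sp by blast
  ultimately show "f -` S \<inter> space (borel_of T) \<in> sets (borel_of T)" by (simp only:)
qed

lemma sum_single_nonzero:
  fixes g :: "'x \<Rightarrow> real"
  assumes "finite F" "x \<in> F" "\<And>y. y \<in> F \<Longrightarrow> y \<noteq> x \<Longrightarrow> g y = 0"
  shows "sum g F = g x"
proof -
  have "sum g (F - {x}) = 0" by (rule sum.neutral) (use assms(3) in blast)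
  then show ?thesis using sum.remove[OF assms(1,2), of g] by simp
qed

lemma abs_sum_unique_le:
  fixes g :: "'x \<Rightarrow> real"
  assumes "finite F" "\<And>x y. x \<in> F \<Longrightarrow> y \<in> F \<Longrightarrow> g x \<noteq> 0 \<Longrightarrow> g y \<noteq> 0 \<Longrightarrow> x = y" "\<And>x. x \<in> F \<Longrightarrow> \<bar>g x\<bar> \<le> B" "0 \<le> B"
  shows "\<bar>sum g F\<bar> \<le> B"
proof (cases "\<exists>x\<in>F. g x \<noteq> 0")
  case True
  then obtain x where x: "x \<in> F" "g x \<noteq> 0" by blast
  have "sum g F = g x"
  proof (rule sum_single_nonzero[OF assms(1) x(1)])
    fix y assume "y \<in> F" "y \<noteq> x"
    then show "g y = 0" using assms(2)[of x y] x by blast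
  qed
  then show ?thesis using assms(3)[OF x(1)] by simp
next
  case False
  then have "sum g F = 0" by (intro sum.neutral) blast
  then show ?thesis using assms(4) by simp
qed

lemma decreasing_le_first:
  fixes b :: "nat \<Rightarrow> 'r::preorder"
  assumes "\<And>i. 1 \<le> i \<Longrightarrow> b (Suc i) \<le> b i" "1 \<le> i" "i \<le> j"
  shows "b j \<le> b i"
  using assms(3)
proof (induction j rule: dec_induct)
  case (step n)
  show ?case by (rule order_trans[OF assms(1) step.IH]) (use step assms(2) in linarith)
qed simp

lemma sorted_profile:
  fixes b :: "nat \<Rightarrow> int"
  assumes dec: "\<And>i. 1 \<le> i \<Longrightarrow> b (Suc i) \<le> b i" and R: "b 1 < R" and S: "{i. 1 \<le> i \<and> c \<le> b i} = {1..k}"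
  defines "rs \<equiv> map b [1..<Suc k]"
  shows "set rs \<subseteq> {c..<R}" "sorted_wrt (\<ge>) rs" "\<And>r. c \<le> r \<Longrightarrow> {i. 1 \<le> i \<and> b i = r} = {i \<in> {1..k}. b i = r}"
proof -
  note anti = decreasing_le_first[of b, OF dec]
  have "c \<le> b i \<and> b i < R" if "i \<in> {1..k}" for i
  proof -
    have "1 \<le> i" "c \<le> b i" using that unfolding S[symmetric] by auto
    then show ?thesis using anti[of 1 i] R by simp
  qed
  then show "set rs \<subseteq> {c..<R}" unfolding rs_def set_map set_upt by fastforce
  show "sorted_wrt (\<ge>) rs"
    unfolding rs_def sorted_wrt_iff_nth_less
  proof (intro allI impI)
    fix i j assume ij: "i < j" "j < length (map b [1..<Suc k])"
    then have "map b [1..<Suc k] ! i = b (1 + i)" "map b [1..<Suc k] ! j = b (1 + j)"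
      by (simp_all del: upt_Suc)
    then show "map b [1..<Suc k] ! i \<ge> map b [1..<Suc k] ! j" using anti[of "1 + i" "1 + j"] ij by simp
  qed
  show "{i. 1 \<le> i \<and> b i = r} = {i \<in> {1..k}. b i = r}" if "c \<le> r" for r
    unfolding S[symmetric] using that by auto
qed

context poisson_marks
begin

lemma emeasure_cell:
  assumes "\<Xi> \<omega> = distr (count_space {1..}) borel (\<lambda>i. P i \<omega>)"
  shows "emeasure (\<Xi> \<omega>) (cell r) = emeasure (count_space {1..}) {i. 1 \<le> i \<and> b i \<omega> = r}"
  unfolding assms emeasure_points[OF cell_sets] in_cell by (rule refl)

lemma profiles_counts_unique:
  assumes "rs \<in> profiles c R K L" "rs' \<in> profiles c R K L" "\<omega> \<in> counts c R rs" "\<omega> \<in> counts c R rs'"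
  shows "rs = rs'"
proof (rule sorted_counts_unique[where S = "{c..<R}"])
  fix r assume r: "r \<in> {c..<R}"
  have "(of_nat (count_list rs r) :: ennreal) = of_nat (count_list rs' r)"
    using assms(3,4) r unfolding counts_def by simp
  then show "count_list rs r = count_list rs' r" by simp
qed (use assms(1,2) in \<open>simp_all add: profiles_def\<close>)

text \<open>When all points lie below the upper end and finitely many above the lower end, the
  points of the range form an initial segment of the decreasing sequence. It includes point
  \<open>K + 1\<close>, so at least \<open>K\<close> points are read off.\<close>

lemma counts_prefix:
  assumes dec: "\<forall>i\<ge>1. P (Suc i) \<omega> \<le> P i \<omega>" and Xi: "\<Xi> \<omega> = distr (count_space {1..}) borel (\<lambda>i. P i \<omega>)" and sp: "\<omega> \<in> space N"
    and R: "P 1 \<omega> < of_int R - \<epsilon>" and c: "of_int c - \<epsilon> \<le> P (Suc K) \<omega>"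
    and J: "emeasure (\<Xi> \<omega>) {of_int c - \<epsilon> ..< of_int R - \<epsilon>} = of_nat m" "m \<le> L"
  shows "\<exists>k\<ge>K. map (\<lambda>i. b i \<omega>) [1..<Suc k] \<in> profiles c R K L \<and> \<omega> \<in> counts c R (map (\<lambda>i. b i \<omega>) [1..<Suc k])"
proof -
  let ?b = "\<lambda>i. b i \<omega>"
  let ?S = "{i. 1 \<le> i \<and> c \<le> ?b i}"
  have bdec: "?b (Suc i) \<le> ?b i" if "1 \<le> i" for i using dec that by (intro floor_mono) simp
  have P1: "P i \<omega> \<le> P 1 \<omega>" if "1 \<le> i" for i using decreasing_le_first[of "\<lambda>i. P i \<omega>" 1 i] dec that by simp
  have bR: "?b 1 < R" using R by (simp add: floor_less_iff)
  have "emeasure (count_space {1..}) {i. 1 \<le> i \<and> P i \<omega> \<in> {of_int c - \<epsilon> ..< of_int R - \<epsilon>}} = of_nat m"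
    using J(1) unfolding Xi by (subst (asm) emeasure_points) simp_all
  also have "{i. 1 \<le> i \<and> P i \<omega> \<in> {of_int c - \<epsilon> ..< of_int R - \<epsilon>}} = ?S"
  proof (rule Collect_cong)
    fix i
    have "c \<le> ?b i \<longleftrightarrow> of_int c - \<epsilon> \<le> P i \<omega>" by (simp add: le_floor_iff) linarith
    then show "(1 \<le> i \<and> P i \<omega> \<in> {of_int c - \<epsilon> ..< of_int R - \<epsilon>}) \<longleftrightarrow> 1 \<le> i \<and> c \<le> ?b i" using P1[of i] R by auto
  qed
  finally have Sm: "emeasure (count_space {1..}) ?S = of_nat m" .
  have sub: "?S \<subseteq> {1..}" by auto
  have fin: "finite ?S"
  proof (rule ccontr)
    assume "infinite ?S"
    then show False using Sm emeasure_count_space_infinite[OF sub] by simp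
  qed
  then have m: "card ?S = m" using Sm emeasure_count_space_finite[OF sub] by simp
  have S: "?S = {1..m}" using decreasing_prefix[of ?b c] bdec fin unfolding m by blast
  have "Suc K \<in> ?S" using c by (simp add: le_floor_iff)
  then have Km: "K \<le> m" unfolding S by simp
  note prof = sorted_profile[of ?b R c m, OF bdec bR S]
  have "\<omega> \<in> counts c R (map ?b [1..<Suc m])"
    unfolding counts_def
  proof (intro CollectI conjI ballI sp)
    fix r assume r: "r \<in> {c..<R}"
    have "emeasure (\<Xi> \<omega>) (cell r) = emeasure (count_space {1..}) {i \<in> {1..m}. ?b i = r}"
      unfolding emeasure_cell[OF Xi] using prof(3)[of r] r by simp
    also have "\<dots> = of_nat (card {i \<in> {1..m}. ?b i = r})" by (rule emeasure_count_space_finite) auto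
    finally show "emeasure (\<Xi> \<omega>) (cell r) = of_nat (count_list (map ?b [1..<Suc m]) r)"
      by (simp only: count_list_map_upt)
  qed
  moreover have "map ?b [1..<Suc m] \<in> profiles c R K L"
    unfolding profiles_def using prof(1,2) Km J(2) by (simp del: upt_Suc)
  ultimately show ?thesis using Km by blast
qed

text \<open>Tightness of three random variables: point \<open>K + 1\<close> (rather than
  \<open>K\<close>, which may be 0), the highest point, and the Poisson count in between. The free
  lower bound \<open>R0\<close> lets the tree side impose its own requirement on
  \<open>R\<close>.\<close>

lemma tail_bounds:
  assumes "0 < \<eta>"
  shows "\<exists>c R L. R0 \<le> R \<and> prob {\<omega> \<in> space N. P (Suc K) \<omega> < of_int c - \<epsilon>} \<le> \<eta> \<and>
    prob {\<omega> \<in> space N. of_int R - \<epsilon> \<le> P 1 \<omega>} \<le> \<eta> \<and>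
    prob {\<omega> \<in> space N. \<not> (\<exists>m\<le>L. emeasure (\<Xi> \<omega>) {of_int c - \<epsilon> ..< of_int R - \<epsilon>} = of_nat m)} \<le> \<eta>"
proof -
  have [measurable]: "P i \<in> borel_measurable N" if "1 \<le> i" for i by (rule P_measurable[OF that])
  interpret A: real_distribution "distr N borel (P (Suc K))" by (rule real_distribution_distr) (simp add: P_measurable)
  interpret A1: real_distribution "distr N borel (P 1)" by (rule real_distribution_distr) (simp add: P_measurable)
  have "\<forall>\<^sub>F x in at_bot. cdf (distr N borel (P (Suc K))) x < \<eta>"
    using order_tendstoD(2)[OF A.cdf_lim_at_bot assms] .
  then obtain x0 where x0: "cdf (distr N borel (P (Suc K))) x0 < \<eta>" unfolding eventually_at_bot_linorder by blast
  have "\<forall>\<^sub>F x in at_top. 1 - \<eta> < cdf (distr N borel (P 1)) x"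
    using order_tendstoD(1)[OF A1.cdf_lim_at_top_prob, of "1 - \<eta>"] assms by simp
  then obtain x1 where x1: "1 - \<eta> < cdf (distr N borel (P 1)) x1" unfolding eventually_at_top_linorder by blast
  define c where "c = \<lfloor>x0 + \<epsilon>\<rfloor>"
  \<comment> \<open>The maximum with \<open>c\<close> keeps the interval in the right order, as
    \<open>measure_Lam\<close> requires.\<close>
  define R where "R = max (max R0 c) (\<lceil>x1 + \<epsilon>\<rceil> + 1)"
  have cx: "of_int c - \<epsilon> \<le> x0" unfolding c_def by linarith
  have Rx: "x1 < of_int R - \<epsilon>" unfolding R_def by linarith
  have "prob {\<omega> \<in> space N. P (Suc K) \<omega> < of_int c - \<epsilon>} \<le> prob {\<omega> \<in> space N. P (Suc K) \<omega> \<le> x0}"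
    by (rule finite_measure_mono) (use cx in auto)
  also have "\<dots> = cdf (distr N borel (P (Suc K))) x0"
    unfolding cdf_def by (subst measure_distr) (auto intro!: arg_cong[where f = prob] simp: P_measurable)
  finally have 1: "prob {\<omega> \<in> space N. P (Suc K) \<omega> < of_int c - \<epsilon>} \<le> \<eta>" using x0 by simp
  have ms1: "{\<omega> \<in> space N. P 1 \<omega> \<le> x1} \<in> events" by measurable
  have "prob {\<omega> \<in> space N. of_int R - \<epsilon> \<le> P 1 \<omega>} \<le> prob (space N - {\<omega> \<in> space N. P 1 \<omega> \<le> x1})"
    by (rule finite_measure_mono) (use Rx ms1 in auto)
  also have "\<dots> = 1 - prob {\<omega> \<in> space N. P 1 \<omega> \<le> x1}" by (rule prob_compl[OF ms1])
  also have "prob {\<omega> \<in> space N. P 1 \<omega> \<le> x1} = cdf (distr N borel (P 1)) x1"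
    unfolding cdf_def by (subst measure_distr) (auto intro!: arg_cong[where f = prob] simp: P_measurable)
  finally have 2: "prob {\<omega> \<in> space N. of_int R - \<epsilon> \<le> P 1 \<omega>} \<le> \<eta>" using x1 by simp
  define J where "J = {of_int c - \<epsilon> ..< of_int R - \<epsilon>}"
  have "c \<le> R" unfolding R_def by simp
  then have Jfin: "emeasure Lam J < \<infinity>" unfolding J_def by (intro measure_Lam) simp
  have Jb: "J \<in> sets borel" unfolding J_def by simp
  define t where "t = measure Lam J"
  have "(\<lambda>k. t ^ k /\<^sub>R fact k * exp (- t)) sums (exp t * exp (- t))" by (intro sums_mult2 exp_converges)
  then have "(\<lambda>L. \<Sum>k<L. t ^ k / fact k * exp (- t)) \<longlonglongrightarrow> 1"
    unfolding sums_def by (simp add: exp_minus_inverse divide_inverse mult.commute)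
  then have "\<forall>\<^sub>F L in sequentially. 1 - \<eta> < (\<Sum>k<L. t ^ k / fact k * exp (- t))" by (rule order_tendstoD(1)) (use assms in simp)
  then obtain L where "1 - \<eta> < (\<Sum>k<L. t ^ k / fact k * exp (- t))" unfolding eventually_sequentially by blast
  also have "\<dots> \<le> (\<Sum>k\<le>L. t ^ k / fact k * exp (- t))"
    by (rule sum_mono2) (auto simp: t_def)
  finally have L: "1 - \<eta> < (\<Sum>k\<le>L. t ^ k / fact k * exp (- t))" .
  let ?E = "\<lambda>k. {\<omega> \<in> space N. emeasure (\<Xi> \<omega>) J = of_nat k}"
  note [measurable] = count_measurable[OF Jb]
  have Es: "?E k \<in> events" for k by measurable
  have "(\<Sum>k\<le>L. t ^ k / fact k * exp (- t)) = (\<Sum>k\<in>{..L}. prob (?E k))"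
    by (rule sum.cong) (simp_all add: count_law[OF Jb Jfin] t_def)
  also have "\<dots> = prob (\<Union>k\<in>{..L}. ?E k)"
  proof (rule finite_measure_finite_Union[symmetric])
    show "?E ` {..L} \<subseteq> events" using Es by blast
    show "disjoint_family_on ?E {..L}" unfolding disjoint_family_on_def by auto
  qed simp
  finally have U: "1 - \<eta> < prob (\<Union>k\<in>{..L}. ?E k)" using L by simp
  have Us: "(\<Union>k\<in>{..L}. ?E k) \<in> events" using Es by auto
  have "{\<omega> \<in> space N. \<not> (\<exists>m\<le>L. emeasure (\<Xi> \<omega>) J = of_nat m)} = space N - (\<Union>k\<in>{..L}. ?E k)" by auto
  then have 3: "prob {\<omega> \<in> space N. \<not> (\<exists>m\<le>L. emeasure (\<Xi> \<omega>) J = of_nat m)} \<le> \<eta>"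
    using prob_compl[OF Us] U by simp
  have "R0 \<le> R" unfolding R_def by simp
  then show ?thesis using 1 2 3 unfolding J_def by blast
qed

lemma limit_measurable:
  "(\<lambda>\<omega>. \<lambda>i\<in>{1..K}. (b i \<omega>, Z i \<omega>)) \<in> measurable N (borel_of (product_topology (\<lambda>_. euclidean) {1..K}))"
proof (rule borel_of_restrict_measurable)
  fix i :: nat assume "i \<in> {1..K}"
  then have "P i \<in> borel_measurable N" "Z i \<in> borel_measurable N" using P_measurable Z_measurable by auto
  note [measurable] = this
  have "(\<lambda>\<omega>. b i \<omega>) \<in> measurable N (count_space UNIV)" by measurable
  then have "(\<lambda>\<omega>. b i \<omega>) \<in> borel_measurable N" by (rule measurable_compose) simp
  then show "(\<lambda>\<omega>. (b i \<omega>, Z i \<omega>)) \<in> borel_measurable N" by (intro borel_measurable_Pair) simp_all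
qed

text \<open>The part of the limiting expectation carried by the listed profiles, as a finite
  sum.\<close>

definition approx :: "int \<Rightarrow> int \<Rightarrow> nat \<Rightarrow> nat \<Rightarrow> ((nat \<Rightarrow> int \<times> real) \<Rightarrow> real) \<Rightarrow> real" where
  "approx c R K L f = (\<Sum>rs\<in>profiles c R K L. weight c R rs * normal_integral (length rs) (entries K f rs))"

text \<open>Off a rare event exactly one listed profile matches and its summand equals the value of
  \<open>f\<close>; on the rare event both are at most \<open>B\<close>. The cut-offs are chosen
  before \<open>f\<close>, so that the same ones serve for \<open>f\<close> and for the constant
  1.\<close>

lemma limit_approx:
  assumes "0 < \<eta>"
  shows "\<exists>c R L. R0 \<le> R \<and> (\<forall>f B. continuous_map (product_topology (\<lambda>_. euclidean) {1..K}) euclideanreal f \<longrightarrow>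
    (\<forall>y. \<bar>f (restrict y {1..K})\<bar> \<le> B) \<longrightarrow> \<bar>expectation (\<lambda>\<omega>. f (\<lambda>i\<in>{1..K}. (b i \<omega>, Z i \<omega>))) - approx c R K L f\<bar> \<le> B * \<eta>)"
proof -
  \<comment> \<open>Three exceptional events, and a loss of at most \<open>2 * B\<close> on
    them.\<close>
  have "0 < \<eta> / 6" using assms by simp
  from tail_bounds[OF this, of R0 K] obtain c R L where R0: "R0 \<le> R" and
    p1: "prob {\<omega> \<in> space N. P (Suc K) \<omega> < of_int c - \<epsilon>} \<le> \<eta> / 6" and
    p2: "prob {\<omega> \<in> space N. of_int R - \<epsilon> \<le> P 1 \<omega>} \<le> \<eta> / 6" and
    p3: "prob {\<omega> \<in> space N. \<not> (\<exists>m\<le>L. emeasure (\<Xi> \<omega>) {of_int c - \<epsilon> ..< of_int R - \<epsilon>} = of_nat m)} \<le> \<eta> / 6"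
    (is "prob ?B3 \<le> _") by blast
  let ?B1 = "{\<omega> \<in> space N. P (Suc K) \<omega> < of_int c - \<epsilon>}" and ?B2 = "{\<omega> \<in> space N. of_int R - \<epsilon> \<le> P 1 \<omega>}"
  define Bd where "Bd = ?B1 \<union> ?B2 \<union> ?B3"
  have [measurable]: "P (Suc K) \<in> borel_measurable N" "P 1 \<in> borel_measurable N" by (auto intro: P_measurable)
  note [measurable] = count_measurable[of "{of_int c - \<epsilon> ..< of_int R - \<epsilon>}", simplified]
  have B1s: "?B1 \<in> events" by measurable
  have B2s: "?B2 \<in> events" by measurable
  have B3s: "?B3 \<in> events" by measurable
  have Bds: "Bd \<in> events" unfolding Bd_def by (intro sets.Un B1s B2s B3s)
  have "prob Bd \<le> prob (?B1 \<union> ?B2) + prob ?B3" unfolding Bd_def by (intro measure_Un_le sets.Un B1s B2s B3s)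
  also have "prob (?B1 \<union> ?B2) \<le> prob ?B1 + prob ?B2" by (rule measure_Un_le[OF B1s B2s])
  finally have pBd: "prob Bd \<le> \<eta> / 2" using p1 p2 p3 by linarith
  have "\<bar>expectation (\<lambda>\<omega>. f (\<lambda>i\<in>{1..K}. (b i \<omega>, Z i \<omega>))) - approx c R K L f\<bar> \<le> B * \<eta>"
    if f: "continuous_map (product_topology (\<lambda>_. euclidean) {1..K}) euclideanreal f" "\<forall>y. \<bar>f (restrict y {1..K})\<bar> \<le> B" for f B
  proof -
    have B0: "0 \<le> B" using f(2)[rule_format, of undefined] by linarith
    let ?X = "\<lambda>\<omega>. f (\<lambda>i\<in>{1..K}. (b i \<omega>, Z i \<omega>))"
    let ?F = "profiles c R K L"
    let ?G = "\<lambda>rs \<omega>. entries K f rs (map (\<lambda>i. Z i \<omega>) [1..<Suc (length rs)])"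
    let ?g = "\<lambda>rs \<omega>. indicator (counts c R rs) \<omega> * ?G rs \<omega>"
    have eb: "\<bar>entries K f rs zs\<bar> \<le> B" for rs zs unfolding entries_def using f(2) by simp
    have X: "?X \<in> borel_measurable N" by (rule measurable_compose[OF limit_measurable continuous_map_borel_of[OF f(1)]])
    have iX: "integrable N ?X" by (rule integrable_const_bound[where B = B]) (use X f(2) in simp_all)
    have gE: "expectation (?g rs) = weight c R rs * normal_integral (length rs) (entries K f rs)"
      and gm: "?g rs \<in> borel_measurable N" if "rs \<in> ?F" for rs
    proof -
      have rs: "set rs \<subseteq> {c..<R}" "K \<le> length rs" using that by (simp_all add: profiles_def)
      note ec = expectation_counts[OF rs(1) list_cont_entries[OF f(1) rs(2), of rs] eb]
      show "expectation (?g rs) = weight c R rs * normal_integral (length rs) (entries K f rs)" by (rule ec(1))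
      show "?g rs \<in> borel_measurable N" by (intro borel_measurable_times borel_measurable_indicator counts_sets ec(2))
    qed
    have gb: "\<bar>?g rs \<omega>\<bar> \<le> B" for rs \<omega> using eb B0 by (simp add: indicator_def del: upt_Suc)
    have ig: "integrable N (?g rs)" if "rs \<in> ?F" for rs
      by (rule integrable_const_bound[where B = B]) (use gm[OF that] gb in simp_all)
    let ?S = "\<lambda>\<omega>. \<Sum>rs\<in>?F. ?g rs \<omega>"
    have iS: "integrable N ?S" by (rule Bochner_Integration.integrable_sum) (rule ig)
    have ES: "expectation ?S = approx c R K L f"
    proof -
      have "expectation ?S = (\<Sum>rs\<in>?F. expectation (?g rs))" by (rule Bochner_Integration.integral_sum) (rule ig)
      then show ?thesis unfolding approx_def using gE by simp
    qed
    have AE: "AE \<omega> in N. \<bar>?X \<omega> - ?S \<omega>\<bar> \<le> 2 * B * indicator Bd \<omega>"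
      using AE_points AE_space
    proof eventually_elim
      case (elim \<omega>)
      show ?case
      proof (cases "\<omega> \<in> Bd")
        case True
        have "\<bar>?S \<omega>\<bar> \<le> B"
        proof (rule abs_sum_unique_le[OF finite_profiles _ gb B0])
          fix rs rs' assume h: "rs \<in> ?F" "rs' \<in> ?F" "?g rs \<omega> \<noteq> 0" "?g rs' \<omega> \<noteq> 0"
          then have "\<omega> \<in> counts c R rs" "\<omega> \<in> counts c R rs'" by (auto simp: indicator_def split: if_splits)
          then show "rs = rs'" by (rule profiles_counts_unique[OF h(1,2)])
        qed
        moreover have "\<bar>?X \<omega>\<bar> \<le> B" using f(2) by simp
        moreover have "\<bar>?X \<omega> - ?S \<omega>\<bar> \<le> \<bar>?X \<omega>\<bar> + \<bar>?S \<omega>\<bar>" by (rule abs_triangle_ineq4)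
        ultimately show ?thesis using True by simp
      next
        case False
        have n1: "of_int c - \<epsilon> \<le> P (Suc K) \<omega>" and n2: "P 1 \<omega> < of_int R - \<epsilon>"
          using False elim(2) unfolding Bd_def by (simp_all add: not_less not_le)
        obtain m where m: "m \<le> L" "emeasure (\<Xi> \<omega>) {of_int c - \<epsilon> ..< of_int R - \<epsilon>} = of_nat m"
          using False elim(2) unfolding Bd_def by blast
        obtain k where k: "K \<le> k" "map (\<lambda>i. b i \<omega>) [1..<Suc k] \<in> ?F" "\<omega> \<in> counts c R (map (\<lambda>i. b i \<omega>) [1..<Suc k])"
          using counts_prefix[OF conjunct1[OF elim(1)] conjunct2[OF elim(1)] elim(2) n2 n1 m(2,1)] by blast
        let ?rs = "map (\<lambda>i. b i \<omega>) [1..<Suc k]"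
        have "?S \<omega> = ?g ?rs \<omega>"
        proof (rule sum_single_nonzero[OF finite_profiles k(2)])
          fix y assume y: "y \<in> ?F" "y \<noteq> ?rs"
          then have "\<omega> \<notin> counts c R y" using profiles_counts_unique[OF y(1) k(2) _ k(3)] by blast
          then show "?g y \<omega> = 0" by simp
        qed
        also have "\<dots> = ?G ?rs \<omega>" using k(3) by (simp del: upt_Suc)
        also have "\<dots> = ?X \<omega>"
          unfolding entries_def
        proof (rule arg_cong[where f = f], rule restrict_ext)
          fix i assume i: "i \<in> {1..K}"
          then have "i - 1 < k" "1 + (i - 1) = i" using k(1) by auto
          then show "(?rs ! (i - 1), map (\<lambda>i. Z i \<omega>) [1..<Suc (length ?rs)] ! (i - 1)) = (b i \<omega>, Z i \<omega>)"
            by (simp del: upt_Suc)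
        qed
        finally show ?thesis using False by simp
      qed
    qed
    have iB: "integrable N (\<lambda>\<omega>. 2 * B * indicator Bd \<omega>)"
      by (rule integrable_const_bound[where B = "2 * B"]) (use Bds B0 in \<open>auto simp: indicator_def\<close>)
    have eq: "expectation ?X - approx c R K L f = expectation (\<lambda>\<omega>. ?X \<omega> - ?S \<omega>)"
      unfolding ES[symmetric] by (rule Bochner_Integration.integral_diff[OF iX iS, symmetric])
    have "\<bar>expectation ?X - approx c R K L f\<bar> \<le> expectation (\<lambda>\<omega>. \<bar>?X \<omega> - ?S \<omega>\<bar>)"
      unfolding eq by (rule integral_abs_bound)
    also have "\<dots> \<le> expectation (\<lambda>\<omega>. 2 * B * indicator Bd \<omega>)"
      by (rule integral_mono_AE) (use iX iS iB AE in auto)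
    also have "\<dots> = 2 * B * prob Bd" using Bds by (simp add: sets.Int_space_eq2)
    also have "\<dots> \<le> 2 * B * (\<eta> / 2)" using pBd B0 by (intro mult_left_mono) simp_all
    finally show ?thesis by simp
  qed
  then show ?thesis using R0 by blast
qed

end

section \<open>Comparison of the two sides\<close>

lemma average_const:
  assumes "finite A"
  shows "(\<Sum>vs\<in>sorted_orders A g. c) / real (card (sorted_orders A g)) = (c :: real)"
  using sorted_orders_nonempty[OF assms, of g] finite_sorted_orders[OF assms, of g] by simp

context poisson_window
begin

text \<open>The test function at a tuple whose in-degrees are known to be given by
  \<open>rs\<close>; it then depends on the labels alone.\<close>

definition tent :: "nat \<Rightarrow> nat \<Rightarrow> ((nat \<Rightarrow> int \<times> real) \<Rightarrow> real) \<Rightarrow> int list \<Rightarrow> nat list \<Rightarrow> real" where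
  "tent K j f rs ls = f (\<lambda>i\<in>{1..K}. (rs ! (i - 1), std_label e (ns j) (ls ! (i - 1))))"

definition sample :: "nat \<Rightarrow> nat \<Rightarrow> ((nat \<Rightarrow> int \<times> real) \<Rightarrow> real) \<Rightarrow> (nat \<Rightarrow> nat) \<Rightarrow> nat list \<Rightarrow> real" where
  "sample K j f x vs = f (\<lambda>i\<in>{1..K}. (int (x (vs ! (i - 1))) - d j, std_label e (ns j) (vs ! (i - 1))))"

text \<open>\<open>sample\<close> averaged over the uniform tie-breaking.\<close>

definition average :: "nat \<Rightarrow> nat \<Rightarrow> ((nat \<Rightarrow> int \<times> real) \<Rightarrow> real) \<Rightarrow> 'a \<Rightarrow> real" where
  "average K j f \<omega> = (\<Sum>vs\<in>sorted_orders {1..ns j} (indeg (par \<omega>) (ns j)). sample K j f (indeg (par \<omega>) (ns j)) vs)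
     / real (card (sorted_orders {1..ns j} (indeg (par \<omega>) (ns j))))"

text \<open>\<open>profile_sum\<close> counts every arrangement of tied vertices; division by their
  number turns the sum into an average over tie-breaking.\<close>

definition share :: "int \<Rightarrow> int \<Rightarrow> int list \<Rightarrow> nat \<Rightarrow> (nat list \<Rightarrow> real) \<Rightarrow> 'a \<Rightarrow> real" where
  "share c R rs j f \<omega> = profile_part c R rs j f \<omega> / real (arrangements rs)"

text \<open>Outside this event, all vertices of the tree at level \<open>c\<close> or above lie in
  \<open>verts_in c R j \<omega>\<close>, once \<open>a j \<le> ns j\<close>.\<close>

definition atypical :: "int \<Rightarrow> int \<Rightarrow> nat \<Rightarrow> 'a set" where
  "atypical c R j = {\<omega> \<in> space M. \<exists>l\<in>{1..a j}. lev c j \<le> indeg (par \<omega>) (ns j) l}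
     \<union> {\<omega> \<in> space M. \<exists>l\<in>window j. lev R j \<le> indeg (par \<omega>) (ns j) l}"

lemma lev_le: "r \<le> dev j \<omega> l \<Longrightarrow> lev r j \<le> indeg (par \<omega>) (ns j) l"
  unfolding lev_def dev_def by linarith

text \<open>The hypothesis on \<open>A\<close> makes \<open>verts_in\<close> its top block, so
  \<open>average_sorted_orders\<close> applies; tuples that leave \<open>verts_in\<close> cannot
  realise \<open>rs\<close>.\<close>

lemma profile_average:
  assumes A: "finite A" and V: "{l \<in> A. c \<le> dev j \<omega> l} = verts_in c R j \<omega>"
    and prof: "has_profile c R rs j \<omega>" and rs: "set rs \<subseteq> {c..<R}" "sorted_wrt (\<ge>) rs"
    and f: "\<And>ls. length ls = length rs \<Longrightarrow> map (dev j \<omega>) ls = rs \<Longrightarrow> f ls = g ls"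
  shows "(\<Sum>vs\<in>sorted_orders A (dev j \<omega>). f (take (length rs) vs)) / real (card (sorted_orders A (dev j \<omega>))) = share c R rs j g \<omega>"
proof -
  have "(\<Sum>vs\<in>sorted_orders A (dev j \<omega>). f (take (length rs) vs)) / real (card (sorted_orders A (dev j \<omega>)))
    = (\<Sum>ls\<in>dlists (verts_in c R j \<omega>) (length rs). if map (dev j \<omega>) ls = rs then f ls else 0) / real (arrangements rs)"
    by (rule average_sorted_orders[OF A V[symmetric] prof[unfolded has_profile_def] rs(2)])
  also have "(\<Sum>ls\<in>dlists (verts_in c R j \<omega>) (length rs). if map (dev j \<omega>) ls = rs then f ls else 0)
    = (\<Sum>ls\<in>dlists (verts_in c R j \<omega>) (length rs). if map (dev j \<omega>) ls = rs then g ls else 0)"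
  proof (rule sum.cong[OF refl])
    fix ls assume "ls \<in> dlists (verts_in c R j \<omega>) (length rs)"
    then have "length ls = length rs" by (simp add: dlists_def)
    then show "(if map (dev j \<omega>) ls = rs then f ls else 0) = (if map (dev j \<omega>) ls = rs then g ls else 0)" using f by simp
  qed
  also have "\<dots> = profile_sum rs j g \<omega>"
    unfolding profile_sum_def
  proof (rule sum.mono_neutral_left)
    show "finite (dlists (window j) (length rs))" by (rule finite_dlists) simp
    show "dlists (verts_in c R j \<omega>) (length rs) \<subseteq> dlists (window j) (length rs)"
      unfolding dlists_def verts_in_def by blast
    show "\<forall>ls\<in>dlists (window j) (length rs) - dlists (verts_in c R j \<omega>) (length rs). (if map (dev j \<omega>) ls = rs then g ls else 0) = 0"
    proof
      fix ls assume ls: "ls \<in> dlists (window j) (length rs) - dlists (verts_in c R j \<omega>) (length rs)"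
      have "map (dev j \<omega>) ls \<noteq> rs"
      proof
        assume "map (dev j \<omega>) ls = rs"
        then have "set ls \<subseteq> verts_in c R j \<omega>" using has_profile_iff(1)[of ls j rs \<omega> c R] ls rs(1) by blast
        then show False using ls unfolding dlists_def by blast
      qed
      then show "(if map (dev j \<omega>) ls = rs then g ls else 0) = 0" by simp
    qed
  qed
  finally show ?thesis unfolding share_def profile_part_def using prof by simp
qed

lemma share_zero: "\<not> has_profile c R rs j \<omega> \<Longrightarrow> share c R rs j f \<omega> = 0"
  by (simp add: share_def profile_part_def)

text \<open>\<open>profile_average\<close> is applied to the window vertices below level
  \<open>R\<close>, whose top block is \<open>verts_in\<close> by construction; this works on
  atypical outcomes as well.\<close>

lemma share_one:
  assumes "has_profile c R rs j \<omega>" "set rs \<subseteq> {c..<R}" "sorted_wrt (\<ge>) rs"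
  shows "share c R rs j (\<lambda>_. 1) \<omega> = 1"
proof -
  have "{l \<in> {l \<in> window j. dev j \<omega> l < R}. c \<le> dev j \<omega> l} = verts_in c R j \<omega>" unfolding verts_in_def by auto
  then have "share c R rs j (\<lambda>_. 1) \<omega> = (\<Sum>vs\<in>sorted_orders {l \<in> window j. dev j \<omega> l < R} (dev j \<omega>). 1) / real (card (sorted_orders {l \<in> window j. dev j \<omega> l < R} (dev j \<omega>)))"
    using profile_average[of "{l \<in> window j. dev j \<omega> l < R}" c j \<omega> R rs "\<lambda>_. 1" "\<lambda>_. 1"] assms by simp
  also have "\<dots> = 1" by (rule average_const) simp
  finally show ?thesis .
qed

lemma share_bound:
  assumes "\<And>ls. \<bar>f ls\<bar> \<le> B"
  shows "\<bar>share c R rs j f \<omega>\<bar> \<le> B * share c R rs j (\<lambda>_. 1) \<omega>"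
proof -
  have "\<bar>profile_sum rs j f \<omega>\<bar> \<le> (\<Sum>ls\<in>dlists (window j) (length rs). \<bar>if map (dev j \<omega>) ls = rs then f ls else 0\<bar>)"
    unfolding profile_sum_def by (rule sum_abs)
  also have "\<dots> \<le> (\<Sum>ls\<in>dlists (window j) (length rs). B * (if map (dev j \<omega>) ls = rs then 1 else 0))"
    by (rule sum_mono) (use assms in simp)
  also have "\<dots> = B * profile_sum rs j (\<lambda>_. 1) \<omega>" unfolding profile_sum_def by (simp only: sum_distrib_left)
  finally have "\<bar>profile_part c R rs j f \<omega>\<bar> \<le> B * profile_part c R rs j (\<lambda>_. 1) \<omega>" unfolding profile_part_def by simp
  then show ?thesis unfolding share_def abs_divide by (simp add: divide_right_mono)
qed

lemma share_integrable: "(\<And>ls. \<bar>f ls\<bar> \<le> B) \<Longrightarrow> integrable M (share c R rs j f)"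
  unfolding share_def[abs_def] by (rule Bochner_Integration.integrable_divide, rule profile_part_integrable)

definition shares :: "int \<Rightarrow> int \<Rightarrow> nat \<Rightarrow> nat \<Rightarrow> nat \<Rightarrow> ((nat \<Rightarrow> int \<times> real) \<Rightarrow> real) \<Rightarrow> 'a \<Rightarrow> real" where
  "shares c R K L j f \<omega> = (\<Sum>rs\<in>profiles c R K L. share c R rs j (tent K j f rs) \<omega>)"

lemma average_bound:
  assumes "\<And>y. \<bar>f (restrict y {1..K})\<bar> \<le> B"
  shows "\<bar>average K j f \<omega>\<bar> \<le> B"
proof -
  let ?S = "sorted_orders {1..ns j} (indeg (par \<omega>) (ns j))"
  have "\<bar>average K j f \<omega>\<bar> \<le> (\<Sum>vs\<in>?S. \<bar>sample K j f (indeg (par \<omega>) (ns j)) vs\<bar>) / real (card ?S)"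
    unfolding average_def abs_divide by (simp add: divide_right_mono)
  also have "\<dots> \<le> (\<Sum>vs\<in>?S. B) / real (card ?S)"
    by (intro divide_right_mono sum_mono) (use assms in \<open>simp_all add: sample_def\<close>)
  also have "\<dots> = B" by (rule average_const) simp
  finally show ?thesis .
qed

text \<open>If no listed profile occurs, all shares vanish and the deficit \<open>1 - shares\<close>
  at the constant 1 pays for \<open>f\<close>. If one occurs, it is unique, and
  \<open>average\<close> and \<open>shares\<close> agree outside \<open>atypical\<close>.\<close>

lemma average_shares_bound:
  assumes f: "\<And>y. \<bar>f (restrict y {1..K})\<bar> \<le> B" and sp: "\<omega> \<in> space M" and aj: "a j \<le> ns j"
  shows "\<bar>average K j f \<omega> - shares c R K L j f \<omega>\<bar> \<le> B * (2 * indicator (atypical c R j) \<omega> + 1 - shares c R K L j (\<lambda>_. 1) \<omega>)"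
proof -
  have B0: "0 \<le> B" using f[of undefined] by linarith
  have tb: "\<bar>tent K j f rs ls\<bar> \<le> B" for rs ls unfolding tent_def by (rule f)
  have av: "\<bar>average K j f \<omega>\<bar> \<le> B" by (rule average_bound) (rule f)
  have one: "tent K j (\<lambda>_. 1) rs = (\<lambda>_. 1)" for rs unfolding tent_def ..
  show ?thesis
  proof (cases "\<exists>rs\<in>profiles c R K L. has_profile c R rs j \<omega>")
    case False
    then have "shares c R K L j f' \<omega> = 0" for f' unfolding shares_def by (intro sum.neutral) (simp add: share_zero)
    then show ?thesis using av B0 by (simp add: indicator_def)
  next
    case True
    then obtain rs where rs: "rs \<in> profiles c R K L" "has_profile c R rs j \<omega>" by blast
    have rs': "set rs \<subseteq> {c..<R}" "sorted_wrt (\<ge>) rs" "K \<le> length rs" using rs(1) by (simp_all add: profiles_def)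
    have single: "shares c R K L j f' \<omega> = share c R rs j (tent K j f' rs) \<omega>" for f'
      unfolding shares_def
    proof (rule sum_single_nonzero[OF finite_profiles rs(1)])
      fix y assume y: "y \<in> profiles c R K L" "y \<noteq> rs"
      have "\<not> has_profile c R y j \<omega>"
      proof
        assume "has_profile c R y j \<omega>"
        then have "mset y = mset rs" using rs(2) unfolding has_profile_def by simp
        then show False using sorted_wrt_ge_unique[of y rs] y rs'(2) unfolding profiles_def by simp
      qed
      then show "share c R y j (tent K j f' y) \<omega> = 0" by (rule share_zero)
    qed
    have s1: "shares c R K L j (\<lambda>_. 1) \<omega> = 1" unfolding single one by (rule share_one[OF rs(2) rs'(1,2)])
    have sb: "\<bar>shares c R K L j f \<omega>\<bar> \<le> B"
    proof -
      have "\<bar>share c R rs j (tent K j f rs) \<omega>\<bar> \<le> B * share c R rs j (\<lambda>_. 1) \<omega>" by (rule share_bound) (rule tb)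
      then show ?thesis unfolding single share_one[OF rs(2) rs'(1,2)] by simp
    qed
    show ?thesis
    proof (cases "\<omega> \<in> atypical c R j")
      case True
      have "\<bar>average K j f \<omega> - shares c R K L j f \<omega>\<bar> \<le> \<bar>average K j f \<omega>\<bar> + \<bar>shares c R K L j f \<omega>\<bar>" by (rule abs_triangle_ineq4)
      then show ?thesis using av sb s1 True by simp
    next
      case False
      have low: "dev j \<omega> l < c" if "l \<in> {1..a j}" for l
        using False sp that lev_le[of c j \<omega> l] unfolding atypical_def by force
      have high: "dev j \<omega> l < R" if "l \<in> window j" for l
        using False sp that lev_le[of R j \<omega> l] unfolding atypical_def by force
      have V: "{l \<in> {1..ns j}. c \<le> dev j \<omega> l} = verts_in c R j \<omega>"
      proof (rule set_eqI, rule iffI)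
        fix l assume l: "l \<in> {l \<in> {1..ns j}. c \<le> dev j \<omega> l}"
        then have "\<not> l \<le> a j" using low[of l] by auto
        then show "l \<in> verts_in c R j \<omega>" using l high[of l] unfolding verts_in_def by simp
      next
        fix l assume "l \<in> verts_in c R j \<omega>"
        then show "l \<in> {l \<in> {1..ns j}. c \<le> dev j \<omega> l}" unfolding verts_in_def by simp
      qed
      let ?f = "\<lambda>ls. f (\<lambda>i\<in>{1..K}. (dev j \<omega> (ls ! (i - 1)), std_label e (ns j) (ls ! (i - 1))))"
      have so: "sorted_orders {1..ns j} (indeg (par \<omega>) (ns j)) = sorted_orders {1..ns j} (dev j \<omega>)"
        unfolding dev_def[abs_def] by (rule sorted_orders_shift[symmetric])
      have tk: "sample K j f (indeg (par \<omega>) (ns j)) vs = ?f (take (length rs) vs)" for vs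
        unfolding sample_def dev_def
      proof (rule arg_cong[where f = f], rule restrict_ext)
        fix i assume "i \<in> {1..K}"
        then have "i - 1 < length rs" using rs'(3) by auto
        then show "(int (indeg (par \<omega>) (ns j) (vs ! (i - 1))) - d j, std_label e (ns j) (vs ! (i - 1)))
          = (int (indeg (par \<omega>) (ns j) (take (length rs) vs ! (i - 1))) - d j, std_label e (ns j) (take (length rs) vs ! (i - 1)))"
          by simp
      qed
      have "average K j f \<omega> = share c R rs j (tent K j f rs) \<omega>"
        unfolding average_def so tk
      proof (rule profile_average[OF _ V rs(2) rs'(1,2)])
        fix ls :: "nat list" assume ls: "length ls = length rs" "map (dev j \<omega>) ls = rs"
        show "?f ls = tent K j f rs ls"
          unfolding tent_def
        proof (rule arg_cong[where f = f], rule restrict_ext)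
          fix i assume "i \<in> {1..K}"
          then have "i - 1 < length ls" using rs'(3) ls(1) by auto
          then have "dev j \<omega> (ls ! (i - 1)) = rs ! (i - 1)" using nth_map[of "i - 1" ls "dev j \<omega>"] unfolding ls(2) by simp
          then show "(dev j \<omega> (ls ! (i - 1)), std_label e (ns j) (ls ! (i - 1))) = (rs ! (i - 1), std_label e (ns j) (ls ! (i - 1)))" by simp
        qed
      qed simp
      then show ?thesis using single[of f] s1 B0 by simp
    qed
  qed
qed

definition approx :: "int \<Rightarrow> int \<Rightarrow> nat \<Rightarrow> nat \<Rightarrow> ((nat \<Rightarrow> int \<times> real) \<Rightarrow> real) \<Rightarrow> real" where
  "approx c R K L f = (\<Sum>rs\<in>profiles c R K L. prod_list (map lam rs) / real (arrangements rs) * exp (- (\<Sum>r\<in>{c..<R}. lam r))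
     * normal_integral (length rs) (entries K f rs))"

lemma shares_integrable:
  assumes f: "\<And>y. \<bar>f (restrict y {1..K})\<bar> \<le> B"
  shows "integrable M (shares c R K L j f)"
  unfolding shares_def[abs_def]
  by (rule Bochner_Integration.integrable_sum, rule share_integrable[where B = B], unfold tent_def) (rule f)

lemma shares_tendsto:
  assumes f: "continuous_map (product_topology (\<lambda>_. euclidean) {1..K}) euclideanreal f" "\<And>y. \<bar>f (restrict y {1..K})\<bar> \<le> B"
  shows "(\<lambda>j. expectation (shares c R K L j f)) \<longlonglongrightarrow> approx c R K L f"
proof -
  have tb: "\<bar>tent K j f rs ls\<bar> \<le> B" for j rs ls unfolding tent_def by (rule f)
  have E: "expectation (shares c R K L j f) = (\<Sum>rs\<in>profiles c R K L. expectation (profile_part c R rs j (tent K j f rs)) / real (arrangements rs))" for j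
  proof -
    have "expectation (shares c R K L j f) = (\<Sum>rs\<in>profiles c R K L. expectation (share c R rs j (tent K j f rs)))"
      unfolding shares_def[abs_def] by (rule Bochner_Integration.integral_sum) (rule share_integrable[OF tb])
    then show ?thesis unfolding share_def[abs_def] by simp
  qed
  have "(\<lambda>j. \<Sum>rs\<in>profiles c R K L. expectation (profile_part c R rs j (tent K j f rs)) / real (arrangements rs))
    \<longlonglongrightarrow> (\<Sum>rs\<in>profiles c R K L. prod_list (map lam rs) * exp (- (\<Sum>r\<in>{c..<R}. lam r)) * normal_integral (length rs) (entries K f rs) / real (arrangements rs))"
  proof (rule tendsto_sum)
    fix rs assume "rs \<in> profiles c R K L"
    then have rs: "set rs \<subseteq> {c..<R}" "K \<le> length rs" by (simp_all add: profiles_def)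
    have conv: "label_conv (length rs) (\<lambda>j. tent K j f rs) (entries K f rs)"
      unfolding label_conv_def tent_def entries_def
    proof (intro allI impI)
      fix X :: "nat \<Rightarrow> nat \<Rightarrow> nat" and xs :: "real list"
      assume xs: "length xs = length rs" "\<forall>i<length rs. eventually (\<lambda>j. X i j \<in> window j) sequentially \<and> (\<lambda>j. std_label e (ns j) (X i j)) \<longlonglongrightarrow> xs ! i"
      show "(\<lambda>j. f (\<lambda>i\<in>{1..K}. (rs ! (i - 1), std_label e (ns j) (map (\<lambda>i. X i j) [0..<length rs] ! (i - 1))))) \<longlonglongrightarrow> f (\<lambda>i\<in>{1..K}. (rs ! (i - 1), xs ! (i - 1)))"
      proof (rule continuous_map_restrict_tendsto[OF f(1)])
        fix i assume "i \<in> {1..K}"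
        then have i: "i - 1 < length rs" using rs(2) by auto
        have "(\<lambda>j. std_label e (ns j) (X (i - 1) j)) \<longlonglongrightarrow> xs ! (i - 1)" using xs(2) i by blast
        then show "(\<lambda>j. (rs ! (i - 1), std_label e (ns j) (map (\<lambda>i. X i j) [0..<length rs] ! (i - 1)))) \<longlonglongrightarrow> (rs ! (i - 1), xs ! (i - 1))"
          using i by (intro tendsto_Pair tendsto_const) simp
      qed
    qed
    have "\<bar>entries K f rs xs\<bar> \<le> B" for xs unfolding entries_def by (rule f)
    from profile_part_tendsto[OF rs(1) tb this list_cont_entries[OF f(1) rs(2)] conv]
    show "(\<lambda>j. expectation (profile_part c R rs j (tent K j f rs)) / real (arrangements rs))
      \<longlonglongrightarrow> prod_list (map lam rs) * exp (- (\<Sum>r\<in>{c..<R}. lam r)) * normal_integral (length rs) (entries K f rs) / real (arrangements rs)"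
      by (rule tendsto_divide[OF _ tendsto_const]) (use arrangements_pos[of rs] in simp)
  qed
  moreover have "(\<Sum>rs\<in>profiles c R K L. prod_list (map lam rs) * exp (- (\<Sum>r\<in>{c..<R}. lam r)) * normal_integral (length rs) (entries K f rs) / real (arrangements rs)) = approx c R K L f"
    unfolding approx_def by (rule sum.cong) simp_all
  ultimately show ?thesis unfolding E by simp
qed

lemma atypical_sets: "atypical c R j \<in> sets M"
  unfolding atypical_def by (intro sets.Un indeg_event)

lemma atypical_bound:
  assumes "0 < \<delta>" "h < (sqrt (1 + e) - 1) / (2 * (sqrt (1 + e) + 3))"
  shows "\<forall>\<^sub>F j in sequentially. prob (atypical c R j) \<le> 3 * (tau * (1 + e) powr (- real_of_int R)) * ((1 + e) / e) + \<delta>"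
proof -
  have "\<forall>\<^sub>F j in sequentially. prob {\<omega> \<in> space M. \<exists>l\<in>{1..a j}. lev c j \<le> indeg (par \<omega>) (ns j) l} < \<delta>"
    by (rule order_tendstoD(2)[OF low_labels_negligible[OF level_lev assms(2)] assms(1)])
  with high_degree_bound[OF level_lev[of R]] show ?thesis
  proof eventually_elim
    case (elim j)
    have "prob (atypical c R j) \<le> prob {\<omega> \<in> space M. \<exists>l\<in>{1..a j}. lev c j \<le> indeg (par \<omega>) (ns j) l}
      + prob {\<omega> \<in> space M. \<exists>l\<in>window j. lev R j \<le> indeg (par \<omega>) (ns j) l}"
      unfolding atypical_def by (intro measure_Un_le indeg_event)
    then show ?case using elim by linarith
  qed
qed

lemma eventually_a_le_ns: "\<forall>\<^sub>F j in sequentially. 1 \<le> ns j \<and> a j \<le> ns j"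
proof -
  have "\<forall>\<^sub>F j in sequentially. 1 \<le> ns j" using ns_top by (simp add: filterlim_at_top)
  with a_le show ?thesis
  proof eventually_elim
    case (elim j)
    have "loc e \<le> 1" unfolding loc_def using e_pos by simp
    then have "real (ns j) powr h \<le> real (ns j) powr 1" by (intro powr_mono) (use h_less elim in simp_all)
    then show ?case using elim by simp
  qed
qed

text \<open>The probability that no listed profile occurs enters as \<open>1 - approx\<close> at the
  constant 1. The Poisson side will show that this is small, which is how tightness is transferred
  to the tree.\<close>

lemma tree_approx:
  assumes f: "continuous_map (product_topology (\<lambda>_. euclidean) {1..K}) euclideanreal f" "\<And>y. \<bar>f (restrict y {1..K})\<bar> \<le> B"
    and v: "\<And>n. n \<ge> 1 \<Longrightarrow> uniform_degree_ordering M W p n (v n)"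
    and \<delta>: "0 < \<delta>" and h: "h < (sqrt (1 + e) - 1) / (2 * (sqrt (1 + e) + 3))"
  shows "\<forall>\<^sub>F j in sequentially. \<bar>expectation (\<lambda>\<omega>. sample K j f (indeg (par \<omega>) (ns j)) (v (ns j) \<omega>)) - approx c R K L f\<bar>
     \<le> B * (6 * (tau * (1 + e) powr (- real_of_int R)) * ((1 + e) / e) + 1 - approx c R K L (\<lambda>_. 1) + 3 * \<delta>) + \<delta>"
proof -
  have B0: "0 \<le> B" using f(2)[of undefined] by linarith
  have c1: "continuous_map (product_topology (\<lambda>_. euclidean) {1..K}) euclideanreal (\<lambda>_. 1 :: real)" by simp
  have l1: "\<forall>\<^sub>F j in sequentially. \<bar>expectation (shares c R K L j f) - approx c R K L f\<bar> < \<delta>"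
    using tendstoD[OF shares_tendsto[OF f] \<delta>] by (simp only: dist_real_def)
  have l2: "\<forall>\<^sub>F j in sequentially. \<bar>expectation (shares c R K L j (\<lambda>_. 1)) - approx c R K L (\<lambda>_. 1)\<bar> < \<delta>"
    using tendstoD[OF shares_tendsto[OF c1, where B = 1] \<delta>] by (simp add: dist_real_def)
  show ?thesis
    using l1 l2 atypical_bound[OF \<delta> h, of c R] eventually_a_le_ns
  proof eventually_elim
    case (elim j)
    let ?A = "average K j f" and ?S = "shares c R K L j f" and ?S1 = "shares c R K L j (\<lambda>_. 1)"
    let ?I = "\<lambda>\<omega>. B * (2 * indicator (atypical c R j) \<omega> + 1 - ?S1 \<omega>)"
    have E: "expectation (\<lambda>\<omega>. sample K j f (indeg (par \<omega>) (ns j)) (v (ns j) \<omega>)) = expectation ?A"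
      unfolding average_def[abs_def]
      by (rule ordering_expectation[where B = B]) (use elim v f(2) in \<open>simp_all add: sample_def\<close>)
    have mA: "?A \<in> borel_measurable M"
      unfolding average_def[abs_def]
      by (rule indeg_measurable[where F = "\<lambda>x. (\<Sum>vs\<in>sorted_orders {1..ns j} x. sample K j f x vs) / real (card (sorted_orders {1..ns j} x))"])
    have avb: "\<bar>?A \<omega>\<bar> \<le> B" for \<omega> by (rule average_bound) (rule f(2))
    have iA: "integrable M ?A" by (rule integrable_const_bound[where B = B]) (use mA avb in simp_all)
    have iS: "integrable M ?S" by (rule shares_integrable) (rule f(2))
    have iS1: "integrable M ?S1" by (rule shares_integrable[where B = 1]) simp
    have iT: "integrable M (\<lambda>\<omega>. indicator (atypical c R j) \<omega> :: real)"
      using atypical_sets by (simp add: less_top[symmetric])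
    have iI: "integrable M ?I" by (intro Bochner_Integration.integrable_mult_right Bochner_Integration.integrable_diff Bochner_Integration.integrable_add iT iS1 integrable_const)
    have EI: "expectation ?I = B * (2 * prob (atypical c R j) + 1 - expectation ?S1)"
      using iT iS1 atypical_sets[of c R j] prob_space by (simp add: sets.Int_space_eq2)
    have "expectation ?A - expectation ?S = expectation (\<lambda>\<omega>. ?A \<omega> - ?S \<omega>)"
      by (rule Bochner_Integration.integral_diff[OF iA iS, symmetric])
    then have "\<bar>expectation ?A - expectation ?S\<bar> \<le> expectation (\<lambda>\<omega>. \<bar>?A \<omega> - ?S \<omega>\<bar>)"
      using integral_abs_bound[of M "\<lambda>\<omega>. ?A \<omega> - ?S \<omega>"] by simp
    also have "\<dots> \<le> expectation ?I"
    proof (rule integral_mono)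
      show "integrable M (\<lambda>\<omega>. \<bar>?A \<omega> - ?S \<omega>\<bar>)" by (intro integrable_abs Bochner_Integration.integrable_diff iA iS)
      show "\<bar>?A \<omega> - ?S \<omega>\<bar> \<le> ?I \<omega>" if "\<omega> \<in> space M" for \<omega>
        by (rule average_shares_bound[OF _ that]) (use elim f(2) in simp_all)
    qed (rule iI)
    also have "\<dots> \<le> B * (6 * (tau * (1 + e) powr (- real_of_int R)) * ((1 + e) / e) + 1 - approx c R K L (\<lambda>_. 1) + 3 * \<delta>)"
      unfolding EI by (rule mult_left_mono[OF _ B0]) (use elim in linarith)
    finally show ?case unfolding E using elim(1) by linarith
  qed
qed

end

section \<open>Choice of the parameters and conclusion\<close>

text \<open>Equivalent to \<open>1 - 1 / (1 + e) < ln (1 + e)\<close>.\<close>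

lemma loc_pos:
  assumes "0 < e"
  shows "0 < loc e"
proof -
  have "ln 1 - ln (1 + e) < (1 - (1 + e)) / (1 + e)" by (rule ln_diff_less) (use assms in simp_all)
  then have "e / (1 + e) < ln (1 + e)" by simp
  then have "e < (1 + e) * ln (1 + e)" using assms by (simp add: pos_divide_less_eq mult.commute)
  then have "e / ((1 + e) * ln (1 + e)) < 1" using assms by (simp add: divide_less_eq)
  then show ?thesis unfolding loc_def by simp
qed

lemma powr_tail_small:
  assumes "1 < b" "0 < c" "0 < \<eta>"
  shows "\<exists>R0 :: int. \<forall>R\<ge>R0. c * b powr (- real_of_int R) \<le> (\<eta> :: real)"
proof (intro exI allI impI)
  fix R assume "\<lceil>log b (c / \<eta>)\<rceil> \<le> R"
  then have "log b (c / \<eta>) \<le> real_of_int R" by linarith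
  then have "b powr (log b (c / \<eta>)) \<le> b powr real_of_int R" using assms(1) by simp
  then have "c / \<eta> \<le> b powr real_of_int R" using assms by simp
  then have "c \<le> \<eta> * b powr real_of_int R" using assms(3) by (simp add: pos_divide_le_eq mult.commute)
  then have "c / b powr real_of_int R \<le> \<eta>" using assms(1) by (simp add: pos_divide_le_eq)
  then show "c * b powr (- real_of_int R) \<le> \<eta>" by (simp only: powr_minus_divide mult.right_neutral times_divide_eq_right)
qed

text \<open>Beyond the supremum the distribution function is 1, and right continuity carries this to
  the supremum itself.\<close>

lemma measure_atMost_of_sup:
  assumes D: "real_distribution D" and s: "(SUP x\<in>{x. measure D {..x} < 1}. ereal x) = ereal s"
  shows "measure D {..s} = 1"
proof -
  interpret D: real_distribution D by (rule D)
  have one: "cdf D x = 1" if "s < x" for x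
  proof (rule ccontr)
    assume "cdf D x \<noteq> 1"
    then have "measure D {..x} < 1" using D.prob_le_1[of "{..x}"] unfolding cdf_def by linarith
    then have "ereal x \<le> (SUP x\<in>{x. measure D {..x} < 1}. ereal x)" by (intro SUP_upper) simp
    then show False using that unfolding s by simp
  qed
  have "(cdf D \<longlongrightarrow> cdf D s) (at_right s)" using D.cdf_is_right_cont[of s] by (simp add: continuous_within)
  moreover have "eventually (\<lambda>x. cdf D x = 1) (at_right s)"
    using eventually_at_right_less[of s] by eventually_elim (rule one)
  then have "(cdf D \<longlongrightarrow> 1) (at_right s)" by (rule tendsto_eventually)
  ultimately have "cdf D s = 1" using tendsto_unique trivial_limit_at_right_real by blast
  then show ?thesis unfolding cdf_def .
qed

lemma window_start:
  fixes h :: real and ns :: "nat \<Rightarrow> nat"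
  assumes h: "0 < h" and ns: "\<And>j. ns j > 0"
  defines "a \<equiv> \<lambda>j. max 1 (nat \<lfloor>real (ns j) powr h\<rfloor>)"
  shows "1 \<le> a j" "real (a j) \<le> real (ns j) powr h" "real (ns j) powr h / 2 \<le> real (a j)"
proof -
  have y: "1 \<le> real (ns j) powr h" using ns[of j] h by (intro ge_one_powr_ge_zero) simp_all
  then have f: "1 \<le> \<lfloor>real (ns j) powr h\<rfloor>" by simp
  then have "a j = nat \<lfloor>real (ns j) powr h\<rfloor>" unfolding a_def by linarith
  then have aj: "real (a j) = real_of_int \<lfloor>real (ns j) powr h\<rfloor>" using f by simp
  show "1 \<le> a j" unfolding a_def by simp
  show "real (a j) \<le> real (ns j) powr h" unfolding aj by linarith
  show "real (ns j) powr h / 2 \<le> real (a j)" unfolding aj using f by linarith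
qed

lemma (in weighted_recursive_tree) indeg_at_measurable:
  "(\<lambda>\<omega>. indeg (par \<omega>) n l) \<in> measurable M (count_space UNIV)"
proof -
  have "(\<lambda>\<omega>. real (indeg (par \<omega>) n l)) \<in> borel_measurable M" by (rule indeg_measurable)
  then have "(\<lambda>\<omega>. nat \<lfloor>real (indeg (par \<omega>) n l)\<rfloor>) \<in> measurable M (count_space UNIV)" by measurable
  then show ?thesis by simp
qed

theorem theorem2p11:
  fixes M :: "'a measure" and D :: "real measure"
    and W :: "nat \<Rightarrow> 'a \<Rightarrow> real" and p :: "nat \<Rightarrow> 'a \<Rightarrow> nat"
    and v :: "nat \<Rightarrow> 'a \<Rightarrow> nat list" and lab deg :: "nat \<Rightarrow> nat \<Rightarrow> 'a \<Rightarrow> nat"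
    and q\<^sub>0 \<theta> \<mu> \<sigma>2 \<epsilon> :: real and \<epsilon>seq :: "nat \<Rightarrow> real" and ns :: "nat \<Rightarrow> nat"
    and N :: "'b measure" and \<Xi> :: "'b \<Rightarrow> real measure"
    and P Z :: "nat \<Rightarrow> 'b \<Rightarrow> real"
  assumes tree: "weighted_recursive_tree M D W p"
    and weight_sup: "(SUP x\<in>{x. measure D {..x} < 1}. ereal x) = 1"
    and atom: "measure D {1} = q\<^sub>0" "q\<^sub>0 \<in> {0<..1}"
    and theta: "\<theta> = 1 + (\<integral>x. x \<partial>D)"
    and mu: "\<mu> = 1 - (\<theta> - 1) / (\<theta> * ln \<theta>)"
    and sigma2: "\<sigma>2 = 1 - (\<theta> - 1)\<^sup>2 / (\<theta>\<^sup>2 * ln \<theta>)"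
    and ordering: "\<And>n. n \<ge> 1 \<Longrightarrow> uniform_degree_ordering M W p n (v n)"
    and label: "\<And>n i \<omega>. lab n i \<omega> = v n \<omega> ! (i - 1)"
    and degree: "\<And>n i \<omega>. deg n i \<omega> = in_degree (tree_of (\<lambda>k. p k \<omega>) n) (lab n i \<omega>)"
    and eps_seq: "\<And>n. \<epsilon>seq n = log \<theta> (real n) - of_int \<lfloor>log \<theta> (real n)\<rfloor>"
    and eps: "\<epsilon> \<in> {0..1}"
    and ns_pos: "\<And>j. ns j > 0"
    and ns_div: "filterlim ns at_top sequentially"
    and eps_lim: "(\<lambda>j. \<epsilon>seq (ns j)) \<longlonglongrightarrow> \<epsilon>"
    and limit_space: "prob_space N"
    and ppp: "poisson_point_process N
      (density lborel (\<lambda>x. ennreal (q\<^sub>0 * \<theta> powr (- x) * ln \<theta>))) \<Xi>"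
    and points: "decreasing_points N \<Xi> P"
    and marks_indep: "prob_space.indep_vars N (\<lambda>_. borel) Z {1..}"
    and marks_law: "\<And>i. i \<ge> 1 \<Longrightarrow> distr N borel (Z i) = std_normal_distribution"
    and points_marks_indep: "prob_space.indep_var N
      (Pi\<^sub>M {1..} (\<lambda>_. borel)) (\<lambda>\<omega>. \<lambda>i\<in>{1..}. P i \<omega>)
      (Pi\<^sub>M {1..} (\<lambda>_. borel)) (\<lambda>\<omega>. \<lambda>i\<in>{1..}. Z i \<omega>)"
  shows "sequence_converges_in_distribution
      M (\<lambda>j i \<omega>.
        (int (deg (ns j) i \<omega>) - \<lfloor>log \<theta> (real (ns j))\<rfloor>,
         (ln (real (lab (ns j) i \<omega>)) - \<mu> * ln (real (ns j)))
           / sqrt ((1 - \<sigma>2) * ln (real (ns j)))))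
      N (\<lambda>i \<omega>. (\<lfloor>P i \<omega> + \<epsilon>\<rfloor>, Z i \<omega>))"
proof -
  define e where "e = \<theta> - 1"
  have \<theta>: "\<theta> = 1 + e" unfolding e_def by simp
  have e: "e = (\<integral>x. x \<partial>D)" unfolding e_def theta by simp
  have rd: "real_distribution D" using tree by (rule weighted_recursive_tree.weight_law)
  have D1: "measure D {..1} = 1" by (rule measure_atMost_of_sup[OF rd]) (use weight_sup in \<open>simp add: one_ereal_def\<close>)
  interpret B: bounded_weight_tree M D W p e
    by (rule bounded_weight_tree.intro[OF tree bounded_weight_tree_axioms.intro[OF D1 e]])
  have e0: "0 < e" by (rule B.mean_pos)
  have \<theta>1: "1 < \<theta>" unfolding \<theta> using e0 by simp
  \<comment> \<open>The bound on \<open>h\<close> under which \<open>low_labels_negligible\<close>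
    disposes of the old vertices.\<close>
  define \<kappa> where "\<kappa> = (sqrt (1 + e) - 1) / (2 * (sqrt (1 + e) + 3))"
  have sq: "1 < sqrt (1 + e)" using e0 by simp
  have \<kappa>0: "0 < \<kappa>" unfolding \<kappa>_def by (intro divide_pos_pos mult_pos_pos) (use sq in linarith)+
  \<comment> \<open>Below \<open>\<kappa>\<close> for the old vertices and below
    \<open>loc e\<close> for the typical labels; halving makes both inequalities strict.\<close>
  define h where "h = min \<kappa> (loc e) / 2"
  have h: "0 < h" "h < \<kappa>" "h < loc e" unfolding h_def using \<kappa>0 loc_pos[OF e0] by linarith+
  define a where "a = (\<lambda>j. max 1 (nat \<lfloor>real (ns j) powr h\<rfloor>))"
  have a1: "1 \<le> a j" and a2: "real (a j) \<le> real (ns j) powr h" and a3: "real (ns j) powr h / 2 \<le> real (a j)" for j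
    unfolding a_def by (rule window_start[OF h(1) ns_pos])+
  define d where "d = (\<lambda>j. \<lfloor>log \<theta> (real (ns j))\<rfloor>)"
  define tau where "tau = \<theta> powr \<epsilon>"
  have d_top: "filterlim d at_top sequentially"
    unfolding filterlim_at_top
  proof (intro allI)
    fix Y :: int
    have "filterlim (\<lambda>j. real (ns j)) at_top sequentially" by (rule filterlim_compose[OF filterlim_real_sequentially ns_div])
    then have "\<forall>\<^sub>F j in sequentially. \<theta> powr real_of_int Y \<le> real (ns j)" unfolding filterlim_at_top by blast
    then show "\<forall>\<^sub>F j in sequentially. Y \<le> d j"
    proof eventually_elim
      case (elim j)
      then have "real_of_int Y \<le> log \<theta> (real (ns j))" using le_log_iff[OF \<theta>1, of "real (ns j)"] ns_pos[of j] by simp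
      then show ?case unfolding d_def by (simp add: le_floor_iff)
    qed
  qed
  \<comment> \<open>The product is \<open>\<theta>\<close> raised to the fractional part of the
    logarithm, and that fractional part tends to \<open>\<epsilon>\<close>.\<close>
  have d_tau: "(\<lambda>j. real (ns j) * (1 + e) powr (- real_of_int (d j))) \<longlonglongrightarrow> tau"
  proof -
    have "real (ns j) * (1 + e) powr (- real_of_int (d j)) = \<theta> powr (\<epsilon>seq (ns j))" for j
    proof -
      have "\<theta> powr (\<epsilon>seq (ns j)) = \<theta> powr (log \<theta> (real (ns j)) + - real_of_int (d j))" unfolding eps_seq d_def by simp
      also have "\<dots> = \<theta> powr (log \<theta> (real (ns j))) * \<theta> powr (- real_of_int (d j))" by (rule powr_add)
      also have "\<theta> powr (log \<theta> (real (ns j))) = real (ns j)" using \<theta>1 ns_pos[of j] by simp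
      finally show ?thesis unfolding \<theta> by simp
    qed
    moreover have "(\<lambda>j. \<theta> powr (\<epsilon>seq (ns j))) \<longlonglongrightarrow> \<theta> powr \<epsilon>" by (intro tendsto_powr tendsto_const eps_lim) (use \<theta>1 in simp)
    ultimately show ?thesis unfolding tau_def by simp
  qed
  have tau0: "0 < tau" unfolding tau_def using \<theta>1 by simp
  have lw: "label_window e h ns a"
    by (rule label_window.intro[OF e0 ns_div h(1,3) a1 always_eventually always_eventually]) (use a2 a3 in blast)+
  have tw: "tree_window M D W p e h ns a"
    by (rule tree_window.intro[OF B.bounded_weight_tree_axioms lw])
  interpret T: poisson_window M D W p e h ns a d tau
    by (rule poisson_window.intro[OF tw poisson_window_axioms.intro[OF tau0 d_top d_tau]])
  interpret N: prob_space N by (rule limit_space)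
  interpret L: poisson_marks N \<Xi> P Z q\<^sub>0 \<theta> \<epsilon>
    by (rule poisson_marks.intro[OF limit_space poisson_marks_axioms.intro[OF _ \<theta>1 ppp points marks_indep marks_law points_marks_indep]])
      (use atom in simp_all)
  \<comment> \<open>The two sides meet here: the Poisson mass of a unit cell contains
    \<open>1 - 1 / \<theta> = e / (1 + e)\<close>, the factor that the Erlang normalisation produced
    on the tree side.\<close>
  have mass: "L.mass = T.lam"
  proof
    fix r
    have 1: "\<theta> powr (\<epsilon> - real_of_int r - 1) = \<theta> powr (\<epsilon> - real_of_int r) / \<theta>" using \<theta>1 by (simp add: powr_diff)
    have 2: "\<theta> powr (\<epsilon> - real_of_int r) = tau * \<theta> powr (- real_of_int r)"
      unfolding tau_def powr_add[symmetric] by simp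
    have 3: "1 - 1 / \<theta> = e / \<theta>" unfolding \<theta> using e0 by (simp add: field_simps)
    have "L.mass r = q\<^sub>0 * (tau * \<theta> powr (- real_of_int r) * (1 - 1 / \<theta>))"
      unfolding L.mass_def 1 2 by (simp only: right_diff_distrib mult.right_neutral times_divide_eq_right)
    then show "L.mass r = T.lam r"
      unfolding T.lam_def T.intens_def atom(1) 3 by (simp add: \<theta>)
  qed
  have approx: "L.approx c R K k f = T.approx c R K k f" for c R K k f
    unfolding L.approx_def T.approx_def L.weight_def mass by (rule refl)
  let ?X = "\<lambda>j i \<omega>. (int (deg (ns j) i \<omega>) - \<lfloor>log \<theta> (real (ns j))\<rfloor>,
         (ln (real (lab (ns j) i \<omega>)) - \<mu> * ln (real (ns j))) / sqrt ((1 - \<sigma>2) * ln (real (ns j))))"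
  have X: "?X j i \<omega> = (int (indeg (\<lambda>k. p k \<omega>) (ns j) (v (ns j) \<omega> ! (i - 1))) - d j, std_label e (ns j) (v (ns j) \<omega> ! (i - 1)))" for j i \<omega>
  proof -
    have "\<mu> = loc e" unfolding mu loc_def \<theta> by simp
    moreover have "1 - \<sigma>2 = e\<^sup>2 / ((1 + e)\<^sup>2 * ln (1 + e))" unfolding sigma2 \<theta> by simp
    ultimately show ?thesis unfolding std_label_def label degree in_degree_tree_of d_def by simp
  qed
  have Xm: "(\<lambda>\<omega>. \<lambda>i\<in>{1..K}. ?X j i \<omega>) \<in> measurable M (borel_of (product_topology (\<lambda>_. euclidean) {1..K}))" for K j
  proof (rule borel_of_restrict_measurable)
    fix i :: nat
    have "1 \<le> ns j" using ns_pos[of j] by simp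
    then have vm [measurable]: "v (ns j) \<in> measurable M (count_space UNIV)" using ordering unfolding uniform_degree_ordering_def by blast
    have lm: "(\<lambda>\<omega>. v (ns j) \<omega> ! (i - 1)) \<in> measurable M (count_space UNIV)" by measurable
    have "(\<lambda>\<omega>. indeg (\<lambda>k. p k \<omega>) (ns j) (v (ns j) \<omega> ! (i - 1))) \<in> measurable M (count_space UNIV)"
      by (rule measurable_compose_countable[OF B.indeg_at_measurable lm])
    then have "(\<lambda>\<omega>. int (indeg (\<lambda>k. p k \<omega>) (ns j) (v (ns j) \<omega> ! (i - 1))) - d j) \<in> borel_measurable M"
      by (rule measurable_compose) simp
    moreover have "(\<lambda>\<omega>. std_label e (ns j) (v (ns j) \<omega> ! (i - 1))) \<in> borel_measurable M"
      by (rule measurable_compose[OF lm]) simp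
    ultimately show "(\<lambda>\<omega>. ?X j i \<omega>) \<in> borel_measurable M" unfolding X by (rule borel_measurable_Pair)
  qed
  have conv: "(\<lambda>j. \<integral>\<omega>. f (\<lambda>i\<in>{1..K}. ?X j i \<omega>) \<partial>M) \<longlonglongrightarrow> (\<integral>\<omega>. f (\<lambda>i\<in>{1..K}. (\<lfloor>P i \<omega> + \<epsilon>\<rfloor>, Z i \<omega>)) \<partial>N)"
    if f: "continuous_map (product_topology (\<lambda>_. euclidean) {1..K}) euclideanreal f"
      "bounded (f ` topspace (product_topology (\<lambda>_. euclidean) {1..K}))" for K and f :: "(nat \<Rightarrow> int \<times> real) \<Rightarrow> real"
  proof (rule LIMSEQ_I)
    fix r :: real assume r: "0 < r"
    obtain B where B: "\<forall>y\<in>topspace (product_topology (\<lambda>_. euclidean) {1..K}). norm (f y) \<le> B"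
      using f(2) unfolding bounded_iff by blast
    have fb: "\<bar>f (restrict y {1..K})\<bar> \<le> B" for y using B by (simp add: restrict_PiE_iff)
    have B0: "0 \<le> B" using fb[of undefined] by linarith
    \<comment> \<open>The errors below add up to \<open>(6 * B + 1) * \<eta>\<close>: the tree
      contributes \<open>5 * B * \<eta> + \<eta>\<close> and the Poisson side
      \<open>B * \<eta>\<close>.\<close>
    define \<eta> where "\<eta> = r / (6 * B + 2)"
    have \<eta>: "0 < \<eta>" unfolding \<eta>_def using r B0 by (intro divide_pos_pos) simp_all
    have c0: "0 < 6 * tau * ((1 + e) / e)" using tau0 e0 by simp
    \<comment> \<open>\<open>R0\<close> is fixed first; the cut-offs of the Poisson side are then
      taken with \<open>R \<ge> R0\<close>, so that in-degrees beyond the range are rare in the tree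
      too.\<close>
    obtain R0 where R0: "\<And>R. R0 \<le> R \<Longrightarrow> 6 * tau * ((1 + e) / e) * \<theta> powr (- real_of_int R) \<le> \<eta>"
      using powr_tail_small[OF \<theta>1 c0 \<eta>] by blast
    obtain c R k where R: "R0 \<le> R" and lim: "\<And>f B. continuous_map (product_topology (\<lambda>_. euclidean) {1..K}) euclideanreal f \<Longrightarrow>
        (\<forall>y. \<bar>f (restrict y {1..K})\<bar> \<le> B) \<Longrightarrow> \<bar>(\<integral>\<omega>. f (\<lambda>i\<in>{1..K}. (\<lfloor>P i \<omega> + \<epsilon>\<rfloor>, Z i \<omega>)) \<partial>N) - L.approx c R K k f\<bar> \<le> B * \<eta>"
      using L.limit_approx[OF \<eta>, of R0 K] by blast
    let ?EY = "\<integral>\<omega>. f (\<lambda>i\<in>{1..K}. (\<lfloor>P i \<omega> + \<epsilon>\<rfloor>, Z i \<omega>)) \<partial>N"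
    have Ef: "\<bar>?EY - T.approx c R K k f\<bar> \<le> B * \<eta>" using lim[OF f(1), of B] fb unfolding approx by blast
    \<comment> \<open>With the constant 1 as test function, the listed profiles are seen to carry
      nearly all the mass of the limit.\<close>
    have "continuous_map (product_topology (\<lambda>_. euclidean) {1..K}) euclideanreal (\<lambda>_ :: nat \<Rightarrow> int \<times> real. 1)" by simp
    from lim[OF this, of 1] have "\<bar>1 - T.approx c R K k (\<lambda>_. 1)\<bar> \<le> \<eta>" unfolding approx using N.prob_space by simp
    then have E1: "1 - T.approx c R K k (\<lambda>_. 1) \<le> \<eta>" by linarith
    have hk: "h < (sqrt (1 + e) - 1) / (2 * (sqrt (1 + e) + 3))" using h(2) unfolding \<kappa>_def .
    have small: "6 * (tau * (1 + e) powr (- real_of_int R)) * ((1 + e) / e) \<le> \<eta>" using R0[OF R] unfolding \<theta> by (simp only: mult_ac)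
    have ta: "\<forall>\<^sub>F j in sequentially. \<bar>(\<integral>\<omega>. T.sample K j f (indeg (\<lambda>k. p k \<omega>) (ns j)) (v (ns j) \<omega>) \<partial>M) - T.approx c R K k f\<bar>
        \<le> B * (6 * (tau * (1 + e) powr (- real_of_int R)) * ((1 + e) / e) + 1 - T.approx c R K k (\<lambda>_. 1) + 3 * \<eta>) + \<eta>"
      by (rule T.tree_approx[OF f(1) fb _ \<eta> hk]) (rule ordering)
    have "\<forall>\<^sub>F j in sequentially. norm ((\<integral>\<omega>. f (\<lambda>i\<in>{1..K}. ?X j i \<omega>) \<partial>M) - ?EY) < r"
      using ta
    proof eventually_elim
      case (elim j)
      have s: "T.sample K j f (indeg (\<lambda>k. p k \<omega>) (ns j)) (v (ns j) \<omega>) = f (\<lambda>i\<in>{1..K}. ?X j i \<omega>)" for \<omega>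
        unfolding T.sample_def X ..
      have "B * (6 * (tau * (1 + e) powr (- real_of_int R)) * ((1 + e) / e) + 1 - T.approx c R K k (\<lambda>_. 1) + 3 * \<eta>) \<le> B * (5 * \<eta>)"
        by (rule mult_left_mono[OF _ B0]) (use small E1 in linarith)
      then have "\<bar>(\<integral>\<omega>. f (\<lambda>i\<in>{1..K}. ?X j i \<omega>) \<partial>M) - T.approx c R K k f\<bar> \<le> B * (5 * \<eta>) + \<eta>"
        using elim unfolding s by linarith
      then have "\<bar>(\<integral>\<omega>. f (\<lambda>i\<in>{1..K}. ?X j i \<omega>) \<partial>M) - ?EY\<bar> \<le> B * (5 * \<eta>) + \<eta> + B * \<eta>" using Ef by linarith
      also have "\<dots> = (6 * B + 1) * \<eta>" by (simp add: algebra_simps)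
      also have "\<dots> < (6 * B + 2) * \<eta>" using \<eta> by simp
      also have "\<dots> = r" unfolding \<eta>_def using B0 by simp
      finally show ?case by simp
    qed
    then show "\<exists>no. \<forall>j\<ge>no. norm ((\<integral>\<omega>. f (\<lambda>i\<in>{1..K}. ?X j i \<omega>) \<partial>M) - ?EY) < r" unfolding eventually_sequentially .
  qed
  show ?thesis
    unfolding sequence_converges_in_distribution_def converges_in_distribution_def
    using Xm L.limit_measurable conv by blast
qed

end
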